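(* Let $k$, $\chi$, $U^+=T(V^+(\chi))/\mathcal I$, $U(\chi)$, $\tau$, $\mathbf c\in k^n$, $B_{\mathbf c}$ be as in the context. The surjective homomorphism of graded algebras $\varphi:\operatorname{gr}(B_{\mathbf c})\to H_\theta\ltimes U^-$ is an algebra isomorphism if and only if the following condition holds: the ideal $\mathcal I\subset T(V^+(\chi))$ is generated by finitely many homogeneous noncommutative polynomials $p_j(E_1,\dots,E_n)$, $j=1,\dots,r$, of degrees $\lambda_j\in\mathbb N^n$ respectively, for which $\pi_{0,0}\circ P_{-\lambda_j}\big(p_j(B_1,\dots,B_n)\big)=0$ for $j=1,\dots,r$.
   Context: Let $k$ be a field, $\mathbb N=\{0,1,2,\dots\}$, $I=\{1,\dots,n\}$, $\{\alpha_i\}_{i\in I}$ the standard basis of $\mathbb Z^n$. Let $\chi:\mathbb Z^n\times\mathbb Z^n\to k^\times$ be a bicharacter with $q_{ij}:=\chi(\alpha_i,\alpha_j)=q_{ji}$ for all $i,j$. $H=k[K_i^{\pm1}\mid i\in I]$ is the group algebra of $\mathbb Z^n$ and $K_\lambda=K_1^{\lambda_1}\cdots K_n^{\lambda_n}$. $\widetilde U(\chi)$ is the Hopf algebra with generators $E_i,F_i,K_i^{\pm1}$, relations $K_iK_i^{-1}=1=K_i^{-1}K_i$, $K_iK_j=K_jK_i$, $K_iE_j=q_{ij}E_jK_i$, $K_iF_j=q_{ij}^{-1}F_jK_i$, $E_iF_j-F_jE_i=\delta_{ij}(K_i-K_i^{-1})$ and coproduct $\Delta(E_i)=E_i\otimes1+K_i\otimes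 E_i$, $\Delta(F_i)=F_i\otimes K_i^{-1}+1\otimes F_i$, $\Delta(K_i)=K_i\otimes K_i$. The subalgebras generated by the $E_i$, resp. the $F_i$, are the tensor algebras $T(V^+(\chi))$, $T(V^-(\chi))$ on $V^+(\chi)=\mathrm{span}\{E_i\}$, $V^-(\chi)=\mathrm{span}\{F_i\}$. $V^+(\chi)$ is a Yetter–Drinfeld module over $H$ with $K_i\cdot E_j=q_{ij}E_j$, $\delta(E_i)=K_i\otimes E_i$, so $T(V^+(\chi))$ is a $\mathbb Z^n$-graded braided Hopf algebra ($\deg E_i=\alpha_i$). $\omega$ is the algebra automorphism of $\widetilde U(\chi)$ with $\omega(E_i)=F_i$, $\omega(F_i)=E_i$, $\omega(K_i)=K_i^{-1}$. Fix a $\mathbb Z^n$-graded biideal $\mathcal I\subseteq\bigoplus_{m\ge2}T(V^+(\chi))_m$. Put $U(\chi)=\widetilde U(\chi)/(\mathcal I,\omega(\mathcal I))$ (a Hopf algebra), $U^+=T(V^+(\chi))/\mathcal I$ (a pre-Nichols algebra of diagonal type), $U^-=T(V^-(\chi))/\omega(\mathcal I)$. Multiplication $U^+\otimes H\otimes U^-\to U(\chi)$ is a linear isomorphism; $U^\pm$ are graded with $\deg E_i=\alpha_i$, $\deg F_i=-\alpha_i$. Let $\tau:I\to I$ be a bijection with $\tau^2=\mathrm{id}$, $q_{\tau(i)\tau(j)}=q_{ij}$, and assume $\tau(\mathcal I)=\mathcal I$ for the automorphism $E_i\mapsto E_{\tau(i)}$. $H_\theta\subset H$ is the subalgebra generated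 by all $K_iK_{\tau(i)}^{-1}$, and $H_\theta\ltimes U^-$ is the subalgebra of $U(\chi)$ generated by $H_\theta$ and $U^-$ (as a vector space $H_\theta\otimes U^-$). For $\mathbf c=(c_1,\dots,c_n)\in k^n$, $B_{\mathbf c}$ is the subalgebra of $U(\chi)$ generated by $H_\theta$ and $B_i=F_i+c_iE_{\tau(i)}K_i^{-1}$, $i\in I$. It is filtered by $\deg(B_i)=1$, $\deg(h)=0$ for $h\in H_\theta$, and $\varphi:\operatorname{gr}(B_{\mathbf c})\to H_\theta\ltimes U^-$ is the surjective graded algebra homomorphism sending the class of $B_i$ to $F_i$ and $h\in H_\theta$ to $h$. Projections: let $G^-\subset U(\chi)$ be the subalgebra generated by the $F_iK_i$; $U(\chi)=\bigoplus_{\lambda\in\mathbb Z^n}U^+K_\lambda G^-$ and $P_\lambda:U(\chi)\to U^+K_\lambda G^-$ is the corresponding projection. Also $U(\chi)=\bigoplus_{\alpha,\beta\in\mathbb N^n}U^+_\alpha HU^-_{-\beta}$ and $\pi_{0,0}:U(\chi)\to H$ is the projection onto the summand $\alpha=\beta=0$. A noncommutative polynomial is an element of the free algebra $k\langle x_1,\dots,x_n\rangle$, $\mathbb N^n$-graded by $\deg x_i=\alpha_i$; homogeneous refers to this grading.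
   Formalization: The ideal I is additionally assumed to be finitely generated; without this the "only if" direction fails, since for c = 0 the map φ is always an isomorphism while I need not be finitely generated (e.g. all q_ij = 1, U^+ the enveloping algebra of the free metabelian Lie algebra on two generators). *)

theory Defs
  imports
    "HOL-Algebra.Algebra"
    "HOL-Algebra.Algebraic_Closure_Type"
    "HOL-Library.Poly_Mapping"
    "HOL-Library.Product_Plus"
    "HOL-Library.Function_Algebras"
begin

section \<open>Free algebras\<close>

text \<open>Words form the free monoid, written additively so that finitely supported functions on
  words become, with the convolution product, the free associative algebra.\<close>

datatype 'x word = Word (letters: "'x list")

instantiation word :: (type) monoid_add
begin
definition zero_word :: "'a word" where "0 = Word []"
definition plus_word :: "'a word \<Rightarrow> 'a word \<Rightarrow> 'a word"
  where "v + w = Word (letters v @ letters w)"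
instance by standard (simp_all add: zero_word_def plus_word_def)
end

type_synonym ('x, 'k) ncpoly = "'x word \<Rightarrow>\<^sub>0 'k"

abbreviation free_alg :: "('x, 'k::field) ncpoly ring"
  where "free_alg \<equiv> ring_of_type_algebra"

definition nc_var :: "'x \<Rightarrow> ('x, 'k::field) ncpoly"
  where "nc_var x = Poly_Mapping.single (Word [x]) 1"

definition nc_const :: "'k \<Rightarrow> ('x, 'k::field) ncpoly"
  where "nc_const a = Poly_Mapping.single 0 a"

text \<open>The value \<open>p(f\<^sub>1,\<dots>,f\<^sub>n)\<close> in an algebra \<open>R\<close> whose scalars are embedded by \<open>s\<close>.\<close>

definition nc_eval ::
    "('k \<Rightarrow> 'a) \<Rightarrow> ('a, 'm) ring_scheme \<Rightarrow> ('x \<Rightarrow> 'a) \<Rightarrow> ('x, 'k::field) ncpoly \<Rightarrow> 'a"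
  where "nc_eval s R f p =
    (\<Oplus>\<^bsub>R\<^esub>w\<in>Poly_Mapping.keys p.
       s (Poly_Mapping.lookup p w) \<otimes>\<^bsub>R\<^esub> foldr (\<lambda>x y. f x \<otimes>\<^bsub>R\<^esub> y) (letters w) \<one>\<^bsub>R\<^esub>)"

definition wdeg :: "'i word \<Rightarrow> 'i \<Rightarrow> nat"
  where "wdeg w = (\<lambda>i. count_list (letters w) i)"

definition homogeneous :: "('i \<Rightarrow> nat) \<Rightarrow> ('i, 'k::field) ncpoly \<Rightarrow> bool"
  where "homogeneous lam p \<longleftrightarrow> (\<forall>w\<in>Poly_Mapping.keys p. wdeg w = lam)"

definition hom_component :: "('i \<Rightarrow> nat) \<Rightarrow> ('i, 'k::field) ncpoly \<Rightarrow> ('i, 'k) ncpoly"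
  where "hom_component lam p =
    (\<Sum>w\<in>{w \<in> Poly_Mapping.keys p. wdeg w = lam}. Poly_Mapping.single w (Poly_Mapping.lookup p w))"


section \<open>Spans, direct sums and associated graded algebras\<close>

text \<open>The additive subgroup generated by \<open>S\<close>. It is applied only to sets that are stable under
  scalars, where it is the linear span.\<close>

definition add_span :: "('a, 'm) ring_scheme \<Rightarrow> 'a set \<Rightarrow> 'a set"
  where "add_span R S = generate (add_monoid R) S"

text \<open>The component of \<open>x\<close> in \<open>V j\<close> when \<open>R\<close> is the internal direct sum of the \<open>V i\<close>.\<close>

definition ds_component :: "('a, 'm) ring_scheme \<Rightarrow> ('j \<Rightarrow> 'a set) \<Rightarrow> 'j \<Rightarrow> 'a \<Rightarrow> 'a"
  where "ds_component R V j x =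
    (THE y. \<exists>f. (\<forall>i. f i \<in> V i) \<and> finite {i. f i \<noteq> \<zero>\<^bsub>R\<^esub>} \<and>
       x = (\<Oplus>\<^bsub>R\<^esub>i\<in>{i. f i \<noteq> \<zero>\<^bsub>R\<^esub>}. f i) \<and> y = f j)"

text \<open>For an increasing multiplicative filtration \<open>Fil 0 \<subseteq> Fil 1 \<subseteq> \<dots>\<close>, with \<open>Fil (-1) = 0\<close>,
  the elements of the associated graded algebra are the finitely supported families of cosets
  in \<open>Fil m / Fil (m - 1)\<close>.\<close>

definition fil_pred :: "('a, 'm) ring_scheme \<Rightarrow> (nat \<Rightarrow> 'a set) \<Rightarrow> nat \<Rightarrow> 'a set"
  where "fil_pred R Fil m = (case m of 0 \<Rightarrow> {\<zero>\<^bsub>R\<^esub>} | Suc l \<Rightarrow> Fil l)"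

definition assoc_graded :: "('a, 'm) ring_scheme \<Rightarrow> (nat \<Rightarrow> 'a set) \<Rightarrow> (nat \<Rightarrow> 'a set) ring"
  where "assoc_graded R Fil =
    \<lparr> carrier = {f. (\<forall>m. \<exists>x\<in>Fil m. f m = fil_pred R Fil m +>\<^bsub>R\<^esub> x) \<and>
                    finite {m. f m \<noteq> fil_pred R Fil m}},
      monoid.mult = (\<lambda>f g m. {z \<oplus>\<^bsub>R\<^esub> (\<Oplus>\<^bsub>R\<^esub>i\<in>{..m}. x i \<otimes>\<^bsub>R\<^esub> y (m - i)) | z x y.
                    z \<in> fil_pred R Fil m \<and> (\<forall>i. x i \<in> f i) \<and> (\<forall>i. y i \<in> g i)}),
      one = (fil_pred R Fil)(0 := fil_pred R Fil 0 +>\<^bsub>R\<^esub> \<one>\<^bsub>R\<^esub>),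
      ring.zero = fil_pred R Fil,
      add = (\<lambda>f g m. f m <+>\<^bsub>R\<^esub> g m) \<rparr>"

definition gr_class :: "('a, 'm) ring_scheme \<Rightarrow> (nat \<Rightarrow> 'a set) \<Rightarrow> nat \<Rightarrow> 'a \<Rightarrow> nat \<Rightarrow> 'a set"
  where "gr_class R Fil m x = (fil_pred R Fil)(m := fil_pred R Fil m +>\<^bsub>R\<^esub> x)"


section \<open>Bicharacters and graded biideals of the tensor algebra\<close>

type_synonym ('i, 'k) bichar = "('i \<Rightarrow> int) \<Rightarrow> ('i \<Rightarrow> int) \<Rightarrow> 'k"

definition bicharacter :: "('i, 'k::field) bichar \<Rightarrow> bool"
  where "bicharacter \<chi> \<longleftrightarrow>
    (\<forall>a b. \<chi> a b \<noteq> 0) \<and>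
    (\<forall>a b c. \<chi> (a + b) c = \<chi> a c * \<chi> b c) \<and>
    (\<forall>a b c. \<chi> a (b + c) = \<chi> a b * \<chi> a c)"

definition alpha :: "'i \<Rightarrow> 'i \<Rightarrow> int"
  where "alpha i = (\<lambda>j. if j = i then 1 else 0)"

definition qmat :: "('i, 'k::field) bichar \<Rightarrow> 'i \<Rightarrow> 'i \<Rightarrow> 'k"
  where "qmat \<chi> i j = \<chi> (alpha i) (alpha j)"

text \<open>\<open>T(V\<^sup>+)\<close> is the free algebra on the \<open>E\<^sub>i\<close>, and \<open>T(V\<^sup>+) \<otimes> T(V\<^sup>+)\<close> has the pairs of words as a
  basis. The coaction \<open>\<delta>(x) = K\<^sub>\<beta> \<otimes> x\<close> for \<open>x\<close> of degree \<open>\<beta>\<close> and the action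
  \<open>K\<^sub>\<beta> \<cdot> y = \<chi>(\<beta>,\<gamma>) y\<close> for \<open>y\<close> of degree \<open>\<gamma>\<close> give the braiding \<open>x \<otimes> y \<mapsto> \<chi>(\<beta>,\<gamma>) y \<otimes> x\<close>, hence
  the product \<open>(a \<otimes> b)(c \<otimes> d) = \<chi>(deg b, deg c) ac \<otimes> bd\<close>.\<close>

type_synonym ('i, 'k) tensor2 = "('i word \<times> 'i word) \<Rightarrow>\<^sub>0 'k"

definition braided_mult ::
    "('i, 'k::field) bichar \<Rightarrow> ('i, 'k) tensor2 \<Rightarrow> ('i, 'k) tensor2 \<Rightarrow> ('i, 'k) tensor2"
  where "braided_mult \<chi> s t =
    (\<Sum>(a, b)\<in>Poly_Mapping.keys s. \<Sum>(c, d)\<in>Poly_Mapping.keys t.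
       Poly_Mapping.single (a + c, b + d)
         (\<chi> (\<lambda>i. int (wdeg b i)) (\<lambda>i. int (wdeg c i)) *
          Poly_Mapping.lookup s (a, b) * Poly_Mapping.lookup t (c, d)))"

definition braided_tensor ::
    "('i, 'k::field) bichar \<Rightarrow> ('i, 'k) tensor2 ring"
  where "braided_tensor \<chi> =
    \<lparr> carrier = UNIV, monoid.mult = braided_mult \<chi>, one = Poly_Mapping.single 0 1,
      ring.zero = 0, add = (+) \<rparr>"

definition tensor :: "('i, 'k) ncpoly \<Rightarrow> ('i, 'k::field) ncpoly \<Rightarrow> ('i, 'k) tensor2"
  where "tensor p t =
    (\<Sum>a\<in>Poly_Mapping.keys p. \<Sum>b\<in>Poly_Mapping.keys t.
       Poly_Mapping.single (a, b) (Poly_Mapping.lookup p a * Poly_Mapping.lookup t b))"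

definition coprod ::
    "('i, 'k::field) bichar \<Rightarrow> ('i, 'k) ncpoly \<Rightarrow> ('i, 'k) tensor2"
  where "coprod \<chi> =
    nc_eval (Poly_Mapping.single 0) (braided_tensor \<chi>)
      (\<lambda>i. tensor (nc_var i) 1 + tensor 1 (nc_var i))"

definition counit :: "('i, 'k::field) ncpoly \<Rightarrow> 'k"
  where "counit p = Poly_Mapping.lookup p 0"

definition graded_biideal ::
    "('i, 'k::field) bichar \<Rightarrow> ('i, 'k) ncpoly set \<Rightarrow> bool"
  where "graded_biideal \<chi> \<I> \<longleftrightarrow>
    ideal \<I> free_alg \<and>
    (\<forall>p\<in>\<I>. \<forall>lam. hom_component lam p \<in> \<I>) \<and>
    (\<forall>p\<in>\<I>. coprod \<chi> p \<in> add_span (braided_tensor \<chi>) {tensor a b | a b. a \<in> \<I> \<or> b \<in> \<I>}) \<and>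
    (\<forall>p\<in>\<I>. counit p = 0)"


section \<open>The algebra \<open>U(\<chi>)\<close>\<close>

datatype 'i gen = GenE 'i | GenF 'i | GenK 'i | GenKinv 'i

definition Utilde_rels ::
    "('i, 'k::field) bichar \<Rightarrow> ('i gen, 'k) ncpoly set"
  where "Utilde_rels \<chi> =
    (let E = \<lambda>i. nc_var (GenE i); F = \<lambda>i. nc_var (GenF i);
         K = \<lambda>i. nc_var (GenK i); L = \<lambda>i. nc_var (GenKinv i)
     in (\<Union>i j. {K i * L i - 1,
                 L i * K i - 1,
                 K i * K j - K j * K i,
                 K i * E j - nc_const (qmat \<chi> i j) * E j * K i,
                 K i * F j - nc_const (inverse (qmat \<chi> i j)) * F j * K i,
                 E i * F j - F j * E i - (if i = j then K i - L i else 0)}))"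

definition Utilde_ideal ::
    "('i, 'k::field) bichar \<Rightarrow> ('i gen, 'k) ncpoly set"
  where "Utilde_ideal \<chi> = Idl\<^bsub>free_alg\<^esub> (Utilde_rels \<chi>)"

definition Utilde ::
    "('i, 'k::field) bichar \<Rightarrow> ('i gen, 'k) ncpoly set ring"
  where "Utilde \<chi> = free_alg Quot Utilde_ideal \<chi>"

definition Ut_class ::
    "('i, 'k::field) bichar \<Rightarrow> ('i gen, 'k) ncpoly \<Rightarrow> ('i gen, 'k) ncpoly set"
  where "Ut_class \<chi> x = Utilde_ideal \<chi> +>\<^bsub>free_alg\<^esub> x"

definition Ut_scal ::
    "('i, 'k::field) bichar \<Rightarrow> 'k \<Rightarrow> ('i gen, 'k) ncpoly set"
  where "Ut_scal \<chi> a = Ut_class \<chi> (nc_const a)"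

text \<open>Since \<open>\<omega>(E\<^sub>i) = F\<^sub>i\<close>, the set \<open>\<omega>(\<I>)\<close> consists of the elements \<open>p(F\<^sub>1,\<dots>,F\<^sub>n)\<close>, \<open>p \<in> \<I>\<close>.\<close>

definition U_ideal ::
    "('i, 'k::field) bichar \<Rightarrow> ('i, 'k) ncpoly set \<Rightarrow> ('i gen, 'k) ncpoly set set"
  where "U_ideal \<chi> \<I> = Idl\<^bsub>Utilde \<chi>\<^esub>
    (nc_eval (Ut_scal \<chi>) (Utilde \<chi>) (\<lambda>i. Ut_class \<chi> (nc_var (GenE i))) ` \<I> \<union>
     nc_eval (Ut_scal \<chi>) (Utilde \<chi>) (\<lambda>i. Ut_class \<chi> (nc_var (GenF i))) ` \<I>)"

type_synonym ('i, 'k) U_elem = "('i gen, 'k) ncpoly set set"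

definition Uchi ::
    "('i, 'k::field) bichar \<Rightarrow> ('i, 'k) ncpoly set \<Rightarrow> ('i, 'k) U_elem ring"
  where "Uchi \<chi> \<I> = Utilde \<chi> Quot U_ideal \<chi> \<I>"

definition U_class ::
    "('i, 'k::field) bichar \<Rightarrow> ('i, 'k) ncpoly set \<Rightarrow>
     ('i gen, 'k) ncpoly \<Rightarrow> ('i, 'k) U_elem"
  where "U_class \<chi> \<I> x = U_ideal \<chi> \<I> +>\<^bsub>Utilde \<chi>\<^esub> Ut_class \<chi> x"

definition U_scal ::
    "('i, 'k::field) bichar \<Rightarrow> ('i, 'k) ncpoly set \<Rightarrow> 'k \<Rightarrow> ('i, 'k) U_elem"
  where "U_scal \<chi> \<I> a = U_class \<chi> \<I> (nc_const a)"

definition U_E ::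
    "('i, 'k::field) bichar \<Rightarrow> ('i, 'k) ncpoly set \<Rightarrow> 'i \<Rightarrow> ('i, 'k) U_elem"
  where "U_E \<chi> \<I> i = U_class \<chi> \<I> (nc_var (GenE i))"

definition U_F ::
    "('i, 'k::field) bichar \<Rightarrow> ('i, 'k) ncpoly set \<Rightarrow> 'i \<Rightarrow> ('i, 'k) U_elem"
  where "U_F \<chi> \<I> i = U_class \<chi> \<I> (nc_var (GenF i))"

definition U_K ::
    "('i, 'k::field) bichar \<Rightarrow> ('i, 'k) ncpoly set \<Rightarrow> 'i \<Rightarrow> ('i, 'k) U_elem"
  where "U_K \<chi> \<I> i = U_class \<chi> \<I> (nc_var (GenK i))"

definition U_Kinv ::
    "('i, 'k::field) bichar \<Rightarrow> ('i, 'k) ncpoly set \<Rightarrow> 'i \<Rightarrow> ('i, 'k) U_elem"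
  where "U_Kinv \<chi> \<I> i = U_class \<chi> \<I> (nc_var (GenKinv i))"

text \<open>The \<open>k\<close>-subalgebra generated by \<open>S\<close>.\<close>

definition subalg ::
    "('i, 'k::field) bichar \<Rightarrow> ('i, 'k) ncpoly set \<Rightarrow>
     ('i, 'k) U_elem set \<Rightarrow> ('i, 'k) U_elem set"
  where "subalg \<chi> \<I> S = generate_ring (Uchi \<chi> \<I>) (range (U_scal \<chi> \<I>) \<union> S)"

definition Uplus :: "('i, 'k::field) bichar \<Rightarrow> ('i, 'k) ncpoly set \<Rightarrow> ('i, 'k) U_elem set"
  where "Uplus \<chi> \<I> = subalg \<chi> \<I> (range (U_E \<chi> \<I>))"

definition Uminus :: "('i, 'k::field) bichar \<Rightarrow> ('i, 'k) ncpoly set \<Rightarrow> ('i, 'k) U_elem set"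
  where "Uminus \<chi> \<I> = subalg \<chi> \<I> (range (U_F \<chi> \<I>))"

definition Ucartan :: "('i, 'k::field) bichar \<Rightarrow> ('i, 'k) ncpoly set \<Rightarrow> ('i, 'k) U_elem set"
  where "Ucartan \<chi> \<I> = subalg \<chi> \<I> (range (U_K \<chi> \<I>) \<union> range (U_Kinv \<chi> \<I>))"

definition Gminus :: "('i, 'k::field) bichar \<Rightarrow> ('i, 'k) ncpoly set \<Rightarrow> ('i, 'k) U_elem set"
  where "Gminus \<chi> \<I> = subalg \<chi> \<I> (range (\<lambda>i. U_F \<chi> \<I> i \<otimes>\<^bsub>Uchi \<chi> \<I>\<^esub> U_K \<chi> \<I> i))"

text \<open>The product is taken in the commutative subalgebra \<open>H\<close> because \<^const>\<open>finprod\<close> is meant for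
  commutative monoids.\<close>

definition K_pow ::
    "('i::finite, 'k::field) bichar \<Rightarrow> ('i, 'k) ncpoly set \<Rightarrow>
     ('i \<Rightarrow> int) \<Rightarrow> ('i, 'k) U_elem"
  where "K_pow \<chi> \<I> lam =
    finprod (Uchi \<chi> \<I>\<lparr>carrier := Ucartan \<chi> \<I>\<rparr>) (\<lambda>i. U_K \<chi> \<I> i [^]\<^bsub>Uchi \<chi> \<I>\<^esub> lam i) UNIV"

definition Uplus_deg ::
    "('i, 'k::field) bichar \<Rightarrow> ('i, 'k) ncpoly set \<Rightarrow>
     ('i \<Rightarrow> nat) \<Rightarrow> ('i, 'k) U_elem set"
  where "Uplus_deg \<chi> \<I> a = nc_eval (U_scal \<chi> \<I>) (Uchi \<chi> \<I>) (U_E \<chi> \<I>) ` {p. homogeneous a p}"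

text \<open>\<open>Uminus_deg \<chi> \<I> b\<close> is the component of degree \<open>-b\<close>.\<close>

definition Uminus_deg ::
    "('i, 'k::field) bichar \<Rightarrow> ('i, 'k) ncpoly set \<Rightarrow>
     ('i \<Rightarrow> nat) \<Rightarrow> ('i, 'k) U_elem set"
  where "Uminus_deg \<chi> \<I> b = nc_eval (U_scal \<chi> \<I>) (Uchi \<chi> \<I>) (U_F \<chi> \<I>) ` {p. homogeneous b p}"

definition P_proj ::
    "('i::finite, 'k::field) bichar \<Rightarrow> ('i, 'k) ncpoly set \<Rightarrow>
     ('i \<Rightarrow> int) \<Rightarrow> ('i, 'k) U_elem \<Rightarrow> ('i, 'k) U_elem"
  where "P_proj \<chi> \<I> =
    ds_component (Uchi \<chi> \<I>)
      (\<lambda>mu. add_span (Uchi \<chi> \<I>)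
         {u \<otimes>\<^bsub>Uchi \<chi> \<I>\<^esub> K_pow \<chi> \<I> mu \<otimes>\<^bsub>Uchi \<chi> \<I>\<^esub> g | u g. u \<in> Uplus \<chi> \<I> \<and> g \<in> Gminus \<chi> \<I>})"

definition pi_proj ::
    "('i, 'k::field) bichar \<Rightarrow> ('i, 'k) ncpoly set \<Rightarrow>
     ('i \<Rightarrow> nat) \<times> ('i \<Rightarrow> nat) \<Rightarrow> ('i, 'k) U_elem \<Rightarrow> ('i, 'k) U_elem"
  where "pi_proj \<chi> \<I> =
    ds_component (Uchi \<chi> \<I>)
      (\<lambda>(a, b). add_span (Uchi \<chi> \<I>)
         {u \<otimes>\<^bsub>Uchi \<chi> \<I>\<^esub> h \<otimes>\<^bsub>Uchi \<chi> \<I>\<^esub> v | u h v.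
            u \<in> Uplus_deg \<chi> \<I> a \<and> h \<in> Ucartan \<chi> \<I> \<and> v \<in> Uminus_deg \<chi> \<I> b})"


section \<open>The coideal subalgebra and its filtration\<close>

definition Htheta ::
    "('i, 'k::field) bichar \<Rightarrow> ('i, 'k) ncpoly set \<Rightarrow>
     ('i \<Rightarrow> 'i) \<Rightarrow> ('i, 'k) U_elem set"
  where "Htheta \<chi> \<I> \<tau> = subalg \<chi> \<I> (range (\<lambda>i. U_K \<chi> \<I> i \<otimes>\<^bsub>Uchi \<chi> \<I>\<^esub> U_Kinv \<chi> \<I> (\<tau> i)))"

definition Htheta_Uminus ::
    "('i, 'k::field) bichar \<Rightarrow> ('i, 'k) ncpoly set \<Rightarrow>
     ('i \<Rightarrow> 'i) \<Rightarrow> ('i, 'k) U_elem set"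
  where "Htheta_Uminus \<chi> \<I> \<tau> = subalg \<chi> \<I> (Htheta \<chi> \<I> \<tau> \<union> Uminus \<chi> \<I>)"

definition B_gen ::
    "('i, 'k::field) bichar \<Rightarrow> ('i, 'k) ncpoly set \<Rightarrow>
     ('i \<Rightarrow> 'i) \<Rightarrow> ('i \<Rightarrow> 'k) \<Rightarrow> 'i \<Rightarrow> ('i, 'k) U_elem"
  where "B_gen \<chi> \<I> \<tau> c i =
    U_F \<chi> \<I> i \<oplus>\<^bsub>Uchi \<chi> \<I>\<^esub>
      U_scal \<chi> \<I> (c i) \<otimes>\<^bsub>Uchi \<chi> \<I>\<^esub> U_E \<chi> \<I> (\<tau> i) \<otimes>\<^bsub>Uchi \<chi> \<I>\<^esub> U_Kinv \<chi> \<I> i"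

definition B_alg ::
    "('i, 'k::field) bichar \<Rightarrow> ('i, 'k) ncpoly set \<Rightarrow>
     ('i \<Rightarrow> 'i) \<Rightarrow> ('i \<Rightarrow> 'k) \<Rightarrow> ('i, 'k) U_elem set"
  where "B_alg \<chi> \<I> \<tau> c = subalg \<chi> \<I> (Htheta \<chi> \<I> \<tau> \<union> range (B_gen \<chi> \<I> \<tau> c))"

text \<open>\<open>B_fil m\<close> is spanned by the products \<open>h\<^sub>0 B\<^bsub>i\<^sub>1\<^esub> h\<^sub>1 \<cdots> B\<^bsub>i\<^sub>l\<^esub> h\<^sub>l\<close> with \<open>l \<le> m\<close> and
  all \<open>h\<^sub>j\<close> in \<open>H\<^sub>\<theta>\<close>.\<close>

primrec B_fil ::
    "('i, 'k::field) bichar \<Rightarrow> ('i, 'k) ncpoly set \<Rightarrow>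
     ('i \<Rightarrow> 'i) \<Rightarrow> ('i \<Rightarrow> 'k) \<Rightarrow> nat \<Rightarrow> ('i, 'k) U_elem set"
  where
    "B_fil \<chi> \<I> \<tau> c 0 = Htheta \<chi> \<I> \<tau>"
  | "B_fil \<chi> \<I> \<tau> c (Suc m) = add_span (Uchi \<chi> \<I>)
       (B_fil \<chi> \<I> \<tau> c m \<union>
        {x \<otimes>\<^bsub>Uchi \<chi> \<I>\<^esub> B_gen \<chi> \<I> \<tau> c i \<otimes>\<^bsub>Uchi \<chi> \<I>\<^esub> h | x i h.
           x \<in> B_fil \<chi> \<I> \<tau> c m \<and> h \<in> Htheta \<chi> \<I> \<tau>})"

definition grB ::
    "('i, 'k::field) bichar \<Rightarrow> ('i, 'k) ncpoly set \<Rightarrow>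
     ('i \<Rightarrow> 'i) \<Rightarrow> ('i \<Rightarrow> 'k) \<Rightarrow> (nat \<Rightarrow> ('i, 'k) U_elem set) ring"
  where "grB \<chi> \<I> \<tau> c = assoc_graded (Uchi \<chi> \<I>\<lparr>carrier := B_alg \<chi> \<I> \<tau> c\<rparr>) (B_fil \<chi> \<I> \<tau> c)"

definition grB_class ::
    "('i, 'k::field) bichar \<Rightarrow> ('i, 'k) ncpoly set \<Rightarrow>
     ('i \<Rightarrow> 'i) \<Rightarrow> ('i \<Rightarrow> 'k) \<Rightarrow> nat \<Rightarrow> ('i, 'k) U_elem \<Rightarrow> nat \<Rightarrow> ('i, 'k) U_elem set"
  where "grB_class \<chi> \<I> \<tau> c = gr_class (Uchi \<chi> \<I>\<lparr>carrier := B_alg \<chi> \<I> \<tau> c\<rparr>) (B_fil \<chi> \<I> \<tau> c)"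

end

theory Submission
  imports Defs "HOL-Library.Multiset"
begin

text \<open>Let the algebra \<open>U\<close>-tilde act on the space \<open>M\<close> with basis \<open>E\<^sub>u F\<^sub>v K\<^sub>l\<close>, and let \<open>J\<close> be the kernel of
  a graded normal form modulo the biideal. The biideal property makes \<open>J\<close> a submodule, so that
  \<open>x \<mapsto> x \<cdot> 1\<close> identifies \<open>U(\<chi>)\<close> with \<open>M / J\<close>. The map \<open>\<phi>\<close> reads off the component of highest degree in
  \<open>F\<close>; it is bijective if and only if, for every \<open>n\<close>, an element of the \<open>n\<close>-th filtration step without
  terms of degree \<open>n\<close> in \<open>F\<close> lies in the step before.

  For homogeneous \<open>p\<close> in the biideal, of degree \<open>\<lambda>\<close>, the projection \<open>P\<close> of \<open>p(B)\<close> at \<open>-\<lambda>\<close> is \<open>p(B)\<close> computed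
  in the degeneration in which \<open>[E\<^sub>i, F\<^sub>i] = - K\<^sub>i\<^sup>-\<^sup>1\<close>, because \<open>K\<^sub>i\<close> leads to a larger index. The coproduct
  induces a map from the degeneration to \<open>U\<close>-tilde tensor the degeneration under which \<open>B\<^sub>i\<close> becomes
  \<open>B\<^sub>i \<otimes> K\<^sub>i\<^sup>-\<^sup>1\<close> plus \<open>1 \<otimes> F\<^sub>i\<close> and a multiple of \<open>K\<^sub>\<tau>\<^sub>i K\<^sub>i\<^sup>-\<^sup>1 \<otimes> E\<^sub>\<tau>\<^sub>i K\<^sub>i\<^sup>-\<^sup>1\<close>. Slicing the image of \<open>P(p(B))\<close> by a
  functional that picks a term of maximal degree in \<open>F\<close>, respectively in \<open>E\<close>, and using injectivity
  in lower degrees, one finds that \<open>P(p(B))\<close> lies in \<open>H\<close>. If moreover \<open>\<pi>\<^bsub>0,0\<^esub>\<close> kills it, the same slices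
  show that \<open>p(B)\<close> drops in the filtration. Conversely, if \<open>\<phi>\<close> is injective then \<open>p(B)\<close> drops, and the
  indices occurring in lower filtration steps have coordinate sum larger than that of \<open>-\<lambda>\<close>.\<close>

section \<open>Linear maps between spaces of finitely supported functions\<close>

text \<open>That the projection lands in H is a count. A slice at a term of maximal length in F lies
  in a lower filtration step and contains no F, so injectivity in lower degrees puts its exponent wt
  v - L among the exponents of H_theta, which have coordinate sum 0. Hence v has the full length m
  of the relation, and at that length p(F) = 0 leaves nothing. The same count applies to E: there
  the top part is a multiple of p(E_tau), which vanishes by \<tau>-invariance of \<I>; that one
  multiple serves all words of p rests on the symmetry and \<tau>-invariance of q. A slicing
  functional has to descend from words to U. It is therefore a coefficient of a normal form, so that
  it vanishes on \<I> and the coproduct condition on \<I> applies to it. The module knows left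
  multiplication only, while relations generate a two-sided ideal. Right multiplication within the
  filtration is recovered from the fact that an element is zero in U as soon as it sends the vector
  1 into \<open>J\<close>.\<close>

abbreviation lk :: "('b \<Rightarrow>\<^sub>0 'k) \<Rightarrow> 'b \<Rightarrow> 'k::field" where "lk \<equiv> Poly_Mapping.lookup"
abbreviation bas :: "'b \<Rightarrow> ('b \<Rightarrow>\<^sub>0 'k::field)" where "bas x \<equiv> Poly_Mapping.single x 1"

definition psc :: "'k::field \<Rightarrow> ('b \<Rightarrow>\<^sub>0 'k) \<Rightarrow> ('b \<Rightarrow>\<^sub>0 'k)"
  where "psc c = Poly_Mapping.map ((*) c)"

lemma lookup_psc [simp]: "lk (psc c p) x = c * lk p x"
  by (simp add: psc_def Poly_Mapping.map.rep_eq when_def)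

interpretation pm: vector_space "psc :: 'k::field \<Rightarrow> ('b \<Rightarrow>\<^sub>0 'k) \<Rightarrow> _"
  by unfold_locales (auto intro!: poly_mapping_eqI simp: lookup_add algebra_simps)

lemma psc_single [simp]: "psc c (Poly_Mapping.single x a) = Poly_Mapping.single x (c * a)"
  by (rule poly_mapping_eqI) (simp add: lookup_single when_def)

lemma single_eq_psc: "Poly_Mapping.single x a = psc a (bas x)"
  by simp

definition lin :: "(('b \<Rightarrow>\<^sub>0 'k::field) \<Rightarrow> ('c \<Rightarrow>\<^sub>0 'k)) \<Rightarrow> bool"
  where "lin T \<longleftrightarrow> (\<forall>x y. T (x + y) = T x + T y) \<and> (\<forall>c x. T (psc c x) = psc c (T x))"

lemma lin_add: "lin T \<Longrightarrow> T (x + y) = T x + T y"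
  by (simp add: lin_def)

lemma lin_psc: "lin T \<Longrightarrow> T (psc c x) = psc c (T x)"
  by (simp add: lin_def)

lemma lin_zero: "lin T \<Longrightarrow> T 0 = 0"
  using lin_psc[of T 0 0] by simp

lemma lin_uminus: "lin T \<Longrightarrow> T (- x) = - T x"
  using lin_psc[of T "-1" x] by simp

lemma lin_diff: "lin T \<Longrightarrow> T (x - y) = T x - T y"
  using lin_add[of T x "- y"] by (simp add: lin_uminus)

lemma lin_sum: "lin T \<Longrightarrow> T (sum f A) = (\<Sum>x\<in>A. T (f x))"
  by (induction A rule: infinite_finite_induct) (simp_all add: lin_zero lin_add)

lemma lin_single: "lin T \<Longrightarrow> T (Poly_Mapping.single x a) = psc a (T (bas x))"
  by (metis lin_psc single_eq_psc)

lemma lin_comp: "lin S \<Longrightarrow> lin T \<Longrightarrow> lin (\<lambda>x. S (T x))"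
  by (simp add: lin_def)

lemma lin_id: "lin (\<lambda>x. x)"
  by (simp add: lin_def)

lemma lin_plus: "lin S \<Longrightarrow> lin T \<Longrightarrow> lin (\<lambda>x. S x + T x)"
  by (simp add: lin_def pm.scale_right_distrib)

lemma lin_minus: "lin S \<Longrightarrow> lin T \<Longrightarrow> lin (\<lambda>x. S x - T x)"
  by (simp add: lin_def pm.scale_right_diff_distrib)

lemma lin_scale: "lin S \<Longrightarrow> lin (\<lambda>x. psc c (S x))"
  by (simp add: lin_def pm.scale_right_distrib mult.commute)

lemma lin_0: "lin (\<lambda>x. 0)"
  by (simp add: lin_def)

section \<open>Linear extension from basis vectors\<close>

definition lext :: "('b \<Rightarrow> ('c \<Rightarrow>\<^sub>0 'k::field)) \<Rightarrow> ('b \<Rightarrow>\<^sub>0 'k) \<Rightarrow> ('c \<Rightarrow>\<^sub>0 'k)"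
  where "lext f p = (\<Sum>x\<in>Poly_Mapping.keys p. psc (lk p x) (f x))"

lemma lext_superset:
  assumes "finite A" "Poly_Mapping.keys p \<subseteq> A"
  shows "lext f p = (\<Sum>x\<in>A. psc (lk p x) (f x))"
  unfolding lext_def
  by (rule sum.mono_neutral_left) (use assms in \<open>auto simp: in_keys_iff\<close>)

lemma lin_lext [simp]: "lin (lext f)"
proof -
  have "lext f (x + y) = lext f x + lext f y" for x y
  proof -
    let ?A = "Poly_Mapping.keys x \<union> Poly_Mapping.keys y"
    have "lext f (x + y) = (\<Sum>z\<in>?A. psc (lk (x + y) z) (f z))"
      by (rule lext_superset) (use keys_add[of x y] in auto)
    also have "\<dots> = (\<Sum>z\<in>?A. psc (lk x z) (f z)) + (\<Sum>z\<in>?A. psc (lk y z) (f z))"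
      by (simp add: lookup_add pm.scale_left_distrib sum.distrib)
    also have "\<dots> = lext f x + lext f y"
      by (simp add: lext_superset[of ?A x] lext_superset[of ?A y])
    finally show ?thesis .
  qed
  moreover have "lext f (psc c x) = psc c (lext f x)" for c x
  proof -
    have "lext f (psc c x) = (\<Sum>z\<in>Poly_Mapping.keys x. psc (lk (psc c x) z) (f z))"
      by (rule lext_superset) (auto simp: in_keys_iff)
    then show ?thesis
      by (simp add: lext_def pm.scale_sum_right)
  qed
  ultimately show ?thesis
    by (simp add: lin_def)
qed

lemma lext_bas [simp]: "lext f (bas x) = f x"
  by (simp add: lext_def)

lemma lext_single [simp]: "lext f (Poly_Mapping.single x a) = psc a (f x)"
  by (simp add: lin_single)

lemmas lext_add [simp] = lin_add[OF lin_lext] and lext_psc [simp] = lin_psc[OF lin_lext]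
  and lext_zero [simp] = lin_zero[OF lin_lext] and lext_diff [simp] = lin_diff[OF lin_lext]
  and lext_uminus [simp] = lin_uminus[OF lin_lext] and lext_sum = lin_sum[OF lin_lext]

lemma lext_bas_id: "lext bas p = p"
proof (rule poly_mapping_eqI)
  fix z
  have "lk (lext bas p) z = (\<Sum>x\<in>Poly_Mapping.keys p. lk p x when x = z)"
    by (simp add: lext_def lookup_sum lookup_single)
  also have "\<dots> = lk p z"
    by (simp add: when_def in_keys_iff)
  finally show "lk (lext bas p) z = lk p z" .
qed

lemma lin_lext_comp: "lin T \<Longrightarrow> T (lext f p) = lext (\<lambda>x. T (f x)) p"
  by (simp add: lext_def lin_sum lin_psc)

lemma lin_eq_lext: "lin T \<Longrightarrow> T p = lext (\<lambda>x. T (bas x)) p"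
  by (metis (no_types, lifting) ext lext_bas_id lin_lext_comp)

lemma lin_eqI: "lin S \<Longrightarrow> lin T \<Longrightarrow> (\<And>x. S (bas x) = T (bas x)) \<Longrightarrow> S p = T p"
  by (metis (no_types, lifting) ext lin_eq_lext)

lemma lext_cong: "(\<And>x. x \<in> Poly_Mapping.keys p \<Longrightarrow> f x = g x) \<Longrightarrow> lext f p = lext g p"
  by (simp add: lext_def cong: sum.cong)

lemma lext_in_subspace:
  "pm.subspace S \<Longrightarrow> (\<And>x. x \<in> Poly_Mapping.keys p \<Longrightarrow> f x \<in> S) \<Longrightarrow> lext f p \<in> S"
  unfolding lext_def by (intro pm.subspace_sum pm.subspace_scale) auto

lemma lext_plus_fun: "lext (\<lambda>x. f x + g x) p = lext f p + lext g p"
  by (simp add: lext_def pm.scale_right_distrib sum.distrib)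

lemma lext_minus_fun: "lext (\<lambda>x. f x - g x) p = lext f p - lext g p"
  by (simp add: lext_def pm.scale_right_diff_distrib sum_subtractf)

lemma lext_scale_fun: "lext (\<lambda>x. psc c (f x)) p = psc c (lext f p)"
  by (simp add: lext_def pm.scale_sum_right mult.commute)

lemma subspace_vimage: "lin T \<Longrightarrow> pm.subspace S \<Longrightarrow> pm.subspace {x. T x \<in> S}"
  unfolding pm.subspace_def by (auto simp: lin_add lin_psc lin_zero)

lemma keys_psc_subset: "Poly_Mapping.keys (psc c p) \<subseteq> Poly_Mapping.keys p"
  by (auto simp: in_keys_iff)

lemma subspace_keys: "pm.subspace {x :: _ \<Rightarrow>\<^sub>0 _::field. Poly_Mapping.keys x \<subseteq> A}"
  unfolding pm.subspace_def
proof (intro conjI ballI allI)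
  show "0 \<in> {x. Poly_Mapping.keys x \<subseteq> A}" by simp
next
  fix x y :: "'b \<Rightarrow>\<^sub>0 'k::field" assume "x \<in> {x. Poly_Mapping.keys x \<subseteq> A}" "y \<in> {x. Poly_Mapping.keys x \<subseteq> A}"
  then show "x + y \<in> {x. Poly_Mapping.keys x \<subseteq> A}" using keys_add[of x y] by blast
next
  fix c and x :: "'b \<Rightarrow>\<^sub>0 'k::field" assume "x \<in> {x. Poly_Mapping.keys x \<subseteq> A}"
  then show "psc c x \<in> {x. Poly_Mapping.keys x \<subseteq> A}" using keys_psc_subset[of c x] by blast
qed

section \<open>Coordinate projections and supports\<close>

definition restr :: "('b \<Rightarrow> bool) \<Rightarrow> ('b \<Rightarrow>\<^sub>0 'k::field) \<Rightarrow> ('b \<Rightarrow>\<^sub>0 'k)"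
  where "restr P = lext (\<lambda>x. if P x then bas x else 0)"

lemma lin_restr [simp]: "lin (restr P)"
  by (simp add: restr_def)

lemma lookup_restr: "lk (restr P p) x = (if P x then lk p x else 0)"
proof -
  have "lk (restr P p) x = (\<Sum>z\<in>Poly_Mapping.keys p. (if P x then lk p z else 0) when z = x)"
    unfolding restr_def lext_def lookup_sum
    by (rule sum.cong) (auto simp: lookup_single when_def)
  also have "\<dots> = (if P x then lk p x else 0)"
    by (simp add: when_def in_keys_iff)
  finally show ?thesis .
qed

lemma keys_restr: "Poly_Mapping.keys (restr P p) = {x \<in> Poly_Mapping.keys p. P x}"
  by (auto simp: in_keys_iff lookup_restr split: if_splits)

lemma restr_id: "(\<And>x. x \<in> Poly_Mapping.keys p \<Longrightarrow> P x) \<Longrightarrow> restr P p = p"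
  by (rule poly_mapping_eqI) (auto simp: lookup_restr in_keys_iff)

lemma restr_eq_0: "(\<And>x. x \<in> Poly_Mapping.keys p \<Longrightarrow> \<not> P x) \<Longrightarrow> restr P p = 0"
  by (rule poly_mapping_eqI) (auto simp: lookup_restr in_keys_iff)

lemma lext_restr: "lext f (restr P p) = lext (\<lambda>x. if P x then f x else 0) p"
proof -
  have "lext f (restr P p) = lext (\<lambda>x. lext f (if P x then bas x else 0)) p"
    unfolding restr_def by (rule lin_lext_comp[OF lin_lext])
  also have "\<dots> = lext (\<lambda>x. if P x then f x else 0) p"
    by (rule lext_cong) simp
  finally show ?thesis .
qed

lemma keys_lextE:
  assumes "y \<in> Poly_Mapping.keys (lext f p)"
  obtains x where "x \<in> Poly_Mapping.keys p" "y \<in> Poly_Mapping.keys (f x)"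
proof -
  have "\<exists>x\<in>Poly_Mapping.keys p. lk (psc (lk p x) (f x)) y \<noteq> 0"
  proof (rule ccontr)
    assume "\<not> ?thesis"
    then have "lk (lext f p) y = 0"
      unfolding lext_def lookup_sum by (intro sum.neutral) blast
    then show False using assms by (simp add: in_keys_iff)
  qed
  then obtain x where "x \<in> Poly_Mapping.keys p" "lk (f x) y \<noteq> 0"
    by auto
  then show ?thesis using that[of x] by (simp add: in_keys_iff)
qed

lemma restr_commute:
  assumes "lin T" "\<And>x. x \<in> Poly_Mapping.keys p \<Longrightarrow> P x \<Longrightarrow> restr Q (T (bas x)) = T (bas x)"
    "\<And>x. x \<in> Poly_Mapping.keys p \<Longrightarrow> \<not> P x \<Longrightarrow> restr Q (T (bas x)) = 0"
  shows "restr Q (T p) = T (restr P p)"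
proof -
  have "restr Q (T p) = lext (\<lambda>x. restr Q (T (bas x))) p"
    by (simp add: lin_eq_lext[OF assms(1), of p] lin_lext_comp)
  also have "\<dots> = lext (\<lambda>x. if P x then T (bas x) else 0) p"
    by (rule lext_cong) (use assms in auto)
  also have "\<dots> = T (restr P p)"
    by (simp add: lin_eq_lext[OF assms(1), of "restr P p"] lext_restr)
  finally show ?thesis .
qed

text \<open>A basis of \<open>S\<close> is extended to a basis of the whole space; T kills the
  former and fixes the added vectors. Applied to the biideal this yields linear normal forms without
  any monomial order.\<close>

lemma projection_with_kernel:
  fixes S :: "('b \<Rightarrow>\<^sub>0 'k::field) set"
  assumes "pm.subspace S"
  obtains T where "lin T" "\<And>x. x \<in> S \<Longrightarrow> T x = 0" "\<And>x. T x - x \<in> S"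
proof -
  interpret vs: vector_space_pair "psc :: 'k \<Rightarrow> ('b \<Rightarrow>\<^sub>0 'k) \<Rightarrow> _" "psc :: 'k \<Rightarrow> ('b \<Rightarrow>\<^sub>0 'k) \<Rightarrow> _"
    by (intro vector_space_pair.intro pm.vector_space_axioms)
  obtain B where B: "B \<subseteq> S" "pm.independent B" "S \<subseteq> pm.span B"
    by (rule pm.basis_exists[of S])
  define C where "C = pm.extend_basis B"
  have C: "B \<subseteq> C" "pm.independent C" "pm.span C = UNIV"
    using pm.extend_basis_superset[OF B(2)] pm.independent_extend_basis[OF B(2)]
      pm.span_extend_basis[OF B(2)] by (simp_all add: C_def)
  obtain T where T: "Vector_Spaces.linear psc psc T" "\<forall>x\<in>C. T x = (if x \<in> B then 0 else x)"
    using vs.linear_independent_extend[OF C(2), of "\<lambda>x. if x \<in> B then 0 else x"] by (elim exE conjE)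
  have l: "lin T"
    using T(1) vs.linear_add[of T] vs.linear_scale[of T] by (simp add: lin_def)
  have 1: "T x = 0" if "x \<in> pm.span B" for x
    using that
  proof (induction rule: pm.span_induct_alt)
    case base
    then show ?case by (rule lin_zero[OF l])
  next
    case (step c x y)
    have "x \<in> C" using step(1) C(1) by (rule subsetD[rotated])
    with T(2) step have "T x = 0" by auto
    with step show ?case by (simp only: lin_add[OF l] lin_psc[OF l]) simp
  qed
  have 2: "T x - x \<in> S" if "x \<in> pm.span C" for x
    using that
  proof (induction rule: pm.span_induct_alt)
    case base
    then show ?case by (simp add: lin_zero[OF l] pm.subspace_0[OF assms])
  next
    case (step c x y)
    have "T x = (if x \<in> B then 0 else x)"
      using T(2) step(1) by (rule bspec)
    then have "T x - x \<in> S"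
      using pm.subspace_0[OF assms] pm.subspace_neg[OF assms, of x] B(1) by (cases "x \<in> B") auto
    then have "psc c (T x - x) + (T y - y) \<in> S"
      using step(2) by (intro pm.subspace_add[OF assms] pm.subspace_scale[OF assms])
    moreover have "T (psc c x + y) - (psc c x + y) = psc c (T x - x) + (T y - y)"
      by (simp only: lin_add[OF l] lin_psc[OF l] pm.scale_right_diff_distrib) simp
    ultimately show ?case
      by (simp only:)
  qed
  show ?thesis
  proof (rule that[OF l])
    show "T x = 0" if "x \<in> S" for x by (rule 1, rule subsetD[OF B(3) that])
    show "T x - x \<in> S" for x by (rule 2) (simp add: C(3))
  qed
qed

subsection \<open>Tensor products\<close>

definition tens :: "('b \<Rightarrow>\<^sub>0 'k::field) \<Rightarrow> ('c \<Rightarrow>\<^sub>0 'k) \<Rightarrow> ('b \<times> 'c \<Rightarrow>\<^sub>0 'k)"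
  where "tens m n = lext (\<lambda>x. lext (\<lambda>y. bas (x, y)) n) m"

lemma lin_tens1: "lin (\<lambda>m. tens m n)"
  unfolding tens_def by simp

lemma lin_tens2: "lin (\<lambda>n. tens m n)"
  unfolding lin_def tens_def by (simp add: lext_plus_fun lext_scale_fun)

lemma tens_bas [simp]: "tens (bas x) (bas y) = bas (x, y)"
  by (simp add: tens_def)

lemmas tens_simps = lin_add[OF lin_tens1] lin_add[OF lin_tens2] lin_psc[OF lin_tens1]
  lin_psc[OF lin_tens2] lin_zero[OF lin_tens1] lin_zero[OF lin_tens2]
  lin_diff[OF lin_tens1] lin_diff[OF lin_tens2]

definition ten ::
    "(('b \<Rightarrow>\<^sub>0 'k::field) \<Rightarrow> ('b \<Rightarrow>\<^sub>0 'k)) \<Rightarrow> (('c \<Rightarrow>\<^sub>0 'k) \<Rightarrow> ('c \<Rightarrow>\<^sub>0 'k)) \<Rightarrow>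
     ('b \<times> 'c \<Rightarrow>\<^sub>0 'k) \<Rightarrow> ('b \<times> 'c \<Rightarrow>\<^sub>0 'k)"
  where "ten S T = lext (\<lambda>(x, y). tens (S (bas x)) (T (bas y)))"

lemma lin_ten [simp]: "lin (ten S T)"
  by (simp add: ten_def)

lemma ten_tens: 
  assumes "lin S" "lin T" shows "ten S T (tens m n) = tens (S m) (T n)"
proof -
  have 1: "ten S T (tens (bas x) n) = tens (S (bas x)) (T n)" for x
    by (rule lin_eqI[of "\<lambda>n. ten S T (tens (bas x) n)" "\<lambda>n. tens (S (bas x)) (T n)"])
      (simp_all add: lin_comp[OF lin_ten lin_tens2] lin_comp[OF lin_tens2 assms(2)], simp add: ten_def)
  show ?thesis
    by (rule lin_eqI[of "\<lambda>m. ten S T (tens m n)" "\<lambda>m. tens (S m) (T n)"])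
      (simp_all add: 1 lin_comp[OF lin_ten lin_tens1] lin_comp[OF lin_tens1 assms(1)])
qed

lemma tens_eqI:
  assumes "lin A" "lin B" "\<And>m n. A (tens m n) = B (tens m n)"
  shows "A z = B z"
proof (rule lin_eqI[OF assms(1,2)])
  fix x show "A (bas x) = B (bas x)"
    using assms(3)[of "bas (fst x)" "bas (snd x)"] by simp
qed

text \<open>The map id \<otimes> g, where \<open>g\<close> gives the values of a functional on basis
  vectors.\<close>

definition slice :: "('c \<Rightarrow> 'k) \<Rightarrow> ('b \<times> 'c \<Rightarrow>\<^sub>0 'k::field) \<Rightarrow> ('b \<Rightarrow>\<^sub>0 'k)"
  where "slice g = lext (\<lambda>(x, y). Poly_Mapping.single x (g y))"

text \<open>The functional is coded as a linear map into functions on a one-point type, so that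
  \<open>lin\<close> and \<open>lext\<close> apply to it unchanged.\<close>

definition lfun :: "('c \<Rightarrow> 'k) \<Rightarrow> ('c \<Rightarrow>\<^sub>0 'k::field) \<Rightarrow> 'k"
  where "lfun g n = lk (lext (\<lambda>y. Poly_Mapping.single () (g y)) n) ()"

lemma lin_slice [simp]: "lin (slice g)"
  by (simp add: slice_def)

lemma lfun_simps [simp]: "lfun g (bas y) = g y" "lfun g (m + n) = lfun g m + lfun g n"
  "lfun g (psc c m) = c * lfun g m" "lfun g 0 = 0" "lfun g (Poly_Mapping.single y a) = a * g y"
  by (simp_all add: lfun_def lookup_add)

lemma slice_tens:
  fixes g :: "'c \<Rightarrow> 'k::field"
  shows "slice g (tens m n) = psc (lfun g n) m"
proof -
  have l: "lin (\<lambda>n. psc (lfun g n) m)" for m :: "'b \<Rightarrow>\<^sub>0 'k"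
    unfolding lin_def by (simp add: pm.scale_left_distrib)
  have s1: "lin (\<lambda>n. slice g (tens m n))" "lin (\<lambda>m. slice g (tens m n))"
    for m :: "'b \<Rightarrow>\<^sub>0 'k" and n
    by (rule lin_comp[OF lin_slice lin_tens2], rule lin_comp[OF lin_slice lin_tens1])
  have 0: "slice g (bas (x, y)) = psc (g y) (bas x)" for x :: 'b and y
    by (simp add: slice_def)
  have 1: "slice g (tens (bas x) n) = psc (lfun g n) (bas x)" for x :: 'b
    by (rule lin_eqI[OF s1(1) l]) (simp add: 0)
  show ?thesis
    by (rule lin_eqI[OF s1(2) lin_scale[OF lin_id] 1])
qed

lemma lfun_lin: "lin T \<Longrightarrow> lfun g (T n) = lfun (\<lambda>y. lfun g (T (bas y))) n"
proof -
  assume T: "lin T"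
  have "lext (\<lambda>y. Poly_Mapping.single () (g y)) (T n) =
      lext (\<lambda>y. Poly_Mapping.single () (lfun g (T (bas y)))) n"
    by (rule lin_eqI[of "\<lambda>n. lext (\<lambda>y. Poly_Mapping.single () (g y)) (T n)"
          "lext (\<lambda>y. Poly_Mapping.single () (lfun g (T (bas y))))"])
      (auto intro!: poly_mapping_eqI simp: lin_comp[OF lin_lext T] lfun_def)
  then show ?thesis by (simp add: lfun_def)
qed

text \<open>An operator on the second factor is absorbed into the functional by transposition. This
  turns recursions on operators into recursions on functionals.\<close>

lemma slice_ten:
  assumes "lin S" "lin T"
  shows "slice g (ten S T z) = S (slice (\<lambda>y. lfun g (T (bas y))) z)"
proof -
  let ?g = "\<lambda>y. lfun g (T (bas y))"
  have 1: "lin (\<lambda>z. slice g (ten S T z))" "lin (\<lambda>z. S (slice ?g z))"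
    by (rule lin_comp; fact lin_slice lin_ten assms)+
  have 2: "slice g (ten S T (tens m n)) = S (slice ?g (tens m n))" for m n
    unfolding ten_tens[OF assms] slice_tens lin_psc[OF assms(1)] lfun_lin[OF assms(2), of g n] ..
  show ?thesis
    by (rule tens_eqI[OF 1 2])
qed

text \<open>Weights are handled as elements of the group of functions, never pointwise.\<close>

lemmas fun_apply = plus_fun_apply zero_fun_apply minus_apply uminus_apply
declare fun_apply [simp del]

section \<open>Words and evaluation of noncommutative polynomials\<close>

definition wcons :: "'x \<Rightarrow> 'x word \<Rightarrow> 'x word" where "wcons i w = Word (i # letters w)"

abbreviation wlen :: "'x word \<Rightarrow> nat" where "wlen w \<equiv> length (letters w)"

lemma letters_simps [simp]: "letters 0 = []" "letters (wcons i w) = i # letters w"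
  "letters (v + w) = letters v @ letters w"
  by (simp_all add: zero_word_def wcons_def plus_word_def)

lemma Word_simps [simp]: "Word [] = 0" "Word (i # u) = wcons i (Word u)"
  by (simp_all add: zero_word_def wcons_def)

lemma wcons_plus [simp]: "wcons i w + v = wcons i (w + v)"
  by (rule word.expand) simp

lemma wcons_inject [simp]: "wcons i w = wcons j v \<longleftrightarrow> i = j \<and> w = v"
  by (metis letters_simps(2) list.inject word.expand)

lemma wcons_neq_0 [simp]: "wcons i w \<noteq> 0" "0 \<noteq> wcons i w"
  by (auto dest: arg_cong[of _ _ letters])

lemma wlen_0_iff [simp]: "letters w = [] \<longleftrightarrow> w = 0"
  by (auto intro: word.expand)

lemma word_induct [case_names 0 wcons, induct type: word]:
  assumes "P 0" "\<And>i w. P w \<Longrightarrow> P (wcons i w)" shows "P w"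
proof -
  have "P (Word l)" for l
    by (induction l) (simp_all add: assms)
  from this[of "letters w"] show ?thesis by simp
qed

definition wt :: "'i word \<Rightarrow> 'i \<Rightarrow> int" where "wt w = (\<lambda>i. int (wdeg w i))"

lemma wt_simps [simp]: "wt 0 = 0" "wt (wcons i w) = alpha i + wt w" "wt (v + w) = wt v + wt w"
  by (auto simp: wt_def wdeg_def alpha_def fun_eq_iff fun_apply)

lemma wt_eq_iff: "wt v = wt w \<longleftrightarrow> wdeg v = wdeg w"
  by (auto simp: wt_def fun_eq_iff)

lemma sum_alpha: "(\<Sum>j\<in>UNIV. alpha (i::'i::finite) j) = 1"
  by (simp add: alpha_def)

lemma sum_wt: "(\<Sum>i\<in>UNIV. wt (w :: 'i::finite word) i) = int (wlen w)"
  by (induction w) (simp_all add: sum.distrib sum_alpha fun_apply)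

lemma lin_if: "lin S \<Longrightarrow> lin T \<Longrightarrow> lin (\<lambda>x. if P then S x else T x)"
  by (cases P) simp_all

definition evw :: "('x \<Rightarrow> 'v \<Rightarrow> 'v) \<Rightarrow> 'x word \<Rightarrow> 'v \<Rightarrow> 'v"
  where "evw T w v = foldr T (letters w) v"

lemma evw_simps [simp]: "evw T 0 v = v" "evw T (wcons i w) v = T i (evw T w v)"
  "evw T (w + w') v = evw T w (evw T w' v)"
  by (simp_all add: evw_def)

lemma lin_evw: "(\<And>i. lin (T i)) \<Longrightarrow> lin (evw T w)"
proof (induction w)
  case 0
  then show ?case using lin_id by (simp add: evw_def fun_eq_iff eta_contract_eq id_def)
next
  case (wcons i w)
  have "lin (\<lambda>v. T i (evw T w v))"
    by (rule lin_comp) (use wcons in auto)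
  then show ?case by (simp add: evw_def)
qed

definition evop :: "('x \<Rightarrow> ('b \<Rightarrow>\<^sub>0 'k) \<Rightarrow> ('b \<Rightarrow>\<^sub>0 'k)) \<Rightarrow> ('x, 'k::field) ncpoly \<Rightarrow>
    ('b \<Rightarrow>\<^sub>0 'k) \<Rightarrow> ('b \<Rightarrow>\<^sub>0 'k)"
  where "evop T p v = lext (\<lambda>w. evw T w v) p"

lemma lin_evop1: "lin (\<lambda>p. evop T p v)"
  by (simp add: evop_def)

lemma lin_evop2: "(\<And>i. lin (T i)) \<Longrightarrow> lin (evop T p)"
  using lin_evw[of T] unfolding lin_def evop_def
  by (simp add: lext_plus_fun lext_scale_fun)

lemma evop_bas [simp]: "evop T (bas w) v = evw T w v"
  by (simp add: evop_def)

lemma psc_eq_const: "psc a p = nc_const a * p"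
  by (simp add: psc_def nc_const_def mult_map_scale_conv_mult)

lemma bas_mult [simp]: "bas v * bas w = bas (v + w)"
  by (simp add: mult_single)

lemma one_bas: "1 = bas 0"
  by simp

lemma psc_mult: "psc a p * q = psc a (p * q)" "p * psc a q = psc a (p * (q :: ('x, 'k::field) ncpoly))"
proof -
  show "psc a p * q = psc a (p * q)"
    by (simp add: psc_eq_const mult.assoc)
  have "p * nc_const a = nc_const a * p" for p :: "('x, 'k) ncpoly"
  proof (rule poly_mapping_eqI)
    have l: "lin (\<lambda>p :: ('x, 'k) ncpoly. p * nc_const a)"
      by (simp add: lin_def distrib_right psc_eq_const mult.assoc)
    have "p * nc_const a = psc a p"
      by (rule lin_eqI[OF l lin_scale[OF lin_id]]) (simp add: nc_const_def mult_single)
    then show "lk (p * nc_const a) k = lk (nc_const a * p) k" for k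
      by (simp add: psc_eq_const)
  qed
  then show "p * psc a q = psc a (p * q)"
    by (simp add: psc_eq_const flip: mult.assoc)
qed

lemma lin_mult_left: "lin (\<lambda>q :: ('x, 'k::field) ncpoly. p * q)"
  by (simp add: lin_def distrib_left psc_mult)

lemma lin_mult_right: "lin (\<lambda>p :: ('x, 'k::field) ncpoly. p * q)"
  by (simp add: lin_def distrib_right psc_mult)

lemma evop_1 [simp]: "evop T 1 v = v"
  unfolding one_bas evop_bas by simp

lemma evop_mult:
  assumes "\<And>i. lin (T i)"
  shows "evop T (p * q) v = evop T p (evop T q v)"
proof -
  have l: "lin (evop T p)" for p by (rule lin_evop2[OF assms])
  have 1: "evop T (bas w * q) v = evop T (bas w) (evop T q v)" for w
    by (rule lin_eqI[of "\<lambda>q. evop T (bas w * q) v" "\<lambda>q. evop T (bas w) (evop T q v)"])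
      (simp_all add: lin_comp[OF lin_evop1 lin_mult_left] lin_comp[OF l lin_evop1] del: evop_bas,
        simp)
  show ?thesis
    by (rule lin_eqI[OF lin_comp[OF lin_evop1 lin_mult_right] lin_evop1 1])
qed

lemma nc_const_simps [simp]: "nc_const 0 = 0" "nc_const 1 = 1"
  by (simp_all add: nc_const_def)

lemma evop_nc_const [simp]: "evop T (nc_const a) v = psc a v"
  by (simp add: nc_const_def evop_def)

lemma evop_nc_var [simp]: "evop T (nc_var x) v = T x v"
  unfolding nc_var_def evop_bas by simp

lemmas evop_add [simp] = lin_add[OF lin_evop1] and evop_diff [simp] = lin_diff[OF lin_evop1]
  and evop_psc [simp] = lin_psc[OF lin_evop1] and evop_zero [simp] = lin_zero[OF lin_evop1]

lemma evw_in: "(\<And>i x. x \<in> S \<Longrightarrow> T i x \<in> S) \<Longrightarrow> v \<in> S \<Longrightarrow> evw T w v \<in> S"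
  by (induction w) simp_all

lemma evop_in: "pm.subspace S \<Longrightarrow> (\<And>i x. x \<in> S \<Longrightarrow> T i x \<in> S) \<Longrightarrow> v \<in> S \<Longrightarrow> evop T p v \<in> S"
  unfolding evop_def by (intro lext_in_subspace evw_in)

text \<open>Substitution \<open>x \<mapsto> b x\<close> in a free algebra.\<close>

definition sub :: "('x \<Rightarrow> ('y, 'k) ncpoly) \<Rightarrow> ('x, 'k::field) ncpoly \<Rightarrow> ('y, 'k) ncpoly"
  where "sub b p = evop (\<lambda>x. (*) (b x)) p 1"

lemma lin_sub [simp]: "lin (sub b)"
  unfolding sub_def by (rule lin_evop1)

lemma sub_simps [simp]: "sub b (nc_var x) = b x" "sub b 1 = 1" "sub b (nc_const a) = nc_const a"
  by (simp_all add: sub_def psc_eq_const)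

lemma sub_mult: "sub b (p * q) = sub b p * sub b q"
proof -
  have *: "evop (\<lambda>x. (*) (b x)) p v = sub b p * v" for v
  proof -
    have "evw (\<lambda>x. (*) (b x)) w v = evw (\<lambda>x. (*) (b x)) w 1 * v" for w
      by (induction w) (simp_all add: mult.assoc)
    then have 1: "evop (\<lambda>x. (*) (b x)) (bas w) v = sub b (bas w) * v" for w
      by (simp add: sub_def)
    show ?thesis
      by (rule lin_eqI[OF lin_evop1 lin_comp[OF lin_mult_right lin_sub] 1])
  qed
  show ?thesis
    unfolding sub_def[of b "p * q"] by (subst evop_mult[OF lin_mult_left]) (simp add: * flip: sub_def)
qed

lemma evop_sub:
  assumes "\<And>i. lin (T i)"
  shows "evop T (sub b p) v = evop (\<lambda>x. evop T (b x)) p v"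
proof -
  have 1: "evop T (sub b (bas w)) v = evop (\<lambda>x. evop T (b x)) (bas w) v" for w
    by (simp add: sub_def) (induction w, simp_all add: evop_mult[OF assms])
  show ?thesis
    by (rule lin_eqI[OF lin_comp[OF lin_evop1 lin_sub] lin_evop1 1])
qed

section \<open>The triangular modules\<close>

locale bich =
  fixes \<chi> :: "('i, 'k::field) bichar"
  assumes bichar: "bicharacter \<chi>"
    and qsym: "qmat \<chi> i j = qmat \<chi> j i"
begin

lemma chi_nz [simp]: "\<chi> a b \<noteq> 0"
  and chi_add1: "\<chi> (a + b) c = \<chi> a c * \<chi> b c"
  and chi_add2: "\<chi> a (b + c) = \<chi> a b * \<chi> a c"
  using bichar by (auto simp: bicharacter_def)

lemma chi_0 [simp]: "\<chi> 0 b = 1" "\<chi> a 0 = 1"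
  using chi_add1[of 0 0 b] chi_add2[of a 0 0] by auto

lemma chi_minus1: "\<chi> (- a) b = inverse (\<chi> a b)"
  using chi_add1[of a "- a" b] by (simp add: inverse_unique)

lemma chi_minus2: "\<chi> a (- b) = inverse (\<chi> a b)"
  using chi_add2[of a b "- b"] by (simp add: inverse_unique)

lemma chi_diff1: "\<chi> (a - b) c = \<chi> a c / \<chi> b c"
  using chi_add1[of a "- b" c] by (simp add: chi_minus1 divide_inverse)

lemma chi_diff2: "\<chi> a (b - c) = \<chi> a b / \<chi> a c"
  using chi_add2[of a b "- c"] by (simp add: chi_minus2 divide_inverse)

lemma chi_alpha: "\<chi> (alpha i) (alpha j) = \<chi> (alpha j) (alpha i)"
  using qsym by (simp add: qmat_def)

lemmas chi_simps = chi_add1 chi_add2 chi_minus1 chi_minus2 chi_diff1 chi_diff2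

end

type_synonym 'i trip = "'i word \<times> 'i word \<times> ('i \<Rightarrow> int)"
type_synonym ('i, 'k) tmod = "'i trip \<Rightarrow>\<^sub>0 'k"

text \<open>The basis vector \<open>(u, v, l)\<close> stands for \<open>E\<^sub>u F\<^sub>v K\<^sub>l\<close>. For \<open>a = 1\<close> the operators below give
  the left regular representation of \<open>U\<close>-tilde, for \<open>a = 0\<close> that of the degeneration with
  \<open>E\<^sub>i F\<^sub>j - F\<^sub>j E\<^sub>i = - \<delta>\<^sub>i\<^sub>j K\<^sub>i\<^sup>-\<^sup>1\<close>.\<close>

context bich
begin

definition Eop :: "'i \<Rightarrow> ('i, 'k) tmod \<Rightarrow> ('i, 'k) tmod"
  where "Eop i = lext (\<lambda>(u, v, l). bas (wcons i u, v, l))"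

definition Kop :: "('i \<Rightarrow> int) \<Rightarrow> ('i, 'k) tmod \<Rightarrow> ('i, 'k) tmod"
  where "Kop \<mu> = lext (\<lambda>(u, v, l). Poly_Mapping.single (u, v, \<mu> + l) (\<chi> \<mu> (wt u - wt v)))"

text \<open>F_i is carried past E_u one letter at a time by F_i E_j = E_j F_i - \<delta>_ij (a K_i -
  K_i^{-1}).\<close>

primrec Fb :: "'k \<Rightarrow> 'i \<Rightarrow> 'i list \<Rightarrow> 'i word \<Rightarrow> ('i \<Rightarrow> int) \<Rightarrow> ('i, 'k) tmod" where
  "Fb a i [] v l = bas (0, wcons i v, l)"
| "Fb a i (j # u) v l = Eop j (Fb a i u v l) -
     (if i = j then psc a (Kop (alpha i) (bas (Word u, v, l))) - Kop (- alpha i) (bas (Word u, v, l))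
      else 0)"

definition Fop :: "'k \<Rightarrow> 'i \<Rightarrow> ('i, 'k) tmod \<Rightarrow> ('i, 'k) tmod"
  where "Fop a i = lext (\<lambda>(u, v, l). Fb a i (letters u) v l)"

lemma lin_ops [simp]: "lin (Eop i)" "lin (Kop \<mu>)" "lin (Fop a i)"
  by (simp_all add: Eop_def Kop_def Fop_def)

lemmas ops_add = lin_ops[THEN lin_add] and ops_psc = lin_ops[THEN lin_psc]
  and ops_zero = lin_ops[THEN lin_zero] and ops_diff = lin_ops[THEN lin_diff]

lemmas lin_intros = lin_ops lin_ops[THEN lin_comp] lin_plus lin_minus lin_scale lin_id lin_0 lin_if

lemma Eop_bas [simp]: "Eop i (bas (u, v, l)) = bas (wcons i u, v, l)"
  by (simp add: Eop_def)

lemma Kop_bas: "Kop \<mu> (bas (u, v, l)) = Poly_Mapping.single (u, v, \<mu> + l) (\<chi> \<mu> (wt u - wt v))"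
  by (simp add: Kop_def)

lemma Fop_bas0 [simp]: "Fop a i (bas (0, v, l)) = bas (0, wcons i v, l)"
  by (simp add: Fop_def)

lemma ops_single:
  "Eop i (Poly_Mapping.single (u, v, l) b) = Poly_Mapping.single (wcons i u, v, l) b"
  "Kop \<mu> (Poly_Mapping.single (u, v, l) b) = Poly_Mapping.single (u, v, \<mu> + l) (b * \<chi> \<mu> (wt u - wt v))"
  "Fop a i (Poly_Mapping.single (0, v, l) b) = Poly_Mapping.single (0, wcons i v, l) b"
  by (simp_all add: Eop_def Kop_def Fop_def)

lemma Fop_bas_wcons: "Fop a i (bas (wcons j u, v, l)) = Eop j (Fop a i (bas (u, v, l))) -
     (if i = j then psc a (Kop (alpha i) (bas (u, v, l))) - Kop (- alpha i) (bas (u, v, l)) else 0)"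
  by (simp add: Fop_def)

lemma lin_eq3I:
  fixes S T :: "('i, 'k) tmod \<Rightarrow> ('b \<Rightarrow>\<^sub>0 'k)"
  assumes "lin S" "lin T" "\<And>u v l. S (bas (u, v, l)) = T (bas (u, v, l))"
  shows "S p = T p"
  by (rule lin_eqI[OF assms(1,2)]) (use assms(3) in auto)

lemma Kop_0 [simp]: "Kop 0 m = m"
  by (rule lin_eq3I[OF lin_ops(2) lin_id]) (simp add: Kop_bas)

lemma Kop_Kop: "Kop \<mu> (Kop \<nu> m) = Kop (\<mu> + \<nu>) m"
  by (rule lin_eq3I[OF lin_comp[OF lin_ops(2) lin_ops(2)] lin_ops(2)])
    (simp add: ops_single chi_add1 add.assoc mult.commute)

lemma Kop_Eop: "Kop \<mu> (Eop i m) = psc (\<chi> \<mu> (alpha i)) (Eop i (Kop \<mu> m))"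
  by (rule lin_eq3I[OF lin_comp[OF lin_ops(2) lin_ops(1)] lin_scale[OF lin_comp[OF lin_ops(1) lin_ops(2)]]])
    (simp add: ops_single chi_simps)

lemma Eop_Fop: "Eop i (Fop a j m) - Fop a j (Eop i m) =
    (if i = j then psc a (Kop (alpha i) m) - Kop (- alpha i) m else 0)"
proof (rule lin_eq3I[of "\<lambda>m. Eop i (Fop a j m) - Fop a j (Eop i m)"
      "\<lambda>m. if i = j then psc a (Kop (alpha i) m) - Kop (- alpha i) m else 0"])
  show "lin (\<lambda>m. Eop i (Fop a j m) - Fop a j (Eop i m))"
    by (intro lin_intros)
  show "lin (\<lambda>m. if i = j then psc a (Kop (alpha i) m) - Kop (- alpha i) m else 0)"
    by (intro lin_intros)
qed (auto simp: Fop_bas_wcons)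

text \<open>In the induction a correction term appears only for i = j, where the weights of E_j and
  F_i cancel, so that commuting with \<open>Kop\<close> costs it no scalar.\<close>

lemma Kop_Fop: "Kop \<mu> (Fop a i m) = psc (\<chi> \<mu> (- alpha i)) (Fop a i (Kop \<mu> m))"
proof (rule lin_eq3I[of "\<lambda>m. Kop \<mu> (Fop a i m)" "\<lambda>m. psc (\<chi> \<mu> (- alpha i)) (Fop a i (Kop \<mu> m))"])
  show "lin (\<lambda>m. Kop \<mu> (Fop a i m))" "lin (\<lambda>m. psc (\<chi> \<mu> (- alpha i)) (Fop a i (Kop \<mu> m)))"
    by (intro lin_intros)+
  show "Kop \<mu> (Fop a i (bas (u, v, l))) = psc (\<chi> \<mu> (- alpha i)) (Fop a i (Kop \<mu> (bas (u, v, l))))"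
    for u v l
  proof (induction u)
    case 0
    show ?case
      by (simp add: ops_single chi_simps field_simps)
  next
    case (wcons j u)
    let ?b = "bas (u, v, l) :: ('i, 'k) tmod"
    have e: "bas (wcons j u, v, l) = Eop j ?b" by simp
    have F: "Fop a i (Eop j x) = Eop j (Fop a i x) -
        (if j = i then psc a (Kop (alpha i) x) - Kop (- alpha i) x else 0)" for x
      using Eop_Fop[of j a i x] by (simp add: algebra_simps split: if_splits)
    show ?case
      unfolding e Kop_Eop ops_psc F ops_diff
      by (simp add: wcons.IH ops_psc ops_diff ops_zero Kop_Kop add.commute pm.scale_right_diff_distrib
          chi_minus2 mult.commute)
  qed
qed

end

text \<open>The relations are required only modulo \<open>N\<close>, so that one construction serves
  twice: \<open>N\<close> = 0 gives the coaction, and the kernel of the free algebra onto U(\<chi>)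
  gives the map from the module back to U(\<chi>), where relations hold only between
  classes.\<close>

locale triangular_rep = bich \<chi> for \<chi> :: "('i, 'k::field) bichar" +
  fixes a :: 'k and e f :: "'i \<Rightarrow> ('b \<Rightarrow>\<^sub>0 'k) \<Rightarrow> ('b \<Rightarrow>\<^sub>0 'k)"
    and k :: "('i \<Rightarrow> int) \<Rightarrow> ('b \<Rightarrow>\<^sub>0 'k) \<Rightarrow> ('b \<Rightarrow>\<^sub>0 'k)" and N :: "('b \<Rightarrow>\<^sub>0 'k) set"
  assumes lin_e: "lin (e i)" and lin_f: "lin (f i)" and lin_k: "lin (k \<mu>)"
    and N: "pm.subspace N"
    and e_N: "x \<in> N \<Longrightarrow> e i x \<in> N" and f_N: "x \<in> N \<Longrightarrow> f i x \<in> N" and k_N: "x \<in> N \<Longrightarrow> k \<mu> x \<in> N"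
    and kk: "k \<mu> (k \<nu> x) - k (\<mu> + \<nu>) x \<in> N"
    and ke: "k \<mu> (e i x) - psc (\<chi> \<mu> (alpha i)) (e i (k \<mu> x)) \<in> N"
    and kf: "k \<mu> (f i x) - psc (\<chi> \<mu> (- alpha i)) (f i (k \<mu> x)) \<in> N"
    and ef: "e i (f j x) - f j (e i x) -
      (if i = j then psc a (k (alpha i) x) - k (- alpha i) x else 0) \<in> N"
begin

text \<open>The map sending E_u F_v K_l to its value on the vector \<open>x\<close>. The lemmas
  below say that it intertwines the operators up to \<open>N\<close>.\<close>

definition Psi :: "('b \<Rightarrow>\<^sub>0 'k) \<Rightarrow> ('i, 'k) tmod \<Rightarrow> ('b \<Rightarrow>\<^sub>0 'k)"
  where "Psi x = lext (\<lambda>(u, v, l). evw e u (evw f v (k l x)))"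

definition eqN :: "('b \<Rightarrow>\<^sub>0 'k) \<Rightarrow> ('b \<Rightarrow>\<^sub>0 'k) \<Rightarrow> bool" (infix \<open>\<doteq>\<close> 50)
  where "x \<doteq> y \<longleftrightarrow> x - y \<in> N"

lemma eqN_refl [simp]: "x \<doteq> x"
  by (simp add: eqN_def pm.subspace_0[OF N])

lemma eqN_sym: "x \<doteq> y \<Longrightarrow> y \<doteq> x"
  using pm.subspace_neg[OF N, of "x - y"] by (simp add: eqN_def)

lemma eqN_trans [trans]: "x \<doteq> y \<Longrightarrow> y \<doteq> z \<Longrightarrow> x \<doteq> z"
  using pm.subspace_add[OF N, of "x - y" "y - z"] by (simp add: eqN_def)

lemma eqN_diff: "x \<doteq> y \<Longrightarrow> x' \<doteq> y' \<Longrightarrow> x - x' \<doteq> y - y'"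
  using pm.subspace_diff[OF N, of "x - y" "x' - y'"] by (simp add: eqN_def algebra_simps)

lemma eqN_psc: "x \<doteq> y \<Longrightarrow> psc c x \<doteq> psc c y"
  using pm.subspace_scale[OF N, of "x - y" c] by (simp add: eqN_def pm.scale_right_diff_distrib)

lemma eqN_if: "x \<doteq> y \<Longrightarrow> x' \<doteq> y' \<Longrightarrow> (if P then x else x') \<doteq> (if P then y else y')"
  by simp

lemma eqN_ops: "x \<doteq> y \<Longrightarrow> e i x \<doteq> e i y" "x \<doteq> y \<Longrightarrow> f i x \<doteq> f i y" "x \<doteq> y \<Longrightarrow> k \<mu> x \<doteq> k \<mu> y"
  by (simp_all add: eqN_def e_N f_N k_N flip: lin_diff[OF lin_e] lin_diff[OF lin_f] lin_diff[OF lin_k])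

lemma lin_Psi [simp]: "lin (Psi x)"
  by (simp add: Psi_def)

lemma Psi_single: "Psi x (Poly_Mapping.single (u, v, l) b) = psc b (evw e u (evw f v (k l x)))"
  by (simp add: Psi_def)

lemma Psi_bas [simp]: "Psi x (bas (u, v, l)) = evw e u (evw f v (k l x))"
  by (simp add: Psi_def)

lemma eqN_lin:
  assumes "lin S" "lin T" "\<And>u v l. S (bas (u, v, l)) \<doteq> T (bas (u, v, l))"
  shows "S m \<doteq> T (m :: ('i, 'k) tmod)"
proof -
  have "S m - T m = lext (\<lambda>t. S (bas t) - T (bas t)) m"
    by (simp add: lext_minus_fun flip: lin_eq_lext[OF assms(1)] lin_eq_lext[OF assms(2)])
  also have "\<dots> \<in> N"
    by (rule lext_in_subspace[OF N]) (use assms(3) in \<open>auto simp: eqN_def\<close>)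
  finally show ?thesis by (simp add: eqN_def)
qed

lemma Psi_Eop: "Psi x (Eop i m) = e i (Psi x m)"
  by (rule lin_eq3I[OF lin_comp[OF lin_Psi lin_ops(1)] lin_comp[OF lin_e lin_Psi]]) simp

lemma k_evw_e: "k \<mu> (evw e u x) \<doteq> psc (\<chi> \<mu> (wt u)) (evw e u (k \<mu> x))"
proof (induction u)
  case 0
  show ?case by simp
next
  case (wcons i u)
  have "k \<mu> (e i (evw e u x)) \<doteq> psc (\<chi> \<mu> (alpha i)) (e i (k \<mu> (evw e u x)))"
    using ke by (simp add: eqN_def)
  also have "\<dots> \<doteq> psc (\<chi> \<mu> (alpha i)) (e i (psc (\<chi> \<mu> (wt u)) (evw e u (k \<mu> x))))"
    by (intro eqN_psc eqN_ops wcons.IH)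
  finally show ?case by (simp add: lin_psc[OF lin_e] chi_simps)
qed

lemma k_evw_f: "k \<mu> (evw f u x) \<doteq> psc (\<chi> \<mu> (- wt u)) (evw f u (k \<mu> x))"
proof (induction u)
  case 0
  show ?case by simp
next
  case (wcons i u)
  have "k \<mu> (f i (evw f u x)) \<doteq> psc (\<chi> \<mu> (- alpha i)) (f i (k \<mu> (evw f u x)))"
    using kf by (simp add: eqN_def)
  also have "\<dots> \<doteq> psc (\<chi> \<mu> (- alpha i)) (f i (psc (\<chi> \<mu> (- wt u)) (evw f u (k \<mu> x))))"
    by (intro eqN_psc eqN_ops wcons.IH)
  finally show ?case by (simp add: lin_psc[OF lin_f] chi_simps divide_inverse)
qed

lemma evw_eqN: "x \<doteq> y \<Longrightarrow> evw e u x \<doteq> evw e u y" "x \<doteq> y \<Longrightarrow> evw f u x \<doteq> evw f u y"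
  by (induction u) (simp_all add: eqN_ops)

lemma Psi_Kop: "Psi x (Kop \<mu> m) \<doteq> k \<mu> (Psi x m)"
proof (rule eqN_lin[OF lin_comp[OF lin_Psi lin_ops(2)] lin_comp[OF lin_k lin_Psi]])
  fix u v l
  have "k \<mu> (evw e u (evw f v (k l x))) \<doteq> psc (\<chi> \<mu> (wt u)) (evw e u (k \<mu> (evw f v (k l x))))"
    by (rule k_evw_e)
  also have "\<dots> \<doteq> psc (\<chi> \<mu> (wt u)) (evw e u (psc (\<chi> \<mu> (- wt v)) (evw f v (k \<mu> (k l x)))))"
    by (intro eqN_psc evw_eqN k_evw_f)
  also have "\<dots> \<doteq> psc (\<chi> \<mu> (wt u)) (evw e u (psc (\<chi> \<mu> (- wt v)) (evw f v (k (\<mu> + l) x))))"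
    by (rule eqN_psc, rule evw_eqN(1), rule eqN_psc, rule evw_eqN(2)) (unfold eqN_def, rule kk)
  finally have "psc (\<chi> \<mu> (wt u)) (evw e u (psc (\<chi> \<mu> (- wt v)) (evw f v (k (\<mu> + l) x))))
      \<doteq> k \<mu> (evw e u (evw f v (k l x)))"
    by (rule eqN_sym)
  then show "Psi x (Kop \<mu> (bas (u, v, l))) \<doteq> k \<mu> (Psi x (bas (u, v, l)))"
    by (simp add: Kop_bas Psi_single lin_psc[OF lin_evw[of e, OF lin_e]] chi_simps divide_inverse)
qed

text \<open>In the triangular basis F_i is the operator given by a recursion; \<open>ef\<close>
  repeats that recursion in the target, so induction on u compares the two.\<close>

lemma Psi_Fop: "Psi x (Fop a i m) \<doteq> f i (Psi x m)"
proof (rule eqN_lin[OF lin_comp[OF lin_Psi lin_ops(3)] lin_comp[OF lin_f lin_Psi]])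
  fix u v l
  show "Psi x (Fop a i (bas (u, v, l))) \<doteq> f i (Psi x (bas (u, v, l)))"
  proof (induction u)
    case 0
    show ?case by simp
  next
    case (wcons j u)
    let ?b = "bas (u, v, l) :: ('i, 'k) tmod"
    let ?D = "\<lambda>y. if i = j then psc a (k (alpha i) y) - k (- alpha i) y else 0"
    have eq: "Psi x (Fop a i (bas (wcons j u, v, l))) = e j (Psi x (Fop a i ?b)) -
       (if i = j then psc a (Psi x (Kop (alpha i) ?b)) - Psi x (Kop (- alpha i) ?b) else 0)"
      by (simp add: Fop_bas_wcons lin_diff[OF lin_Psi] lin_psc[OF lin_Psi] lin_zero[OF lin_Psi] Psi_Eop)
    have "e j (Psi x (Fop a i ?b)) -
       (if i = j then psc a (Psi x (Kop (alpha i) ?b)) - Psi x (Kop (- alpha i) ?b) else 0) \<doteq> e j (f i (Psi x ?b)) - ?D (Psi x ?b)"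
      by (rule eqN_diff, rule eqN_ops(1), rule wcons.IH, rule eqN_if, rule eqN_diff, rule eqN_psc,
          rule Psi_Kop, rule Psi_Kop, rule eqN_refl)
    also have "\<dots> \<doteq> f i (e j (Psi x ?b))"
    proof -
      define y where "y = Psi x ?b"
      have "e j (f i y) - ?D y - f i (e j y) = e j (f i y) - f i (e j y) -
          (if j = i then psc a (k (alpha j) y) - k (- alpha j) y else 0)"
        by (cases "i = j") simp_all
      then show ?thesis
        using ef[of j i y] unfolding eqN_def y_def by (simp only:)
    qed
    finally show ?case
      unfolding eq by simp
  qed
qed

end

section \<open>Graded biideals\<close>

lemma free_alg_simps [simp]:
  "carrier (free_alg :: ('x, 'k::field) ncpoly ring) = UNIV"
  "x \<otimes>\<^bsub>(free_alg :: ('x, 'k::field) ncpoly ring)\<^esub> y = x * y"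
  "x \<oplus>\<^bsub>(free_alg :: ('x, 'k::field) ncpoly ring)\<^esub> y = x + y"
  "\<one>\<^bsub>(free_alg :: ('x, 'k::field) ncpoly ring)\<^esub> = 1" "\<zero>\<^bsub>(free_alg :: ('x, 'k::field) ncpoly ring)\<^esub> = 0"
  by (simp_all add: ring_of_type_algebra_def)

lemma ring_free_alg: "ring (free_alg :: ('x, 'k::field) ncpoly ring)"
proof (rule ringI)
  show "abelian_group (free_alg :: ('x, 'k) ncpoly ring)"
  proof (rule abelian_groupI)
    show "\<exists>y\<in>carrier free_alg. y \<oplus>\<^bsub>free_alg\<^esub> x = \<zero>\<^bsub>free_alg\<^esub>" for x :: "('x, 'k) ncpoly"
      by (rule bexI[of _ "- x"]) simp_all
  qed (simp_all add: algebra_simps)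
  show "monoid (free_alg :: ('x, 'k) ncpoly ring)"
    by (rule monoidI) (simp_all add: mult.assoc)
qed (simp_all add: algebra_simps)

lemma finsum_eq_sum:
  assumes "carrier R = UNIV" "add R = (+)" "ring.zero R = (0 :: 'a::ab_group_add)" "finite A"
  shows "finsum R f A = sum f A"
proof -
  interpret abelian_monoid R
    by (rule abelian_monoidI) (simp_all add: assms add.assoc add.commute)
  show ?thesis
    using assms(4) by (induction A) (simp_all add: assms(1,2,3))
qed

lemma minv_eq_uminus:
  assumes "carrier R = UNIV" "add R = (+)" "ring.zero R = (0 :: 'a::ab_group_add)"
  shows "m_inv (add_monoid R) x = - x"
  unfolding m_inv_def
proof (rule the_equality)
  show "- x \<in> carrier (add_monoid R) \<and> x \<otimes>\<^bsub>add_monoid R\<^esub> - x = \<one>\<^bsub>add_monoid R\<^esub> \<and>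
      - x \<otimes>\<^bsub>add_monoid R\<^esub> x = \<one>\<^bsub>add_monoid R\<^esub>"
    by (simp add: assms)
next
  fix y assume "y \<in> carrier (add_monoid R) \<and> x \<otimes>\<^bsub>add_monoid R\<^esub> y = \<one>\<^bsub>add_monoid R\<^esub> \<and>
      y \<otimes>\<^bsub>add_monoid R\<^esub> x = \<one>\<^bsub>add_monoid R\<^esub>"
  then have "x + y = 0" by (simp add: assms)
  then show "y = - x" by (rule minus_unique[symmetric])
qed

lemma hom_component_restr: "hom_component lam p = restr (\<lambda>w. wdeg w = lam) p"
proof (rule poly_mapping_eqI)
  fix z
  have "lk (hom_component lam p) z =
      (\<Sum>w\<in>{w \<in> Poly_Mapping.keys p. wdeg w = lam}. lk p w when w = z)"
    by (simp add: hom_component_def lookup_sum lookup_single)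
  also have "\<dots> = (if z \<in> {w \<in> Poly_Mapping.keys p. wdeg w = lam} then lk p z else 0)"
    by (simp add: when_def)
  also have "\<dots> = lk (restr (\<lambda>w. wdeg w = lam) p) z"
    by (auto simp: lookup_restr in_keys_iff)
  finally show "lk (hom_component lam p) z = lk (restr (\<lambda>w. wdeg w = lam) p) z" .
qed

context bich
begin

text \<open>The braided coproduct of a word, built from the left: a new letter i multiplies by E_i
  \<otimes> 1 + 1 \<otimes> E_i, and 1 \<otimes> E_i picks up the braiding scalar when it passes the
  first factor.\<close>

definition cop :: "'i word \<Rightarrow> ('i, 'k) tensor2"
  where "cop w = foldr (\<lambda>i z. lext (\<lambda>(c, d). bas (wcons i c, d)) z +
     lext (\<lambda>(c, d). Poly_Mapping.single (c, wcons i d) (\<chi> (alpha i) (wt c))) z) (letters w) (bas 0)"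

lemma cop_0 [simp]: "cop 0 = bas (0, 0)"
  by (simp add: cop_def zero_prod_def)

lemma cop_wcons: "cop (wcons i w) = lext (\<lambda>(c, d). bas (wcons i c, d)) (cop w) +
     lext (\<lambda>(c, d). Poly_Mapping.single (c, wcons i d) (\<chi> (alpha i) (wt c))) (cop w)"
  by (simp add: cop_def)

lemma braided_mult_lext: "braided_mult \<chi> s t =
    lext (\<lambda>(a, b). lext (\<lambda>(c, d). Poly_Mapping.single (a + c, b + d) (\<chi> (wt b) (wt c))) t) s"
  unfolding braided_mult_def lext_def
  by (rule sum.cong[OF refl]) (auto intro!: sum.cong simp: pm.scale_sum_right wt_def mult_ac)

lemma tensor_eq_tens: "tensor p t = tens p t"
  unfolding tensor_def tens_def lext_def by (simp add: pm.scale_sum_right)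

lemma coprod_eq: "coprod \<chi> p = lext cop p"
proof -
  let ?R = "braided_tensor \<chi>"
  let ?f = "\<lambda>i. tensor (nc_var i) 1 + tensor 1 (nc_var i) :: ('i, 'k) tensor2"
  have f: "?f i = bas (wcons i 0, 0) + bas (0, wcons i 0)" for i
    unfolding tensor_eq_tens nc_var_def one_bas tens_bas by simp
  have 1: "foldr (\<lambda>x y. ?f x \<otimes>\<^bsub>?R\<^esub> y) (letters w) \<one>\<^bsub>?R\<^esub> = cop w" for w
  proof (induction w)
    case 0
    then show ?case by (simp add: braided_tensor_def cop_def)
  next
    case (wcons i w)
    have "foldr (\<lambda>x y. ?f x \<otimes>\<^bsub>?R\<^esub> y) (letters (wcons i w)) \<one>\<^bsub>?R\<^esub> = braided_mult \<chi> (?f i) (cop w)"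
      by (simp only: letters_simps foldr.simps comp_apply wcons) (simp add: braided_tensor_def)
    also have "\<dots> = cop (wcons i w)"
      unfolding braided_mult_lext f lext_add cop_wcons by (simp add: case_prod_beta')
    finally show ?case .
  qed
  have 2: "Poly_Mapping.single 0 a \<otimes>\<^bsub>?R\<^esub> t = psc a t" for a t
  proof -
    have "Poly_Mapping.single 0 a \<otimes>\<^bsub>?R\<^esub> t = psc a (lext (\<lambda>(c, d). bas (c, d)) t)"
      by (simp add: braided_tensor_def braided_mult_lext zero_prod_def)
    moreover have "(\<lambda>(c, d). bas (c, d)) = (bas :: 'i word \<times> 'i word \<Rightarrow> ('i, 'k) tensor2)"
      by auto
    ultimately show ?thesis
      by (simp only: lext_bas_id)
  qed
  show ?thesis
    unfolding coprod_def nc_eval_def 1 2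
    by (subst finsum_eq_sum) (simp_all add: braided_tensor_def lext_def)
qed

end

definition del :: "'b \<Rightarrow> 'b \<Rightarrow> 'k::field" where "del x = (\<lambda>y. if y = x then 1 else 0)"

lemma lfun_del: "lfun (del x) p = lk p x"
proof -
  have "lfun (del x) p = (\<Sum>y\<in>Poly_Mapping.keys p. if y = x then lk p y else 0)"
    unfolding lfun_def lext_def lookup_sum by (rule sum.cong) (simp_all add: del_def)
  then show ?thesis by (simp add: in_keys_iff)
qed

definition swp :: "('b \<times> 'c \<Rightarrow>\<^sub>0 'k::field) \<Rightarrow> ('c \<times> 'b \<Rightarrow>\<^sub>0 'k)"
  where "swp = lext (\<lambda>(x, y). bas (y, x))"

lemma lin_swp [simp]: "lin swp"
  by (simp add: swp_def)

lemma swp_tens: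
  fixes m :: "'b \<Rightarrow>\<^sub>0 'k::field"
  shows "swp (tens m n) = tens n m"
proof -
  have 1: "swp (tens (bas x) n) = tens n (bas x)" for x :: 'b and n :: "'c \<Rightarrow>\<^sub>0 'k"
    by (rule lin_eqI[OF lin_comp[OF lin_swp lin_tens2] lin_tens1]) (simp add: swp_def)
  show ?thesis
    by (rule lin_eqI[OF lin_comp[OF lin_swp lin_tens1] lin_tens2 1])
qed

locale biid = bich \<chi> for \<chi> :: "('i, 'k::field) bichar" +
  fixes \<I> :: "('i, 'k) ncpoly set"
  assumes biideal: "graded_biideal \<chi> \<I>"
    and len2: "p \<in> \<I> \<Longrightarrow> w \<in> Poly_Mapping.keys p \<Longrightarrow> wlen w \<ge> 2"
begin

lemma I_ideal: "ideal \<I> free_alg"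
  using biideal by (simp add: graded_biideal_def)

lemma I_mult: "p \<in> \<I> \<Longrightarrow> q * p \<in> \<I>" "p \<in> \<I> \<Longrightarrow> p * q \<in> \<I>"
  using ideal.I_l_closed[OF I_ideal, of p q] ideal.I_r_closed[OF I_ideal, of p q] by simp_all

lemma I_subspace: "pm.subspace \<I>"
proof -
  interpret ideal \<I> free_alg by (rule I_ideal)
  show ?thesis
    using a_subgroup additive_subgroup.zero_closed[OF is_additive_subgroup]
      additive_subgroup.a_closed[OF is_additive_subgroup]
    unfolding pm.subspace_def by (simp add: psc_eq_const I_mult)
qed

lemma I_restr: "p \<in> \<I> \<Longrightarrow> restr (\<lambda>w. wdeg w = lam) p \<in> \<I>"
  using biideal by (simp add: graded_biideal_def hom_component_restr)

text \<open>Scaling each degree by its own factor is a finite combination of homogeneous components,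
  which stay in \<I>. The scalars produced by K_mu are of this kind.\<close>

lemma I_diag:
  assumes "p \<in> \<I>"
  shows "lext (\<lambda>w. Poly_Mapping.single w (h (wdeg w))) p \<in> \<I>"
proof -
  let ?L = "wdeg ` Poly_Mapping.keys p"
  have "lk (lext (\<lambda>w. Poly_Mapping.single w (h (wdeg w))) p) z =
      lk (\<Sum>lam\<in>?L. psc (h lam) (restr (\<lambda>w. wdeg w = lam) p)) z" for z
  proof -
    have "lk (lext (\<lambda>w. Poly_Mapping.single w (h (wdeg w))) p) z =
        (\<Sum>w\<in>Poly_Mapping.keys p. if w = z then lk p z * h (wdeg z) else 0)"
      unfolding lext_def lookup_sum by (rule sum.cong) (auto simp: lookup_single when_def)
    also have "\<dots> = lk p z * h (wdeg z)"
      by (simp add: in_keys_iff)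
    also have "\<dots> = (\<Sum>lam\<in>?L. if wdeg z = lam then h lam * lk p z else 0)"
      by (auto simp: in_keys_iff)
    also have "\<dots> = lk (\<Sum>lam\<in>?L. psc (h lam) (restr (\<lambda>w. wdeg w = lam) p)) z"
      unfolding lookup_sum by (rule sum.cong) (auto simp: lookup_restr)
    finally show ?thesis .
  qed
  then have "lext (\<lambda>w. Poly_Mapping.single w (h (wdeg w))) p =
      (\<Sum>lam\<in>?L. psc (h lam) (restr (\<lambda>w. wdeg w = lam) p))"
    by (rule poly_mapping_eqI)
  then show ?thesis
    by (simp add: pm.subspace_sum[OF I_subspace] pm.subspace_scale[OF I_subspace] I_restr[OF assms])
qed

text \<open>\<open>add_span\<close> is only an additive subgroup, but every subspace containing the
  generating tensors contains it; this is the form in which the coproduct condition gets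
  used.\<close>

lemma cop_in_span:
  assumes p: "p \<in> \<I>" and W: "pm.subspace W"
    and gen: "\<And>a b. a \<in> \<I> \<or> b \<in> \<I> \<Longrightarrow> tens a b \<in> W"
  shows "lext cop p \<in> W"
proof -
  let ?R = "braided_tensor \<chi>" and ?S = "{tensor a b | a b. a \<in> \<I> \<or> b \<in> \<I>}"
  have R: "carrier ?R = UNIV" "add ?R = (+)" "ring.zero ?R = 0"
    by (simp_all add: braided_tensor_def)
  have S: "?S \<subseteq> W"
    using gen by (auto simp: tensor_eq_tens)
  have "x \<in> generate (add_monoid ?R) ?S \<Longrightarrow> x \<in> W" for x
  proof (induction rule: generate.induct)
    case one
    then show ?case using pm.subspace_0[OF W] by (simp add: R)
  next
    case (incl h)
    then show ?case using S by (rule subsetD[rotated])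
  next
    case (inv h)
    then have "- h \<in> W" using S by (intro pm.subspace_neg[OF W]) (rule subsetD[rotated])
    then show ?case using minv_eq_uminus[OF R, of h] by (simp only:)
  next
    case (eng h1 h2)
    then show ?case using pm.subspace_add[OF W] by (simp add: R)
  qed
  moreover have "lext cop p \<in> add_span ?R ?S"
    using p biideal by (simp add: graded_biideal_def coprod_eq)
  ultimately show ?thesis by (simp add: add_span_def)
qed

text \<open>If one of a, b lies in \<I>, then slicing a \<otimes> b by a functional that vanishes on
  \<I> gives 0 or a multiple of an element of \<I>.\<close>

lemma slice_cop:
  assumes "p \<in> \<I>" "\<And>q. q \<in> \<I> \<Longrightarrow> lfun g q = 0"
  shows "slice g (lext cop p) \<in> \<I>" "slice g (swp (lext cop p)) \<in> \<I>"
proof -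
  have "lext cop p \<in> {z. slice g z \<in> \<I>}"
    by (rule cop_in_span[OF assms(1) subspace_vimage[OF lin_slice I_subspace]])
      (auto simp: slice_tens assms(2) pm.subspace_0[OF I_subspace] pm.subspace_scale[OF I_subspace])
  then show "slice g (lext cop p) \<in> \<I>" by simp
  have "lext cop p \<in> {z. slice g (swp z) \<in> \<I>}"
    by (rule cop_in_span[OF assms(1) subspace_vimage[OF lin_comp[OF lin_slice lin_swp] I_subspace]])
      (auto simp: swp_tens slice_tens assms(2) pm.subspace_0[OF I_subspace] pm.subspace_scale[OF I_subspace])
  then show "slice g (swp (lext cop p)) \<in> \<I>" by simp
qed

end

subsection \<open>Skew derivations\<close>

context bich
begin

lemma slice_cop_wcons: "slice g (cop (wcons j u)) = bas (wcons j 0) * slice g (cop u) +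
    lext (\<lambda>c. Poly_Mapping.single c (\<chi> (alpha j) (wt c))) (slice (\<lambda>d. g (wcons j d)) (cop u))"
proof -
  have 1: "slice g (lext (\<lambda>(c, d). bas (wcons j c, d)) z) = bas (wcons j 0) * slice g z" for z
    by (rule lin_eqI[OF lin_comp[OF lin_slice lin_lext] lin_comp[OF lin_mult_left lin_slice]])
      (auto simp: slice_def mult_single)
  have 2: "slice g (lext (\<lambda>(c, d). Poly_Mapping.single (c, wcons j d) (\<chi> (alpha j) (wt c))) z) =
      lext (\<lambda>c. Poly_Mapping.single c (\<chi> (alpha j) (wt c))) (slice (\<lambda>d. g (wcons j d)) z)" for z
    by (rule lin_eqI[OF lin_comp[OF lin_slice lin_lext] lin_comp[OF lin_lext lin_slice]])
      (auto simp: slice_def mult.commute)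
  show ?thesis
    by (simp add: cop_wcons lin_add[OF lin_slice] 1 2)
qed

lemma slice_swp_cop_wcons: "slice g (swp (cop (wcons j u))) = slice (\<lambda>c. g (wcons j c)) (swp (cop u)) +
    bas (wcons j 0) * slice (\<lambda>c. \<chi> (alpha j) (wt c) * g c) (swp (cop u))"
proof -
  have 1: "slice g (swp (lext (\<lambda>(c, d). bas (wcons j c, d)) z)) = slice (\<lambda>c. g (wcons j c)) (swp z)" for z
    by (rule lin_eqI[OF lin_comp[OF lin_slice lin_comp[OF lin_swp lin_lext]] lin_comp[OF lin_slice lin_swp]])
      (auto simp: slice_def swp_def)
  have 2: "slice g (swp (lext (\<lambda>(c, d). Poly_Mapping.single (c, wcons j d) (\<chi> (alpha j) (wt c))) z)) =
      bas (wcons j 0) * slice (\<lambda>c. \<chi> (alpha j) (wt c) * g c) (swp z)" for z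
    by (rule lin_eqI[OF lin_comp[OF lin_slice lin_comp[OF lin_swp lin_lext]]
          lin_comp[OF lin_mult_left lin_comp[OF lin_slice lin_swp]]])
      (auto simp: slice_def swp_def mult_single mult.commute)
  show ?thesis
    by (simp add: cop_wcons lin_add[OF lin_slice] lin_add[OF lin_swp] 1 2)
qed

lemma slice_zero_fun: "slice (\<lambda>c. 0) z = 0"
proof -
  have "slice (\<lambda>c. 0) z = lext (\<lambda>_. 0) z" by (simp add: slice_def case_prod_beta')
  also have "\<dots> = 0" by (simp add: lext_def)
  finally show ?thesis .
qed

text \<open>\<open>del 0\<close> is the counit, so these are the two counit axioms of the braided
  coproduct.\<close>

lemma slice_cop_del0: "slice (del 0) (cop u) = bas u" "slice (del 0) (swp (cop u)) = bas u"
proof -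
  have z: "(\<lambda>d. del 0 (wcons j d)) = (\<lambda>d. 0)" for j :: 'i
    by (simp add: del_def)
  show "slice (del 0) (cop u) = bas u"
    by (induction u) (simp_all add: slice_cop_wcons z slice_zero_fun mult_single, simp add: slice_def del_def)
  have z2: "(\<lambda>c. \<chi> (alpha j) (wt c) * del 0 c) = del 0" for j
    by (auto simp: del_def)
  show "slice (del 0) (swp (cop u)) = bas u"
    by (induction u) (simp_all add: slice_swp_cop_wcons z z2 slice_zero_fun mult_single,
      simp add: slice_def del_def swp_def)
qed

text \<open>The right and left skew derivations known from Nichols algebras: they collect the terms
  of the coproduct whose second, respectively first, factor is the single letter i.\<close>

definition dR :: "'i \<Rightarrow> ('i, 'k) ncpoly \<Rightarrow> ('i, 'k) ncpoly"
  where "dR i p = slice (del (wcons i 0)) (lext cop p)"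

definition dL :: "'i \<Rightarrow> ('i, 'k) ncpoly \<Rightarrow> ('i, 'k) ncpoly"
  where "dL i p = slice (del (wcons i 0)) (swp (lext cop p))"

lemma lin_d [simp]: "lin (dR i)" "lin (dL i)"
  unfolding dR_def dL_def by (intro lin_comp[OF lin_slice] lin_comp[OF lin_swp] lin_lext)+

lemma d_0 [simp]: "dR i 1 = 0" "dL i 1 = 0"
  unfolding dR_def dL_def one_bas lext_bas by (simp_all add: slice_def swp_def del_def)

lemma dR_wcons: "dR i (bas (wcons j u)) = bas (wcons j 0) * dR i (bas u) +
    (if i = j then Poly_Mapping.single u (\<chi> (alpha i) (wt u)) else 0)"
proof -
  have 1: "(\<lambda>d. del (wcons i 0) (wcons j d)) = (if i = j then del 0 else (\<lambda>_. 0))"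
    by (auto simp: del_def fun_eq_iff)
  show ?thesis
    unfolding dR_def lext_bas slice_cop_wcons 1 by (simp add: slice_cop_del0 slice_zero_fun)
qed

lemma dL_wcons: "dL i (bas (wcons j u)) = psc (\<chi> (alpha i) (alpha j)) (bas (wcons j 0) * dL i (bas u)) +
    (if i = j then bas u else 0)"
proof -
  have 1: "(\<lambda>d. del (wcons i 0) (wcons j d)) = (if i = j then del 0 else (\<lambda>_. 0))"
    by (auto simp: del_def fun_eq_iff)
  have 2: "(\<lambda>c. \<chi> (alpha j) (wt c) * del (wcons i 0) c) =
      (\<lambda>c. \<chi> (alpha i) (alpha j) * del (wcons i 0) c)"
    by (auto simp: del_def fun_eq_iff chi_alpha)
  have 3: "slice (\<lambda>c. b * g c) z = psc b (slice g z)" for b and g :: "'i word \<Rightarrow> 'k" and z :: "('i, 'k) tensor2"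
    by (rule lin_eqI[OF lin_slice lin_scale[OF lin_slice]]) (auto simp: slice_def)
  show ?thesis
    unfolding dL_def lext_bas slice_swp_cop_wcons 1 2 3
    by (simp add: slice_cop_del0 slice_zero_fun psc_mult add.commute)
qed

end

text \<open>The coefficient of a single letter is a functional that vanishes on \<I>, because \<I>
  starts in degree 2; hence \<open>slice_cop\<close> applies.\<close>

lemma (in biid) d_in_I: "p \<in> \<I> \<Longrightarrow> dR i p \<in> \<I>" "p \<in> \<I> \<Longrightarrow> dL i p \<in> \<I>"
proof -
  have k: "lfun (del (wcons i 0)) q = 0" if "q \<in> \<I>" for q
    using len2[OF that, of "wcons i 0"] by (force simp: lfun_del in_keys_iff)
  show "p \<in> \<I> \<Longrightarrow> dR i p \<in> \<I>" "p \<in> \<I> \<Longrightarrow> dL i p \<in> \<I>"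
    unfolding dR_def dL_def by (intro slice_cop k; assumption)+
qed

lemma restr_bas: "restr P (bas x) = (if P x then bas x else 0)"
  by (simp add: restr_def)

subsection \<open>Normal forms modulo the biideal\<close>

lemma wdeg_eq_wlen: "wdeg v = wdeg w \<Longrightarrow> wlen v = wlen w"
proof -
  assume "wdeg v = wdeg w"
  then have "mset (letters v) = mset (letters w)"
    by (simp add: multiset_eq_iff count_mset wdeg_def fun_eq_iff)
  then show ?thesis by (rule mset_eq_length)
qed

text \<open>The element p(E) q(F) K_l of the module.\<close>

definition tr :: "('i \<Rightarrow> int) \<Rightarrow> ('i, 'k::field) ncpoly \<Rightarrow> ('i, 'k) ncpoly \<Rightarrow> ('i, 'k) tmod"
  where "tr l p q = lext (\<lambda>u. lext (\<lambda>v. bas (u, v, l)) q) p"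

lemma lin_tr1: "lin (\<lambda>p. tr l p q)"
  unfolding tr_def by simp

lemma lin_tr2: "lin (\<lambda>q. tr l p q)"
  unfolding lin_def tr_def by (simp add: lext_plus_fun lext_scale_fun)

lemma tr_bas [simp]: "tr l (bas u) (bas v) = bas (u, v, l)"
  by (simp add: tr_def)

lemma tr_single: "tr l (Poly_Mapping.single u a) (Poly_Mapping.single v b) = Poly_Mapping.single (u, v, l) (a * b)"
  by (simp add: tr_def)

lemma tr_1 [simp]: "tr l 1 (bas v) = bas (0, v, l)" "tr l (bas u) 1 = bas (u, 0, l)"
  "tr l 1 1 = bas (0, 0, l)"
  unfolding one_bas tr_bas by simp_all

lemma lin_tr_eqI:
  assumes "\<And>q. lin (\<lambda>p. A p q)" "\<And>q. lin (\<lambda>p. B p q)" "\<And>p. lin (A p)" "\<And>p. lin (B p)"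
    "\<And>u v. A (bas u) (bas v) = B (bas u) (bas v)"
  shows "A p q = B p q"
proof -
  have "A (bas u) q = B (bas u) q" for u
    by (rule lin_eqI[OF assms(3,4,5)])
  then show ?thesis
    by (rule lin_eqI[OF assms(1,2)])
qed

context biid
begin

definition nf0 :: "('i, 'k) ncpoly \<Rightarrow> ('i, 'k) ncpoly"
  where "nf0 = (SOME T. lin T \<and> (\<forall>x\<in>\<I>. T x = 0) \<and> (\<forall>x. T x - x \<in> \<I>))"

lemma nf0: "lin nf0" "p \<in> \<I> \<Longrightarrow> nf0 p = 0" "nf0 p - p \<in> \<I>"
proof -
  have "\<exists>T. lin T \<and> (\<forall>x\<in>\<I>. T x = 0) \<and> (\<forall>x. T x - x \<in> \<I>)"
  proof (rule projection_with_kernel[OF I_subspace])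
    fix T assume "lin T" "\<And>x. x \<in> \<I> \<Longrightarrow> T x = 0" "\<And>x. T x - x \<in> \<I>"
    then show ?thesis by (intro exI[of _ T]) simp
  qed
  from someI_ex[OF this, folded nf0_def]
  show "lin nf0" "p \<in> \<I> \<Longrightarrow> nf0 p = 0" "nf0 p - p \<in> \<I>"
    by auto
qed

text \<open>Averaging an arbitrary projection over the degrees makes it homogeneous.\<close>

definition nf :: "('i, 'k) ncpoly \<Rightarrow> ('i, 'k) ncpoly"
  where "nf = lext (\<lambda>w. restr (\<lambda>z. wdeg z = wdeg w) (nf0 (bas w)))"

lemma lin_nf [simp]: "lin nf"
  by (simp add: nf_def)

lemma nf_keys: "w' \<in> Poly_Mapping.keys (nf (bas w)) \<Longrightarrow> wdeg w' = wdeg w"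
  by (simp add: nf_def keys_restr)

lemma nf_I: assumes "p \<in> \<I>" shows "nf p = 0"
proof (rule poly_mapping_eqI)
  fix w
  \<comment> \<open>The coefficient at w sees only the component of degree \<open>wdeg w\<close>,
    and on that component it is the coefficient of \<open>nf0\<close>.\<close>
  have "restr (\<lambda>z. z = w) (nf q) = restr (\<lambda>z. z = w) (nf0 (restr (\<lambda>z. wdeg z = wdeg w) q))" for q
    by (rule lin_eqI[OF lin_comp[OF lin_restr lin_nf] lin_comp[OF lin_restr lin_comp[OF nf0(1) lin_restr]]])
      (auto intro!: poly_mapping_eqI simp: nf_def lookup_restr restr_bas lin_zero[OF nf0(1)])
  from this[of p] have "restr (\<lambda>z. z = w) (nf p) = 0"
    by (simp add: nf0(2)[OF I_restr[OF assms]] lin_zero)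
  then have "lk (restr (\<lambda>z. z = w) (nf p)) w = 0" by simp
  then show "lk (nf p) w = lk 0 w"
    by (simp add: lookup_restr)
qed

lemma nf_diff: "nf p - p \<in> \<I>"
proof -
  have "nf (bas w) - bas w \<in> \<I>" for w
  proof -
    have "restr (\<lambda>z. wdeg z = wdeg w) (nf0 (bas w) - bas w) \<in> \<I>"
      by (rule I_restr[OF nf0(3)])
    then show ?thesis
      by (simp add: lin_diff[OF lin_restr] nf_def restr_bas)
  qed
  then have "lext (\<lambda>w. nf (bas w) - bas w) p \<in> \<I>"
    by (intro lext_in_subspace[OF I_subspace])
  then show ?thesis
    by (simp add: lext_minus_fun lext_bas_id flip: lin_eq_lext[OF lin_nf])
qed

lemma nf_zero_iff: "nf p = 0 \<longleftrightarrow> p \<in> \<I>"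
  using nf_I[of p] nf_diff[of p] pm.subspace_neg[OF I_subspace, of "- p"] by auto

lemma nf_idem [simp]: "nf (nf p) = nf p"
  using nf_I[OF nf_diff[of p]] by (simp add: lin_diff[OF lin_nf])

text \<open>Because the unit is its own normal form, the coefficient of a nonempty word in the
  normal form vanishes at 1; the slicing arguments depend on this.\<close>

lemma nf_1 [simp]: "nf 1 = 1"
proof (rule poly_mapping_eqI)
  fix w :: "'i word"
  show "lk (nf 1) w = lk 1 w"
  proof (cases "w = 0")
    case True
    have "w \<notin> Poly_Mapping.keys (nf 1 - 1)"
      using len2[OF nf_diff[of 1], of w] True by fastforce
    then show ?thesis by (simp add: in_keys_iff lookup_minus)
  next
    case False
    have "w \<notin> Poly_Mapping.keys (nf (bas 0))"
      using nf_keys[of w 0] wdeg_eq_wlen[of w 0] False by auto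
    then show ?thesis using False by (simp add: in_keys_iff lookup_one)
  qed
qed

definition NF :: "('i, 'k) tmod \<Rightarrow> ('i, 'k) tmod"
  where "NF = lext (\<lambda>(u, v, l). tr l (nf (bas u)) (nf (bas v)))"

lemma lin_NF [simp]: "lin NF"
  by (simp add: NF_def)

lemma NF_bas: "NF (bas (u, v, l)) = tr l (nf (bas u)) (nf (bas v))"
  by (simp add: NF_def)

lemma NF_tr: "NF (tr l p q) = tr l (nf p) (nf q)"
  by (rule lin_tr_eqI[of "\<lambda>p q. NF (tr l p q)" "\<lambda>p q. tr l (nf p) (nf q)",
        OF lin_comp[OF lin_NF lin_tr1] lin_comp[OF lin_tr1 lin_nf]
          lin_comp[OF lin_NF lin_tr2] lin_comp[OF lin_tr2 lin_nf]])
    (simp only: tr_bas NF_bas)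

text \<open>The quotient by \<open>J\<close> is \<open>U\<^sup>+ \<otimes> U\<^sup>- \<otimes> H\<close>, the underlying space of \<open>U(\<chi>)\<close>.\<close>

definition J :: "('i, 'k) tmod set" where "J = {m. NF m = 0}"

lemma J_subspace: "pm.subspace J"
  unfolding J_def pm.subspace_def by (simp add: lin_add[OF lin_NF] lin_psc[OF lin_NF] lin_zero[OF lin_NF])

lemmas J_zero = pm.subspace_0[OF J_subspace] and J_add = pm.subspace_add[OF J_subspace]
  and J_diff = pm.subspace_diff[OF J_subspace] and J_scale = pm.subspace_scale[OF J_subspace]

lemma tr_in_J: "p \<in> \<I> \<Longrightarrow> tr l p q \<in> J" "p \<in> \<I> \<Longrightarrow> tr l q p \<in> J"
  by (simp_all add: J_def NF_tr nf_I lin_zero[OF lin_tr1] lin_zero[OF lin_tr2])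

lemma NF_idem [simp]: "NF (NF m) = NF m"
  by (rule lin_eq3I[OF lin_comp[OF lin_NF lin_NF] lin_NF]) (simp add: NF_bas NF_tr)

lemma NF_diff: "NF m - m \<in> J"
  by (simp add: J_def lin_diff[OF lin_NF])

text \<open>\<open>J\<close> is spanned by p(E) F_v K_l and E_u p(F) K_l with p in \<I>: the
  difference between a basis vector and its normal form telescopes into (nf u - u) \<otimes> v + nf
  u \<otimes> (nf v - v).\<close>

lemma J_subset:
  assumes S: "pm.subspace S" and 1: "\<And>l p v. p \<in> \<I> \<Longrightarrow> tr l p (bas v) \<in> S"
    and 2: "\<And>l p u. p \<in> \<I> \<Longrightarrow> tr l (bas u) p \<in> S" and m: "m \<in> J"
  shows "m \<in> S"
proof -
  have "NF (bas t) - bas t \<in> S" for t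
  proof -
    obtain u v l where t: "t = (u, v, l)" by (metis prod_cases3)
    let ?d = "nf (bas v) - bas v"
    have "NF (bas t) - bas t = tr l (nf (bas u) - bas u) (bas v) + tr l (nf (bas u)) ?d"
      by (simp add: t NF_bas lin_diff[OF lin_tr1] lin_diff[OF lin_tr2])
    moreover have "tr l (nf (bas u)) ?d = lext (\<lambda>w. tr l (bas w) ?d) (nf (bas u))"
      by (rule lin_eq_lext[OF lin_tr1])
    moreover have "\<dots> \<in> S"
      by (intro lext_in_subspace[OF S] 2 nf_diff)
    ultimately show ?thesis
      by (simp add: pm.subspace_add[OF S] 1 nf_diff)
  qed
  then have "lext (\<lambda>t. NF (bas t) - bas t) m \<in> S"
    by (intro lext_in_subspace[OF S])
  then have "NF m - m \<in> S"
    by (simp only: lext_minus_fun lext_bas_id lin_eq_lext[OF lin_NF, symmetric])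
  then show ?thesis
    using m pm.subspace_neg[OF S, of "- m"] by (simp add: J_def)
qed

lemma J_stable:
  assumes "lin T" "\<And>l p v. p \<in> \<I> \<Longrightarrow> T (tr l p (bas v)) \<in> J"
    "\<And>l p u. p \<in> \<I> \<Longrightarrow> T (tr l (bas u) p) \<in> J" "m \<in> J"
  shows "T m \<in> J"
  using J_subset[OF subspace_vimage[OF assms(1) J_subspace], of m] assms(2-4) by simp

lemma NF_keys:
  assumes "(u', v', l') \<in> Poly_Mapping.keys (NF (bas (u, v, l)))"
  shows "wdeg u' = wdeg u" "wdeg v' = wdeg v" "l' = l"
proof -
  from assms obtain x where x: "x \<in> Poly_Mapping.keys (nf (bas u))"
    "(u', v', l') \<in> Poly_Mapping.keys (lext (\<lambda>v. bas (x, v, l)) (nf (bas v)))"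
    unfolding NF_bas tr_def by (rule keys_lextE)
  from x(2) obtain y where y: "y \<in> Poly_Mapping.keys (nf (bas v))"
    "(u', v', l') \<in> Poly_Mapping.keys (bas (x, y, l) :: ('i, 'k) tmod)"
    by (rule keys_lextE)
  from x y show "wdeg u' = wdeg u" "wdeg v' = wdeg v" "l' = l"
    by (auto dest: nf_keys)
qed

text \<open>Normal forms preserve the degrees of u and v and the exponent, hence commute with
  restriction to any set described by these data.\<close>

lemma NF_restr:
  assumes "\<And>u v l u' v'. wdeg u = wdeg u' \<Longrightarrow> wdeg v = wdeg v' \<Longrightarrow> Q (u, v, l) = Q (u', v', l)"
  shows "restr Q (NF m) = NF (restr Q m)"
proof (rule restr_commute[OF lin_NF])
  fix t assume "Q t"
  obtain u v l where t: "t = (u, v, l)" by (metis prod_cases3)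
  show "restr Q (NF (bas t)) = NF (bas t)"
  proof (rule restr_id)
    fix x assume "x \<in> Poly_Mapping.keys (NF (bas t))"
    moreover obtain u' v' l' where x: "x = (u', v', l')" by (metis prod_cases3)
    ultimately show "Q x" using NF_keys[of u' v' l' u v l] assms[of u' u v' v l] \<open>Q t\<close> t by simp
  qed
next
  fix t assume "\<not> Q t"
  obtain u v l where t: "t = (u, v, l)" by (metis prod_cases3)
  show "restr Q (NF (bas t)) = 0"
  proof (rule restr_eq_0)
    fix x assume "x \<in> Poly_Mapping.keys (NF (bas t))"
    moreover obtain u' v' l' where x: "x = (u', v', l')" by (metis prod_cases3)
    ultimately show "\<not> Q x" using NF_keys[of u' v' l' u v l] assms[of u' u v' v l] \<open>\<not> Q t\<close> t by simp
  qed
qed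

end

subsection \<open>Stability of the kernel of the normal form under the operators\<close>

context bich
begin

lemma evw_Eop: "evw Eop w (bas (u, v, l)) = bas (w + u, v, l)"
  by (induction w) simp_all

lemma evw_Fop: "evw (Fop a) w (bas (0, v, l)) = bas (0, w + v, l)"
  by (induction w) simp_all

lemma evop_Eop_tr: "evop Eop p (tr l q r) = tr l (p * q) r"
proof -
  have 1: "evw Eop w (tr l q r) = tr l (bas w * q) r" for w
    by (rule lin_tr_eqI[of "\<lambda>q r. evw Eop w (tr l q r)" "\<lambda>q r. tr l (bas w * q) r",
          OF lin_comp[OF lin_evw[OF lin_ops(1)] lin_tr1] lin_comp[OF lin_tr1 lin_mult_left]
            lin_comp[OF lin_evw[OF lin_ops(1)] lin_tr2] lin_tr2])
      (simp only: tr_bas evw_Eop bas_mult)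
  show ?thesis
    by (rule lin_eqI[OF lin_evop1 lin_comp[OF lin_tr1 lin_mult_right]]) (simp only: 1 evop_bas)
qed

lemma evop_Fop_tr: "evop (Fop a) p (tr l 1 r) = tr l 1 (p * r)"
proof -
  have 1: "evw (Fop a) w (tr l 1 r) = tr l 1 (bas w * r)" for w
    unfolding one_bas
    by (rule lin_eqI[OF lin_comp[OF lin_evw[OF lin_ops(3)] lin_tr2] lin_comp[OF lin_tr2 lin_mult_left]])
      (simp only: tr_bas evw_Fop bas_mult)
  show ?thesis
    by (rule lin_eqI[OF lin_evop1 lin_comp[OF lin_tr2 lin_mult_right]]) (simp only: 1 evop_bas)
qed

lemma Eop_tr: "Eop i (tr l p q) = tr l (bas (wcons i 0) * p) q"
  using evop_Eop_tr[of "bas (wcons i 0)" l p q] by simp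

lemma Fop_tr: "Fop a i (tr l 1 q) = tr l 1 (bas (wcons i 0) * q)"
  using evop_Fop_tr[of a "bas (wcons i 0)" l q] by simp

lemma Kop_tr: "Kop \<mu> (tr l p q) = tr (\<mu> + l) (lext (\<lambda>w. Poly_Mapping.single w (\<chi> \<mu> (wt w))) p)
    (lext (\<lambda>w. Poly_Mapping.single w (\<chi> \<mu> (- wt w))) q)"
proof -
  let ?p = "lext (\<lambda>w. Poly_Mapping.single w (\<chi> \<mu> (wt w)))"
  let ?q = "lext (\<lambda>w. Poly_Mapping.single w (\<chi> \<mu> (- wt w)))"
  have 1: "lin (\<lambda>p. Kop \<mu> (tr l p q))" "lin (\<lambda>p. tr (\<mu> + l) (?p p) (?q q))"
    "lin (\<lambda>q. Kop \<mu> (tr l p q))" "lin (\<lambda>q. tr (\<mu> + l) (?p p) (?q q))" for p q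
    by (rule lin_comp[OF lin_ops(2) lin_tr1], rule lin_comp[OF lin_tr1 lin_lext],
      rule lin_comp[OF lin_ops(2) lin_tr2], rule lin_comp[OF lin_tr2 lin_lext])
  show ?thesis
    by (rule lin_tr_eqI[of "\<lambda>p q. Kop \<mu> (tr l p q)" "\<lambda>p q. tr (\<mu> + l) (?p p) (?q q)", OF 1])
      (simp add: tr_single Kop_bas chi_simps divide_inverse)
qed

lemma Kop_evw_Eop: "Kop \<mu> (evw Eop u m) = psc (\<chi> \<mu> (wt u)) (evw Eop u (Kop \<mu> m))"
  by (induction u) (simp_all add: Kop_Eop ops_psc chi_add2)

lemma Kop_evw_Fop: "Kop \<mu> (evw (Fop a) u m) = psc (\<chi> \<mu> (- wt u)) (evw (Fop a) u (Kop \<mu> m))"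
  by (induction u) (simp_all add: Kop_Fop ops_psc chi_simps divide_inverse)

lemma evw_psc: "evw Eop u (psc b m) = psc b (evw Eop u m)" "evw (Fop a) u (psc b m) = psc b (evw (Fop a) u m)"
  by (rule lin_psc[OF lin_evw[OF lin_ops(1)]], rule lin_psc[OF lin_evw[OF lin_ops(3)]])

lemma evop_single: "evop T (Poly_Mapping.single w b) m = psc b (evw T w m)"
  by (simp add: evop_def)

lemma evop_wcons: "evop Eop (bas (wcons j 0) * p) m = Eop j (evop Eop p m)"
  "evop (Fop a) (bas (wcons j 0) * p) m = Fop a j (evop (Fop a) p m)"
  by (simp_all add: evop_mult)

text \<open>Each letter i of u contributes a K_i - K_i^{-1} at its place. Moving K_i to the right
  past the rest of u, and K_i^{-1} to the left past its beginning, produces exactly the scalars of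
  \<open>dR\<close> and \<open>dL\<close>.\<close>

lemma evw_Eop_Fop: "evw Eop u (Fop a i m) - Fop a i (evw Eop u m) =
    psc a (evop Eop (dR i (bas u)) (Kop (alpha i) m)) - Kop (- alpha i) (evop Eop (dL i (bas u)) m)"
proof (induction u)
  case 0
  show ?case by (simp add: ops_zero)
next
  case (wcons j u)
  let ?x = "evw Eop u m"
  have "evw Eop (wcons j u) (Fop a i m) - Fop a i (evw Eop (wcons j u) m) =
      Eop j (evw Eop u (Fop a i m) - Fop a i ?x) + (Eop j (Fop a i ?x) - Fop a i (Eop j ?x))"
    by (simp add: ops_diff)
  also have "\<dots> = Eop j (psc a (evop Eop (dR i (bas u)) (Kop (alpha i) m)) -
        Kop (- alpha i) (evop Eop (dL i (bas u)) m)) +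
      (if j = i then psc a (Kop (alpha j) ?x) - Kop (- alpha j) ?x else 0)"
    by (simp only: wcons Eop_Fop)
  also have "\<dots> = psc a (evop Eop (dR i (bas (wcons j u))) (Kop (alpha i) m)) -
      Kop (- alpha i) (evop Eop (dL i (bas (wcons j u))) m)"
  proof (cases "i = j")
    case True
    have 1: "psc (\<chi> (alpha i) (wt u)) (evw Eop u (Kop (alpha i) m)) = Kop (alpha i) ?x"
      by (simp add: Kop_evw_Eop)
    show ?thesis
      by (simp add: True dR_wcons dL_wcons evop_wcons evop_single Kop_Eop ops_add ops_psc ops_diff
          pm.scale_right_distrib pm.scale_right_diff_distrib chi_minus1 1[unfolded True])
  next
    case False
    then show ?thesis
      by (simp add: dR_wcons dL_wcons evop_wcons Kop_Eop ops_add ops_psc ops_diff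
          chi_minus1)
  qed
  finally show ?case .
qed

text \<open>The mirror image of \<open>evw_Eop_Fop\<close>: F has negative weight, so now K_j moves
  to the left and K_j^{-1} to the right.\<close>

lemma evw_Fop_Eop: "Eop j (evw (Fop a) w m) - evw (Fop a) w (Eop j m) =
    psc a (Kop (alpha j) (evop (Fop a) (dL j (bas w)) m)) - evop (Fop a) (dR j (bas w)) (Kop (- alpha j) m)"
proof (induction w)
  case 0
  show ?case by (simp add: ops_zero)
next
  case (wcons i w)
  let ?x = "evw (Fop a) w m"
  have "Eop j (evw (Fop a) (wcons i w) m) - evw (Fop a) (wcons i w) (Eop j m) =
      Fop a i (Eop j ?x - evw (Fop a) w (Eop j m)) + (Eop j (Fop a i ?x) - Fop a i (Eop j ?x))"
    by (simp add: ops_diff)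
  also have "\<dots> = Fop a i (psc a (Kop (alpha j) (evop (Fop a) (dL j (bas w)) m)) -
        evop (Fop a) (dR j (bas w)) (Kop (- alpha j) m)) +
      (if j = i then psc a (Kop (alpha j) ?x) - Kop (- alpha j) ?x else 0)"
    by (simp only: wcons Eop_Fop)
  also have "\<dots> = psc a (Kop (alpha j) (evop (Fop a) (dL j (bas (wcons i w))) m)) -
      evop (Fop a) (dR j (bas (wcons i w))) (Kop (- alpha j) m)"
  proof (cases "i = j")
    case True
    have 1: "psc (\<chi> (alpha j) (wt w)) (evw (Fop a) w (Kop (- alpha j) m)) = Kop (- alpha j) ?x"
      by (simp add: Kop_evw_Fop chi_simps)
    show ?thesis
      by (simp add: True dR_wcons dL_wcons evop_wcons evop_single Kop_Fop ops_add ops_psc ops_diff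
          pm.scale_right_distrib pm.scale_right_diff_distrib chi_minus2 1)
  next
    case False
    then show ?thesis
      by (simp add: dR_wcons dL_wcons evop_wcons Kop_Fop ops_add ops_psc ops_diff chi_minus2)
  qed
  finally show ?case .
qed

lemma evop_Eop_Fop: "evop Eop p (Fop a i m) - Fop a i (evop Eop p m) =
    psc a (evop Eop (dR i p) (Kop (alpha i) m)) - Kop (- alpha i) (evop Eop (dL i p) m)"
  by (rule lin_eqI[of "\<lambda>p. evop Eop p (Fop a i m) - Fop a i (evop Eop p m)"
        "\<lambda>p. psc a (evop Eop (dR i p) (Kop (alpha i) m)) - Kop (- alpha i) (evop Eop (dL i p) m)"])
    ((rule lin_minus lin_scale lin_evop1 lin_comp[OF lin_evop1 lin_d(1)] lin_comp[OF lin_ops(3) lin_evop1]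
      lin_comp[OF lin_ops(2) lin_comp[OF lin_evop1 lin_d(2)]])+, simp only: evop_bas evw_Eop_Fop)

lemma evop_Fop_Eop: "Eop j (evop (Fop a) p m) - evop (Fop a) p (Eop j m) =
    psc a (Kop (alpha j) (evop (Fop a) (dL j p) m)) - evop (Fop a) (dR j p) (Kop (- alpha j) m)"
  by (rule lin_eqI[of "\<lambda>p. Eop j (evop (Fop a) p m) - evop (Fop a) p (Eop j m)"
        "\<lambda>p. psc a (Kop (alpha j) (evop (Fop a) (dL j p) m)) - evop (Fop a) (dR j p) (Kop (- alpha j) m)"])
    ((rule lin_minus lin_scale lin_evop1 lin_comp[OF lin_evop1 lin_d(1)] lin_comp[OF lin_ops(1) lin_evop1]
      lin_comp[OF lin_ops(2) lin_comp[OF lin_evop1 lin_d(2)]])+, simp only: evop_bas evw_Fop_Eop)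

end

context biid
begin

lemma Eop_J: "m \<in> J \<Longrightarrow> Eop i m \<in> J"
  by (rule J_stable[OF lin_ops(1)]) (simp_all add: Eop_tr tr_in_J I_mult)

lemma Kop_J: "m \<in> J \<Longrightarrow> Kop \<mu> m \<in> J"
proof (rule J_stable[OF lin_ops(2)])
  fix l p v assume "p \<in> \<I>"
  then show "Kop \<mu> (tr l p (bas v)) \<in> J" "Kop \<mu> (tr l (bas v) p) \<in> J"
    using I_diag[of p "\<lambda>d. \<chi> \<mu> (\<lambda>i. int (d i))"] I_diag[of p "\<lambda>d. \<chi> \<mu> (- (\<lambda>i. int (d i)))"]
    by (simp_all only: Kop_tr tr_in_J wt_def)
qed

lemma in_J_lext: "lin T \<Longrightarrow> (\<And>u v l. T (bas (u, v, l)) \<in> J) \<Longrightarrow> T m \<in> J"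
  by (subst lin_eq_lext) (auto intro!: lext_in_subspace[OF J_subspace])

lemma evop_Eop_J: "p \<in> \<I> \<Longrightarrow> evop Eop p m \<in> J"
proof (rule in_J_lext[OF lin_evop2[OF lin_ops(1)]])
  fix u v l assume "p \<in> \<I>"
  then show "evop Eop p (bas (u, v, l)) \<in> J"
    using evop_Eop_tr[of p l "bas u" "bas v"] tr_in_J(1)[OF I_mult(2)] by simp
qed

text \<open>The biideal condition enters here. If p in \<I> stands on the E side, F_i commutes past
  p(E) up to skew derivatives of p; if it stands on the F side, F_i multiplies p from the left once
  it has passed the letters of u.\<close>

lemma Fop_J: "m \<in> J \<Longrightarrow> Fop a i m \<in> J"
proof (rule J_stable[OF lin_ops(3)])
  fix l p v assume p: "p \<in> \<I>"
  let ?b = "bas (0, v, l) :: ('i, 'k) tmod"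
  have "tr l p (bas v) = evop Eop p ?b"
    using evop_Eop_tr[of p l 1 "bas v"] unfolding tr_1 by simp
  moreover have "Fop a i (evop Eop p ?b) = evop Eop p (Fop a i ?b) -
      (psc a (evop Eop (dR i p) (Kop (alpha i) ?b)) - Kop (- alpha i) (evop Eop (dL i p) ?b))"
    unfolding evop_Eop_Fop[symmetric] by simp
  moreover have "\<dots> \<in> J"
    by (intro J_diff J_scale Kop_J evop_Eop_J p d_in_I)
  ultimately show "Fop a i (tr l p (bas v)) \<in> J" by simp
next
  fix l p u assume p: "p \<in> \<I>"
  show "Fop a i (tr l (bas u) p) \<in> J"
  proof (induction u)
    case 0
    show ?case using Fop_tr[of a i l p] p by (simp add: tr_in_J I_mult)
  next
    case (wcons j u)
    let ?y = "tr l (bas u) p"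
    have "tr l (bas (wcons j u)) p = Eop j ?y"
      by (simp add: Eop_tr)
    moreover have "Fop a i (Eop j ?y) = Eop j (Fop a i ?y) -
        (if j = i then psc a (Kop (alpha j) ?y) - Kop (- alpha j) ?y else 0)"
      unfolding Eop_Fop[symmetric] by simp
    moreover have "\<dots> \<in> J"
      using p by (auto intro!: J_diff J_scale Kop_J Eop_J wcons tr_in_J J_zero)
    ultimately show ?case by simp
  qed
qed

text \<open>The induction keeps p arbitrary, because moving p(F) past a letter E_j leaves skew
  derivatives of p.\<close>

lemma evop_Fop_J: "p \<in> \<I> \<Longrightarrow> evop (Fop a) p m \<in> J"
proof (rule in_J_lext[OF lin_evop2[OF lin_ops(3)]])
  fix u v l assume "p \<in> \<I>"
  then show "evop (Fop a) p (bas (u, v, l)) \<in> J"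
  proof (induction u arbitrary: p v l)
    case 0
    have "evop (Fop a) p (bas (0, v, l)) = tr l 1 (p * bas v)"
      using evop_Fop_tr[of a p l "bas v"] unfolding tr_1 .
    then show ?case using tr_in_J(2)[OF I_mult(2)[OF 0]] by simp
  next
    case (wcons j u)
    let ?y = "bas (u, v, l) :: ('i, 'k) tmod"
    have "evop (Fop a) p (Eop j ?y) = Eop j (evop (Fop a) p ?y) -
      (psc a (Kop (alpha j) (evop (Fop a) (dL j p) ?y)) - evop (Fop a) (dR j p) (Kop (- alpha j) ?y))"
      unfolding evop_Fop_Eop[symmetric] by simp
    moreover have "evop (Fop a) (dR j p) (Kop (- alpha j) ?y) \<in> J"
      unfolding Kop_bas single_eq_psc[of _ "\<chi> _ _"] lin_psc[OF lin_evop2[OF lin_ops(3)]]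
      by (intro J_scale wcons d_in_I)
    moreover have "Eop j (evop (Fop a) p ?y) \<in> J" "psc a (Kop (alpha j) (evop (Fop a) (dL j p) ?y)) \<in> J"
      by (intro Eop_J J_scale Kop_J wcons d_in_I)+
    ultimately have "evop (Fop a) p (Eop j ?y) \<in> J"
      by (simp add: J_diff)
    then show ?case by simp
  qed
qed

end

section \<open>The generators of the coideal subalgebra\<close>

locale qsp = biid \<chi> \<I> for \<chi> :: "('i::finite, 'k::field) bichar" and \<I> :: "('i, 'k) ncpoly set" +
  fixes \<tau> :: "'i \<Rightarrow> 'i" and c :: "'i \<Rightarrow> 'k"
  assumes tau_tau [simp]: "\<tau> (\<tau> i) = i"
    and q_tau: "qmat \<chi> (\<tau> i) (\<tau> j) = qmat \<chi> i j"
    and I_tau: "p \<in> \<I> \<Longrightarrow> sub (\<lambda>i. nc_var (\<tau> i)) p \<in> \<I>"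
begin

lemma chi_tau: "\<chi> (alpha (\<tau> i)) (alpha (\<tau> j)) = \<chi> (alpha i) (alpha j)"
  using q_tau by (simp add: qmat_def)

lemma chi_tau_swap: "\<chi> (alpha (\<tau> i)) (alpha j) = \<chi> (alpha i) (alpha (\<tau> j))"
  using chi_tau[of i "\<tau> j"] by simp

definition BL :: "'k \<Rightarrow> 'i \<Rightarrow> ('i, 'k) tmod \<Rightarrow> ('i, 'k) tmod"
  where "BL a i m = Fop a i m + psc (c i) (Eop (\<tau> i) (Kop (- alpha i) m))"

lemma lin_BL [simp]: "lin (BL a i)"
proof -
  have "lin (\<lambda>m. BL a i m)"
    unfolding BL_def by (intro lin_plus lin_scale lin_comp[OF lin_ops(1) lin_ops(2)] lin_ops)
  then show ?thesis .
qed

text \<open>The exponents \<open>\<eta>\<close> with \<open>K\<^sub>\<eta> \<in> H\<^sub>\<theta>\<close>.\<close>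

inductive_set Th :: "('i \<Rightarrow> int) set" where
  zero: "0 \<in> Th"
| step: "\<eta> \<in> Th \<Longrightarrow> \<eta> + (alpha i - alpha (\<tau> i)) \<in> Th"

lemma Th_sum: "\<eta> \<in> Th \<Longrightarrow> (\<Sum>i\<in>UNIV. \<eta> i) = 0"
  by (induction rule: Th.induct) (simp_all add: fun_apply sum.distrib sum_subtractf sum_alpha)

lemma Th_add: "\<eta> \<in> Th \<Longrightarrow> \<eta>' \<in> Th \<Longrightarrow> \<eta> + \<eta>' \<in> Th"
proof (induction rule: Th.induct)
  case (step \<eta> i)
  then have "(\<eta> + \<eta>') + (alpha i - alpha (\<tau> i)) \<in> Th"
    by (intro Th.step)
  then show ?case by (simp only: ac_simps)
qed simp

lemma Th_gen: "alpha i - alpha (\<tau> i) \<in> Th"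
  using Th.step[OF Th.zero, of i] by simp

lemma Th_gen': "alpha (\<tau> i) - alpha i \<in> Th"
  using Th_gen[of "\<tau> i"] by simp

text \<open>alpha_j - alpha_tau(j) pairs trivially with alpha_i + alpha_tau(i) by \<tau>-invariance
  and symmetry of q. Hence K_eta with eta in \<open>Th\<close> commutes with both summands of B_i up
  to the same scalar.\<close>

lemma chi_Th: "\<eta> \<in> Th \<Longrightarrow> \<chi> \<eta> (alpha (\<tau> i)) = \<chi> \<eta> (- alpha i)"
proof (induction rule: Th.induct)
  case zero
  then show ?case by simp
next
  case (step \<eta> j)
  then show ?case
    by (simp add: chi_simps chi_tau_swap chi_tau field_simps)
qed

lemma Kop_BL: "\<eta> \<in> Th \<Longrightarrow> Kop \<eta> (BL a i m) = psc (\<chi> \<eta> (- alpha i)) (BL a i (Kop \<eta> m))"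
  by (simp add: BL_def ops_add ops_psc Kop_Fop Kop_Eop chi_Th Kop_Kop pm.scale_right_distrib add.commute
      mult.commute)

text \<open>As K_eta passes a product of the B_i up to a scalar, factors from H_theta need to appear
  only at the right end in the generators of the filtration.\<close>

lemma Kop_evw_BL: "\<eta> \<in> Th \<Longrightarrow> Kop \<eta> (evw (BL a) w m) = psc (\<chi> \<eta> (- wt w)) (evw (BL a) w (Kop \<eta> m))"
  by (induction w) (simp_all add: Kop_BL lin_psc[OF lin_BL] chi_simps divide_inverse)

lemma BL_J: "m \<in> J \<Longrightarrow> BL a i m \<in> J"
  unfolding BL_def by (intro J_add J_scale Fop_J Eop_J Kop_J)

text \<open>The filtration of \<open>B\<^sub>c\<close>, transported to the module by \<open>x \<mapsto> x \<cdot> 1\<close>; \<open>Bfp m\<close> is the step before \<open>Bf m\<close>.\<close>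

definition Bgen :: "nat \<Rightarrow> ('i, 'k) tmod set"
  where "Bgen m = {evw (BL 1) w (bas (0, 0, \<eta>)) | w \<eta>. wlen w \<le> m \<and> \<eta> \<in> Th}"

definition Bf :: "nat \<Rightarrow> ('i, 'k) tmod set"
  where "Bf m = pm.span (Bgen m \<union> J)"

definition Bfp :: "nat \<Rightarrow> ('i, 'k) tmod set"
  where "Bfp m = (case m of 0 \<Rightarrow> J | Suc l \<Rightarrow> Bf l)"

lemma Bfp_simps [simp]: "Bfp 0 = J" "Bfp (Suc l) = Bf l"
  by (simp_all add: Bfp_def)

lemma Bf_subspace: "pm.subspace (Bf m)"
  by (simp add: Bf_def pm.subspace_span)

lemma Bfp_subspace: "pm.subspace (Bfp m)"
  by (cases m) (simp_all add: J_subspace Bf_subspace)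

lemma J_Bf: "m \<in> J \<Longrightarrow> m \<in> Bf n"
  by (simp add: Bf_def pm.span_base)

lemma J_Bfp: "m \<in> J \<Longrightarrow> m \<in> Bfp n"
  by (cases n) (simp_all add: J_Bf)

lemma BfI: "wlen w \<le> m \<Longrightarrow> \<eta> \<in> Th \<Longrightarrow> evw (BL 1) w (bas (0, 0, \<eta>)) \<in> Bf m"
  unfolding Bf_def Bgen_def by (intro pm.span_base UnI1) auto

lemma Bf_linI:
  assumes "lin T" "pm.subspace S" "\<And>w \<eta>. wlen w \<le> m \<Longrightarrow> \<eta> \<in> Th \<Longrightarrow> T (evw (BL 1) w (bas (0, 0, \<eta>))) \<in> S"
    "\<And>x. x \<in> J \<Longrightarrow> T x \<in> S" and x: "x \<in> Bf m"
  shows "T x \<in> S"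
proof -
  have "Bgen m \<union> J \<subseteq> {x. T x \<in> S}"
    using assms(3,4) by (auto simp: Bgen_def)
  from pm.span_minimal[OF this subspace_vimage[OF assms(1,2)]] x
  show ?thesis by (auto simp: Bf_def)
qed

lemma Bf_mono: "x \<in> Bf m \<Longrightarrow> m \<le> n \<Longrightarrow> x \<in> Bf n"
  by (rule Bf_linI[OF lin_id Bf_subspace]) (auto intro: BfI J_Bf)

lemma Bfp_Bf: "x \<in> Bfp m \<Longrightarrow> x \<in> Bf m"
  by (cases m) (auto intro: J_Bf Bf_mono)

lemma BL_Bf: "x \<in> Bf m \<Longrightarrow> BL 1 i x \<in> Bf (Suc m)"
proof (rule Bf_linI[OF lin_BL Bf_subspace])
  fix w :: "'i word" and \<eta> assume "wlen w \<le> m" "\<eta> \<in> Th"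
  then show "BL 1 i (evw (BL 1) w (bas (0, 0, \<eta>))) \<in> Bf (Suc m)"
    using BfI[of "wcons i w" "Suc m" \<eta>] by simp
qed (auto intro: J_Bf BL_J)

lemma Kop_Bf: "\<eta> \<in> Th \<Longrightarrow> x \<in> Bf m \<Longrightarrow> Kop \<eta> x \<in> Bf m"
proof (rule Bf_linI[OF lin_ops(2) Bf_subspace])
  fix w :: "'i word" and \<eta>' assume "wlen w \<le> m" "\<eta>' \<in> Th" "\<eta> \<in> Th"
  then show "Kop \<eta> (evw (BL 1) w (bas (0, 0, \<eta>'))) \<in> Bf m"
    by (simp add: Kop_evw_BL Kop_bas BfI Th_add pm.subspace_scale[OF Bf_subspace])
qed (auto intro: J_Bf Kop_J)

lemma BL_Bfp: "x \<in> Bfp m \<Longrightarrow> BL 1 i x \<in> Bfp (Suc m)"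
  by (cases m) (auto intro: BL_J J_Bf BL_Bf)

lemma evw_BL_Bfp: "x \<in> Bfp m \<Longrightarrow> evw (BL 1) w x \<in> Bfp (wlen w + m)"
  by (induction w) (auto dest: BL_Bfp simp del: Bfp_simps)

end

subsection \<open>Supports\<close>

lemma keys_add_cases: "x \<in> Poly_Mapping.keys (p + q) \<Longrightarrow> x \<in> Poly_Mapping.keys p \<or> x \<in> Poly_Mapping.keys q"
  using keys_add[of p q] by auto

lemma keys_add_subset: "Poly_Mapping.keys p \<subseteq> A \<Longrightarrow> Poly_Mapping.keys q \<subseteq> A \<Longrightarrow> Poly_Mapping.keys (p + q) \<subseteq> A"
  using keys_add[of p q] by auto

lemma keys_diff_cases:
  "x \<in> Poly_Mapping.keys (p - q) \<Longrightarrow> x \<in> Poly_Mapping.keys p \<or> x \<in> Poly_Mapping.keys (q :: _ \<Rightarrow>\<^sub>0 'k::field)"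
  by (auto simp: in_keys_iff lookup_minus)

lemma keys_pscD: "x \<in> Poly_Mapping.keys (psc b p) \<Longrightarrow> x \<in> Poly_Mapping.keys p"
  by (auto simp: in_keys_iff)

lemma keys_linI:
  assumes "lin T" "\<And>x. x \<in> Poly_Mapping.keys m \<Longrightarrow> Poly_Mapping.keys (T (bas x)) \<subseteq> A"
  shows "Poly_Mapping.keys (T m) \<subseteq> A"
proof
  fix y assume "y \<in> Poly_Mapping.keys (T m)"
  then have "y \<in> Poly_Mapping.keys (lext (\<lambda>x. T (bas x)) m)"
    by (simp flip: lin_eq_lext[OF assms(1)])
  then obtain x where "x \<in> Poly_Mapping.keys m" "y \<in> Poly_Mapping.keys (T (bas x))"
    by (rule keys_lextE)
  with assms(2) show "y \<in> A" by auto
qed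

lemma wt_wlen: "wt u' + alpha i = wt u \<Longrightarrow> wlen u' < wlen (u :: 'i::finite word)"
proof -
  assume "wt u' + alpha i = wt u"
  then have "(\<Sum>j\<in>UNIV. (wt u' + alpha i) j) = (\<Sum>j\<in>UNIV. wt u j)" by simp
  then show ?thesis by (simp add: fun_apply sum.distrib sum_wt sum_alpha)
qed

context bich
begin

lemma Eop_keys: "(u', v', l') \<in> Poly_Mapping.keys (Eop i m) \<Longrightarrow>
    \<exists>u. u' = wcons i u \<and> (u, v', l') \<in> Poly_Mapping.keys m"
  unfolding Eop_def by (erule keys_lextE) auto

lemma Kop_keys: "(u', v', l') \<in> Poly_Mapping.keys (Kop \<mu> m) \<Longrightarrow> (u', v', l' - \<mu>) \<in> Poly_Mapping.keys m"
  unfolding Kop_def by (erule keys_lextE) (auto split: if_splits)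

text \<open>The exponents l - alpha_i and l + alpha_i come from K_i^{-1} and K_i, and the second
  needs a \<noteq> 0. This asymmetry is what the comparison with the degeneration exploits.\<close>

lemma Fop_keys:
  assumes "(u', v', l') \<in> Poly_Mapping.keys (Fop a i (bas (u, v, l)))"
  shows "u' = u \<and> v' = wcons i v \<and> l' = l \<or>
    v' = v \<and> wt u' + alpha i = wt u \<and> (l' = l - alpha i \<or> a \<noteq> 0 \<and> l' = l + alpha i)"
  using assms
proof (induction u arbitrary: u')
  case 0
  then show ?case by simp
next
  case (wcons j u)
  let ?b = "bas (u, v, l) :: ('i, 'k) tmod"
  from wcons.prems[unfolded Fop_bas_wcons, THEN keys_diff_cases]
  consider "(u', v', l') \<in> Poly_Mapping.keys (Eop j (Fop a i ?b))"
    | "i = j" "(u', v', l') \<in> Poly_Mapping.keys (psc a (Kop (alpha i) ?b))"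
    | "i = j" "(u', v', l') \<in> Poly_Mapping.keys (Kop (- alpha i) ?b)"
    by (auto dest!: keys_diff_cases split: if_splits)
  then show ?case
  proof cases
    case 1
    then obtain u1 where "u' = wcons j u1" "(u1, v', l') \<in> Poly_Mapping.keys (Fop a i ?b)"
      using Eop_keys by blast
    with wcons.IH[of u1] show ?thesis by (auto simp: add.assoc)
  next
    case 2
    then have "a \<noteq> 0" "(u', v', l' - alpha i) \<in> Poly_Mapping.keys ?b"
      using Kop_keys[of u' v' l' "alpha i" ?b] by (auto dest: keys_pscD)
    with 2 show ?thesis by (auto simp: algebra_simps)
  next
    case 3
    then have "(u', v', l' + alpha i) \<in> Poly_Mapping.keys ?b"
      using Kop_keys[of u' v' l' "- alpha i" ?b] by simp
    with 3 show ?thesis by (auto simp: algebra_simps)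
  qed
qed

text \<open>The two actions differ only by the K_i terms of the commutators.\<close>

lemma Fop_diff_keys:
  assumes "(u', v', l') \<in> Poly_Mapping.keys (Fop a i (bas (u, v, l)) - Fop 0 i (bas (u, v, l)))"
  shows "v' = v \<and> l' = l + alpha i"
  using assms
proof (induction u arbitrary: u')
  case 0
  then show ?case by simp
next
  case (wcons j u)
  let ?b = "bas (u, v, l) :: ('i, 'k) tmod"
  have "Fop a i (bas (wcons j u, v, l)) - Fop 0 i (bas (wcons j u, v, l)) =
      Eop j (Fop a i ?b - Fop 0 i ?b) - (if i = j then psc a (Kop (alpha i) ?b) else 0)"
    by (simp add: Fop_bas_wcons ops_diff)
  with wcons.prems consider "(u', v', l') \<in> Poly_Mapping.keys (Eop j (Fop a i ?b - Fop 0 i ?b))"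
    | "i = j" "(u', v', l') \<in> Poly_Mapping.keys (psc a (Kop (alpha i) ?b))"
    by (auto dest!: keys_diff_cases split: if_splits)
  then show ?case
  proof cases
    case 1
    then obtain u1 where "(u1, v', l') \<in> Poly_Mapping.keys (Fop a i ?b - Fop 0 i ?b)"
      using Eop_keys by blast
    with wcons.IH show ?thesis by blast
  next
    case 2
    then have "(u', v', l' - alpha i) \<in> Poly_Mapping.keys ?b"
      using Kop_keys[of u' v' l' "alpha i" ?b] by (auto dest: keys_pscD)
    then show ?thesis by (auto simp: algebra_simps)
  qed
qed

end

context qsp
begin

section \<open>Leading terms and degrees of products of the B_i\<close>

lemma BL_keys:
  assumes "(u', v', l') \<in> Poly_Mapping.keys (BL a i (bas (u, v, l)))"
  shows "u' = u \<and> v' = wcons i v \<and> l' = l \<or>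
    v' = v \<and> wt u' + alpha i = wt u \<and> (l' = l - alpha i \<or> a \<noteq> 0 \<and> l' = l + alpha i) \<or>
    u' = wcons (\<tau> i) u \<and> v' = v \<and> l' = l - alpha i"
proof -
  from assms[unfolded BL_def, THEN keys_add_cases]
  consider "(u', v', l') \<in> Poly_Mapping.keys (Fop a i (bas (u, v, l)))"
    | "(u', v', l') \<in> Poly_Mapping.keys (Eop (\<tau> i) (Kop (- alpha i) (bas (u, v, l))))"
    by (auto dest: keys_pscD)
  then show ?thesis
  proof cases
    case 1
    then show ?thesis using Fop_keys by blast
  next
    case 2
    then show ?thesis by (auto dest!: Eop_keys Kop_keys simp: algebra_simps)
  qed
qed

text \<open>Only the creation of a letter by F_i lengthens the F-part, so F_w K_eta is the single
  term of full length.\<close>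

lemma evw_BL_Ftop:
  "(u, v, l) \<in> Poly_Mapping.keys (evw (BL a) w (bas (0, 0, \<eta>)) - bas (0, w, \<eta>)) \<Longrightarrow> wlen v < wlen w"
proof -
  let ?K = "\<lambda>n. {(u :: 'i word, v :: 'i word, l :: 'i \<Rightarrow> int). wlen v < n}"
  have "Poly_Mapping.keys (evw (BL a) w (bas (0, 0, \<eta>)) - bas (0, w, \<eta>)) \<subseteq> ?K (wlen w)"
  proof (induction w)
    case 0
    then show ?case by simp
  next
    case (wcons i w)
    let ?x = "evw (BL a) w (bas (0, 0, \<eta>)) - bas (0, w, \<eta>)"
    have 1: "Poly_Mapping.keys (BL a i ?x) \<subseteq> ?K (Suc (wlen w))"
    proof (rule keys_linI[OF lin_BL])
      fix t assume "t \<in> Poly_Mapping.keys ?x"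
      then obtain u v l where t: "t = (u, v, l)" "wlen v < wlen w"
        using wcons.IH by auto
      then show "Poly_Mapping.keys (BL a i (bas t)) \<subseteq> ?K (Suc (wlen w))"
        by (auto dest!: BL_keys)
    qed
    have 2: "Poly_Mapping.keys (BL a i (bas (0, w, \<eta>)) - bas (0, wcons i w, \<eta>)) \<subseteq> ?K (Suc (wlen w))"
      unfolding BL_def by (auto dest!: keys_pscD Eop_keys Kop_keys split: if_splits)
    have "evw (BL a) (wcons i w) (bas (0, 0, \<eta>)) - bas (0, wcons i w, \<eta>) =
        BL a i ?x + (BL a i (bas (0, w, \<eta>)) - bas (0, wcons i w, \<eta>))"
      by (simp add: lin_diff[OF lin_BL])
    then have "Poly_Mapping.keys (evw (BL a) (wcons i w) (bas (0, 0, \<eta>)) - bas (0, wcons i w, \<eta>)) \<subseteq>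
        ?K (Suc (wlen w))"
      using keys_add_subset[OF 1 2] by (simp only:)
    then show ?case by simp
  qed
  then show "(u, v, l) \<in> Poly_Mapping.keys (evw (BL a) w (bas (0, 0, \<eta>)) - bas (0, w, \<eta>)) \<Longrightarrow>
      wlen v < wlen w" by auto
qed

text \<open>The scalar \<open>sc w\<close> is the coefficient of \<open>E\<^bsub>\<tau>(w)\<^esub>\<close> in \<open>B\<^sub>w \<cdot> 1\<close>.\<close>

definition sc_step :: "'i \<Rightarrow> ('i \<Rightarrow> int) \<times> 'k \<Rightarrow> ('i \<Rightarrow> int) \<times> 'k"
  where "sc_step i s = (alpha (\<tau> i) + fst s, snd s * c i * \<chi> (- alpha i) (fst s))"

definition sc :: "'i word \<Rightarrow> 'k" where "sc w = snd (foldr sc_step (letters w) (0, 1))"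

abbreviation tw :: "'i word \<Rightarrow> 'i word" where "tw w \<equiv> Word (map \<tau> (letters w))"

text \<open>Exchanging two letters trades \<chi>(alpha_i, alpha_tau(j)) for \<chi>(alpha_j,
  alpha_tau(i)), and these agree. Hence the coefficient depends on the degree of the word
  only.\<close>

lemma sc_step_commute: "sc_step i \<circ> sc_step j = sc_step j \<circ> sc_step i"
proof -
  have "\<chi> (alpha i) (alpha (\<tau> j)) = \<chi> (alpha j) (alpha (\<tau> i))"
    by (metis chi_alpha chi_tau_swap)
  then show ?thesis
    by (auto simp: sc_step_def fun_eq_iff[of "_ \<circ> _"] chi_simps add_ac mult_ac)
qed

lemma sc_cong: "wdeg v = wdeg w \<Longrightarrow> sc v = sc w"
proof -
  assume "wdeg v = wdeg w"
  then have "mset (rev (letters v)) = mset (rev (letters w))"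
    by (simp add: multiset_eq_iff count_mset wdeg_def fun_eq_iff)
  then have "fold sc_step (rev (letters v)) = fold sc_step (rev (letters w))"
    by (intro fold_multiset_equiv sc_step_commute)
  then show ?thesis by (simp add: sc_def foldr_conv_fold)
qed

lemma sc_wcons: "sc (wcons i w) = sc w * c i * \<chi> (- alpha i) (wt (tw w))"
proof -
  have "fst (foldr sc_step (letters w) (0, 1)) = wt (tw w)" for w
    by (induction w) (simp_all add: sc_step_def)
  then show ?thesis by (simp add: sc_def sc_step_def)
qed

text \<open>F_i keeps or shortens the E-part, so the top term arises by always taking E_tau(i)
  K_i^{-1}; moving each K_i^{-1} past the E-letters already present gives the factor in
  \<open>sc_wcons\<close>.\<close>

lemma evw_BL_Etop:
  "(u, v, l) \<in> Poly_Mapping.keys (evw (BL a) w (bas (0, 0, 0)) -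
     Poly_Mapping.single (tw w, 0, - wt w) (sc w)) \<Longrightarrow> wlen u < wlen w"
proof -
  let ?K = "\<lambda>n. {(u :: 'i word, v :: 'i word, l :: 'i \<Rightarrow> int). wlen u < n}"
  let ?s = "\<lambda>w. Poly_Mapping.single (tw w, 0, - wt w) (sc w) :: ('i, 'k) tmod"
  have "Poly_Mapping.keys (evw (BL a) w (bas (0, 0, 0)) - ?s w) \<subseteq> ?K (wlen w)"
  proof (induction w)
    case 0
    then show ?case by (simp add: sc_def)
  next
    case (wcons i w)
    let ?x = "evw (BL a) w (bas (0, 0, 0)) - ?s w"
    have 1: "Poly_Mapping.keys (BL a i ?x) \<subseteq> ?K (Suc (wlen w))"
    proof (rule keys_linI[OF lin_BL])
      fix t assume "t \<in> Poly_Mapping.keys ?x"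
      then obtain u v l where t: "t = (u, v, l)" "wlen u < wlen w"
        using wcons.IH by auto
      then show "Poly_Mapping.keys (BL a i (bas t)) \<subseteq> ?K (Suc (wlen w))"
        by (auto dest!: BL_keys wt_wlen)
    qed
    have 2: "Poly_Mapping.keys (Fop a i (?s w)) \<subseteq> ?K (Suc (wlen w))"
    proof (rule keys_linI[OF lin_ops(3)])
      fix t assume "t \<in> Poly_Mapping.keys (?s w)"
      then have "t = (tw w, 0, - wt w)" by (auto split: if_splits)
      then show "Poly_Mapping.keys (Fop a i (bas t)) \<subseteq> ?K (Suc (wlen w))"
        by (auto dest!: Fop_keys wt_wlen)
    qed
    have "evw (BL a) (wcons i w) (bas (0, 0, 0)) - ?s (wcons i w) = BL a i ?x + Fop a i (?s w)"
      by (simp add: lin_diff[OF lin_BL] BL_def[of _ _ "?s w"] ops_single sc_wcons mult_ac)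
    then have "Poly_Mapping.keys (evw (BL a) (wcons i w) (bas (0, 0, 0)) - ?s (wcons i w)) \<subseteq> ?K (Suc (wlen w))"
      using keys_add_subset[OF 1 2] by (simp only:)
    then show ?case by (simp add: case_prod_beta')
  qed
  then show "(u, v, l) \<in> Poly_Mapping.keys (evw (BL a) w (bas (0, 0, 0)) - ?s w) \<Longrightarrow> wlen u < wlen w"
    by auto
qed

text \<open>The index \<open>\<lambda>\<close> of the summand \<open>U\<^sup>+ K\<^sub>\<lambda> G\<^sup>-\<close> containing \<open>E\<^sub>u F\<^sub>v K\<^sub>l\<close>, since \<open>G\<^sup>-\<close> is generated by
  the \<open>F\<^sub>i K\<^sub>i\<close>.\<close>

definition grade :: "'i trip \<Rightarrow> 'i \<Rightarrow> int"
  where "grade = (\<lambda>(u, v, l). l - wt v)"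

text \<open>A coarse degree: each B_i moves it by one step up or down, and K_eta with eta in
  \<open>Th\<close> has degree 0.\<close>

definition tot :: "'i trip \<Rightarrow> int" where "tot t = (\<Sum>i\<in>UNIV. grade t i)"

lemma sum_fun_apply: "(\<Sum>i\<in>UNIV. (f + g) i) = (\<Sum>i\<in>UNIV. f i) + (\<Sum>i\<in>UNIV. (g i :: int))"
  "(\<Sum>i\<in>UNIV. (f - g) i) = (\<Sum>i\<in>UNIV. f i) - (\<Sum>i\<in>UNIV. (g i :: int))"
  "(\<Sum>i\<in>UNIV. (- f) i) = - (\<Sum>i\<in>UNIV. (f i :: int))" "(\<Sum>i\<in>UNIV. (0 :: 'i \<Rightarrow> int) i) = 0"
  by (simp_all add: fun_apply sum.distrib sum_subtractf sum_negf)

lemma BL_grade: "t' \<in> Poly_Mapping.keys (BL a i (bas t)) \<Longrightarrow>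
    grade t' = grade t - alpha i \<or> a \<noteq> 0 \<and> grade t' = grade t + alpha i"
  by (cases t; cases t') (auto dest!: BL_keys simp: grade_def algebra_simps)

lemma BL_tot: "t' \<in> Poly_Mapping.keys (BL a i (bas t)) \<Longrightarrow> tot t' = tot t - 1 \<or> tot t' = tot t + 1"
  by (auto dest!: BL_grade simp: tot_def sum_fun_apply sum_alpha)

lemma evw_BL_tot: "t \<in> Poly_Mapping.keys (evw (BL a) w (bas (0, 0, \<eta>))) \<Longrightarrow> \<eta> \<in> Th \<Longrightarrow> tot t \<ge> - int (wlen w)"
proof -
  assume \<eta>: "\<eta> \<in> Th"
  have "Poly_Mapping.keys (evw (BL a) w (bas (0, 0, \<eta>))) \<subseteq> {t. tot t \<ge> - int (wlen w)}"
  proof (induction w)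
    case 0
    then show ?case by (simp add: tot_def grade_def Th_sum[OF \<eta>])
  next
    case (wcons i w)
    have "Poly_Mapping.keys (BL a i (evw (BL a) w (bas (0, 0, \<eta>)))) \<subseteq> {t. tot t \<ge> - int (Suc (wlen w))}"
    proof (rule keys_linI[OF lin_BL], rule subsetI)
      fix t t' assume "t \<in> Poly_Mapping.keys (evw (BL a) w (bas (0, 0, \<eta>)))"
        and "t' \<in> Poly_Mapping.keys (BL a i (bas t))"
      then show "t' \<in> {t. tot t \<ge> - int (Suc (wlen w))}"
        using wcons.IH by (auto dest!: BL_tot)
    qed
    then show ?case by simp
  qed
  then show "t \<in> Poly_Mapping.keys (evw (BL a) w (bas (0, 0, \<eta>))) \<Longrightarrow> tot t \<ge> - int (wlen w)"
    by auto
qed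

lemma evw_BL0_grade: "t \<in> Poly_Mapping.keys (evw (BL 0) w (bas (0, 0, 0))) \<Longrightarrow> grade t = - wt w"
proof -
  have "Poly_Mapping.keys (evw (BL 0) w (bas (0, 0, 0))) \<subseteq> {t. grade t = - wt w}"
  proof (induction w)
    case 0
    then show ?case by (simp add: grade_def)
  next
    case (wcons i w)
    have "Poly_Mapping.keys (BL 0 i (evw (BL 0) w (bas (0, 0, 0)))) \<subseteq> {t. grade t = - wt (wcons i w)}"
    proof (rule keys_linI[OF lin_BL], rule subsetI)
      fix t t' assume "t \<in> Poly_Mapping.keys (evw (BL 0) w (bas (0, 0, 0)))"
        and "t' \<in> Poly_Mapping.keys (BL 0 i (bas t))"
      then show "t' \<in> {t. grade t = - wt (wcons i w)}"
        using wcons.IH by (auto dest!: BL_grade)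
    qed
    then show ?case by simp
  qed
  then show "t \<in> Poly_Mapping.keys (evw (BL 0) w (bas (0, 0, 0))) \<Longrightarrow> grade t = - wt w"
    by auto
qed

lemma BL_diff_grade: "t' \<in> Poly_Mapping.keys (BL a i (bas t) - BL 0 i (bas t)) \<Longrightarrow> grade t' = grade t + alpha i"
  by (cases t; cases t') (auto dest!: Fop_diff_keys simp: BL_def grade_def)

text \<open>Only the lowest summand of \<open>B\<^sub>w\<close> matters, and it is computed in the degeneration.\<close>

lemma evw_BL_diff: "t \<in> Poly_Mapping.keys (evw (BL 1) w (bas (0, 0, 0)) - evw (BL 0) w (bas (0, 0, 0))) \<Longrightarrow>
    tot t > - int (wlen w)"
proof -
  have "Poly_Mapping.keys (evw (BL 1) w (bas (0, 0, 0)) - evw (BL 0) w (bas (0, 0, 0))) \<subseteq>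
      {t. tot t > - int (wlen w)}"
  proof (induction w)
    case 0
    then show ?case by simp
  next
    case (wcons i w)
    let ?x = "evw (BL 1) w (bas (0, 0, 0))" and ?y = "evw (BL 0) w (bas (0, 0, 0))"
    let ?A = "{t. tot t > - int (Suc (wlen w))}"
    have 1: "Poly_Mapping.keys (BL 1 i (?x - ?y)) \<subseteq> ?A"
    proof (rule keys_linI[OF lin_BL], rule subsetI)
      fix t t' assume "t \<in> Poly_Mapping.keys (?x - ?y)" "t' \<in> Poly_Mapping.keys (BL 1 i (bas t))"
      then show "t' \<in> ?A"
        using wcons.IH by (auto dest!: BL_tot)
    qed
    \<comment> \<open>Where the two last steps differ, the grade is - wt w + alpha_i, whose
      coordinate sum is two above the minimal one.\<close>
    have 2: "Poly_Mapping.keys (BL 1 i ?y - BL 0 i ?y) \<subseteq> ?A"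
    proof (rule keys_linI[OF lin_minus[OF lin_BL lin_BL]], rule subsetI)
      fix t t' assume "t \<in> Poly_Mapping.keys ?y" "t' \<in> Poly_Mapping.keys (BL 1 i (bas t) - BL 0 i (bas t))"
      then have "grade t' = - wt w + alpha i"
        by (simp add: evw_BL0_grade BL_diff_grade)
      then show "t' \<in> ?A"
        by (simp add: tot_def sum_fun_apply sum_alpha sum_wt)
    qed
    have "evw (BL 1) (wcons i w) (bas (0, 0, 0)) - evw (BL 0) (wcons i w) (bas (0, 0, 0)) =
        BL 1 i (?x - ?y) + (BL 1 i ?y - BL 0 i ?y)"
      by (simp add: lin_diff[OF lin_BL])
    then have "Poly_Mapping.keys (evw (BL 1) (wcons i w) (bas (0, 0, 0)) - evw (BL 0) (wcons i w) (bas (0, 0, 0)))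
        \<subseteq> ?A"
      using keys_add_subset[OF 1 2] by (simp only:)
    then show ?case by simp
  qed
  then show "t \<in> Poly_Mapping.keys (evw (BL 1) w (bas (0, 0, 0)) - evw (BL 0) w (bas (0, 0, 0))) \<Longrightarrow>
      tot t > - int (wlen w)"
    by auto
qed

end

section \<open>The coaction on the degeneration\<close>

lemma lookup_lext_delta:
  assumes "\<And>t. lk (f t) x = (if t = t0 then 1 else 0)"
  shows "lk (lext f m) x = lk m t0"
proof -
  have "lk (lext f m) x = (\<Sum>t\<in>Poly_Mapping.keys m. if t = t0 then lk m t else 0)"
    unfolding lext_def lookup_sum by (rule sum.cong) (simp_all add: assms)
  then show ?thesis by (simp add: in_keys_iff)
qed

lemma psc_one: "psc a 1 = Poly_Mapping.single 0 a"
  by (rule poly_mapping_eqI) (simp add: lookup_one lookup_single when_def)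

lemma del_simps [simp]: "del x x = 1" "y \<noteq> x \<Longrightarrow> del x y = 0"
  by (simp_all add: del_def)

lemma lext_one [simp]: "lext f 1 = f 0"
  unfolding one_bas lext_bas ..

lemma tens_bas_single: "tens (bas x) (Poly_Mapping.single y a) = Poly_Mapping.single (x, y) a"
  by (simp add: tens_def)

lemma lin_scale_fun: "lin (\<lambda>r. psc (lk r x) m)"
  by (simp add: lin_def lookup_add pm.scale_left_distrib)

context qsp
begin

definition Eh :: "'i \<Rightarrow> ('i trip \<times> 'i trip \<Rightarrow>\<^sub>0 'k) \<Rightarrow> ('i trip \<times> 'i trip \<Rightarrow>\<^sub>0 'k)"
  where "Eh i z = ten (Eop i) (\<lambda>x. x) z + ten (Kop (alpha i)) (Eop i) z"

definition Fh :: "'i \<Rightarrow> ('i trip \<times> 'i trip \<Rightarrow>\<^sub>0 'k) \<Rightarrow> ('i trip \<times> 'i trip \<Rightarrow>\<^sub>0 'k)"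
  where "Fh i z = ten (Fop 1 i) (Kop (- alpha i)) z + ten (\<lambda>x. x) (Fop 0 i) z"

definition Kh :: "('i \<Rightarrow> int) \<Rightarrow> ('i trip \<times> 'i trip \<Rightarrow>\<^sub>0 'k) \<Rightarrow> ('i trip \<times> 'i trip \<Rightarrow>\<^sub>0 'k)"
  where "Kh \<mu> z = ten (Kop \<mu>) (Kop \<mu>) z"

lemma lin_h [simp]: "lin (Eh i)" "lin (Fh i)" "lin (Kh \<mu>)"
proof -
  have "lin (\<lambda>z. Eh i z)" "lin (\<lambda>z. Fh i z)" "lin (\<lambda>z. Kh \<mu> z)"
    unfolding Eh_def Fh_def Kh_def by (intro lin_plus lin_ten)+
  then show "lin (Eh i)" "lin (Fh i)" "lin (Kh \<mu>)" .
qed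

lemma h_tens:
  "Eh i (tens m n) = tens (Eop i m) n + tens (Kop (alpha i) m) (Eop i n)"
  "Fh i (tens m n) = tens (Fop 1 i m) (Kop (- alpha i) n) + tens m (Fop 0 i n)"
  "Kh \<mu> (tens m n) = tens (Kop \<mu> m) (Kop \<mu> n)"
  by (simp_all add: Eh_def Fh_def Kh_def ten_tens lin_id)

lemma Kh_Kh: "Kh \<mu> (Kh \<nu> z) = Kh (\<mu> + \<nu>) z"
  by (rule tens_eqI[OF lin_comp[OF lin_h(3) lin_h(3)] lin_h(3)]) (simp add: h_tens Kop_Kop)

lemma Kh_Eh: "Kh \<mu> (Eh i z) = psc (\<chi> \<mu> (alpha i)) (Eh i (Kh \<mu> z))"
  by (rule tens_eqI[OF lin_comp[OF lin_h(3) lin_h(1)] lin_scale[OF lin_comp[OF lin_h(1) lin_h(3)]]])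
    (simp add: h_tens lin_add[OF lin_h(3)] Kop_Kop Kop_Eop tens_simps pm.scale_right_distrib add.commute)

lemma Kh_Fh: "Kh \<mu> (Fh i z) = psc (\<chi> \<mu> (- alpha i)) (Fh i (Kh \<mu> z))"
proof (rule tens_eqI[OF lin_comp[OF lin_h(3) lin_h(2)] lin_scale[OF lin_comp[OF lin_h(2) lin_h(3)]]])
  fix m n
  have "\<mu> + - alpha i = - alpha i + \<mu>" by (rule add.commute)
  then show "Kh \<mu> (Fh i (tens m n)) = psc (\<chi> \<mu> (- alpha i)) (Fh i (Kh \<mu> (tens m n)))"
    by (simp only: h_tens lin_add[OF lin_h(3)] Kop_Kop Kop_Fop tens_simps pm.scale_right_distrib)
qed

text \<open>(K_i - K_i^{-1}) \<otimes> K_i^{-1} from the full left factor and - K_i \<otimes>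
  K_i^{-1} from the degenerate right factor add up to - K_i^{-1} \<otimes> K_i^{-1}, which is again
  the degenerate relation.\<close>

lemma Eh_Fh: "Eh i (Fh j z) - Fh j (Eh i z) =
    (if i = j then psc 0 (Kh (alpha i) z) - Kh (- alpha i) z else 0)"
proof (rule tens_eqI[of "\<lambda>z. Eh i (Fh j z) - Fh j (Eh i z)"
      "\<lambda>z. if i = j then psc 0 (Kh (alpha i) z) - Kh (- alpha i) z else 0"])
  show "lin (\<lambda>z. Eh i (Fh j z) - Fh j (Eh i z))"
    by (intro lin_minus lin_comp[OF lin_h(1) lin_h(2)] lin_comp[OF lin_h(2) lin_h(1)])
  show "lin (\<lambda>z. if i = j then psc 0 (Kh (alpha i) z) - Kh (- alpha i) z else 0)"
    by (intro lin_if lin_minus lin_scale lin_h lin_0)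
  fix m n
  \<comment> \<open>The cross terms K_i F_j \<otimes> E_i K_j^{-1} agree in both orders because q is
    symmetric.\<close>
  have 1: "tens (Kop (alpha i) (Fop 1 j m)) (Eop i (Kop (- alpha j) n)) =
      tens (Fop 1 j (Kop (alpha i) m)) (Kop (- alpha j) (Eop i n))"
    by (simp add: Kop_Fop Kop_Eop tens_simps chi_simps chi_alpha)
  have "Eh i (Fh j (tens m n)) - Fh j (Eh i (tens m n)) =
      tens (Eop i (Fop 1 j m) - Fop 1 j (Eop i m)) (Kop (- alpha j) n) +
      tens (Kop (alpha i) m) (Eop i (Fop 0 j n) - Fop 0 j (Eop i n))"
    by (simp add: h_tens lin_add[OF lin_h(1)] lin_add[OF lin_h(2)] 1 tens_simps)
  also have "\<dots> = (if i = j then psc 0 (Kh (alpha i) (tens m n)) - Kh (- alpha i) (tens m n) else 0)"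
    by (simp add: Eop_Fop h_tens tens_simps lin_uminus[OF lin_tens2])
  finally show "Eh i (Fh j (tens m n)) - Fh j (Eh i (tens m n)) =
      (if i = j then psc 0 (Kh (alpha i) (tens m n)) - Kh (- alpha i) (tens m n) else 0)" .
qed

interpretation th: triangular_rep \<chi> 0 Eh Fh Kh "{0}"
  by unfold_locales (simp_all add: Kh_Kh Kh_Eh Kh_Fh Eh_Fh lin_zero[OF lin_h(1)] lin_zero[OF lin_h(2)]
      lin_zero[OF lin_h(3)])

abbreviation b1 :: "('i, 'k) tmod" where "b1 \<equiv> bas (0, 0, 0)"

definition Bh :: "'i \<Rightarrow> ('i trip \<times> 'i trip \<Rightarrow>\<^sub>0 'k) \<Rightarrow> ('i trip \<times> 'i trip \<Rightarrow>\<^sub>0 'k)"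
  where "Bh i z = Fh i z + psc (c i) (Eh (\<tau> i) (Kh (- alpha i) z))"

text \<open>The coaction sends the basis vector \<open>E\<^sub>u F\<^sub>v K\<^sub>l\<close> to \<open>\<Delta>(E\<^sub>u F\<^sub>v K\<^sub>l)(1 \<otimes> 1)\<close>.\<close>

definition Co :: "('i, 'k) tmod \<Rightarrow> ('i trip \<times> 'i trip \<Rightarrow>\<^sub>0 'k)"
  where "Co = th.Psi (tens b1 b1)"

lemma lin_Co [simp]: "lin Co"
  unfolding Co_def by (rule th.lin_Psi)

lemma Co_bas: "Co (bas (u, v, l)) = evw Eh u (evw Fh v (tens (bas (0, 0, l)) (bas (0, 0, l))))"
  by (simp add: Co_def th.Psi_bas h_tens Kop_bas del: tens_bas)

lemma Co_BL: "Co (BL 0 i m) = Bh i (Co m)"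
proof -
  have "Co (Fop 0 i m) = Fh i (Co m)" "Co (Kop (- alpha i) m) = Kh (- alpha i) (Co m)"
    using th.Psi_Fop[of "tens b1 b1" i m] th.Psi_Kop[of "tens b1 b1" "- alpha i" m]
    by (simp_all add: Co_def th.eqN_def)
  moreover have "Co (Eop (\<tau> i) x) = Eh (\<tau> i) (Co x)" for x
    unfolding Co_def by (rule th.Psi_Eop)
  ultimately show ?thesis
    by (simp add: BL_def Bh_def lin_add[OF lin_Co] lin_psc[OF lin_Co])
qed

lemma Co_evw: "Co (evw (BL 0) w b1) = evw Bh w (tens b1 b1)"
  by (induction w) (simp_all add: Co_BL Co_bas)

subsection \<open>The coideal property\<close>

text \<open>The left tensor factors are B_i, 1 and K_tau(i) K_i^{-1}, all of which lie in B_c: this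
  is the coideal property.\<close>

lemma Bh_eq: "Bh i z = ten (BL 1 i) (Kop (- alpha i)) z + ten (\<lambda>x. x) (Fop 0 i) z +
    psc (c i) (ten (Kop (alpha (\<tau> i) - alpha i)) (\<lambda>n. Eop (\<tau> i) (Kop (- alpha i) n)) z)"
proof (rule tens_eqI[of "Bh i" "\<lambda>z. ten (BL 1 i) (Kop (- alpha i)) z + ten (\<lambda>x. x) (Fop 0 i) z +
    psc (c i) (ten (Kop (alpha (\<tau> i) - alpha i)) (\<lambda>n. Eop (\<tau> i) (Kop (- alpha i) n)) z)"])
  have "lin (\<lambda>z. Bh i z)"
    unfolding Bh_def by (intro lin_plus lin_scale lin_comp[OF lin_h(1) lin_h(3)] lin_h)
  then show "lin (Bh i)" .
  show "lin (\<lambda>z. ten (BL 1 i) (Kop (- alpha i)) z + ten (\<lambda>x. x) (Fop 0 i) z +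
    psc (c i) (ten (Kop (alpha (\<tau> i) - alpha i)) (\<lambda>n. Eop (\<tau> i) (Kop (- alpha i) n)) z))"
    by (intro lin_plus lin_scale lin_ten)
  fix m n :: "('i, 'k) tmod"
  show "Bh i (tens m n) = ten (BL 1 i) (Kop (- alpha i)) (tens m n) + ten (\<lambda>x. x) (Fop 0 i) (tens m n) +
    psc (c i) (ten (Kop (alpha (\<tau> i) - alpha i)) (\<lambda>n. Eop (\<tau> i) (Kop (- alpha i) n)) (tens m n))"
    by (simp add: Bh_def h_tens ten_tens lin_id lin_comp[OF lin_ops(1) lin_ops(2)] BL_def[of 1 i m] tens_simps
        Kop_Kop pm.scale_right_distrib)
qed

text \<open>The functional is arbitrary in the induction, since each summand of the coproduct of B_i
  transposes into a new functional. Only B_i \<otimes> K_i^{-1} raises the filtration degree, so the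
  leading coefficient is the value of \<open>g\<close> at K_{-wt w}.\<close>

lemma Bh_slice: "slice g (evw Bh w (tens b1 b1)) - psc (g (0, 0, - wt w)) (evw (BL 1) w b1) \<in> Bfp (wlen w)"
proof (induction w arbitrary: g)
  case 0
  show ?case by (simp add: slice_def J_zero)
next
  case (wcons i w)
  let ?z = "evw Bh w (tens b1 b1)" and ?x = "evw (BL 1) w b1"
  define g1 where "g1 = (\<lambda>y. lfun g (Kop (- alpha i) (bas y)))"
  define g2 where "g2 = (\<lambda>y. lfun g (Fop 0 i (bas y)))"
  define g3 where "g3 = (\<lambda>y. lfun g (Eop (\<tau> i) (Kop (- alpha i) (bas y))))"
  have g1w: "g1 (0, 0, - wt w) = g (0, 0, - wt (wcons i w))"
    by (simp add: g1_def Kop_bas)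
  have x: "?x \<in> Bf (wlen w)"
    by (rule BfI) (simp_all add: Th.zero)
  have sl: "slice g' ?z \<in> Bf (wlen w)" for g'
  proof -
    have "slice g' ?z - psc (g' (0, 0, - wt w)) ?x \<in> Bf (wlen w)"
      by (rule Bfp_Bf, rule wcons.IH)
    from pm.subspace_add[OF Bf_subspace this pm.subspace_scale[OF Bf_subspace x, of "g' (0, 0, - wt w)"]]
    show ?thesis by simp
  qed
  have "BL 1 i (slice g1 ?z - psc (g1 (0, 0, - wt w)) ?x) \<in> Bfp (Suc (wlen w))"
    by (intro BL_Bfp wcons.IH)
  then have 1: "BL 1 i (slice g1 ?z) - psc (g (0, 0, - wt (wcons i w))) (BL 1 i ?x) \<in> Bf (wlen w)"
    by (simp add: lin_diff[OF lin_BL] lin_psc[OF lin_BL] g1w)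
  have 3: "psc (c i) (Kop (alpha (\<tau> i) - alpha i) (slice g3 ?z)) \<in> Bf (wlen w)"
    by (intro pm.subspace_scale[OF Bf_subspace] Kop_Bf Th_gen' sl)
  have "slice g (Bh i ?z) = BL 1 i (slice g1 ?z) + slice g2 ?z +
      psc (c i) (Kop (alpha (\<tau> i) - alpha i) (slice g3 ?z))"
    unfolding Bh_eq g1_def g2_def g3_def
    by (simp only: lin_add[OF lin_slice] lin_psc[OF lin_slice] slice_ten[OF lin_BL lin_ops(2)]
        slice_ten[OF lin_id lin_ops(3)] slice_ten[OF lin_ops(2) lin_comp[OF lin_ops(1) lin_ops(2)]])
  then have "slice g (Bh i ?z) - psc (g (0, 0, - wt (wcons i w))) (BL 1 i ?x) =
      (BL 1 i (slice g1 ?z) - psc (g (0, 0, - wt (wcons i w))) (BL 1 i ?x)) + slice g2 ?z +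
      psc (c i) (Kop (alpha (\<tau> i) - alpha i) (slice g3 ?z))"
    by (simp only: add_diff_eq diff_add_eq)
  moreover have "\<dots> \<in> Bf (wlen w)"
    by (intro pm.subspace_add[OF Bf_subspace] 1 sl 3)
  ultimately show ?case
    by (simp only: evw_simps letters_simps length_Cons Bfp_simps)
qed

text \<open>All words of p have the same weight, so they share the leading coefficient: up to the
  previous step, a slice of the degenerate p(B) is a multiple of the genuine p(B).\<close>

lemma Co_slice:
  assumes "\<And>w. w \<in> Poly_Mapping.keys p \<Longrightarrow> wt w = L \<and> wlen w = m"
  shows "slice g (Co (evop (BL 0) p b1)) - psc (g (0, 0, - L)) (evop (BL 1) p b1) \<in> Bfp m"
proof -
  have "slice g (Co (evop (BL 0) p b1)) = lext (\<lambda>w. slice g (evw Bh w (tens b1 b1))) p"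
    unfolding evop_def by (simp add: lin_lext_comp[OF lin_Co] lin_lext_comp[OF lin_slice] Co_evw)
  then have "slice g (Co (evop (BL 0) p b1)) - psc (g (0, 0, - L)) (evop (BL 1) p b1) =
      lext (\<lambda>w. slice g (evw Bh w (tens b1 b1)) - psc (g (0, 0, - L)) (evw (BL 1) w b1)) p"
    by (simp add: evop_def lext_minus_fun lext_scale_fun)
  also have "\<dots> \<in> Bfp m"
    by (rule lext_in_subspace[OF Bfp_subspace]) (use Bh_slice assms in metis)
  finally show ?thesis .
qed

subsection \<open>Slices of the coaction in the triangular basis\<close>

text \<open>All terms of the coproduct other than v \<otimes> 1, respectively 1 \<otimes> v, have a
  shorter word in the factor where \<open>f\<close> is evaluated.\<close>

lemma slice_cop_top:
  assumes "\<And>b. wlen b < wlen v \<Longrightarrow> f b = 0"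
  shows "slice f (swp (cop v)) = psc (f v) 1" "slice f (cop v) = psc (f v) 1"
  using assms
proof (induction v arbitrary: f)
  case 0
  { case 1 show ?case by (simp add: slice_def swp_def psc_one)
  next case 2 show ?case by (simp add: slice_def swp_def psc_one) }
next
  case (wcons j v)
  { case 1
    have "slice (\<lambda>b. f (wcons j b)) (swp (cop v)) = psc (f (wcons j v)) 1"
      by (rule wcons.IH(1)) (use 1 in simp)
    moreover have "slice (\<lambda>b. \<chi> (alpha j) (wt b) * f b) (swp (cop v)) = psc (\<chi> (alpha j) (wt v) * f v) 1"
      by (rule wcons.IH(1)) (use 1 in simp)
    ultimately show ?case using 1[of v] by (simp add: slice_swp_cop_wcons)
  next
    case 2
    have "slice (\<lambda>b. f (wcons j b)) (cop v) = psc (f (wcons j v)) (bas 0)"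
      using wcons.IH(2)[of "\<lambda>b. f (wcons j b)"] 2 by simp
    moreover have "slice f (cop v) = psc (f v) 1"
      by (rule wcons.IH(2)) (use 2 in simp)
    ultimately show ?case using 2[of v] by (simp add: slice_cop_wcons) }
qed

text \<open>Functionals that kill every term containing an E (for \<open>G2\<close>: an F) and
  ignore the exponent, so that every K_l is sent to the value of \<open>f\<close> at the empty
  word.\<close>

definition G1 :: "('i word \<Rightarrow> 'k) \<Rightarrow> 'i trip \<Rightarrow> 'k"
  where "G1 f = (\<lambda>(u, v, l). if u = 0 then f v else 0)"

definition G2 :: "('i word \<Rightarrow> 'k) \<Rightarrow> 'i trip \<Rightarrow> 'k"
  where "G2 f = (\<lambda>(u, v, l). if v = 0 then f u else 0)"

definition S1 :: "('i word \<Rightarrow> 'k) \<Rightarrow> ('i, 'k) tmod \<Rightarrow> ('i, 'k) tmod"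
  where "S1 f = lext (\<lambda>(u, v, l). tr l (bas u) (slice f (swp (cop v))))"

definition S2 :: "('i word \<Rightarrow> 'k) \<Rightarrow> ('i \<Rightarrow> int) \<Rightarrow> ('i, 'k) tmod \<Rightarrow> ('i, 'k) tmod"
  where "S2 f \<mu> = lext (\<lambda>(u, v, l). tr (\<mu> + l) (slice f (cop u)) (Poly_Mapping.single v (\<chi> \<mu> (- wt v))))"

lemma lin_S [simp]: "lin (S1 f)" "lin (S2 f \<mu>)"
  by (simp_all add: S1_def S2_def)

lemma S_bas: "S1 f (bas (u, v, l)) = tr l (bas u) (slice f (swp (cop v)))"
  "S2 f \<mu> (bas (u, v, l)) = tr (\<mu> + l) (slice f (cop u)) (Poly_Mapping.single v (\<chi> \<mu> (- wt v)))"
  by (simp_all add: S1_def S2_def)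

text \<open>In \<Delta>(F_i) the group-like element stands on the right, so compared with E the two
  factors of the braided coproduct change places: the first one, \<open>b\<close>, goes to the
  right.\<close>

lemma evw_Fh: "evw Fh v (tens (bas (0, 0, l)) (bas (0, 0, l))) =
    lext (\<lambda>(b, a). bas ((0, a, l), (0, b, l - wt a))) (cop v)"
proof (induction v)
  case 0
  show ?case by simp
next
  case (wcons i v)
  let ?f = "\<lambda>(b, a). bas ((0, a, l), (0, b, l - wt a)) :: 'i trip \<times> 'i trip \<Rightarrow>\<^sub>0 'k"
  have 1: "Fh i (?f (b, a)) = Poly_Mapping.single ((0, wcons i a, l), (0, b, l - wt (wcons i a))) (\<chi> (alpha i) (wt b)) +
      ?f (wcons i b, a)" for b a
  proof -
    have "?f (b, a) = tens (bas (0, a, l)) (bas (0, b, l - wt a))" by simp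
    then have "Fh i (?f (b, a)) = tens (bas (0, wcons i a, l))
          (psc (\<chi> (- alpha i) (- wt b)) (bas (0, b, - alpha i + (l - wt a)))) +
        tens (bas (0, a, l)) (bas (0, wcons i b, l - wt a))"
      by (simp only: h_tens Fop_bas0 Kop_bas diff_0 single_eq_psc[of _ "\<chi> _ _"] wt_simps)
    then show ?thesis
      by (simp add: tens_bas_single chi_simps algebra_simps)
  qed
  have "Fh i (lext ?f (cop v)) = lext (\<lambda>t. Fh i (?f t)) (cop v)"
    by (rule lin_lext_comp[OF lin_h(2)])
  also have "\<dots> = lext ?f (cop (wcons i v))"
    unfolding cop_wcons lext_add
    by (simp add: lin_lext_comp[OF lin_lext] flip: lext_plus_fun)
      (auto intro!: lext_cong simp: 1[simplified] add.commute)
  finally show ?case by (simp only: evw_simps wcons)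
qed

text \<open>The summand K_i \<otimes> E_i creates an E on the right, which \<open>G1\<close> kills;
  only E_i \<otimes> 1 survives.\<close>

lemma slice_G1_Eh: "slice (G1 f) (evw Eh u z) = evw Eop u (slice (G1 f) z)"
proof (induction u)
  case 0
  show ?case by simp
next
  case (wcons i u)
  have 1: "(\<lambda>y. lfun (G1 f) (Eop i (bas y))) = (\<lambda>y. 0)"
    by (auto simp: G1_def fun_eq_iff)
  have "slice (G1 f) (Eh i z) = Eop i (slice (\<lambda>y. lfun (G1 f) (bas y)) z) +
      Kop (alpha i) (slice (\<lambda>y. lfun (G1 f) (Eop i (bas y))) z)" for z
    unfolding Eh_def lin_add[OF lin_slice] slice_ten[OF lin_ops(1) lin_id] slice_ten[OF lin_ops(2) lin_ops(1)] ..
  then show ?case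
    unfolding 1 by (simp add: slice_zero_fun ops_zero wcons)
qed

lemma Co_S1: "slice (G1 f) (Co m) = S1 f m"
proof (rule lin_eq3I[OF lin_comp[OF lin_slice lin_Co] lin_S(1)])
  fix u v l
  have 1: "slice (G1 f) (lext (\<lambda>(b, a). bas ((0, a, l), (0, b, l - wt a))) z) = tr l 1 (slice f (swp z))" for z
    unfolding one_bas
    by (rule lin_eqI[OF lin_comp[OF lin_slice lin_lext] lin_comp[OF lin_tr2 lin_comp[OF lin_slice lin_swp]]])
      (auto simp: slice_def swp_def G1_def tr_def)
  show "slice (G1 f) (Co (bas (u, v, l))) = S1 f (bas (u, v, l))"
    using evop_Eop_tr[of "bas u" l 1 "slice f (swp (cop v))"]
    by (simp add: Co_bas slice_G1_Eh evw_Fh[unfolded tens_bas] 1 S_bas)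
qed

lemma evw_Eh: "evw Eh u (tens x y) =
    lext (\<lambda>(a, b). tens (evw Eop a (Kop (wt b) x)) (evw Eop b y)) (cop u)"
proof (induction u)
  case 0
  show ?case by simp
next
  case (wcons i u)
  let ?f = "\<lambda>(a, b). tens (evw Eop a (Kop (wt b) x)) (evw Eop b y)"
  have 1: "Eh i (?f (a, b)) = ?f (wcons i a, b) + psc (\<chi> (alpha i) (wt a)) (?f (a, wcons i b))" for a b
    by (simp add: h_tens Kop_evw_Eop Kop_Kop tens_simps)
  have "Eh i (lext ?f (cop u)) = lext (\<lambda>t. Eh i (?f t)) (cop u)"
    by (rule lin_lext_comp[OF lin_h(1)])
  also have "\<dots> = lext ?f (cop (wcons i u))"
    unfolding cop_wcons lext_add
    by (simp add: lin_lext_comp[OF lin_lext] flip: lext_plus_fun)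
      (auto intro!: lext_cong simp: 1[simplified])
  finally show ?case by (simp add: wcons)
qed

text \<open>The coproduct of E_u consists of terms E_p K_{wt q} \<otimes> E_q. Since
  \<open>f\<close> lives in a single weight, K_{wt q} is the same K_mu in all contributing
  terms.\<close>

lemma Co_S2:
  assumes f: "\<And>b. f b \<noteq> 0 \<Longrightarrow> wt b = \<mu>"
  shows "slice (G2 f) (Co m) = S2 f \<mu> m"
proof (rule lin_eq3I[OF lin_comp[OF lin_slice lin_Co] lin_S(2)])
  fix u v l
  define R where "R a = tr (\<mu> + l) (slice f (cop u)) (Poly_Mapping.single a (\<chi> \<mu> (- wt a)))" for a
  have 1: "slice (G2 f) (evw Eh u (bas ((0, a, l), (0, b, l')))) = (if b = 0 then R a else 0)" for a b l'
  proof -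
    have "slice (G2 f) (evw Eh u (bas ((0, a, l), (0, b, l')))) =
        slice (G2 f) (evw Eh u (tens (bas (0, a, l)) (bas (0, b, l'))))"
      by simp
    also have "\<dots> = lext (\<lambda>(p, q). psc (lfun (G2 f) (evw Eop q (bas (0, b, l'))))
        (evw Eop p (Kop (wt q) (bas (0, a, l))))) (cop u)"
      unfolding evw_Eh lin_lext_comp[OF lin_slice] by (simp add: slice_tens case_prod_beta')
    also have "\<dots> = lext (\<lambda>(p, q). if b = 0 then Poly_Mapping.single (p, a, \<mu> + l) (f q * \<chi> \<mu> (- wt a)) else 0) (cop u)"
    proof (rule lext_cong)
      fix t :: "'i word \<times> 'i word"
      obtain p q where t: "t = (p, q)" by (cases t)
      show "(case t of (p, q) \<Rightarrow> psc (lfun (G2 f) (evw Eop q (bas (0, b, l')))) (evw Eop p (Kop (wt q) (bas (0, a, l))))) =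
        (case t of (p, q) \<Rightarrow> if b = 0 then Poly_Mapping.single (p, a, \<mu> + l) (f q * \<chi> \<mu> (- wt a)) else 0)"
        using f[of q] by (cases "f q = 0")
          (simp_all add: t evw_Eop G2_def Kop_bas single_eq_psc[of _ "\<chi> _ _"] evw_psc del: psc_single, simp)
    qed
    also have "\<dots> = (if b = 0 then R a else 0)"
    proof -
      have "lext (\<lambda>(p, q). Poly_Mapping.single (p, a, \<mu> + l) (f q * h)) z =
          tr (\<mu> + l) (slice f z) (Poly_Mapping.single a h)" for z h
        by (rule lin_eqI[OF lin_lext lin_comp[OF lin_tr1 lin_slice]]) (auto simp: slice_def tr_single)
      moreover have "lext (\<lambda>(p, q). 0) z = (0 :: ('i, 'k) tmod)" for z :: "('i, 'k) tensor2"
        by (simp add: lext_def case_prod_beta')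
      ultimately show ?thesis by (simp add: R_def)
    qed
    finally show ?thesis .
  qed
  have slice_del0: "slice (del 0) (bas (x, y)) = Poly_Mapping.single x (del 0 y)" for x y :: "'i word"
    by (simp add: slice_def)
  \<comment> \<open>\<open>G2\<close> allows no F on the right, so all of F_v stays on the left; on
    the F-part this is a slice by the counit.\<close>
  have "slice (G2 f) (evw Eh u (lext (\<lambda>(b, a). bas ((0, a, l), (0, b, l - wt a))) z)) =
      lext R (slice (del 0) (swp z))" for z
    by (rule lin_eqI[OF lin_comp[OF lin_slice lin_comp[OF lin_evw[OF lin_h(1)] lin_lext]]
          lin_comp[OF lin_lext lin_comp[OF lin_slice lin_swp]]])
      (auto simp: 1 slice_del0 swp_def)
  then show "slice (G2 f) (Co (bas (u, v, l))) = S2 f \<mu> (bas (u, v, l))"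
    by (simp add: Co_bas evw_Fh[unfolded tens_bas] slice_cop_del0 R_def S_bas)
qed

text \<open>Slicing leaves the E-part alone and acts on the F-part through the coproduct, where
  \<open>slice_cop\<close> keeps \<I> inside \<I>.\<close>

lemma S1_J:
  assumes "\<And>q. q \<in> \<I> \<Longrightarrow> lfun f q = 0" "m \<in> J"
  shows "S1 f m \<in> J"
proof -
  have "S1 f (tr l q r) = tr l q (slice f (swp (lext cop r)))" for l q r
    by (rule lin_tr_eqI[of "\<lambda>q r. S1 f (tr l q r)" "\<lambda>q r. tr l q (slice f (swp (lext cop r)))",
          OF lin_comp[OF lin_S(1) lin_tr1] lin_tr1 lin_comp[OF lin_S(1) lin_tr2]
            lin_comp[OF lin_tr2 lin_comp[OF lin_slice lin_comp[OF lin_swp lin_lext]]]])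
      (simp add: S_bas)
  then show ?thesis
    by (intro J_stable[OF lin_S(1) _ _ assms(2)]) (simp_all only: tr_in_J slice_cop[OF _ assms(1)])
qed

lemma S2_J:
  assumes "\<And>q. q \<in> \<I> \<Longrightarrow> lfun f q = 0" "m \<in> J"
  shows "S2 f \<mu> m \<in> J"
proof -
  let ?D = "lext (\<lambda>w. Poly_Mapping.single w (\<chi> \<mu> (- wt w)))"
  have "S2 f \<mu> (tr l q r) = tr (\<mu> + l) (slice f (lext cop q)) (?D r)" for l q r
    by (rule lin_tr_eqI[of "\<lambda>q r. S2 f \<mu> (tr l q r)" "\<lambda>q r. tr (\<mu> + l) (slice f (lext cop q)) (?D r)",
          OF lin_comp[OF lin_S(2) lin_tr1] lin_comp[OF lin_tr1 lin_comp[OF lin_slice lin_lext]]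
            lin_comp[OF lin_S(2) lin_tr2] lin_comp[OF lin_tr2 lin_lext]])
      (simp add: S_bas)
  moreover have "?D r \<in> \<I>" if "r \<in> \<I>" for r
    using I_diag[OF that, of "\<lambda>d. \<chi> \<mu> (- (\<lambda>i. int (d i)))"] by (simp only: wt_def)
  ultimately show ?thesis
    by (intro J_stable[OF lin_S(2) _ _ assms(2)]) (simp_all only: tr_in_J slice_cop[OF _ assms(1)])
qed

end

section \<open>The relations of the coideal subalgebra\<close>

lemma max_key:
  assumes "t0 \<in> Poly_Mapping.keys m"
  shows "\<exists>t\<in>Poly_Mapping.keys m. \<forall>s\<in>Poly_Mapping.keys m. f s \<le> (f t :: nat)"
proof -
  have "finite (f ` Poly_Mapping.keys m)" "f ` Poly_Mapping.keys m \<noteq> {}" using assms by auto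
  then have "Max (f ` Poly_Mapping.keys m) \<in> f ` Poly_Mapping.keys m" by (rule Max_in)
  then obtain t where "t \<in> Poly_Mapping.keys m" "f t = Max (f ` Poly_Mapping.keys m)" by auto
  then show ?thesis by (intro bexI[of _ t]) simp_all
qed

context biid
begin

lemma lfun_nf: "lfun (\<lambda>v. lk (nf (bas v)) v0) q = lk (nf q) v0"
proof -
  have "lfun (\<lambda>v. lk (nf (bas v)) v0) q = lk (lext (\<lambda>v. nf (bas v)) q) v0"
    unfolding lfun_def lext_def lookup_sum by (rule sum.cong) simp_all
  then show ?thesis by (simp flip: lin_eq_lext[OF lin_nf])
qed

lemma lk_nf_wdeg: "lk (nf (bas v)) v0 \<noteq> 0 \<Longrightarrow> wdeg v0 = wdeg v"
  using nf_keys[of v0 v] by (simp add: in_keys_iff)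

end

context qsp
begin

lemma NF_J_cong: "x - y \<in> J \<Longrightarrow> NF x = NF y"
  by (simp add: J_def lin_diff[OF lin_NF])

text \<open>The component in which \<open>F\<close> has normal form \<open>v\<^sub>0\<close>, respectively \<open>E\<close> has normal form \<open>u\<^sub>0\<close>.\<close>

lemma slice_F_component:
  fixes y :: "('i, 'k) tmod"
  assumes v0: "v0 \<noteq> 0" and max: "\<And>u v l. (u, v, l) \<in> Poly_Mapping.keys (NF y) \<Longrightarrow> wlen v \<le> wlen v0"
    and y: "\<And>g. slice g (Co y) - psc (g (0, 0, - L)) x \<in> Bfp m"
  obtains z where "z \<in> Bfp m" "\<And>u v l. (u, v, l) \<in> Poly_Mapping.keys (NF z) \<Longrightarrow> v = 0"
    "\<And>u l. lk (NF z) (u, 0, l) = lk (NF y) (u, v0, l)"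
proof -
  \<comment> \<open>A coefficient of the normal form and not of the word: it vanishes on \<I>, and
    by homogeneity also on words shorter than v0.\<close>
  define f where "f = (\<lambda>v. lk (nf (bas v)) v0)"
  define R :: "('i, 'k) tmod \<Rightarrow> ('i, 'k) tmod" where "R = lext (\<lambda>(u, v, l). Poly_Mapping.single (u, 0, l) (del v0 v))"
  define Z :: "('i, 'k) tmod \<Rightarrow> ('i, 'k) tmod" where "Z = lext (\<lambda>(u, v, l). Poly_Mapping.single (u, 0, l) (f v))"
  have f0: "f 0 = 0"
    using v0 by (simp add: f_def lookup_one)
  have f_len: "f v = 0" if "wlen v < wlen v0" for v
    using that lk_nf_wdeg[of v v0] wdeg_eq_wlen[of v0 v] by (auto simp: f_def)
  have f_I: "lfun f q = 0" if "q \<in> \<I>" for q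
    using that by (simp add: f_def lfun_nf nf_I)
  have R_tr: "R (tr l q r) = psc (lk r v0) (tr l q 1)" for l q r
    by (rule lin_tr_eqI[of "\<lambda>q r. R (tr l q r)" "\<lambda>q r. psc (lk r v0) (tr l q 1)",
          OF lin_comp[OF _ lin_tr1] lin_scale[OF lin_tr1] lin_comp[OF _ lin_tr2] lin_scale_fun])
      (auto simp: R_def del_def lookup_single)
  have NF_Z: "NF (Z q) = R (NF q)" for q
  proof (rule lin_eq3I[of "\<lambda>q. NF (Z q)" "\<lambda>q. R (NF q)"])
    show "lin (\<lambda>q. NF (Z q))" "lin (\<lambda>q. R (NF q))"
      unfolding Z_def R_def by (intro lin_comp[OF lin_NF] lin_comp[OF lin_lext] lin_lext lin_NF)+
    show "NF (Z (bas (u, v, l))) = R (NF (bas (u, v, l)))" for u v l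
      by (simp add: Z_def NF_bas R_tr f_def single_eq_psc[of _ "lk _ _"] lin_psc[OF lin_NF] del: psc_single)
  qed
  define z where "z = S1 f y"
  \<comment> \<open>Since \<open>f\<close> vanishes at 1, the multiple of \<open>x\<close> drops out
    and the slice itself lies in \<open>Bfp m\<close>.\<close>
  have "slice (G1 f) (Co y) - psc (G1 f (0, 0, - L)) x \<in> Bfp m" by (rule y)
  then have 1: "z \<in> Bfp m"
    unfolding z_def Co_S1 by (simp add: G1_def f0)
  \<comment> \<open>By maximality of v0 every F-word that occurs is sliced down to a scalar.\<close>
  have "S1 f (NF y) = Z (NF y)"
  proof -
    have "S1 f (NF y) = lext (\<lambda>t. S1 f (bas t)) (NF y)" by (rule lin_eq_lext[OF lin_S(1)])
    also have "\<dots> = lext (\<lambda>(u, v, l). Poly_Mapping.single (u, 0, l) (f v)) (NF y)"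
    proof (rule lext_cong)
      fix t assume t: "t \<in> Poly_Mapping.keys (NF y)"
      obtain u v l where t': "t = (u, v, l)" by (cases t)
      have "slice f (swp (cop v)) = psc (f v) 1"
        by (rule slice_cop_top) (use f_len max t t' in force)
      then show "S1 f (bas t) = (case t of (u, v, l) \<Rightarrow> Poly_Mapping.single (u, 0, l) (f v))"
        by (simp add: t' S_bas lin_psc[OF lin_tr2])
    qed
    finally show ?thesis by (simp add: Z_def)
  qed
  moreover have "S1 f (NF y) - S1 f y \<in> J"
    using S1_J[OF f_I NF_diff[of y]] by (simp add: lin_diff[OF lin_S(1)])
  ultimately have NFz: "NF z = R (NF y)"
    using NF_J_cong[of "S1 f (NF y)" "S1 f y"] by (simp add: z_def NF_Z)
  show ?thesis
  proof (rule that[OF 1])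
    show "v = 0" if "(u, v, l) \<in> Poly_Mapping.keys (NF z)" for u v l
      using that unfolding NFz R_def by (rule keys_lextE) (auto split: if_splits)
    show "lk (NF z) (u, 0, l) = lk (NF y) (u, v0, l)" for u l
      unfolding NFz R_def by (rule lookup_lext_delta) (auto simp: lookup_single del_def when_def split: if_splits)
  qed
qed

lemma slice_E_component:
  fixes y :: "('i, 'k) tmod"
  assumes u0: "u0 \<noteq> 0"
    and max: "\<And>u v l. (u, v, l) \<in> Poly_Mapping.keys (NF y) \<Longrightarrow> wlen u \<le> wlen u0 \<and> v = 0"
    and y: "\<And>g. slice g (Co y) - psc (g (0, 0, - L)) x \<in> Bfp m"
  obtains z where "z \<in> Bfp m" "\<And>u v l. (u, v, l) \<in> Poly_Mapping.keys (NF z) \<Longrightarrow> v = 0"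
    "\<And>l. lk (NF z) (0, 0, wt u0 + l) = lk (NF y) (u0, 0, l)"
proof -
  define f where "f = (\<lambda>v. lk (nf (bas v)) u0)"
  \<comment> \<open>The shift by wt u0 is the K_{wt u0} that the coproduct of E leaves in the left
    factor.\<close>
  define R :: "('i, 'k) tmod \<Rightarrow> ('i, 'k) tmod" where "R = lext (\<lambda>(u, v, l). Poly_Mapping.single (0, v, wt u0 + l) (del u0 u))"
  define Z :: "('i, 'k) tmod \<Rightarrow> ('i, 'k) tmod" where "Z = lext (\<lambda>(u, v, l). Poly_Mapping.single (0, v, wt u0 + l) (f u))"
  have f0: "f 0 = 0"
    using u0 by (simp add: f_def lookup_one)
  have f_wt: "wt v = wt u0" if "f v \<noteq> 0" for v
    using that lk_nf_wdeg[of v u0] by (simp add: f_def wt_eq_iff)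
  have f_len: "f v = 0" if "wlen v < wlen u0" for v
    using that lk_nf_wdeg[of v u0] wdeg_eq_wlen[of u0 v] by (auto simp: f_def)
  have f_I: "lfun f q = 0" if "q \<in> \<I>" for q
    using that by (simp add: f_def lfun_nf nf_I)
  have R_tr: "R (tr l q r) = psc (lk q u0) (tr (wt u0 + l) 1 r)" for l q r
    by (rule lin_tr_eqI[of "\<lambda>q r. R (tr l q r)" "\<lambda>q r. psc (lk q u0) (tr (wt u0 + l) 1 r)",
          OF lin_comp[OF _ lin_tr1] lin_scale_fun lin_comp[OF _ lin_tr2] lin_scale[OF lin_tr2]])
      (auto simp: R_def del_def lookup_single)
  have NF_Z: "NF (Z q) = R (NF q)" for q
  proof (rule lin_eq3I[of "\<lambda>q. NF (Z q)" "\<lambda>q. R (NF q)"])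
    show "lin (\<lambda>q. NF (Z q))" "lin (\<lambda>q. R (NF q))"
      unfolding Z_def R_def by (intro lin_comp[OF lin_NF] lin_comp[OF lin_lext] lin_lext lin_NF)+
    show "NF (Z (bas (u, v, l))) = R (NF (bas (u, v, l)))" for u v l
      by (simp add: Z_def NF_bas R_tr f_def single_eq_psc[of _ "lk _ _"] lin_psc[OF lin_NF] del: psc_single)
  qed
  have Co2: "slice (G2 f) (Co q) = S2 f (wt u0) q" for q
    by (rule Co_S2[OF f_wt])
  define z where "z = S2 f (wt u0) y"
  have "slice (G2 f) (Co y) - psc (G2 f (0, 0, - L)) x \<in> Bfp m" by (rule y)
  then have 1: "z \<in> Bfp m"
    unfolding z_def Co2 by (simp add: G2_def f0)
  have "S2 f (wt u0) (NF y) = Z (NF y)"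
  proof -
    have "S2 f (wt u0) (NF y) = lext (\<lambda>t. S2 f (wt u0) (bas t)) (NF y)" by (rule lin_eq_lext[OF lin_S(2)])
    also have "\<dots> = lext (\<lambda>(u, v, l). Poly_Mapping.single (0, v, wt u0 + l) (f u)) (NF y)"
    proof (rule lext_cong)
      fix t assume t: "t \<in> Poly_Mapping.keys (NF y)"
      obtain u v l where t': "t = (u, v, l)" by (cases t)
      have "slice f (cop u) = psc (f u) 1"
        by (rule slice_cop_top) (use f_len max t t' in force)
      then show "S2 f (wt u0) (bas t) = (case t of (u, v, l) \<Rightarrow> Poly_Mapping.single (0, v, wt u0 + l) (f u))"
        using max[of u v l] t by (simp add: t' S_bas lin_psc[OF lin_tr1])
    qed
    finally show ?thesis by (simp add: Z_def)
  qed
  moreover have "S2 f (wt u0) (NF y) - S2 f (wt u0) y \<in> J"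
    using S2_J[OF f_I NF_diff[of y]] by (simp add: lin_diff[OF lin_S(2)])
  ultimately have NFz: "NF z = R (NF y)"
    using NF_J_cong[of "S2 f (wt u0) (NF y)" "S2 f (wt u0) y"] by (simp add: z_def NF_Z)
  show ?thesis
  proof (rule that[OF 1])
    show "v = 0" if "(u, v, l) \<in> Poly_Mapping.keys (NF z)" for u v l
      using that unfolding NFz R_def by (rule keys_lextE) (use max in \<open>auto split: if_splits\<close>)
    show "lk (NF z) (0, 0, wt u0 + l) = lk (NF y) (u0, 0, l)" for l
      unfolding NFz R_def by (rule lookup_lext_delta) (auto simp: lookup_single del_def when_def split: if_splits)
  qed
qed

lemma S1_del0: "S1 (del 0) m = m"
  by (rule lin_eq3I[OF lin_S(1) lin_id]) (simp add: S_bas slice_cop_del0)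

text \<open>The top components of \<open>p(B)\<close> are \<open>p(F)\<close> and, up to a scalar, \<open>p(E\<^sub>\<tau>)\<close>; both vanish in \<open>U\<close>.\<close>

lemma NF_Ftop:
  assumes p: "p \<in> \<I>" "\<And>w. w \<in> Poly_Mapping.keys p \<Longrightarrow> wlen w = m"
    and t: "(u, v, l) \<in> Poly_Mapping.keys (NF (evop (BL a) p b1))"
  shows "wlen v \<noteq> m"
proof
  assume v: "wlen v = m"
  let ?Q = "\<lambda>(u :: 'i word, v :: 'i word, l :: 'i \<Rightarrow> int). wlen v = m"
  have "restr ?Q (evop (BL a) p b1) = lext (\<lambda>w. restr ?Q (evw (BL a) w b1)) p"
    unfolding evop_def by (rule lin_lext_comp[OF lin_restr])
  also have "\<dots> = lext (\<lambda>w. bas (0, w, 0)) p"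
  proof (rule lext_cong)
    fix w assume "w \<in> Poly_Mapping.keys p"
    with p have w: "wlen w = m" by simp
    have "restr ?Q (evw (BL a) w b1 - bas (0, w, 0)) = 0"
      by (rule restr_eq_0) (use evw_BL_Ftop[of _ _ _ a w 0] w in force)
    moreover have "restr ?Q (bas (0, w, 0)) = bas (0, w, 0)"
      using w by (simp add: restr_bas)
    ultimately show "restr ?Q (evw (BL a) w b1) = bas (0, w, 0)"
      by (simp add: lin_diff[OF lin_restr])
  qed
  also have "\<dots> = tr 0 1 p" by (simp add: tr_def)
  finally have "NF (restr ?Q (evop (BL a) p b1)) = 0"
    using p(1) by (simp add: NF_tr nf_I lin_zero[OF lin_tr2])
  moreover have "restr ?Q (NF (evop (BL a) p b1)) = NF (restr ?Q (evop (BL a) p b1))"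
    by (rule NF_restr) (auto dest: wdeg_eq_wlen)
  moreover have "(u, v, l) \<in> Poly_Mapping.keys (restr ?Q (NF (evop (BL a) p b1)))"
    using t v by (simp add: keys_restr)
  ultimately show False by simp
qed

lemma sub_tau_bas: "sub (\<lambda>i. nc_var (\<tau> i)) (bas w :: ('i, 'k) ncpoly) = bas (tw w)"
proof -
  have "evw (\<lambda>x. (*) (nc_var (\<tau> x))) w (1 :: ('i, 'k) ncpoly) = bas (tw w)"
    by (induction w) (simp_all add: nc_var_def mult_single)
  then show ?thesis by (simp add: sub_def)
qed

lemma NF_Etop:
  assumes p: "p \<in> \<I>" "\<And>w. w \<in> Poly_Mapping.keys p \<Longrightarrow> wlen w = m \<and> wt w = L"
    and t: "(u, v, l) \<in> Poly_Mapping.keys (NF (evop (BL a) p b1))"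
  shows "wlen u \<noteq> m"
proof
  assume u: "wlen u = m"
  let ?Q = "\<lambda>(u :: 'i word, v :: 'i word, l :: 'i \<Rightarrow> int). wlen u = m"
  \<comment> \<open>The words of p have the same degree, so their top coefficients share one value,
    which factors out.\<close>
  obtain s where s: "\<And>w. w \<in> Poly_Mapping.keys p \<Longrightarrow> sc w = s"
  proof (cases "p = 0")
    case False
    then obtain w0 where "w0 \<in> Poly_Mapping.keys p" by (metis ex_in_conv keys_eq_empty)
    then show ?thesis
      using p(2) by (intro that[of "sc w0"] sc_cong) (metis wt_eq_iff)
  qed (use that in simp)
  have "restr ?Q (evop (BL a) p b1) = lext (\<lambda>w. restr ?Q (evw (BL a) w b1)) p"
    unfolding evop_def by (rule lin_lext_comp[OF lin_restr])
  also have "\<dots> = lext (\<lambda>w. psc s (tr (- L) (bas (tw w)) 1)) p"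
  proof (rule lext_cong)
    fix w assume w': "w \<in> Poly_Mapping.keys p"
    with p have w: "wlen w = m" "wt w = L" by simp_all
    let ?s = "Poly_Mapping.single (tw w, 0, - wt w) (sc w) :: ('i, 'k) tmod"
    have "restr ?Q (evw (BL a) w b1 - ?s) = 0"
      by (rule restr_eq_0) (use evw_BL_Etop[of _ _ _ a w] w in force)
    moreover have "restr ?Q ?s = ?s"
      by (rule restr_id) (use w in \<open>auto split: if_splits\<close>)
    ultimately show "restr ?Q (evw (BL a) w b1) = psc s (tr (- L) (bas (tw w)) 1)"
      using s[OF w'] w by (simp add: lin_diff[OF lin_restr])
  qed
  also have "\<dots> = psc s (tr (- L) (sub (\<lambda>i. nc_var (\<tau> i)) p) 1)"
    unfolding lext_scale_fun lin_eq_lext[OF lin_sub, of _ p] lin_lext_comp[OF lin_tr1] sub_tau_bas ..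
  finally have "NF (restr ?Q (evop (BL a) p b1)) = 0"
    using nf_I[OF I_tau[OF p(1)]] by (simp add: lin_psc[OF lin_NF] NF_tr lin_zero[OF lin_tr1])
  moreover have "restr ?Q (NF (evop (BL a) p b1)) = NF (restr ?Q (evop (BL a) p b1))"
    by (rule NF_restr) (auto dest: wdeg_eq_wlen)
  moreover have "(u, v, l) \<in> Poly_Mapping.keys (restr ?Q (NF (evop (BL a) p b1)))"
    using t u by (simp add: keys_restr)
  ultimately show False by simp
qed

lemma keys_NF_grade:
  assumes "\<And>t. t \<in> Poly_Mapping.keys y \<Longrightarrow> grade t = L" and t: "t \<in> Poly_Mapping.keys (NF y)"
  shows "grade t = L"
proof -
  have "restr (\<lambda>t. grade t = L) (NF y) = NF (restr (\<lambda>t. grade t = L) y)"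
    by (rule NF_restr) (simp add: grade_def flip: wt_eq_iff)
  also have "restr (\<lambda>t. grade t = L) y = y" by (rule restr_id) (rule assms(1))
  finally have "t \<in> Poly_Mapping.keys (restr (\<lambda>t. grade t = L) (NF y))" using t by simp
  then show ?thesis by (simp add: keys_restr)
qed

text \<open>Hypothesis C is what injectivity in lower degrees provides: an element of
  \<open>Bfp m\<close> free of F lies in H_theta. The element \<open>y\<close> stands for the lowest
  summand of p(B), and only a multiple of K_{-L} can be left of it modulo \<open>J\<close>.\<close>

theorem lowest_component:
  assumes p: "p \<in> \<I>" "\<And>w. w \<in> Poly_Mapping.keys p \<Longrightarrow> wlen w = m \<and> wt w = L"
    and sumL: "(\<Sum>i\<in>UNIV. L i) = int m"
    and C: "\<And>x u v l. x \<in> Bfp m \<Longrightarrow> (\<And>u v l. (u, v, l) \<in> Poly_Mapping.keys (NF x) \<Longrightarrow> v = 0) \<Longrightarrow>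
      (u, v, l) \<in> Poly_Mapping.keys (NF x) \<Longrightarrow> u = 0 \<and> l \<in> Th"
  defines "y \<equiv> evop (BL 0) p b1"
  shows "y - evop (BL 1) p b1 \<in> Bfp m"
    and "(u, v, l) \<in> Poly_Mapping.keys (NF y) \<Longrightarrow> u = 0 \<and> v = 0 \<and> l = - L"
proof -
  have sl: "slice g (Co y) - psc (g (0, 0, - L)) (evop (BL 1) p b1) \<in> Bfp m" for g
    unfolding y_def by (rule Co_slice) (use p(2) in auto)
  \<comment> \<open>Slicing by the counit: \<open>S1 (del 0)\<close> is the identity, and
    \<open>G1 (del 0)\<close> has the value 1 at K_{-L}.\<close>
  show "y - evop (BL 1) p b1 \<in> Bfp m"
    using sl[of "G1 (del 0)"] unfolding Co_S1 S1_del0 by (simp add: G1_def)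
  have "t \<in> Poly_Mapping.keys y \<Longrightarrow> grade t = - L" for t
    unfolding y_def evop_def by (erule keys_lextE) (use evw_BL0_grade p(2) in auto)
  from keys_NF_grade[OF this] have gr: "l = wt v - L" if "(u, v, l) \<in> Poly_Mapping.keys (NF y)" for u v l
    using that by (force simp: grade_def algebra_simps)
  have v: "v = 0" if t: "(u, v, l) \<in> Poly_Mapping.keys (NF y)" for u v l
  proof (rule ccontr)
    assume "v \<noteq> 0"
    obtain t0 where t0: "t0 \<in> Poly_Mapping.keys (NF y)"
      "\<forall>s\<in>Poly_Mapping.keys (NF y). wlen (fst (snd s)) \<le> wlen (fst (snd t0))"
      using max_key[OF t, of "\<lambda>s. wlen (fst (snd s))"] by auto
    obtain u0 v0 l0 where t0': "t0 = (u0, v0, l0)" by (cases t0)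
    have max: "wlen v' \<le> wlen v0" if "(u', v', l') \<in> Poly_Mapping.keys (NF y)" for u' v' l'
      using bspec[OF t0(2) that] t0' by simp
    have "v0 \<noteq> 0" using max[OF t] \<open>v \<noteq> 0\<close> by auto
    then show False
    proof (rule slice_F_component[OF _ max sl])
      fix z assume z: "z \<in> Bfp m" "\<And>u v l. (u, v, l) \<in> Poly_Mapping.keys (NF z) \<Longrightarrow> v = 0"
      "\<And>u l. lk (NF z) (u, 0, l) = lk (NF y) (u, v0, l)"
    have "(u0, 0, l0) \<in> Poly_Mapping.keys (NF z)"
      using t0(1) t0' z(3)[of u0 l0] by (simp add: in_keys_iff)
    \<comment> \<open>Exponents in \<open>Th\<close> have coordinate sum 0, whereas l0 = wt v0 - L
      has the sum \<open>wlen v0\<close> - m.\<close>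
    from C[OF z(1) z(2) this] have "l0 \<in> Th" by simp
    moreover have "l0 = wt v0 - L" using gr t0(1) t0' by simp
    ultimately have "wlen v0 = m"
      using Th_sum[of l0] sumL by (simp add: sum_fun_apply sum_wt)
    moreover have "wlen v0 \<noteq> m"
      by (rule NF_Ftop[OF p(1)]) (use p(2) t0(1) t0' in \<open>auto simp: y_def\<close>)
    ultimately show False by simp
    qed
  qed
  have u: "u = 0" if t: "(u, v, l) \<in> Poly_Mapping.keys (NF y)" for u v l
  proof (rule ccontr)
    assume "u \<noteq> 0"
    obtain t0 where t0: "t0 \<in> Poly_Mapping.keys (NF y)"
      "\<forall>s\<in>Poly_Mapping.keys (NF y). wlen (fst s) \<le> wlen (fst t0)"
      using max_key[OF t, of "\<lambda>s. wlen (fst s)"] by auto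
    obtain u0 v0 l0 where t0': "t0 = (u0, v0, l0)" by (cases t0)
    have v0: "v0 = 0" using v t0(1) t0' by simp
    have max: "wlen u' \<le> wlen u0 \<and> v' = 0" if "(u', v', l') \<in> Poly_Mapping.keys (NF y)" for u' v' l'
      using bspec[OF t0(2) that] t0' v[OF that] by simp
    have "u0 \<noteq> 0" using max[OF t] \<open>u \<noteq> 0\<close> by auto
    then show False
    proof (rule slice_E_component[OF _ max sl])
      fix z assume z: "z \<in> Bfp m" "\<And>u v l. (u, v, l) \<in> Poly_Mapping.keys (NF z) \<Longrightarrow> v = 0"
      "\<And>l. lk (NF z) (0, 0, wt u0 + l) = lk (NF y) (u0, 0, l)"
    have "(0, 0, wt u0 + l0) \<in> Poly_Mapping.keys (NF z)"
      using t0(1) t0' v0 z(3)[of l0] by (simp add: in_keys_iff)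
    \<comment> \<open>The slice carries the exponent wt u0 - L, so the count is the same as for
      F.\<close>
    from C[OF z(1) z(2) this] have "wt u0 + l0 \<in> Th" by simp
    moreover have "l0 = - L" using gr t0(1) t0' v0 by force
    ultimately have "wlen u0 = m"
      using Th_sum[of "wt u0 + l0"] sumL by (simp add: sum_fun_apply sum_wt)
    moreover have "wlen u0 \<noteq> m"
      by (rule NF_Etop[OF p(1)]) (use p(2) t0(1) t0' in \<open>auto simp: y_def\<close>)
    ultimately show False by simp
    qed
  qed
  show "u = 0 \<and> v = 0 \<and> l = - L" if "(u, v, l) \<in> Poly_Mapping.keys (NF y)"
    using u[OF that] v[OF that] gr[OF that] by simp
qed

end

section \<open>The action of the free algebra\<close>

text \<open>Induction on the sum of the absolute values: a nonzero coordinate can be moved one step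
  towards 0.\<close>

lemma int_fun_induct [case_names zero plus minus]:
  fixes a :: "'i::finite \<Rightarrow> int"
  assumes z: "P 0" and p: "\<And>a i. P a \<Longrightarrow> P (a + alpha i)" and m: "\<And>a i. P a \<Longrightarrow> P (a - alpha i)"
  shows "P a"
proof (induction "nat (\<Sum>i\<in>UNIV. \<bar>a i\<bar>)" arbitrary: a rule: less_induct)
  case less
  show ?case
  proof (cases "a = 0")
    case False
    then obtain i where i: "a i \<noteq> 0" by (auto simp: fun_eq_iff fun_apply)
    define b where "b = (if a i > 0 then a - alpha i else a + alpha i)"
    have "(\<Sum>j\<in>UNIV. \<bar>b j\<bar>) < (\<Sum>j\<in>UNIV. \<bar>a j\<bar>)"
    proof (rule sum_strict_mono_ex1)
      show "\<forall>j\<in>UNIV. \<bar>b j\<bar> \<le> \<bar>a j\<bar>" using i by (auto simp: b_def alpha_def fun_apply)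
      show "\<exists>j\<in>UNIV. \<bar>b j\<bar> < \<bar>a j\<bar>" using i by (intro bexI[of _ i]) (auto simp: b_def alpha_def fun_apply)
    qed simp
    moreover have "0 \<le> (\<Sum>j\<in>UNIV. \<bar>b j\<bar>)" by (rule sum_nonneg) simp
    ultimately have "nat (\<Sum>j\<in>UNIV. \<bar>b j\<bar>) < nat (\<Sum>j\<in>UNIV. \<bar>a j\<bar>)" by linarith
    then have "P b" by (rule less)
    then show ?thesis
      using p[of b i] m[of b i] by (auto simp: b_def split: if_splits)
  qed (use z in simp)
qed

lemma ideal_free_algI:
  fixes S :: "('x, 'k::field) ncpoly set"
  assumes S: "pm.subspace S" and l: "\<And>q w. q \<in> S \<Longrightarrow> bas w * q \<in> S" and r: "\<And>q w. q \<in> S \<Longrightarrow> q * bas w \<in> S"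
  shows "ideal S free_alg"
proof (rule idealI[OF ring_free_alg])
  have R: "carrier (free_alg :: ('x, 'k) ncpoly ring) = UNIV" "add (free_alg :: ('x, 'k) ncpoly ring) = (+)"
    "ring.zero (free_alg :: ('x, 'k) ncpoly ring) = 0"
    by (simp_all add: ring_of_type_algebra_def)
  show "subgroup S (add_monoid free_alg)"
  proof
    show "inv\<^bsub>add_monoid free_alg\<^esub> x \<in> S" if "x \<in> S" for x
      using minv_eq_uminus[OF R, of x] pm.subspace_neg[OF S that] by (simp only:)
  qed (simp_all add: R pm.subspace_0[OF S] pm.subspace_add[OF S])
next
  fix a x :: "('x, 'k) ncpoly" assume a: "a \<in> S"
  have "x * a = lext (\<lambda>w. bas w * a) x" "a * x = lext (\<lambda>w. a * bas w) x"
    by (rule lin_eq_lext[OF lin_mult_right], rule lin_eq_lext[OF lin_mult_left])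
  then show "x \<otimes>\<^bsub>free_alg\<^esub> a \<in> S" "a \<otimes>\<^bsub>free_alg\<^esub> x \<in> S"
    using a by (simp_all add: lext_in_subspace[OF S] l r)
qed

lemma genideal_free_alg_minimal:
  fixes S :: "('x, 'k::field) ncpoly set"
  shows "ideal T free_alg \<Longrightarrow> S \<subseteq> T \<Longrightarrow> Idl\<^bsub>free_alg\<^esub> S \<subseteq> T"
  by (rule ring.genideal_minimal[OF ring_free_alg])

lemma restr_wlen_mult:
  "restr (\<lambda>w. wlen w = m) (bas u * q) =
    (if wlen u \<le> m then bas u * restr (\<lambda>w. wlen w = m - wlen u) q else 0)"
  "restr (\<lambda>w. wlen w = m) (q * bas u) =
    (if wlen u \<le> m then restr (\<lambda>w. wlen w = m - wlen u) q * bas u else 0)"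
proof -
  show "restr (\<lambda>w. wlen w = m) (bas u * q) =
    (if wlen u \<le> m then bas u * restr (\<lambda>w. wlen w = m - wlen u) q else 0)"
    by (rule lin_eqI[OF lin_comp[OF lin_restr lin_mult_left]
          lin_if[OF lin_comp[OF lin_mult_left lin_restr] lin_0]]) (auto simp: restr_bas)
  show "restr (\<lambda>w. wlen w = m) (q * bas u) =
    (if wlen u \<le> m then restr (\<lambda>w. wlen w = m - wlen u) q * bas u else 0)"
    by (rule lin_eqI[OF lin_comp[OF lin_restr lin_mult_right]
          lin_if[OF lin_comp[OF lin_mult_right lin_restr] lin_0]]) (auto simp: restr_bas)
qed

lemma homogeneous_keys:
  "homogeneous lam p \<Longrightarrow> w \<in> Poly_Mapping.keys p \<Longrightarrow> wt w = (\<lambda>i. int (lam i))"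
  by (simp add: homogeneous_def wt_def)

lemma homogeneous_wlen:
  fixes lam :: "'i::finite \<Rightarrow> nat"
  shows "homogeneous lam p \<Longrightarrow> w \<in> Poly_Mapping.keys p \<Longrightarrow> wlen w = (\<Sum>i\<in>UNIV. lam i)"
  using sum_wt[of w] homogeneous_keys[of lam p w] by (simp flip: of_nat_sum)

context bich
begin

definition genop :: "'i gen \<Rightarrow> ('i, 'k) tmod \<Rightarrow> ('i, 'k) tmod"
  where "genop g = (case g of GenE i \<Rightarrow> Eop i | GenF i \<Rightarrow> Fop 1 i | GenK i \<Rightarrow> Kop (alpha i)
    | GenKinv i \<Rightarrow> Kop (- alpha i))"

lemma genop_simps [simp]: "genop (GenE i) = Eop i" "genop (GenF i) = Fop 1 i" "genop (GenK i) = Kop (alpha i)"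
  "genop (GenKinv i) = Kop (- alpha i)"
  by (simp_all add: genop_def)

lemma lin_genop [simp]: "lin (genop g)"
  by (cases g) simp_all

abbreviation act :: "('i gen, 'k) ncpoly \<Rightarrow> ('i, 'k) tmod \<Rightarrow> ('i, 'k) tmod" where "act \<equiv> evop genop"

lemmas act_mult = evop_mult[of genop, OF lin_genop]
lemmas lin_act = lin_evop2[of genop, OF lin_genop]

lemma act_sub: "act (sub b p) m = evop (\<lambda>x. act (b x)) p m"
  by (rule evop_sub[OF lin_genop])

end

context qsp
begin

lemma ex_Kact: "\<exists>x. \<forall>m. act x m = Kop \<mu> m"
proof (induction \<mu> rule: int_fun_induct)
  case zero
  show ?case by (intro exI[of _ 1]) simp
next
  case (plus \<mu> i)
  then obtain x where "\<forall>m. act x m = Kop \<mu> m" ..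
  then show ?case
    by (intro exI[of _ "nc_var (GenK i) * x"]) (simp add: act_mult Kop_Kop add.commute)
next
  case (minus \<mu> i)
  then obtain x where "\<forall>m. act x m = Kop \<mu> m" ..
  then show ?case
    by (intro exI[of _ "nc_var (GenKinv i) * x"]) (simp add: act_mult Kop_Kop)
qed

text \<open>Chosen by its action alone, so that it is available before U(\<chi>) has been
  identified; \<open>uc_Ka\<close> later shows that its class is K_mu.\<close>

definition Ka :: "('i \<Rightarrow> int) \<Rightarrow> ('i gen, 'k) ncpoly"
  where "Ka \<mu> = (SOME x. \<forall>m. act x m = Kop \<mu> m)"

lemma act_Ka [simp]: "act (Ka \<mu>) m = Kop \<mu> m"
  using someI_ex[OF ex_Kact[of \<mu>]] by (simp add: Ka_def)

definition BA :: "'i \<Rightarrow> ('i gen, 'k) ncpoly"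
  where "BA i = nc_var (GenF i) + nc_const (c i) * nc_var (GenE (\<tau> i)) * nc_var (GenKinv i)"

lemma act_BA [simp]: "act (BA i) = BL 1 i"
  by (rule ext) (simp add: BA_def BL_def act_mult)

lemma act_sub_BA [simp]: "act (sub BA p) m = evop (BL 1) p m"
  by (simp add: act_sub)

section \<open>Injectivity degree by degree\<close>

text \<open>This is injectivity of \<open>\<phi>\<close> in degree \<open>n + 1\<close>. In degree \<open>0\<close> it is automatic.\<close>

definition deg_inj :: "nat \<Rightarrow> bool"
  where "deg_inj n \<longleftrightarrow> (\<forall>x\<in>Bf (Suc n). (\<forall>u v l. (u, v, l) \<in> Poly_Mapping.keys (NF x) \<longrightarrow> wlen v \<noteq> Suc n) \<longrightarrow> x \<in> Bf n)"

lemma Bf0_keys: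
  assumes "x \<in> Bf 0" "(u, v, l) \<in> Poly_Mapping.keys (NF x)"
  shows "u = 0 \<and> v = 0 \<and> l \<in> Th"
proof -
  let ?A = "{(u :: 'i word, v :: 'i word, l). u = 0 \<and> v = 0 \<and> l \<in> Th}"
  have "NF x \<in> {m. Poly_Mapping.keys m \<subseteq> ?A}"
  proof (rule Bf_linI[OF lin_NF subspace_keys _ _ assms(1)])
    fix w :: "'i word" and \<eta> assume "wlen w \<le> 0" "\<eta> \<in> Th"
    then show "NF (evw (BL 1) w (bas (0, 0, \<eta>))) \<in> {m. Poly_Mapping.keys m \<subseteq> ?A}"
      by (simp add: NF_bas)
  qed (simp add: J_def)
  with assms(2) show ?thesis by auto
qed

text \<open>Each \<open>deg_inj n\<close> lowers the filtration step of an element without F by one,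
  until H_theta is reached.\<close>

lemma Bf_without_F:
  assumes "\<And>n. n < m \<Longrightarrow> deg_inj n" "x \<in> Bf m" "\<And>u v l. (u, v, l) \<in> Poly_Mapping.keys (NF x) \<Longrightarrow> v = 0"
  shows "x \<in> Bf 0"
  using assms(1,2)
proof (induction m)
  case (Suc m)
  have "x \<in> Bf m"
    using Suc.prems(1)[of m] Suc.prems(2) assms(3) by (force simp: deg_inj_def)
  then show ?case using Suc by simp
qed simp

text \<open>The full and the degenerate action agree in the lowest grade by
  \<open>evw_BL_diff\<close>, so \<open>evop (BL 0) p b1\<close> represents the projection of p(B)
  to the index - lam.\<close>

lemma evop_BL_restr:
  assumes "homogeneous lam p"
  shows "restr (\<lambda>t. grade t = (\<lambda>i. - int (lam i))) (evop (BL 1) p b1) = evop (BL 0) p b1"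
proof -
  let ?Q = "\<lambda>t. grade t = (\<lambda>i. - int (lam i))"
  have "restr ?Q (evop (BL 1) p b1) = lext (\<lambda>w. restr ?Q (evw (BL 1) w b1)) p"
    unfolding evop_def by (rule lin_lext_comp[OF lin_restr])
  also have "\<dots> = lext (\<lambda>w. evw (BL 0) w b1) p"
  proof (rule lext_cong)
    fix w assume "w \<in> Poly_Mapping.keys p"
    then have w: "- wt w = (\<lambda>i. - int (lam i))"
      using homogeneous_keys[OF assms] by (simp add: fun_eq_iff fun_apply)
    have "restr ?Q (evw (BL 1) w b1 - evw (BL 0) w b1) = 0"
    proof (rule restr_eq_0)
      fix t assume "t \<in> Poly_Mapping.keys (evw (BL 1) w b1 - evw (BL 0) w b1)"
      then have "tot t > - int (wlen w)" by (rule evw_BL_diff)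
      then have "grade t \<noteq> - wt w" by (auto simp: tot_def sum_fun_apply sum_wt)
      then show "\<not> ?Q t" by (simp add: w)
    qed
    moreover have "restr ?Q (evw (BL 0) w b1) = evw (BL 0) w b1"
      by (rule restr_id) (simp add: evw_BL0_grade w)
    ultimately show "restr ?Q (evw (BL 1) w b1) = evw (BL 0) w b1"
      by (simp add: lin_diff[OF lin_restr])
  qed
  finally show ?thesis by (simp add: evop_def)
qed

lemma Bf_tot:
  assumes "x \<in> Bf n" "t \<in> Poly_Mapping.keys (NF x)"
  shows "tot t \<ge> - int n"
proof -
  let ?A = "{t. tot t \<ge> - int n}"
  have "NF x \<in> {m. Poly_Mapping.keys m \<subseteq> ?A}"
  proof (rule Bf_linI[OF lin_NF subspace_keys _ _ assms(1)])
    fix w :: "'i word" and \<eta> assume w: "wlen w \<le> n" "\<eta> \<in> Th"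
    show "NF (evw (BL 1) w (bas (0, 0, \<eta>))) \<in> {m. Poly_Mapping.keys m \<subseteq> ?A}"
    proof (rule CollectI, rule keys_linI[OF lin_NF], rule subsetI)
      fix s s' assume "s \<in> Poly_Mapping.keys (evw (BL 1) w (bas (0, 0, \<eta>)))" "s' \<in> Poly_Mapping.keys (NF (bas s))"
      moreover obtain u v l u' v' l' where "s = (u, v, l)" "s' = (u', v', l')" by (cases s, cases s')
      ultimately have "grade s' = grade s" "tot s \<ge> - int (wlen w)"
        using NF_keys[of u' v' l' u v l] evw_BL_tot[OF _ w(2)] by (auto simp: grade_def simp flip: wt_eq_iff)
      then show "s' \<in> ?A" using w by (simp add: tot_def)
    qed
  qed (simp add: J_def)
  with assms(2) show ?thesis by auto
qed

theorem deg_inj_imp_lowest_zero: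
  assumes D: "\<And>n. deg_inj n" and p: "p \<in> \<I>" "homogeneous lam p"
  shows "restr (\<lambda>t. grade t = (\<lambda>i. - int (lam i))) (NF (evop (BL 1) p b1)) = 0"
proof (cases "p = 0")
  case False
  then obtain w0 where w0: "w0 \<in> Poly_Mapping.keys p" by (metis ex_in_conv keys_eq_empty)
  define m where "m = (\<Sum>i\<in>UNIV. lam i)"
  have len: "wlen w = m" if "w \<in> Poly_Mapping.keys p" for w
    using homogeneous_wlen[OF p(2) that] by (simp add: m_def)
  \<comment> \<open>The words of p are nonempty, so there is an earlier step \<open>Bf n\<close>
    into which p(B) can drop.\<close>
  from len2[OF p(1) w0] len[OF w0] obtain n where n: "m = Suc n" by (cases m) auto
  have "evop (BL 1) p b1 \<in> Bf (Suc n)"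
    unfolding evop_def by (rule lext_in_subspace[OF Bf_subspace]) (use len n in \<open>auto intro!: BfI Th.zero\<close>)
  with D[of n] have B: "evop (BL 1) p b1 \<in> Bf n"
    unfolding deg_inj_def using NF_Ftop[OF p(1) len] n by metis
  have "tot t > - int m" if "t \<in> Poly_Mapping.keys (NF (evop (BL 1) p b1))" for t
    using Bf_tot[OF B that] n by simp
  moreover have "tot t = - int m" if "grade t = (\<lambda>i. - int (lam i))" for t
    by (simp add: tot_def that m_def sum_negf)
  ultimately show ?thesis
    by (intro restr_eq_0) force
qed (simp add: lin_zero[OF lin_NF] lin_zero[OF lin_restr])

section \<open>Right multiplication in the filtration and passage from generators to the
  ideal\<close>

context
  assumes faith: "\<And>x m. act x b1 \<in> J \<Longrightarrow> act x m \<in> J"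
begin

text \<open>The module carries only left multiplication. To multiply an element \<open>y\<close> of
  the filtration on the right, it is written modulo \<open>J\<close> as x . 1 with x in the free
  algebra, chosen so that its action respects the filtration.\<close>

lemma Bf_act:
  assumes "y \<in> Bf l"
  shows "\<exists>x. act x b1 - y \<in> J \<and> (\<forall>v \<eta>. \<eta> \<in> Th \<longrightarrow> act x (evw (BL 1) v (bas (0, 0, \<eta>))) \<in> Bf (l + wlen v))"
proof -
  let ?S = "{y. \<exists>x. act x b1 - y \<in> J \<and> (\<forall>v \<eta>. \<eta> \<in> Th \<longrightarrow> act x (evw (BL 1) v (bas (0, 0, \<eta>))) \<in> Bf (l + wlen v))}"
  have "pm.subspace ?S"
    unfolding pm.subspace_def
  proof (intro conjI ballI allI)
    show "0 \<in> ?S"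
      by (auto intro!: exI[of _ 0] simp: J_zero pm.subspace_0[OF Bf_subspace])
  next
    fix y y' assume "y \<in> ?S" "y' \<in> ?S"
    then obtain x x' where x: "act x b1 - y \<in> J" "act x' b1 - y' \<in> J"
      "\<forall>v \<eta>. \<eta> \<in> Th \<longrightarrow> act x (evw (BL 1) v (bas (0, 0, \<eta>))) \<in> Bf (l + wlen v)"
      "\<forall>v \<eta>. \<eta> \<in> Th \<longrightarrow> act x' (evw (BL 1) v (bas (0, 0, \<eta>))) \<in> Bf (l + wlen v)" by auto
    have "act (x + x') b1 - (y + y') \<in> J"
      using J_add[OF x(1,2)] by (simp add: algebra_simps)
    with x(3,4) show "y + y' \<in> ?S"
      by (auto intro!: exI[of _ "x + x'"] pm.subspace_add[OF Bf_subspace])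
  next
    fix b y assume "y \<in> ?S"
    then obtain x where x: "act x b1 - y \<in> J"
      "\<forall>v \<eta>. \<eta> \<in> Th \<longrightarrow> act x (evw (BL 1) v (bas (0, 0, \<eta>))) \<in> Bf (l + wlen v)" by auto
    have "act (psc b x) b1 - psc b y \<in> J"
      using J_scale[OF x(1), of b] by (simp add: pm.scale_right_diff_distrib)
    with x(2) show "psc b y \<in> ?S"
      by (auto intro!: exI[of _ "psc b x"] pm.subspace_scale[OF Bf_subspace])
  qed
  moreover have "Bgen l \<subseteq> ?S"
  proof
    fix y assume "y \<in> Bgen l"
    then obtain w \<eta> where y: "y = evw (BL 1) w (bas (0, 0, \<eta>))" "wlen w \<le> l" "\<eta> \<in> Th"
      by (auto simp: Bgen_def)
    have a: "act (sub BA (bas w) * Ka \<eta>) m = evw (BL 1) w (Kop \<eta> m)" for m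
      by (simp add: act_mult)
    have "evw (BL 1) w (Kop \<eta> (evw (BL 1) v (bas (0, 0, \<eta>')))) \<in> Bf (l + wlen v)" if "\<eta>' \<in> Th" for v \<eta>'
    proof -
      have "evw (BL 1) w (Kop \<eta> (evw (BL 1) v (bas (0, 0, \<eta>')))) =
          psc (\<chi> \<eta> (- wt v)) (evw (BL 1) (w + v) (bas (0, 0, \<eta> + \<eta>')))"
        by (simp add: Kop_evw_BL[OF y(3)] Kop_bas lin_psc[OF lin_evw[OF lin_BL]])
      also have "\<dots> \<in> Bf (l + wlen v)"
        by (intro pm.subspace_scale[OF Bf_subspace] BfI Th_add y(3) that) (use y(2) in simp)
      finally show ?thesis .
    qed
    then show "y \<in> ?S"
      by (auto intro!: exI[of _ "sub BA (bas w) * Ka \<eta>"] simp: a Kop_bas y(1) J_zero simp del: act_sub_BA)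
  qed
  moreover have "J \<subseteq> ?S"
  proof
    fix y assume "y \<in> J"
    then have "act 0 b1 - y \<in> J" using J_diff[OF J_zero, of y] by simp
    then show "y \<in> ?S"
      by (auto intro!: exI[of _ 0] simp: pm.subspace_0[OF Bf_subspace])
  qed
  ultimately have "Bf l \<subseteq> ?S"
    unfolding Bf_def by (intro pm.span_minimal) auto
  with assms show ?thesis by blast
qed

text \<open>x and p(B) agree on the vector 1 modulo \<open>J\<close>, hence on all vectors by
  \<open>faith\<close>; so the estimate for x carries over to p(B).\<close>

lemma Bfp_right_mult:
  assumes "evop (BL 1) p b1 \<in> Bfp m" "\<eta> \<in> Th"
  shows "evop (BL 1) p (evw (BL 1) v (bas (0, 0, \<eta>))) \<in> Bfp (m + wlen v)"
proof (cases m)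
  case 0
  have "act (sub BA p) (evw (BL 1) v (bas (0, 0, \<eta>))) \<in> J"
    by (rule faith) (use assms 0 in simp)
  then show ?thesis by (simp add: J_Bfp)
next
  case (Suc l)
  with assms obtain x where x: "act x b1 - evop (BL 1) p b1 \<in> J"
    "\<forall>v \<eta>. \<eta> \<in> Th \<longrightarrow> act x (evw (BL 1) v (bas (0, 0, \<eta>))) \<in> Bf (l + wlen v)"
    using Bf_act[of "evop (BL 1) p b1" l] by auto
  let ?z = "evw (BL 1) v (bas (0, 0, \<eta>))"
  have "act (x - sub BA p) ?z \<in> J"
    by (rule faith) (use x(1) in simp)
  then have "act x ?z - evop (BL 1) p ?z \<in> Bf (l + wlen v)"
    by (intro J_Bf) simp
  moreover have "act x ?z \<in> Bf (l + wlen v)"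
    using x(2) assms(2) by blast
  ultimately have "act x ?z - (act x ?z - evop (BL 1) p ?z) \<in> Bf (l + wlen v)"
    by (rule pm.subspace_diff[OF Bf_subspace, rotated])
  then show ?thesis using Suc by simp
qed

text \<open>The set \<open>W\<close> has arbitrary right factors and the truncation to degrees at
  most n built in. The former makes it a two-sided ideal; the latter is there because generators of
  larger degree are not yet known to drop.\<close>

lemma I_in_Bfp:
  assumes I: "\<I> = Idl\<^bsub>free_alg\<^esub> S"
    and S: "\<And>p. p \<in> S \<Longrightarrow> \<exists>m. (\<forall>w\<in>Poly_Mapping.keys p. wlen w = m) \<and> (m \<le> n \<longrightarrow> evop (BL 1) p b1 \<in> Bfp m)"
    and p: "p \<in> \<I>" "\<And>w. w \<in> Poly_Mapping.keys p \<Longrightarrow> wlen w = n" and \<eta>: "\<eta> \<in> Th"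
  shows "evop (BL 1) p (bas (0, 0, \<eta>)) \<in> Bfp n"
proof -
  let ?r = "\<lambda>m. restr (\<lambda>w. wlen w = m)"
  define W where "W = {q. \<forall>m v \<eta>. m \<le> n \<and> \<eta> \<in> Th \<longrightarrow>
      evop (BL 1) (?r m q) (evw (BL 1) v (bas (0, 0, \<eta>))) \<in> Bfp (m + wlen v)}"
  have "ideal W free_alg"
  proof (rule ideal_free_algI)
    show "pm.subspace W"
      unfolding pm.subspace_def W_def
      by (auto simp: lin_zero[OF lin_restr] lin_add[OF lin_restr] lin_psc[OF lin_restr]
          pm.subspace_0[OF Bfp_subspace] pm.subspace_add[OF Bfp_subspace] pm.subspace_scale[OF Bfp_subspace])
  next
    fix q w assume q: "q \<in> W"
    show "bas w * q \<in> W" unfolding W_def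
    proof (intro CollectI allI impI)
      fix m v \<eta> assume m: "m \<le> n \<and> \<eta> \<in> Th"
      let ?z = "evw (BL 1) v (bas (0, 0, \<eta>))"
      show "evop (BL 1) (?r m (bas w * q)) ?z \<in> Bfp (m + wlen v)"
      proof (cases "wlen w \<le> m")
        case True
        have "evop (BL 1) (?r (m - wlen w) q) ?z \<in> Bfp (m - wlen w + wlen v)"
        proof -
          have "m - wlen w \<le> n" using m by arith
          then show ?thesis using q m unfolding W_def by blast
        qed
        from evw_BL_Bfp[OF this, of w] True show ?thesis
          by (simp add: restr_wlen_mult evop_mult)
      qed (simp add: restr_wlen_mult pm.subspace_0[OF Bfp_subspace])
    qed
    show "q * bas w \<in> W" unfolding W_def
    proof (intro CollectI allI impI)
      fix m v \<eta> assume m: "m \<le> n \<and> \<eta> \<in> Th"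
      let ?z = "evw (BL 1) v (bas (0, 0, \<eta>))"
      show "evop (BL 1) (?r m (q * bas w)) ?z \<in> Bfp (m + wlen v)"
      proof (cases "wlen w \<le> m")
        case True
        have "evop (BL 1) (?r (m - wlen w) q) (evw (BL 1) (w + v) (bas (0, 0, \<eta>)))
            \<in> Bfp (m - wlen w + wlen (w + v))"
        proof -
          have "m - wlen w \<le> n" using m by arith
          then show ?thesis using q m unfolding W_def by blast
        qed
        then show ?thesis using True
          by (simp add: restr_wlen_mult evop_mult)
      qed (simp add: restr_wlen_mult pm.subspace_0[OF Bfp_subspace])
    qed
  qed
  moreover have "S \<subseteq> W"
  proof
    fix p assume "p \<in> S"
    then obtain m where m: "\<forall>w\<in>Poly_Mapping.keys p. wlen w = m" "m \<le> n \<longrightarrow> evop (BL 1) p b1 \<in> Bfp m"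
      using S by blast
    have "?r m' p = (if m' = m then p else 0)" for m'
      using m(1) by (auto intro!: restr_id restr_eq_0)
    then show "p \<in> W"
      using Bfp_right_mult m(2) by (auto simp: W_def pm.subspace_0[OF Bfp_subspace])
  qed
  ultimately have "\<I> \<subseteq> W"
    unfolding I by (rule genideal_free_alg_minimal)
  with p(1) have "p \<in> W" by auto
  then have "evop (BL 1) (?r n p) (evw (BL 1) 0 (bas (0, 0, \<eta>))) \<in> Bfp (n + wlen (0 :: 'i word))"
    unfolding W_def using \<eta> by blast
  moreover have "?r n p = p" by (rule restr_id) (rule p(2))
  ultimately show ?thesis by simp
qed

lemma Bf_Suc_decomp:
  assumes "x \<in> Bf (Suc n)"
  shows "\<exists>q. Poly_Mapping.keys q \<subseteq> {(w, \<eta>). wlen w = Suc n \<and> \<eta> \<in> Th} \<and>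
    x - lext (\<lambda>(w, \<eta>). evw (BL 1) w (bas (0, 0, \<eta>))) q \<in> Bf n"
proof -
  let ?A = "{(w :: 'i word, \<eta>). wlen w = Suc n \<and> \<eta> \<in> Th}"
  let ?e = "lext (\<lambda>(w, \<eta>). evw (BL 1) w (bas (0, 0, \<eta>)))"
  let ?S = "{x. \<exists>q. Poly_Mapping.keys q \<subseteq> ?A \<and> x - ?e q \<in> Bf n}"
  have "pm.subspace ?S"
    unfolding pm.subspace_def
  proof (intro conjI ballI allI)
    show "0 \<in> ?S"
      by (auto intro!: exI[of _ 0] simp: pm.subspace_0[OF Bf_subspace])
  next
    fix y y' assume "y \<in> ?S" "y' \<in> ?S"
    then obtain q q' where q: "Poly_Mapping.keys q \<subseteq> ?A" "y - ?e q \<in> Bf n"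
      "Poly_Mapping.keys q' \<subseteq> ?A" "y' - ?e q' \<in> Bf n" by auto
    have "y + y' - ?e (q + q') \<in> Bf n"
      using pm.subspace_add[OF Bf_subspace q(2,4)] by (simp add: algebra_simps)
    with keys_add_subset[OF q(1,3)] show "y + y' \<in> ?S" by blast
  next
    fix b y assume "y \<in> ?S"
    then obtain q where q: "Poly_Mapping.keys q \<subseteq> ?A" "y - ?e q \<in> Bf n" by auto
    have "psc b y - ?e (psc b q) \<in> Bf n"
      using pm.subspace_scale[OF Bf_subspace q(2), of b] by (simp add: pm.scale_right_diff_distrib)
    with q(1) keys_psc_subset[of b q] show "psc b y \<in> ?S" by blast
  qed
  moreover have "Bgen (Suc n) \<union> J \<subseteq> ?S"
  proof
    fix y assume "y \<in> Bgen (Suc n) \<union> J"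
    then consider (top) w \<eta> where "y = evw (BL 1) w (bas (0, 0, \<eta>))" "wlen w = Suc n" "\<eta> \<in> Th"
      | (low) "y \<in> Bf n"
      unfolding Bgen_def by (auto simp: le_Suc_eq intro: BfI J_Bf)
    then show "y \<in> ?S"
    proof cases
      case top
      then show ?thesis
        by (auto intro!: exI[of _ "bas (w, \<eta>)"] simp: pm.subspace_0[OF Bf_subspace])
    next
      case low
      then show ?thesis by (auto intro!: exI[of _ 0])
    qed
  qed
  ultimately have "Bf (Suc n) \<subseteq> ?S"
    unfolding Bf_def[of "Suc n"] by (intro pm.span_minimal)
  with assms show ?thesis by blast
qed

lemma Bf_Fbound:
  assumes "x \<in> Bf n" "(u, v, l) \<in> Poly_Mapping.keys (NF x)"
  shows "wlen v \<le> n"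
proof -
  let ?A = "{(u :: 'i word, v :: 'i word, l :: 'i \<Rightarrow> int). wlen v \<le> n}"
  have "NF x \<in> {m. Poly_Mapping.keys m \<subseteq> ?A}"
  proof (rule Bf_linI[OF lin_NF subspace_keys _ _ assms(1)])
    fix w :: "'i word" and \<eta> assume w: "wlen w \<le> n" "\<eta> \<in> Th"
    show "NF (evw (BL 1) w (bas (0, 0, \<eta>))) \<in> {m. Poly_Mapping.keys m \<subseteq> ?A}"
    proof (rule CollectI, rule keys_linI[OF lin_NF], rule subsetI)
      fix s s' assume s: "s \<in> Poly_Mapping.keys (evw (BL 1) w (bas (0, 0, \<eta>)))" "s' \<in> Poly_Mapping.keys (NF (bas s))"
      obtain u v l u' v' l' where s': "s = (u, v, l)" "s' = (u', v', l')" by (cases s, cases s')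
      have "evw (BL 1) w (bas (0, 0, \<eta>)) = (evw (BL 1) w (bas (0, 0, \<eta>)) - bas (0, w, \<eta>)) + bas (0, w, \<eta>)"
        by simp
      with s(1) s'(1) have "(u, v, l) \<in> Poly_Mapping.keys (evw (BL 1) w (bas (0, 0, \<eta>)) - bas (0, w, \<eta>)) \<or>
          (u, v, l) \<in> Poly_Mapping.keys (bas (0, w, \<eta>) :: ('i, 'k) tmod)"
        using keys_add_cases by metis
      then have "wlen v \<le> wlen w" using evw_BL_Ftop[of u v l 1 w \<eta>] by auto
      then show "s' \<in> ?A"
        using w NF_keys(2)[of u' v' l' u v l] s(2) s' wdeg_eq_wlen[of v' v] by auto
    qed
  qed (simp add: J_def)
  with assms(2) show ?thesis by auto
qed

text \<open>If \<open>x\<close> has no top term in F, the polynomial q_eta standing before K_eta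
  satisfies q_eta(F) = 0 in U for each eta. Thus q_eta lies in \<I>, and q_eta(B) drops by
  \<open>I_in_Bfp\<close>.\<close>

lemma deg_inj_step:
  assumes I: "\<I> = Idl\<^bsub>free_alg\<^esub> S"
    and S: "\<And>p. p \<in> S \<Longrightarrow> \<exists>m. (\<forall>w\<in>Poly_Mapping.keys p. wlen w = m) \<and> (m \<le> Suc n \<longrightarrow> evop (BL 1) p b1 \<in> Bfp m)"
  shows "deg_inj n"
  unfolding deg_inj_def
proof (intro ballI impI)
  fix x assume x: "x \<in> Bf (Suc n)" "\<forall>u v l. (u, v, l) \<in> Poly_Mapping.keys (NF x) \<longrightarrow> wlen v \<noteq> Suc n"
  let ?A = "{(w :: 'i word, \<eta>). wlen w = Suc n \<and> \<eta> \<in> Th}"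
  let ?b = "\<lambda>w \<eta>. evw (BL 1) w (bas (0, 0, \<eta>))"
  obtain q where q: "Poly_Mapping.keys q \<subseteq> ?A" "x - lext (\<lambda>(w, \<eta>). ?b w \<eta>) q \<in> Bf n"
    using Bf_Suc_decomp[OF x(1)] by auto
  define e where "e = lext (\<lambda>(w, \<eta>). ?b w \<eta>) q"
  define qe where "qe \<eta> = lext (\<lambda>(w, \<eta>'). if \<eta>' = \<eta> then bas w else 0) q" for \<eta>
  let ?Q = "\<lambda>(u :: 'i word, v :: 'i word, l :: 'i \<Rightarrow> int). wlen v = Suc n"
  have "restr ?Q (NF x) = 0"
    by (rule restr_eq_0) (use x(2) in auto)
  moreover have "restr ?Q (NF (x - e)) = 0"
    by (rule restr_eq_0) (use Bf_Fbound[OF q(2)] in \<open>force simp: e_def\<close>)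
  ultimately have "restr ?Q (NF e) = 0"
    by (simp add: lin_diff[OF lin_restr] lin_diff[OF lin_NF])
  moreover have "restr ?Q (NF e) = NF (restr ?Q e)"
    by (rule NF_restr) (auto dest: wdeg_eq_wlen)
  moreover have "restr ?Q e = lext (\<lambda>(w, \<eta>). bas (0, w, \<eta>)) q"
    unfolding e_def lin_lext_comp[OF lin_restr]
  proof (rule lext_cong)
    fix t assume t: "t \<in> Poly_Mapping.keys q"
    obtain w \<eta> where t': "t = (w, \<eta>)" by (cases t)
    then have w: "wlen w = Suc n" using t q(1) by auto
    have "restr ?Q (?b w \<eta> - bas (0, w, \<eta>)) = 0"
      by (rule restr_eq_0) (use evw_BL_Ftop[of _ _ _ 1 w \<eta>] w in force)
    then show "restr ?Q (case t of (w, \<eta>) \<Rightarrow> ?b w \<eta>) = (case t of (w, \<eta>) \<Rightarrow> bas (0, w, \<eta>))"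
      using w by (simp add: t' lin_diff[OF lin_restr] restr_bas)
  qed
  ultimately have z: "NF (lext (\<lambda>(w, \<eta>). bas (0, w, \<eta>)) q) = 0" by simp
  have qe_I: "qe \<eta> \<in> \<I>" for \<eta>
  proof -
    \<comment> \<open>Reads off the polynomial in the F_i that stands before K_eta.\<close>
    define \<pi> :: "('i, 'k) tmod \<Rightarrow> ('i, 'k) ncpoly"
      where "\<pi> = lext (\<lambda>(u, v, l). if u = 0 \<and> l = \<eta> then bas v else 0)"
    have l\<pi>: "lin \<pi>" by (simp add: \<pi>_def)
    have tr: "\<pi> (tr l 1 r) = (if l = \<eta> then r else 0)" for l r
      by (rule lin_eqI[of "\<lambda>r. \<pi> (tr l 1 r)" "\<lambda>r. if l = \<eta> then r else 0"])
        (auto simp: l\<pi> lin_comp[OF l\<pi> lin_tr2] lin_if lin_id lin_0, auto simp: \<pi>_def)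
    have l1: "lin (\<lambda>q. \<pi> (NF (lext (\<lambda>(w, \<eta>). bas (0, w, \<eta>)) q)))"
      by (rule lin_comp[OF l\<pi> lin_comp[OF lin_NF lin_lext]])
    have "\<pi> (NF (lext (\<lambda>(w, \<eta>). bas (0, w, \<eta>)) q)) = nf (qe \<eta>)"
      unfolding qe_def
      by (rule lin_eqI[OF l1 lin_comp[OF lin_nf lin_lext]]) (auto simp: NF_bas tr lin_zero[OF lin_nf])
    then have "nf (qe \<eta>) = 0"
      by (simp add: z lin_zero[OF l\<pi>])
    then show ?thesis by (simp add: nf_zero_iff)
  qed
  have qe_len: "wlen w = Suc n" if "w \<in> Poly_Mapping.keys (qe \<eta>)" for w \<eta>
    using that unfolding qe_def by (rule keys_lextE) (use q(1) in \<open>auto split: if_splits\<close>)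
  let ?H = "snd ` Poly_Mapping.keys q"
  have "e = (\<Sum>\<eta>\<in>?H. evop (BL 1) (qe \<eta>) (bas (0, 0, \<eta>)))"
  proof -
    have "evop (BL 1) (qe \<eta>) (bas (0, 0, \<eta>)) =
        (\<Sum>t\<in>Poly_Mapping.keys q. if snd t = \<eta> then psc (lk q t) (?b (fst t) \<eta>) else 0)" for \<eta>
      unfolding qe_def lin_lext_comp[OF lin_evop1]
      unfolding lext_def by (rule sum.cong) auto
    then have "(\<Sum>\<eta>\<in>?H. evop (BL 1) (qe \<eta>) (bas (0, 0, \<eta>))) =
        (\<Sum>t\<in>Poly_Mapping.keys q. \<Sum>\<eta>\<in>?H. if snd t = \<eta> then psc (lk q t) (?b (fst t) \<eta>) else 0)"
      by (simp only: sum.swap[of _ ?H])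
    also have "\<dots> = (\<Sum>t\<in>Poly_Mapping.keys q. psc (lk q t) (?b (fst t) (snd t)))"
      by (rule sum.cong) simp_all
    also have "\<dots> = e"
      by (simp add: e_def lext_def case_prod_beta')
    finally show ?thesis ..
  qed
  also have "\<dots> \<in> Bfp (Suc n)"
  proof (rule pm.subspace_sum[OF Bfp_subspace])
    fix \<eta> assume "\<eta> \<in> ?H"
    then have \<eta>: "\<eta> \<in> Th" using q(1) by auto
    show "evop (BL 1) (qe \<eta>) (bas (0, 0, \<eta>)) \<in> Bfp (Suc n)"
      by (rule I_in_Bfp[OF I S qe_I qe_len \<eta>])
  qed
  finally have "e \<in> Bf n" by simp
  from pm.subspace_add[OF Bf_subspace q(2)[folded e_def] this] show "x \<in> Bf n" by simp
qed

text \<open>Strong induction: for a generator of degree m at most n + 1, hypothesis C of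
  \<open>lowest_component\<close> asks for injectivity only in degrees below m.\<close>

theorem deg_inj_of_generators:
  assumes I: "\<I> = Idl\<^bsub>free_alg\<^esub> S"
    and S: "\<And>p. p \<in> S \<Longrightarrow> \<exists>lam. homogeneous lam p \<and> (\<forall>l. lk (NF (evop (BL 0) p b1)) (0, 0, l) = 0)"
  shows "deg_inj n"
proof (induction n rule: less_induct)
  case (less n)
  show ?case
  proof (rule deg_inj_step[OF I])
    fix p assume p: "p \<in> S"
    then obtain lam where lam: "homogeneous lam p" "\<And>l. lk (NF (evop (BL 0) p b1)) (0, 0, l) = 0"
      using S by blast
    have pI: "p \<in> \<I>"
      unfolding I using ring.genideal_self[OF ring_free_alg, of S] p by auto
    define m where "m = (\<Sum>i\<in>UNIV. lam i)"
    define L where "L = (\<lambda>i. int (lam i))"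
    have keys: "wlen w = m \<and> wt w = L" if "w \<in> Poly_Mapping.keys p" for w
      using homogeneous_wlen[OF lam(1) that] homogeneous_keys[OF lam(1) that] by (simp add: m_def L_def)
    have "evop (BL 1) p b1 \<in> Bfp m" if m: "m \<le> Suc n"
    proof -
      have C: "u = 0 \<and> l \<in> Th" if x: "x \<in> Bfp m" "\<And>u v l. (u, v, l) \<in> Poly_Mapping.keys (NF x) \<Longrightarrow> v = 0"
        "(u, v, l) \<in> Poly_Mapping.keys (NF x)" for x u v l
      proof (cases m)
        case 0
        then show ?thesis using x by (simp add: J_def)
      next
        case (Suc m')
        have "x \<in> Bf 0"
          by (rule Bf_without_F[of m']) (use less m Suc x in auto)
        from Bf0_keys[OF this x(3)] show ?thesis by simp
      qed
      have sumL: "(\<Sum>i\<in>UNIV. L i) = int m" by (simp add: L_def m_def)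
      let ?y = "evop (BL 0) p b1"
      have 1: "?y - evop (BL 1) p b1 \<in> Bfp m"
        by (rule lowest_component(1)[OF pI keys sumL C])
      have 2: "u = 0 \<and> v = 0 \<and> l = - L" if "(u, v, l) \<in> Poly_Mapping.keys (NF ?y)" for u v l
        by (rule lowest_component(2)[OF pI keys sumL C that])
      \<comment> \<open>By 2 only a multiple of K_{-L} could survive, and \<open>lam(2)\<close>
        excludes it.\<close>
      have "NF ?y = 0"
      proof (rule ccontr)
        assume "NF ?y \<noteq> 0"
        then obtain t where "t \<in> Poly_Mapping.keys (NF ?y)" by (metis ex_in_conv keys_eq_empty)
        moreover obtain u v l where "t = (u, v, l)" by (cases t)
        ultimately show False using 2 lam(2) by (auto simp: in_keys_iff)
      qed
      then have "?y \<in> Bfp m" by (intro J_Bfp) (simp add: J_def)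
      from pm.subspace_diff[OF Bfp_subspace this 1] show ?thesis by simp
    qed
    then show "\<exists>m. (\<forall>w\<in>Poly_Mapping.keys p. wlen w = m) \<and> (m \<le> Suc n \<longrightarrow> evop (BL 1) p b1 \<in> Bfp m)"
      using keys by (intro exI[of _ m]) auto
  qed
qed

end

end

section \<open>The triangular decomposition of \<open>U(\<chi>)\<close>\<close>

text \<open>Evaluation at images of elements \<open>b i\<close> is the image of a substitution, so
  all evaluations in quotients reduce to the free algebra.\<close>

lemma nc_eval_hom:
  assumes R: "ring R" and h: "h \<in> ring_hom (free_alg :: ('y, 'k::field) ncpoly ring) R"
  shows "nc_eval (\<lambda>a. h (nc_const a)) R (\<lambda>i. h (b i)) p = h (sub b p)"
proof -
  interpret R: ring R by (rule R)
  have hom: "h x \<in> carrier R" "h (x * y) = h x \<otimes>\<^bsub>R\<^esub> h y" "h (x + y) = h x \<oplus>\<^bsub>R\<^esub> h y" "h 1 = \<one>\<^bsub>R\<^esub>" for x y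
    using ring_hom_closed[OF h, of x] ring_hom_mult[OF h, of x y] ring_hom_add[OF h, of x y] ring_hom_one[OF h]
    by simp_all
  have 0: "h 0 = \<zero>\<^bsub>R\<^esub>"
    using ring_hom_zero[OF h ring_free_alg R] by simp
  have w: "foldr (\<lambda>x y. h (b x) \<otimes>\<^bsub>R\<^esub> y) (letters w) \<one>\<^bsub>R\<^esub> = h (evw (\<lambda>x. (*) (b x)) w 1)" for w
    by (induction w) (simp_all add: hom)
  have s: "(\<Oplus>\<^bsub>R\<^esub>x\<in>A. h (f x)) = h (sum f A)" if "finite A" for A :: "'x word set" and f
    using that by (induction A rule: finite_induct) (simp_all add: 0 hom Pi_def)
  have "nc_eval (\<lambda>a. h (nc_const a)) R (\<lambda>i. h (b i)) p =
      (\<Oplus>\<^bsub>R\<^esub>w\<in>Poly_Mapping.keys p. h (psc (lk p w) (evw (\<lambda>x. (*) (b x)) w 1)))"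
    unfolding nc_eval_def w by (simp add: psc_eq_const hom)
  also have "\<dots> = h (sub b p)"
    by (simp add: s sub_def evop_def lext_def)
  finally show ?thesis .
qed

context qsp
begin

abbreviation U :: "('i, 'k) U_elem ring" where "U \<equiv> Uchi \<chi> \<I>"
abbreviation uc :: "('i gen, 'k) ncpoly \<Rightarrow> ('i, 'k) U_elem" where "uc \<equiv> U_class \<chi> \<I>"
abbreviation EA :: "'i \<Rightarrow> ('i gen, 'k) ncpoly" where "EA i \<equiv> nc_var (GenE i)"
abbreviation FA :: "'i \<Rightarrow> ('i gen, 'k) ncpoly" where "FA i \<equiv> nc_var (GenF i)"
abbreviation KG :: "'i \<Rightarrow> ('i gen, 'k) ncpoly" where "KG i \<equiv> nc_var (GenK i)"
abbreviation LG :: "'i \<Rightarrow> ('i gen, 'k) ncpoly" where "LG i \<equiv> nc_var (GenKinv i)"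

lemma Ut_ideal: "ideal (Utilde_ideal \<chi>) free_alg"
  unfolding Utilde_ideal_def by (rule ring.genideal_ideal[OF ring_free_alg]) simp

lemma Ut_ring: "ring (Utilde \<chi>)"
  unfolding Utilde_def by (rule ideal.quotient_is_ring[OF Ut_ideal])

lemma Ut_hom: "Ut_class \<chi> \<in> ring_hom free_alg (Utilde \<chi>)"
  using ideal.rcos_ring_hom[OF Ut_ideal] by (simp add: Utilde_def Ut_class_def[abs_def])

lemma Ut_surj: "Y \<in> carrier (Utilde \<chi>) \<Longrightarrow> \<exists>x. Y = Ut_class \<chi> x"
  by (auto simp: Utilde_def FactRing_def A_RCOSETS_def' Ut_class_def)

lemma Ut_gens_closed:
  "nc_eval (Ut_scal \<chi>) (Utilde \<chi>) (\<lambda>i. Ut_class \<chi> (b i)) p = Ut_class \<chi> (sub b p)"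
  using nc_eval_hom[OF Ut_ring Ut_hom, of b p] by (simp add: Ut_scal_def[abs_def])

lemma U_ideal_eq: "U_ideal \<chi> \<I> = Idl\<^bsub>Utilde \<chi>\<^esub> (Ut_class \<chi> ` (sub EA ` \<I> \<union> sub FA ` \<I>))"
  unfolding U_ideal_def Ut_gens_closed by (simp add: image_Un image_image)

lemma Ut_class_closed: "Ut_class \<chi> x \<in> carrier (Utilde \<chi>)"
  using ring_hom_closed[OF Ut_hom] by simp

lemma U_ideal: "ideal (U_ideal \<chi> \<I>) (Utilde \<chi>)"
  unfolding U_ideal_eq by (rule ring.genideal_ideal[OF Ut_ring]) (auto simp: Ut_class_closed)

lemma U_ring: "ring U"
  unfolding Uchi_def by (rule ideal.quotient_is_ring[OF U_ideal])

sublocale U: ring U by (rule U_ring)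

lemma uc_hom: "uc \<in> ring_hom free_alg U"
proof -
  have "(+>\<^bsub>Utilde \<chi>\<^esub>) (U_ideal \<chi> \<I>) \<in> ring_hom (Utilde \<chi>) U"
    using ideal.rcos_ring_hom[OF U_ideal] by (simp add: Uchi_def)
  from ring_hom_trans[OF Ut_hom this] show ?thesis
    by (simp add: comp_def U_class_def[abs_def])
qed

lemma uc_closed [simp]: "uc x \<in> carrier U"
  using ring_hom_closed[OF uc_hom] by simp

lemma uc_mult: "uc (x * y) = uc x \<otimes>\<^bsub>U\<^esub> uc y" and uc_add: "uc (x + y) = uc x \<oplus>\<^bsub>U\<^esub> uc y"
  and uc_1: "uc 1 = \<one>\<^bsub>U\<^esub>" and uc_0: "uc 0 = \<zero>\<^bsub>U\<^esub>"
  using ring_hom_mult[OF uc_hom, of x y] ring_hom_add[OF uc_hom, of x y] ring_hom_one[OF uc_hom]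
    ring_hom_zero[OF uc_hom ring_free_alg U_ring]
  by simp_all

lemma uc_uminus: "uc (- x) = \<ominus>\<^bsub>U\<^esub> uc x"
proof -
  have "uc (- x) \<oplus>\<^bsub>U\<^esub> uc x = \<zero>\<^bsub>U\<^esub>" by (simp flip: uc_add uc_0)
  then show ?thesis by (simp add: U.minus_equality)
qed

lemma uc_eq_iff: "uc x = uc y \<longleftrightarrow> uc (x - y) = \<zero>\<^bsub>U\<^esub>"
proof -
  have "uc (x - y) = uc x \<ominus>\<^bsub>U\<^esub> uc y"
    using uc_add[of x "- y"] by (simp add: uc_uminus a_minus_def)
  then show ?thesis by (metis U.r_right_minus_eq uc_closed)
qed

lemma uc_surj: "Y \<in> carrier U \<Longrightarrow> \<exists>x. Y = uc x"
proof -
  assume "Y \<in> carrier U"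
  then obtain y where "y \<in> carrier (Utilde \<chi>)" "Y = U_ideal \<chi> \<I> +>\<^bsub>Utilde \<chi>\<^esub> y"
    by (auto simp: Uchi_def FactRing_def A_RCOSETS_def')
  with Ut_surj[of y] show ?thesis by (auto simp: U_class_def)
qed

lemma nc_eval_U: "nc_eval (U_scal \<chi> \<I>) U (\<lambda>i. uc (b i)) p = uc (sub b p)"
  using nc_eval_hom[OF U_ring uc_hom, of b p] by (simp add: U_scal_def[abs_def])

lemma Ut_class_zero_iff: "Ut_class \<chi> x = Ut_class \<chi> y \<longleftrightarrow> x - y \<in> Utilde_ideal \<chi>"
proof -
  interpret ideal "Utilde_ideal \<chi>" free_alg by (rule Ut_ideal)
  have m: "x \<ominus>\<^bsub>free_alg\<^esub> y = x - y" for x y :: "('i gen, 'k) ncpoly"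
    using minv_eq_uminus[of "free_alg :: ('i gen, 'k) ncpoly ring" y]
    by (simp add: a_minus_def a_inv_def ring_of_type_algebra_def)
  show ?thesis
    using quotient_eq_iff_same_a_r_cos[OF Ut_ideal, of x y] by (simp add: m Ut_class_def)
qed

text \<open>U(\<chi>) is a quotient of a quotient. T is pushed to U-tilde, where its image is an
  ideal containing the second set of relations, and pulled back, which is possible because T
  contains the first kernel.\<close>

lemma uc_zero_minimal:
  assumes T: "ideal T free_alg" and rels: "Utilde_rels \<chi> \<subseteq> T" "sub EA ` \<I> \<subseteq> T" "sub FA ` \<I> \<subseteq> T"
    and x: "uc x = \<zero>\<^bsub>U\<^esub>"
  shows "x \<in> T"
proof -
  have sub: "Utilde_ideal \<chi> \<subseteq> T"
    unfolding Utilde_ideal_def by (rule genideal_free_alg_minimal[OF T rels(1)])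
  interpret T: ideal T free_alg by (rule T)
  have Tadd: "a + b \<in> T" if "a \<in> T" "b \<in> T" for a b
    using additive_subgroup.a_closed[OF T.is_additive_subgroup that] by simp
  have "ideal (Ut_class \<chi> ` T) (Utilde \<chi>)"
  proof (rule idealI[OF Ut_ring])
    interpret h: ring_hom_ring "free_alg :: ('i gen, 'k) ncpoly ring" "Utilde \<chi>" "Ut_class \<chi>"
      by (rule ring_hom_ringI2[OF ring_free_alg Ut_ring Ut_hom])
    show "subgroup (Ut_class \<chi> ` T) (add_monoid (Utilde \<chi>))"
      by (rule group_hom.subgroup_img_is_subgroup[OF h.a_group_hom T.a_subgroup])
  next
    fix a Y assume a: "a \<in> Ut_class \<chi> ` T" "Y \<in> carrier (Utilde \<chi>)"
    then obtain t y where t: "a = Ut_class \<chi> t" "t \<in> T" "Y = Ut_class \<chi> y" using Ut_surj by blast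
    have "Y \<otimes>\<^bsub>Utilde \<chi>\<^esub> a = Ut_class \<chi> (y * t)" "a \<otimes>\<^bsub>Utilde \<chi>\<^esub> Y = Ut_class \<chi> (t * y)"
      using ring_hom_mult[OF Ut_hom] by (simp_all add: t)
    moreover have "y * t \<in> T" "t * y \<in> T" using T.I_l_closed[OF t(2), of y] T.I_r_closed[OF t(2), of y] by simp_all
    ultimately show "Y \<otimes>\<^bsub>Utilde \<chi>\<^esub> a \<in> Ut_class \<chi> ` T" "a \<otimes>\<^bsub>Utilde \<chi>\<^esub> Y \<in> Ut_class \<chi> ` T" by auto
  qed
  then have 1: "U_ideal \<chi> \<I> \<subseteq> Ut_class \<chi> ` T"
    unfolding U_ideal_eq by (rule ring.genideal_minimal[OF Ut_ring]) (use rels in auto)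
  have "Ut_class \<chi> x \<in> U_ideal \<chi> \<I>"
  proof -
    interpret V: ideal "U_ideal \<chi> \<I>" "Utilde \<chi>" by (rule U_ideal)
    have "U_ideal \<chi> \<I> +>\<^bsub>Utilde \<chi>\<^esub> Ut_class \<chi> x = U_ideal \<chi> \<I>"
      using x by (simp add: U_class_def Uchi_def FactRing_def)
    then show ?thesis
      using V.a_rcos_self[OF Ut_class_closed[of x]] by simp
  qed
  with 1 obtain t where "t \<in> T" "Ut_class \<chi> x = Ut_class \<chi> t" by auto
  then have "x - t \<in> T" using sub by (auto simp: Ut_class_zero_iff)
  from Tadd[OF this \<open>t \<in> T\<close>] show ?thesis by simp
qed

lemma uc_rels: "x \<in> Utilde_rels \<chi> \<Longrightarrow> uc x = \<zero>\<^bsub>U\<^esub>"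
proof -
  assume "x \<in> Utilde_rels \<chi>"
  then have "x \<in> Utilde_ideal \<chi>"
    unfolding Utilde_ideal_def using ring.genideal_self[OF ring_free_alg, of "Utilde_rels \<chi>"] by auto
  then have "Ut_class \<chi> x = Ut_class \<chi> 0" by (simp add: Ut_class_zero_iff)
  then have "uc x = uc 0" by (simp add: U_class_def)
  then show ?thesis by (simp add: uc_0)
qed

lemma uc_I: "p \<in> \<I> \<Longrightarrow> uc (sub EA p) = \<zero>\<^bsub>U\<^esub>" "p \<in> \<I> \<Longrightarrow> uc (sub FA p) = \<zero>\<^bsub>U\<^esub>"
proof -
  interpret V: ideal "U_ideal \<chi> \<I>" "Utilde \<chi>" by (rule U_ideal)
  have 1: "uc x = \<zero>\<^bsub>U\<^esub>" if "Ut_class \<chi> x \<in> U_ideal \<chi> \<I>" for x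
    using V.a_rcos_const[OF that] by (simp add: U_class_def Uchi_def FactRing_def)
  have 2: "Ut_class \<chi> ` (sub EA ` \<I> \<union> sub FA ` \<I>) \<subseteq> U_ideal \<chi> \<I>"
    unfolding U_ideal_eq by (rule ring.genideal_self[OF Ut_ring]) (auto simp: Ut_class_closed)
  show "p \<in> \<I> \<Longrightarrow> uc (sub EA p) = \<zero>\<^bsub>U\<^esub>" "p \<in> \<I> \<Longrightarrow> uc (sub FA p) = \<zero>\<^bsub>U\<^esub>"
    by (rule 1, rule subsetD[OF 2], simp)+
qed

definition NN :: "('i gen, 'k) ncpoly set" where "NN = {x. uc x = \<zero>\<^bsub>U\<^esub>}"

lemma NN_subspace: "pm.subspace NN"
  unfolding pm.subspace_def NN_def by (auto simp: uc_0 uc_add psc_eq_const uc_mult)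

lemma NN_mult: "x \<in> NN \<Longrightarrow> y * x \<in> NN" "x \<in> NN \<Longrightarrow> x * y \<in> NN"
  by (simp_all add: NN_def uc_mult)

lemma uc_eq_NN: "uc x = uc y \<longleftrightarrow> x - y \<in> NN"
  by (simp add: NN_def uc_eq_iff)

lemma uc_cong_mult: "uc x = uc x' \<Longrightarrow> uc y = uc y' \<Longrightarrow> uc (x * y) = uc (x' * y')"
  by (simp add: uc_mult)

lemma act_J: "m \<in> J \<Longrightarrow> act x m \<in> J"
proof (rule evop_in[OF J_subspace])
  show "genop g m \<in> J" if "m \<in> J" for g m
    using that by (cases g) (simp_all add: Eop_J Fop_J Kop_J)
qed

text \<open>The elements of the free algebra that send the whole module into \<open>J\<close> form
  an ideal containing all relations.\<close>

lemma uc_zero_act: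
  assumes "uc x = \<zero>\<^bsub>U\<^esub>"
  shows "act x m \<in> J"
proof -
  define T where "T = {x. \<forall>m. act x m \<in> J}"
  have "ideal T free_alg"
  proof (rule ideal_free_algI)
    show "pm.subspace T"
      unfolding pm.subspace_def T_def by (auto simp: J_zero J_add J_scale)
  qed (auto simp: T_def act_mult act_J simp del: evop_bas)
  moreover have "Utilde_rels \<chi> \<subseteq> T"
  proof
    fix x assume "x \<in> Utilde_rels \<chi>"
    then have "act x m = 0" for m
      unfolding Utilde_rels_def Let_def
      by (auto simp: act_mult Kop_Kop Kop_Eop Kop_Fop qmat_def chi_minus2 Eop_Fop add.commute)
    then show "x \<in> T" by (simp add: T_def J_zero)
  qed
  moreover have "sub EA ` \<I> \<subseteq> T" "sub FA ` \<I> \<subseteq> T"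
  proof -
    have "(\<lambda>x. act (EA x)) = Eop" "(\<lambda>x. act (FA x)) = Fop 1"
      by (simp_all add: fun_eq_iff)
    then show "sub EA ` \<I> \<subseteq> T" "sub FA ` \<I> \<subseteq> T"
      by (auto simp: T_def act_sub evop_Eop_J evop_Fop_J)
  qed
  ultimately have "x \<in> T"
    using assms by (rule uc_zero_minimal)
  then show ?thesis by (simp add: T_def)
qed

subsection \<open>The elements \<open>K\<^sub>\<lambda>\<close>\<close>

lemma KL: "uc (KG i * LG i) = uc 1" "uc (LG i * KG i) = uc 1"
  and KK: "uc (KG i * KG j) = uc (KG j * KG i)"
  and KE: "uc (KG i * EA j) = uc (nc_const (\<chi> (alpha i) (alpha j)) * EA j * KG i)"
  and KF: "uc (KG i * FA j) = uc (nc_const (\<chi> (alpha i) (- alpha j)) * FA j * KG i)"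
  and EF: "uc (EA i * FA j - FA j * EA i) = uc (if i = j then KG i - LG i else 0)"
  unfolding uc_eq_iff
  by (rule uc_rels, unfold Utilde_rels_def Let_def qmat_def chi_minus2, blast)+

lemma const_central: "x * nc_const a = nc_const a * (x :: ('x, 'b::field) ncpoly)"
  using psc_mult(2)[of x a 1] by (simp add: psc_eq_const)

lemma L_comm:
  assumes "uc (KG i * x) = uc (nc_const q * x * KG i)" "q \<noteq> 0"
  shows "uc (LG i * x) = uc (nc_const (inverse q) * x * LG i)"
proof -
  have "uc (nc_const (inverse q) * x * LG i) = uc (nc_const (inverse q) * ((LG i * KG i) * (x * LG i)))"
    using KL(2)[of i] by (simp add: uc_mult uc_1 mult.assoc[symmetric] U.m_assoc)
  also have "\<dots> = uc (nc_const (inverse q) * (LG i * (KG i * x) * LG i))"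
    by (simp add: mult.assoc)
  also have "\<dots> = uc (nc_const (inverse q) * (LG i * (nc_const q * x * KG i) * LG i))"
    by (intro uc_cong_mult refl assms(1))
  also have "nc_const (inverse q) * (LG i * (nc_const q * x * KG i) * LG i) =
      (nc_const (inverse q) * nc_const q) * (LG i * x * (KG i * LG i))"
  proof -
    have "LG i * (nc_const q * x * KG i) = nc_const q * (LG i * x * KG i)"
      by (simp add: const_central[of "LG i" q] flip: mult.assoc)
    then show ?thesis by (simp only: mult.assoc)
  qed
  also have "nc_const (inverse q) * nc_const q = (1 :: ('i gen, 'k) ncpoly)"
    using assms(2) by (simp add: nc_const_def mult_single)
  also have "uc (1 * (LG i * x * (KG i * LG i))) = uc (LG i * x)"
    using KL(1)[of i] by (simp add: uc_mult uc_1)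
  finally show ?thesis ..
qed

text \<open>Commutation of the generators spreads to the generated ring first in one argument and
  then in the other. It makes the \<open>finprod\<close> behind K_lambda a product in a commutative
  monoid.\<close>

lemma Ucartan_comm:
  assumes "x \<in> Ucartan \<chi> \<I>" "y \<in> Ucartan \<chi> \<I>"
  shows "x \<otimes>\<^bsub>U\<^esub> y = y \<otimes>\<^bsub>U\<^esub> x"
proof -
  let ?S = "range (U_scal \<chi> \<I>) \<union> (range (U_K \<chi> \<I>) \<union> range (U_Kinv \<chi> \<I>))"
  have S: "?S \<subseteq> carrier U" by (auto simp: U_scal_def U_K_def U_Kinv_def)
  have closed: "z \<in> generate_ring U ?S \<Longrightarrow> z \<in> carrier U" for z
    by (rule U.generate_ring_in_carrier[OF S])
  have gen: "z \<in> generate_ring U ?S \<Longrightarrow> z \<otimes>\<^bsub>U\<^esub> s = s \<otimes>\<^bsub>U\<^esub> z"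
    if s: "s \<in> carrier U" and comm: "\<And>t. t \<in> ?S \<Longrightarrow> t \<otimes>\<^bsub>U\<^esub> s = s \<otimes>\<^bsub>U\<^esub> t" for s z
  proof (induction rule: generate_ring.induct)
    case one
    then show ?case using s by simp
  next
    case (incl h)
    then show ?case by (rule comm)
  next
    case (a_inv h)
    then show ?case using s closed by (simp add: U.l_minus U.r_minus)
  next
    case (eng_add h1 h2)
    then show ?case using s closed by (simp add: U.l_distr U.r_distr)
  next
    case (eng_mult h1 h2)
    note c = closed[OF eng_mult(1)] closed[OF eng_mult(2)]
    have "h1 \<otimes>\<^bsub>U\<^esub> h2 \<otimes>\<^bsub>U\<^esub> s = h1 \<otimes>\<^bsub>U\<^esub> (s \<otimes>\<^bsub>U\<^esub> h2)"
      using c s by (simp add: U.m_assoc eng_mult)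
    also have "\<dots> = (s \<otimes>\<^bsub>U\<^esub> h1) \<otimes>\<^bsub>U\<^esub> h2"
      using c s by (simp add: eng_mult flip: U.m_assoc)
    finally show ?case using c s by (simp add: U.m_assoc)
  qed
  have LK: "uc (LG i * KG j) = uc (KG j * LG i)" for i j
  proof -
    have "uc (LG i * KG j) = uc (nc_const (inverse 1) * KG j * LG i)"
      by (rule L_comm) (simp_all add: KK[of i j])
    then show ?thesis by simp
  qed
  have LL: "uc (LG i * LG j) = uc (LG j * LG i)" for i j
  proof -
    have "uc (LG i * LG j) = uc (nc_const (inverse 1) * LG j * LG i)"
      by (rule L_comm) (simp_all add: LK[of j i])
    then show ?thesis by simp
  qed
  let ?G = "range nc_const \<union> (range KG \<union> range LG)"
  have G: "uc (x * y) = uc (y * x)" if "x \<in> ?G" "y \<in> ?G" for x y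
  proof -
    have "x \<in> range nc_const \<Longrightarrow> ?thesis" "y \<in> range nc_const \<Longrightarrow> ?thesis"
      using const_central by (metis imageE)+
    moreover have "x \<in> range KG \<union> range LG \<Longrightarrow> y \<in> range KG \<union> range LG \<Longrightarrow> ?thesis"
      by (elim UnE imageE; simp only: KK LK LL)
    ultimately show ?thesis using that by blast
  qed
  have S_eq: "?S = uc ` ?G"
    by (simp add: image_Un image_image U_scal_def U_K_def U_Kinv_def)
  have base: "t \<otimes>\<^bsub>U\<^esub> s = s \<otimes>\<^bsub>U\<^esub> t" if st: "s \<in> ?S" "t \<in> ?S" for s t
  proof -
    from st(1) obtain x where x: "x \<in> ?G" "s = uc x" unfolding S_eq by (rule imageE)
    from st(2) obtain y where y: "y \<in> ?G" "t = uc y" unfolding S_eq by (rule imageE)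
    from G[OF y(1) x(1)] show ?thesis unfolding x y uc_mult .
  qed
  have "z \<otimes>\<^bsub>U\<^esub> y = y \<otimes>\<^bsub>U\<^esub> z" if "z \<in> generate_ring U ?S" for z
  proof (rule gen[OF _ _ that])
    have y: "y \<in> generate_ring U ?S" using assms(2) by (simp add: Ucartan_def subalg_def)
    then show "y \<in> carrier U" by (rule closed)
    show "t \<otimes>\<^bsub>U\<^esub> y = y \<otimes>\<^bsub>U\<^esub> t" if "t \<in> ?S" for t
      by (rule gen[OF _ base y, symmetric]) (use that S in auto)
  qed
  then show ?thesis using assms(1) by (simp add: Ucartan_def subalg_def)
qed

lemma Ucartan_subring: "subring (Ucartan \<chi> \<I>) U"
  unfolding Ucartan_def subalg_def
  by (rule U.generate_ring_is_subring) (auto simp: U_scal_def U_K_def U_Kinv_def)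

lemma Ucartan_comm_monoid: "comm_monoid (U\<lparr>carrier := Ucartan \<chi> \<I>\<rparr>)"
proof -
  have sub: "x \<in> Ucartan \<chi> \<I> \<Longrightarrow> x \<in> carrier U" for x
    using subringE(1)[OF Ucartan_subring] by auto
  show ?thesis
  proof (rule comm_monoidI)
    fix x y assume "x \<in> carrier (U\<lparr>carrier := Ucartan \<chi> \<I>\<rparr>)" "y \<in> carrier (U\<lparr>carrier := Ucartan \<chi> \<I>\<rparr>)"
    then show "x \<otimes>\<^bsub>U\<lparr>carrier := Ucartan \<chi> \<I>\<rparr>\<^esub> y = y \<otimes>\<^bsub>U\<lparr>carrier := Ucartan \<chi> \<I>\<rparr>\<^esub> x"
      using Ucartan_comm by simp
  qed (simp_all add: sub U.m_assoc subringE(3,6)[OF Ucartan_subring])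
qed

definition pwA :: "'i \<Rightarrow> int \<Rightarrow> ('i gen, 'k) ncpoly"
  where "pwA i z = (if z \<ge> 0 then KG i ^ nat z else LG i ^ nat (- z))"

lemma uc_power: "uc x [^]\<^bsub>U\<^esub> (n::nat) = uc (x ^ n)"
  by (induction n) (simp_all add: uc_1 uc_mult power_Suc2 del: power_Suc)

lemma KL_power: "uc (KG i ^ n * LG i ^ n) = uc 1" "uc (LG i ^ n * KG i ^ n) = uc 1"
proof -
  have "uc (KG i ^ Suc n * LG i ^ Suc n) = uc (KG i ^ n * LG i ^ n)"
    "uc (LG i ^ Suc n * KG i ^ Suc n) = uc (LG i ^ n * KG i ^ n)" for n
  proof -
    have "KG i ^ Suc n * LG i ^ Suc n = KG i ^ n * (KG i * LG i) * LG i ^ n"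
      "LG i ^ Suc n * KG i ^ Suc n = LG i ^ n * (LG i * KG i) * KG i ^ n"
      by (simp only: power_Suc2[of "KG i"] power_Suc[of "LG i"] mult.assoc,
        simp only: power_Suc2[of "LG i"] power_Suc[of "KG i"] mult.assoc)
    then show "uc (KG i ^ Suc n * LG i ^ Suc n) = uc (KG i ^ n * LG i ^ n)"
      "uc (LG i ^ Suc n * KG i ^ Suc n) = uc (LG i ^ n * KG i ^ n)"
      using KL[of i] by (simp_all add: uc_mult uc_1)
  qed
  then show "uc (KG i ^ n * LG i ^ n) = uc 1" "uc (LG i ^ n * KG i ^ n) = uc 1"
    by (induction n) simp_all
qed

lemma U_K_pow: "U_K \<chi> \<I> i [^]\<^bsub>U\<^esub> z = uc (pwA i z)"
proof (cases "z \<ge> 0")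
  case True
  then show ?thesis by (simp add: U_K_def int_pow_def2 pwA_def uc_power)
next
  case False
  have "inv\<^bsub>U\<^esub> uc (KG i ^ n) = uc (LG i ^ n)" for n
    using KL_power[of i n] by (intro U.inv_unique'[symmetric]) (simp_all add: uc_mult uc_1)
  with False show ?thesis by (simp add: U_K_def int_pow_def2 pwA_def uc_power)
qed

lemma pwA_plus: "uc (pwA i (z + 1)) = uc (pwA i z * KG i)"
proof (cases "z \<ge> 0")
  case True
  then have "nat (z + 1) = Suc (nat z)" by simp
  with True show ?thesis by (simp add: pwA_def power_Suc2 del: power_Suc)
next
  case False
  define n where "n = nat (- z) - 1"
  have n: "nat (- z) = Suc n" "nat (- (z + 1)) = n" "z + 1 \<ge> 0 \<Longrightarrow> n = 0 \<and> z = - 1"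
    using False by (simp_all add: n_def)
  have "uc (LG i ^ Suc n * KG i) = uc (LG i ^ n * (LG i * KG i))"
    by (simp add: power_Suc2 mult.assoc del: power_Suc)
  also have "\<dots> = uc (LG i ^ n)" using KL(2)[of i] by (simp add: uc_mult uc_1)
  finally show ?thesis using n False by (cases "z + 1 \<ge> 0") (simp_all add: pwA_def)
qed

lemma gens_Ucartan: "U_K \<chi> \<I> i \<in> Ucartan \<chi> \<I>" "U_Kinv \<chi> \<I> i \<in> Ucartan \<chi> \<I>"
  unfolding Ucartan_def subalg_def by (auto intro: generate_ring.incl)

lemma pwA_Ucartan: "uc (pwA i z) \<in> Ucartan \<chi> \<I>"
proof -
  interpret S: subring "Ucartan \<chi> \<I>" U by (rule Ucartan_subring)
  have "uc (x ^ n) \<in> Ucartan \<chi> \<I>" if "uc x \<in> Ucartan \<chi> \<I>" for x n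
    using that by (induction n) (simp_all add: uc_1 uc_mult)
  then show ?thesis
    using gens_Ucartan by (auto simp: pwA_def U_K_def U_Kinv_def)
qed

lemma K_pow_0: "K_pow \<chi> \<I> 0 = \<one>\<^bsub>U\<^esub>"
proof -
  interpret C: comm_monoid "U\<lparr>carrier := Ucartan \<chi> \<I>\<rparr>" by (rule Ucartan_comm_monoid)
  show ?thesis
    unfolding K_pow_def U_K_pow using C.finprod_one_eqI[of UNIV "\<lambda>i. \<one>\<^bsub>U\<^esub>"] by (simp add: pwA_def uc_1 fun_apply)
qed

lemma K_pow_plus: "K_pow \<chi> \<I> (\<mu> + alpha i) = K_pow \<chi> \<I> \<mu> \<otimes>\<^bsub>U\<^esub> uc (KG i)"
proof -
  let ?C = "U\<lparr>carrier := Ucartan \<chi> \<I>\<rparr>"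
  interpret C: comm_monoid ?C by (rule Ucartan_comm_monoid)
  let ?g = "\<lambda>j. if i = j then uc (KG i) else \<one>\<^bsub>U\<^esub>"
  have g: "uc (KG i) \<in> Ucartan \<chi> \<I>" using gens_Ucartan(1)[of i] by (simp add: U_K_def)
  have c1: "\<one>\<^bsub>?C\<^esub> = \<one>\<^bsub>U\<^esub>" by simp
  have one: "\<one>\<^bsub>U\<^esub> \<in> Ucartan \<chi> \<I>" using C.one_closed by simp
  have "uc (pwA j ((\<mu> + alpha i) j)) = uc (pwA j (\<mu> j)) \<otimes>\<^bsub>U\<^esub> ?g j" for j
    using pwA_plus[of j "\<mu> j"] by (simp add: fun_apply alpha_def uc_mult)
  then have "K_pow \<chi> \<I> (\<mu> + alpha i) = finprod ?C (\<lambda>j. uc (pwA j (\<mu> j)) \<otimes>\<^bsub>?C\<^esub> ?g j) UNIV"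
    by (simp add: K_pow_def U_K_pow)
  also have "\<dots> = finprod ?C (\<lambda>j. uc (pwA j (\<mu> j))) UNIV \<otimes>\<^bsub>?C\<^esub> finprod ?C ?g UNIV"
    by (rule C.finprod_multf) (auto simp: pwA_Ucartan g one)
  also have "finprod ?C ?g UNIV = uc (KG i)"
    using C.finprod_singleton[of i UNIV "\<lambda>_. uc (KG i)"] g unfolding c1 by simp
  finally show ?thesis by (simp add: K_pow_def U_K_pow)
qed

lemma K_pow_closed: "K_pow \<chi> \<I> \<mu> \<in> carrier U"
proof -
  interpret C: comm_monoid "U\<lparr>carrier := Ucartan \<chi> \<I>\<rparr>" by (rule Ucartan_comm_monoid)
  have "K_pow \<chi> \<I> \<mu> \<in> Ucartan \<chi> \<I>"
    unfolding K_pow_def U_K_pow using C.finprod_closed[of "\<lambda>i. uc (pwA i (\<mu> i))" UNIV] pwA_Ucartan by simp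
  then show ?thesis using subringE(1)[OF Ucartan_subring] by auto
qed

text \<open>Chosen by its class, whereas \<open>Ka\<close> is chosen by its action; that both have
  the same class follows only once \<open>uc_zero_iff\<close> is available.\<close>

definition KA :: "('i \<Rightarrow> int) \<Rightarrow> ('i gen, 'k) ncpoly" where "KA \<mu> = (SOME x. K_pow \<chi> \<I> \<mu> = uc x)"

lemma uc_KA: "uc (KA \<mu>) = K_pow \<chi> \<I> \<mu>"
  using someI_ex[OF uc_surj[OF K_pow_closed]] by (simp add: KA_def)

lemma KA_0: "uc (KA 0) = uc 1"
  by (simp add: uc_KA K_pow_0 uc_1)

lemma KA_plus: "uc (KA (\<mu> + alpha i)) = uc (KA \<mu> * KG i)"
  by (simp add: uc_KA K_pow_plus uc_mult)

lemma KA_minus: "uc (KA (\<mu> - alpha i)) = uc (KA \<mu> * LG i)"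
proof -
  have "uc (KA \<mu> * LG i) = uc (KA (\<mu> - alpha i) * KG i * LG i)"
    using KA_plus[of "\<mu> - alpha i" i] by (simp add: uc_mult)
  also have "\<dots> = uc (KA (\<mu> - alpha i) * (KG i * LG i))" by (simp add: mult.assoc)
  also have "\<dots> = uc (KA (\<mu> - alpha i))" using KL(1)[of i] by (simp add: uc_mult uc_1)
  finally show ?thesis ..
qed

lemma KA_add: "uc (KA \<mu> * KA \<nu>) = uc (KA (\<mu> + \<nu>))"
proof (induction \<nu> rule: int_fun_induct)
  case zero
  then show ?case using KA_0 by (simp add: uc_mult uc_1)
next
  case (plus \<nu> i)
  have "uc (KA \<mu> * KA (\<nu> + alpha i)) = uc (KA \<mu> * (KA \<nu> * KG i))"
    by (rule uc_cong_mult[OF refl KA_plus])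
  also have "\<dots> = uc (KA (\<mu> + \<nu>) * KG i)"
    using uc_cong_mult[OF plus.IH refl, of "KG i"] by (simp add: mult.assoc)
  finally show ?case using KA_plus[of "\<mu> + \<nu>" i] by (simp add: add.assoc)
next
  case (minus \<nu> i)
  have "uc (KA \<mu> * KA (\<nu> - alpha i)) = uc (KA \<mu> * (KA \<nu> * LG i))"
    by (rule uc_cong_mult[OF refl KA_minus])
  also have "\<dots> = uc (KA (\<mu> + \<nu>) * LG i)"
    using uc_cong_mult[OF minus.IH refl, of "LG i"] by (simp add: mult.assoc)
  finally show ?case using KA_minus[of "\<mu> + \<nu>" i] by (simp add: add_diff_eq)
qed

lemma KA_comm:
  assumes "\<And>i. uc (KG i * x) = uc (nc_const (\<chi> (alpha i) \<beta>) * x * KG i)"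
  shows "uc (KA \<mu> * x) = uc (nc_const (\<chi> \<mu> \<beta>) * x * KA \<mu>)"
proof -
  have step: "uc (KA \<mu> * y * x) = uc (nc_const (q * \<chi> \<mu> \<beta>) * x * (KA \<mu> * y))"
    if IH: "uc (KA \<mu> * x) = uc (nc_const (\<chi> \<mu> \<beta>) * x * KA \<mu>)" and y: "uc (y * x) = uc (nc_const q * x * y)"
    for \<mu> y q
  proof -
    have "uc (KA \<mu> * y * x) = uc (KA \<mu> * (nc_const q * x * y))"
      using uc_cong_mult[OF refl y, of "KA \<mu>"] by (simp add: mult.assoc)
    also have "KA \<mu> * (nc_const q * x * y) = nc_const q * (KA \<mu> * x) * y"
      by (simp add: const_central[of "KA \<mu>" q] flip: mult.assoc)
    also have "uc \<dots> = uc (nc_const q * (nc_const (\<chi> \<mu> \<beta>) * x * KA \<mu>) * y)"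
      by (intro uc_cong_mult refl IH)
    also have "nc_const q * (nc_const (\<chi> \<mu> \<beta>) * x * KA \<mu>) * y = nc_const (q * \<chi> \<mu> \<beta>) * x * (KA \<mu> * y)"
    proof -
      have "nc_const q * nc_const (\<chi> \<mu> \<beta>) = (nc_const (q * \<chi> \<mu> \<beta>) :: ('i gen, 'k) ncpoly)"
        by (simp add: nc_const_def mult_single)
      then show ?thesis by (simp flip: mult.assoc)
    qed
    finally show ?thesis .
  qed
  show ?thesis
  proof (induction \<mu> rule: int_fun_induct)
    case zero
    then show ?case using KA_0 by (simp add: uc_mult uc_1)
  next
    case (plus \<mu> i)
    have "uc (KA (\<mu> + alpha i) * x) = uc (KA \<mu> * KG i * x)"
      by (rule uc_cong_mult[OF KA_plus refl])
    also have "\<dots> = uc (nc_const (\<chi> (alpha i) \<beta> * \<chi> \<mu> \<beta>) * x * (KA \<mu> * KG i))"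
      by (rule step[OF plus.IH assms])
    also have "\<dots> = uc (nc_const (\<chi> (alpha i) \<beta> * \<chi> \<mu> \<beta>) * x * KA (\<mu> + alpha i))"
      by (rule uc_cong_mult[OF refl KA_plus[symmetric]])
    finally show ?case by (simp add: chi_add1 mult.commute)
  next
    case (minus \<mu> i)
    have "uc (KA (\<mu> - alpha i) * x) = uc (KA \<mu> * LG i * x)"
      by (rule uc_cong_mult[OF KA_minus refl])
    also have "\<dots> = uc (nc_const (inverse (\<chi> (alpha i) \<beta>) * \<chi> \<mu> \<beta>) * x * (KA \<mu> * LG i))"
      by (rule step[OF minus.IH L_comm[OF assms chi_nz]])
    also have "\<dots> = uc (nc_const (inverse (\<chi> (alpha i) \<beta>) * \<chi> \<mu> \<beta>) * x * KA (\<mu> - alpha i))"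
      by (rule uc_cong_mult[OF refl KA_minus[symmetric]])
    finally show ?case by (simp add: chi_diff1 divide_inverse mult.commute)
  qed
qed

lemma KA_alpha: "uc (KA (alpha i)) = uc (KG i)" "uc (KA (- alpha i)) = uc (LG i)"
  using KA_plus[of 0 i] KA_minus[of 0 i] KA_0 by (simp_all add: uc_mult uc_1)

lemma uc_cong_diff: "uc x = uc x' \<Longrightarrow> uc y = uc y' \<Longrightarrow> uc (x - y) = uc (x' - y')"
  using pm.subspace_diff[OF NN_subspace, of "x - x'" "y - y'"] by (simp add: uc_eq_NN algebra_simps)

text \<open>The free algebra acts on itself by left multiplication, and modulo the kernel of
  \<open>uc\<close> this satisfies the relations of the triangular module.\<close>

interpretation tn: triangular_rep \<chi> 1 "\<lambda>i x. EA i * x" "\<lambda>i x. FA i * x" "\<lambda>\<mu> x. KA \<mu> * x" NN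
proof
  fix i j \<mu> \<nu> and x :: "('i gen, 'k) ncpoly"
  show "lin (\<lambda>x. EA i * x)" "lin (\<lambda>x. FA i * x)" "lin (\<lambda>x. KA \<mu> * x)"
    by (rule lin_mult_left)+
  show "pm.subspace NN" by (rule NN_subspace)
  show "EA i * x \<in> NN" "FA i * x \<in> NN" "KA \<mu> * x \<in> NN" if "x \<in> NN"
    using that by (simp_all add: NN_mult)
  show "KA \<mu> * (KA \<nu> * x) - KA (\<mu> + \<nu>) * x \<in> NN"
    using uc_cong_mult[OF KA_add[of \<mu> \<nu>] refl, of x] by (simp add: mult.assoc flip: uc_eq_NN)
  show "KA \<mu> * (EA i * x) - psc (\<chi> \<mu> (alpha i)) (EA i * (KA \<mu> * x)) \<in> NN"
    using uc_cong_mult[OF KA_comm[OF KE] refl, of \<mu> i x] by (simp add: mult.assoc psc_eq_const flip: uc_eq_NN)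
  show "KA \<mu> * (FA i * x) - psc (\<chi> \<mu> (- alpha i)) (FA i * (KA \<mu> * x)) \<in> NN"
    using uc_cong_mult[OF KA_comm[OF KF] refl, of \<mu> i x] by (simp add: mult.assoc psc_eq_const flip: uc_eq_NN)
  show "EA i * (FA j * x) - FA j * (EA i * x) -
      (if i = j then psc 1 (KA (alpha i) * x) - KA (- alpha i) * x else 0) \<in> NN"
  proof -
    have "uc ((EA i * FA j - FA j * EA i) * x) = uc ((if i = j then KG i - LG i else 0) * x)"
      by (rule uc_cong_mult[OF EF refl])
    also have "\<dots> = uc (if i = j then psc 1 (KA (alpha i) * x) - KA (- alpha i) * x else 0)"
    proof (cases "i = j")
      case True
      have "uc (KG i * x - LG i * x) = uc (KA (alpha i) * x - KA (- alpha i) * x)"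
        by (intro uc_cong_diff uc_cong_mult refl KA_alpha[symmetric])
      then show ?thesis using True by (simp add: left_diff_distrib)
    qed simp
    finally show ?thesis
      by (simp add: left_diff_distrib mult.assoc flip: uc_eq_NN)
  qed
qed

section \<open>Identification of U(\<chi>) with the quotient of the module\<close>

definition std :: "('i, 'k) tmod \<Rightarrow> ('i gen, 'k) ncpoly" where "std = tn.Psi 1"

lemma lin_std [simp]: "lin std"
  unfolding std_def by (rule tn.lin_Psi)

lemma evw_mult: "evw (\<lambda>i x. b i * x) w y = sub b (bas w) * (y :: ('x, 'b::field) ncpoly)"
proof -
  have "evw (\<lambda>i x. b i * x) w y = evw (\<lambda>i x. b i * x) w 1 * y"
    by (induction w) (simp_all add: mult.assoc)
  then show ?thesis by (simp add: sub_def)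
qed

lemma std_bas: "std (bas (u, v, l)) = sub EA (bas u) * (sub FA (bas v) * KA l)"
  by (simp add: std_def tn.Psi_bas evw_mult)

lemma std_genop: "uc (std (genop g m)) = uc (nc_var g * std m)"
proof (cases g)
  case (GenE i)
  then show ?thesis by (simp add: std_def tn.Psi_Eop)
next
  case (GenF i)
  then show ?thesis using tn.Psi_Fop[of 1 i m] by (simp add: std_def tn.eqN_def uc_eq_NN)
next
  case (GenK i)
  have "uc (std (Kop (alpha i) m)) = uc (KA (alpha i) * std m)"
    using tn.Psi_Kop[of 1 "alpha i" m] by (simp add: std_def tn.eqN_def uc_eq_NN)
  also have "\<dots> = uc (KG i * std m)" by (rule uc_cong_mult[OF KA_alpha(1) refl])
  finally show ?thesis using GenK by simp
next
  case (GenKinv i)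
  have "uc (std (Kop (- alpha i) m)) = uc (KA (- alpha i) * std m)"
    using tn.Psi_Kop[of 1 "- alpha i" m] by (simp add: std_def tn.eqN_def uc_eq_NN)
  also have "\<dots> = uc (LG i * std m)" by (rule uc_cong_mult[OF KA_alpha(2) refl])
  finally show ?thesis using GenKinv by simp
qed

text \<open>\<open>std\<close> turns the action into left multiplication on classes; taken at the
  vector 1, it therefore inverts x \<mapsto> x . 1.\<close>

lemma std_act: "uc (std (act x m)) = uc (x * std m)"
proof -
  have w: "uc (std (evw genop w m)) = uc (bas w * std m)" for w
  proof (induction w)
    case 0
    then show ?case by simp
  next
    case (wcons g w)
    have "uc (std (genop g (evw genop w m))) = uc (nc_var g * std (evw genop w m))"
      by (rule std_genop)
    also have "\<dots> = uc (nc_var g * (bas w * std m))"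
      by (rule uc_cong_mult[OF refl wcons])
    also have "nc_var g * (bas w * std m) = bas (wcons g w) * std m"
      by (simp add: nc_var_def flip: mult.assoc)
    finally show ?case by simp
  qed
  have "std (act x m) - x * std m = lext (\<lambda>w. std (evw genop w m) - bas w * std m) x"
    by (simp add: lext_minus_fun evop_def lin_lext_comp[OF lin_std] flip: lin_eq_lext[OF lin_mult_right])
  also have "\<dots> \<in> NN"
    by (rule lext_in_subspace[OF NN_subspace]) (use w in \<open>simp add: uc_eq_NN\<close>)
  finally show ?thesis by (simp add: uc_eq_NN)
qed

lemma uc_std: "uc (std (act x b1)) = uc x"
  using KA_0 by (simp add: std_act std_bas sub_def uc_mult uc_1)

lemma uc_std_J: "m \<in> J \<Longrightarrow> std m \<in> NN"
proof -
  assume m: "m \<in> J"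
  have "m \<in> {m. std m \<in> NN}"
  proof (rule J_subset[OF subspace_vimage[OF lin_std NN_subspace] _ _ m])
    fix l p w assume p: "p \<in> \<I>"
    have "std (tr l p (bas w)) = sub EA p * (sub FA (bas w) * KA l)"
      by (rule lin_eqI[OF lin_comp[OF lin_std lin_tr1] lin_comp[OF lin_mult_right lin_sub]])
        (simp add: std_bas)
    moreover have "std (tr l (bas w) p) = sub EA (bas w) * (sub FA p * KA l)"
      by (rule lin_eqI[OF lin_comp[OF lin_std lin_tr2]
            lin_comp[OF lin_mult_left lin_comp[OF lin_mult_right lin_sub]]]) (simp add: std_bas)
    moreover have "sub EA p \<in> NN" "sub FA p \<in> NN"
      using p by (simp_all add: NN_def uc_I)
    ultimately show "tr l p (bas w) \<in> {m. std m \<in> NN}" "tr l (bas w) p \<in> {m. std m \<in> NN}"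
      by (simp_all add: NN_mult)
  qed
  then show ?thesis by simp
qed

text \<open>In one direction, the relations act by 0 modulo \<open>J\<close>. In the other,
  \<open>std\<close> kills \<open>J\<close> on classes and sends x . 1 back to the class of x. This
  is the triangular decomposition in the form used below.\<close>

theorem uc_zero_iff: "uc x = \<zero>\<^bsub>U\<^esub> \<longleftrightarrow> act x b1 \<in> J"
  using uc_zero_act[of x b1] uc_std_J[of "act x b1"] uc_std[of x] by (auto simp: NN_def)

text \<open>Discharges the assumption under which the filtration was studied.\<close>

lemma faith: "act x b1 \<in> J \<Longrightarrow> act x m \<in> J"
  using uc_zero_iff uc_zero_act by blast

lemma uc_eq_act: "uc x = uc y \<longleftrightarrow> act x b1 - act y b1 \<in> J"
  using uc_zero_iff[of "x - y"] by (simp add: uc_eq_iff)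

lemma uc_eq_NF: "uc x = uc y \<longleftrightarrow> NF (act x b1) = NF (act y b1)"
  by (simp add: uc_eq_act J_def lin_diff[OF lin_NF])

lemma uc_Ka: "uc (Ka \<mu>) = K_pow \<chi> \<I> \<mu>"
proof -
  have cong: "act x m - act y m \<in> J" if "uc x = uc y" for x y m
    using uc_zero_act[of "x - y" m] that by (simp add: uc_eq_iff)
  have "act (KA \<mu>) m - Kop \<mu> m \<in> J" for m
  proof (induction \<mu> arbitrary: m rule: int_fun_induct)
    case zero
    show ?case using cong[OF KA_0, of m] by simp
  next
    case (plus \<mu> i)
    from J_add[OF cong[OF KA_plus[of \<mu> i], of m] plus.IH[of "Kop (alpha i) m"]] show ?case
      by (simp add: act_mult Kop_Kop)
  next
    case (minus \<mu> i)
    from J_add[OF cong[OF KA_minus[of \<mu> i], of m] minus.IH[of "Kop (- alpha i) m"]] show ?case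
      by (simp add: act_mult Kop_Kop)
  qed
  from this[of b1] have "uc (KA \<mu>) = uc (Ka \<mu>)" by (simp add: uc_eq_act)
  then show ?thesis by (simp add: uc_KA)
qed

text \<open>A lift built with \<open>Ka\<close> instead of \<open>KA\<close>, so that
  \<open>act (sd m) b1 = m\<close> holds exactly and not just modulo \<open>J\<close>.\<close>

definition sd :: "('i, 'k) tmod \<Rightarrow> ('i gen, 'k) ncpoly"
  where "sd = lext (\<lambda>(u, v, l). sub EA (bas u) * sub FA (bas v) * Ka l)"

lemma lin_sd [simp]: "lin sd" by (simp add: sd_def)

lemma act_EF: "act (sub EA p) m = evop Eop p m" "act (sub FA p) m = evop (Fop 1) p m"
proof -
  have "(\<lambda>x. act (EA x)) = Eop" "(\<lambda>x. act (FA x)) = Fop 1" by (simp_all add: fun_eq_iff)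
  then show "act (sub EA p) m = evop Eop p m" "act (sub FA p) m = evop (Fop 1) p m"
    by (simp_all add: act_sub)
qed

lemma act_sd [simp]: "act (sd m) b1 = m"
proof (rule lin_eq3I[OF lin_comp[OF lin_evop1 lin_sd] lin_id])
  fix u v l
  have "evw (Fop 1) v (bas (0, 0, l)) = (bas (0, v, l) :: ('i, 'k) tmod)" for v l
    using evw_Fop[of 1 v 0 l] by simp
  then show "act (sd (bas (u, v, l))) b1 = bas (u, v, l)"
    by (simp add: sd_def act_mult act_EF Kop_bas evw_Eop)
qed

lemma uc_sd: "uc (sd (act x b1)) = uc x"
  by (simp add: uc_eq_act J_zero)

section \<open>Subalgebras\<close>

lemma gen_fun: "U_E \<chi> \<I> = (\<lambda>i. uc (EA i))" "U_F \<chi> \<I> = (\<lambda>i. uc (FA i))"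
  "U_K \<chi> \<I> = (\<lambda>i. uc (KG i))" "U_Kinv \<chi> \<I> = (\<lambda>i. uc (LG i))"
  "U_scal \<chi> \<I> = (\<lambda>a. uc (nc_const a))" "B_gen \<chi> \<I> \<tau> c = (\<lambda>i. uc (BA i))"
  by (auto simp: U_E_def U_F_def U_K_def U_Kinv_def U_scal_def B_gen_def BA_def uc_add uc_mult fun_eq_iff)

lemma subalg_subspace: "pm.subspace {x. uc x \<in> subalg \<chi> \<I> S}"
  unfolding pm.subspace_def
proof (intro conjI ballI allI; unfold mem_Collect_eq)
  show "uc 0 \<in> subalg \<chi> \<I> S"
    unfolding subalg_def uc_0 by (rule U.zero_in_generate)
  show "uc (x + y) \<in> subalg \<chi> \<I> S" if "uc x \<in> subalg \<chi> \<I> S" "uc y \<in> subalg \<chi> \<I> S" for x y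
    using that unfolding subalg_def uc_add by (rule generate_ring.eng_add)
  show "uc (psc a x) \<in> subalg \<chi> \<I> S" if "uc x \<in> subalg \<chi> \<I> S" for a x
  proof -
    have "uc (nc_const a) \<in> subalg \<chi> \<I> S"
      unfolding subalg_def by (rule generate_ring.incl) (simp add: gen_fun)
    then show ?thesis
      using that unfolding subalg_def psc_eq_const uc_mult by (rule generate_ring.eng_mult)
  qed
qed

lemma subalg_mult: "uc x \<in> subalg \<chi> \<I> S \<Longrightarrow> uc y \<in> subalg \<chi> \<I> S \<Longrightarrow> uc (x * y) \<in> subalg \<chi> \<I> S"
  unfolding subalg_def uc_mult by (rule generate_ring.eng_mult)

lemma subalg_incl: "x \<in> S \<Longrightarrow> x \<in> subalg \<chi> \<I> S"
  unfolding subalg_def by (intro generate_ring.incl) simp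

lemma subalg_one: "uc 1 \<in> subalg \<chi> \<I> S"
  unfolding subalg_def uc_1 by (rule generate_ring.one)

lemma sub_in_subalg:
  assumes "\<And>i. uc (b i) \<in> subalg \<chi> \<I> S"
  shows "uc (sub b p) \<in> subalg \<chi> \<I> S"
proof -
  have "evw (\<lambda>x. (*) (b x)) w 1 \<in> {x. uc x \<in> subalg \<chi> \<I> S}" for w
    by (rule evw_in) (auto simp: assms subalg_mult subalg_one)
  then have "sub b p \<in> {x. uc x \<in> subalg \<chi> \<I> S}"
    unfolding sub_def evop_def by (intro lext_in_subspace[OF subalg_subspace])
  then show ?thesis by simp
qed

lemma subalg_range: "subalg \<chi> \<I> (range (\<lambda>i. uc (b i))) = range (\<lambda>p. uc (sub b p))"
proof
  show "range (\<lambda>p. uc (sub b p)) \<subseteq> subalg \<chi> \<I> (range (\<lambda>i. uc (b i)))"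
    by (rule image_subsetI, rule sub_in_subalg, rule subalg_incl, rule rangeI)
  have "x \<in> generate_ring U (range (U_scal \<chi> \<I>) \<union> range (\<lambda>i. uc (b i))) \<Longrightarrow> \<exists>p. x = uc (sub b p)" for x
  proof (induction rule: generate_ring.induct)
    case one
    show ?case by (intro exI[of _ 1]) (simp add: uc_1)
  next
    case (incl h)
    then consider a where "h = uc (nc_const a)" | i where "h = uc (b i)" by (auto simp: gen_fun)
    then show ?case
    proof cases
      case 1
      then show ?thesis by (intro exI[of _ "nc_const a"]) simp
    next
      case 2
      then show ?thesis by (intro exI[of _ "nc_var i"]) simp
    qed
  next
    case (a_inv h)
    then obtain p where "h = uc (sub b p)" by auto
    then show ?case by (intro exI[of _ "- p"]) (simp add: lin_uminus[OF lin_sub] uc_uminus)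
  next
    case (eng_add h1 h2)
    then obtain p q where "h1 = uc (sub b p)" "h2 = uc (sub b q)" by auto
    then show ?case by (intro exI[of _ "p + q"]) (simp add: lin_add[OF lin_sub] uc_add)
  next
    case (eng_mult h1 h2)
    then obtain p q where "h1 = uc (sub b p)" "h2 = uc (sub b q)" by auto
    then show ?case by (intro exI[of _ "p * q"]) (simp add: sub_mult uc_mult)
  qed
  then show "subalg \<chi> \<I> (range (\<lambda>i. uc (b i))) \<subseteq> range (\<lambda>p. uc (sub b p))"
    by (auto simp: subalg_def)
qed

definition KT :: "'i \<Rightarrow> ('i gen, 'k) ncpoly" where "KT i = KG i * LG (\<tau> i)"
definition FK :: "'i \<Rightarrow> ('i gen, 'k) ncpoly" where "FK i = FA i * KG i"
definition KLA :: "'i + 'i \<Rightarrow> ('i gen, 'k) ncpoly" where "KLA s = (case s of Inl i \<Rightarrow> KG i | Inr i \<Rightarrow> LG i)"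

lemma Htheta_eq: "Htheta \<chi> \<I> \<tau> = range (\<lambda>p. uc (sub KT p))"
  unfolding Htheta_def gen_fun subalg_range[symmetric] by (simp add: KT_def uc_mult)

lemma Uplus_eq: "Uplus \<chi> \<I> = range (\<lambda>p. uc (sub EA p))"
  unfolding Uplus_def gen_fun by (rule subalg_range)

lemma Gminus_eq: "Gminus \<chi> \<I> = range (\<lambda>p. uc (sub FK p))"
  unfolding Gminus_def gen_fun subalg_range[symmetric] by (simp add: FK_def uc_mult)

lemma Ucartan_eq: "Ucartan \<chi> \<I> = range (\<lambda>p. uc (sub KLA p))"
proof -
  have "range (\<lambda>i. uc (KG i)) \<union> range (\<lambda>i. uc (LG i)) = range (\<lambda>s. uc (KLA s))"
  proof
    show "range (\<lambda>i. uc (KG i)) \<union> range (\<lambda>i. uc (LG i)) \<subseteq> range (\<lambda>s. uc (KLA s))"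
    proof (rule Un_least; rule image_subsetI)
      show "uc (KG i) \<in> range (\<lambda>s. uc (KLA s))" for i by (rule range_eqI[of _ _ "Inl i"]) (simp add: KLA_def)
      show "uc (LG i) \<in> range (\<lambda>s. uc (KLA s))" for i by (rule range_eqI[of _ _ "Inr i"]) (simp add: KLA_def)
    qed
    show "range (\<lambda>s. uc (KLA s)) \<subseteq> range (\<lambda>i. uc (KG i)) \<union> range (\<lambda>i. uc (LG i))"
      by (auto simp: KLA_def split: sum.splits)
  qed
  then show ?thesis
    unfolding Ucartan_def gen_fun by (simp only: subalg_range)
qed

lemma deg_eq: "Uplus_deg \<chi> \<I> d = (\<lambda>p. uc (sub EA p)) ` {p. homogeneous d p}"
  "Uminus_deg \<chi> \<I> d = (\<lambda>p. uc (sub FA p)) ` {p. homogeneous d p}"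
  unfolding Uplus_deg_def Uminus_deg_def gen_fun(1,2) nc_eval_U by simp_all

lemma K_pow_Ucartan: "uc (Ka \<mu>) \<in> Ucartan \<chi> \<I>"
proof -
  interpret C: comm_monoid "U\<lparr>carrier := Ucartan \<chi> \<I>\<rparr>" by (rule Ucartan_comm_monoid)
  show ?thesis
    unfolding uc_Ka K_pow_def U_K_pow
    using C.finprod_closed[of "\<lambda>i. uc (pwA i (\<mu> i))" UNIV] pwA_Ucartan by simp
qed

subsection \<open>The filtration\<close>

lemma Ka_Htheta: "\<eta> \<in> Th \<Longrightarrow> uc (Ka \<eta>) \<in> Htheta \<chi> \<I> \<tau>"
proof (induction rule: Th.induct)
  case zero
  have "uc (Ka 0) = uc 1" by (simp add: uc_eq_act J_zero)
  then show ?case using subalg_one unfolding Htheta_def by simp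
next
  case (step \<eta> i)
  have "uc (Ka (\<eta> + (alpha i - alpha (\<tau> i)))) = uc (Ka \<eta> * KT i)"
    by (simp add: uc_eq_act act_mult KT_def Kop_Kop J_zero)
  moreover have "uc (KT i) \<in> Htheta \<chi> \<I> \<tau>"
    unfolding Htheta_eq by (rule range_eqI[of _ _ "nc_var i"]) simp
  ultimately show ?case
    using step.IH unfolding Htheta_def by (simp add: subalg_mult)
qed

lemma act_Bf:
  assumes "act x b1 \<in> Bf l" "\<eta> \<in> Th"
  shows "act x (evw (BL 1) v (bas (0, 0, \<eta>))) \<in> Bf (l + wlen v)"
proof -
  from Bf_act[OF faith assms(1)] obtain y where y: "act y b1 - act x b1 \<in> J"
    "\<And>v \<eta>. \<eta> \<in> Th \<Longrightarrow> act y (evw (BL 1) v (bas (0, 0, \<eta>))) \<in> Bf (l + wlen v)"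
    by auto
  let ?z = "evw (BL 1) v (bas (0, 0, \<eta>))"
  have "act (y - x) ?z \<in> J" by (rule faith) (use y(1) in simp)
  then have "act y ?z - act x ?z \<in> Bf (l + wlen v)" by (intro J_Bf) simp
  from pm.subspace_diff[OF Bf_subspace y(2)[OF assms(2), of v] this] show ?thesis by simp
qed

lemma act_Bf_mult:
  assumes "act x b1 \<in> Bf l" "y \<in> Bf n"
  shows "act x y \<in> Bf (l + n)"
proof (rule Bf_linI[OF lin_act Bf_subspace _ _ assms(2)])
  fix w :: "'i word" and \<eta> assume "wlen w \<le> n" "\<eta> \<in> Th"
  then show "act x (evw (BL 1) w (bas (0, 0, \<eta>))) \<in> Bf (l + n)"
    using Bf_mono[OF act_Bf[OF assms(1), of \<eta> w], of "l + n"] by simp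
qed (auto intro: act_J J_Bf)

definition BFil :: "nat \<Rightarrow> ('i, 'k) U_elem set"
  where "BFil n = uc ` {x. act x b1 \<in> Bf n}"

lemma BFil_iff: "uc x \<in> BFil n \<longleftrightarrow> act x b1 \<in> Bf n"
proof
  assume "uc x \<in> BFil n"
  then obtain y where "uc x = uc y" "act y b1 \<in> Bf n" by (auto simp: BFil_def)
  then have "act x b1 - act y b1 \<in> Bf n" "act y b1 \<in> Bf n" by (auto simp: uc_eq_act intro: J_Bf)
  from pm.subspace_add[OF Bf_subspace this] show "act x b1 \<in> Bf n" by simp
qed (auto simp: BFil_def)

lemma BFilE:
  assumes "Y \<in> BFil n" obtains x where "Y = uc x" "act x b1 \<in> Bf n"
  using assms by (auto simp: BFil_def)

lemma BFil_minimal: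
  assumes "pm.subspace {x. uc x \<in> S}"
    and "\<And>w \<eta>. wlen w \<le> n \<Longrightarrow> \<eta> \<in> Th \<Longrightarrow> uc (sub BA (bas w) * Ka \<eta>) \<in> S"
  shows "BFil n \<subseteq> S"
proof
  fix Y assume "Y \<in> BFil n"
  then obtain x where x: "Y = uc x" "act x b1 \<in> Bf n" by (rule BFilE)
  have "sd (act x b1) \<in> {x. uc x \<in> S}"
  proof (rule Bf_linI[OF lin_sd assms(1) _ _ x(2)])
    fix w :: "'i word" and \<eta> assume w: "wlen w \<le> n" "\<eta> \<in> Th"
    have "act (sub BA (bas w) * Ka \<eta>) b1 = evw (BL 1) w (bas (0, 0, \<eta>))"
      by (simp add: act_mult Kop_bas)
    then have "uc (sd (evw (BL 1) w (bas (0, 0, \<eta>)))) = uc (sub BA (bas w) * Ka \<eta>)"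
      using uc_sd[of "sub BA (bas w) * Ka \<eta>"] by simp
    then show "sd (evw (BL 1) w (bas (0, 0, \<eta>))) \<in> {x. uc x \<in> S}"
      using assms(2)[OF w] by simp
  next
    fix m assume "m \<in> J"
    then have "uc (sd m) = uc 0" by (simp add: uc_eq_act)
    then show "sd m \<in> {x. uc x \<in> S}" using pm.subspace_0[OF assms(1)] by simp
  qed
  then show "Y \<in> S" using x(1) uc_sd[of x] by simp
qed

lemma Htheta_BFil: "Htheta \<chi> \<I> \<tau> = BFil 0"
proof
  show "Htheta \<chi> \<I> \<tau> \<subseteq> BFil 0"
  proof
    fix Y assume "Y \<in> Htheta \<chi> \<I> \<tau>"
    then obtain p where Y: "Y = uc (sub KT p)" by (auto simp: Htheta_eq)
    have "act (sub KT p) b1 \<in> Bf 0"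
      unfolding act_sub
    proof (rule evop_in[OF Bf_subspace])
      show "act (KT i) m \<in> Bf 0" if "m \<in> Bf 0" for i m
        using Kop_Bf[OF Th_gen that, of i] by (simp add: KT_def act_mult Kop_Kop)
      show "b1 \<in> Bf 0" using BfI[of 0 0 0] Th.zero by simp
    qed
    then show "Y \<in> BFil 0" by (simp add: Y BFil_iff)
  qed
  show "BFil 0 \<subseteq> Htheta \<chi> \<I> \<tau>"
  proof (rule BFil_minimal)
    show "pm.subspace {x. uc x \<in> Htheta \<chi> \<I> \<tau>}" unfolding Htheta_def by (rule subalg_subspace)
    show "uc (sub BA (bas w) * Ka \<eta>) \<in> Htheta \<chi> \<I> \<tau>" if "wlen w \<le> 0" "\<eta> \<in> Th" for w \<eta>
      using that Ka_Htheta by simp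
  qed
qed

lemma add_span_induct [consumes 1, case_names zero incl uminus add]:
  assumes "x \<in> add_span U S" "P \<zero>\<^bsub>U\<^esub>" "\<And>h. h \<in> S \<Longrightarrow> P h"
    "\<And>h. h \<in> S \<Longrightarrow> P (\<ominus>\<^bsub>U\<^esub> h)"
    "\<And>h h'. h \<in> add_span U S \<Longrightarrow> h' \<in> add_span U S \<Longrightarrow> P h \<Longrightarrow> P h' \<Longrightarrow> P (h \<oplus>\<^bsub>U\<^esub> h')"
  shows "P x"
  using assms(1) unfolding add_span_def
proof (induction rule: generate.induct)
  case (eng h1 h2)
  then show ?case using assms(5)[of h1 h2] by (simp add: add_span_def)
qed (use assms in \<open>simp_all add: a_inv_def\<close>)

lemma add_span_closed: "S \<subseteq> carrier U \<Longrightarrow> x \<in> add_span U S \<Longrightarrow> x \<in> carrier U"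
  using group.generate_in_carrier[OF U.a_group, of S x] by (simp add: add_span_def)

lemma add_span_add: "x \<in> add_span U S \<Longrightarrow> y \<in> add_span U S \<Longrightarrow> x \<oplus>\<^bsub>U\<^esub> y \<in> add_span U S"
  unfolding add_span_def using generate.eng[of x "add_monoid U" S y] by simp

lemma add_span_incl: "x \<in> S \<Longrightarrow> x \<in> add_span U S"
  unfolding add_span_def by (rule generate.incl)

lemma add_span_zero: "\<zero>\<^bsub>U\<^esub> \<in> add_span U S"
  unfolding add_span_def using generate.one[of "add_monoid U" S] by simp

lemma add_span_uminus: "x \<in> S \<Longrightarrow> \<ominus>\<^bsub>U\<^esub> x \<in> add_span U S"
  unfolding add_span_def a_inv_def by (rule generate.inv)

lemma add_span_subspace:
  assumes S: "S \<subseteq> carrier U" and scal: "\<And>a h. h \<in> S \<Longrightarrow> uc (nc_const a) \<otimes>\<^bsub>U\<^esub> h \<in> S"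
  shows "pm.subspace {x. uc x \<in> add_span U S}"
  unfolding pm.subspace_def
proof (intro conjI ballI allI; unfold mem_Collect_eq)
  show "uc 0 \<in> add_span U S" unfolding uc_0 by (rule add_span_zero)
  show "uc (x + y) \<in> add_span U S" if "uc x \<in> add_span U S" "uc y \<in> add_span U S" for x y
    using that unfolding uc_add by (rule add_span_add)
  have "h \<in> add_span U S \<Longrightarrow> uc (nc_const a) \<otimes>\<^bsub>U\<^esub> h \<in> add_span U S" for a h
  proof (induction rule: add_span_induct)
    case zero
    then show ?case using add_span_zero by simp
  next
    case (incl h)
    then show ?case by (intro add_span_incl scal)
  next
    case (uminus h)
    then have "uc (nc_const a) \<otimes>\<^bsub>U\<^esub> \<ominus>\<^bsub>U\<^esub> h = \<ominus>\<^bsub>U\<^esub> (uc (nc_const a) \<otimes>\<^bsub>U\<^esub> h)"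
      using S by (intro U.r_minus) auto
    then show ?case using add_span_uminus[OF scal[OF uminus]] by simp
  next
    case (add h h')
    have "h \<in> carrier U" "h' \<in> carrier U" using add(1,2) add_span_closed[OF S] by auto
    then have "uc (nc_const a) \<otimes>\<^bsub>U\<^esub> (h \<oplus>\<^bsub>U\<^esub> h') =
        uc (nc_const a) \<otimes>\<^bsub>U\<^esub> h \<oplus>\<^bsub>U\<^esub> uc (nc_const a) \<otimes>\<^bsub>U\<^esub> h'"
      by (intro U.r_distr) auto
    then show ?case using add(3,4) add_span_add by simp
  qed
  then show "uc (psc a x) \<in> add_span U S" if "uc x \<in> add_span U S" for a x
    using that by (simp add: psc_eq_const uc_mult)
qed

lemma BFil_subspace: "pm.subspace {x. uc x \<in> BFil n}"
  unfolding BFil_iff by (rule subspace_vimage[OF lin_evop1 Bf_subspace])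

lemma BFil_closed: "x \<in> BFil n \<Longrightarrow> x \<in> carrier U"
  by (auto simp: BFil_def)

lemma word_snoc: "wlen w = Suc n \<Longrightarrow> \<exists>v i. w = v + wcons i 0 \<and> wlen v = n"
proof -
  assume n: "wlen w = Suc n"
  then obtain xs x where xs: "letters w = xs @ [x]" "length xs = n" by (auto simp: length_Suc_conv_rev)
  have "w = Word xs + wcons x 0" by (rule word.expand) (simp add: xs)
  with xs show ?thesis by (intro exI[of _ "Word xs"] exI[of _ x]) simp
qed

text \<open>The recursive definition appends B_i h on the right, while \<open>Bf\<close> is built by
  prepending letters. Words are therefore split at their last letter, and h is absorbed at the right
  end.\<close>

lemma B_fil_eq: "B_fil \<chi> \<I> \<tau> c n = BFil n"
proof (induction n)
  case 0
  then show ?case by (simp add: Htheta_BFil)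
next
  case (Suc n)
  define S where "S = BFil n \<union> {x \<otimes>\<^bsub>U\<^esub> uc (BA i) \<otimes>\<^bsub>U\<^esub> h | x i h. x \<in> BFil n \<and> h \<in> BFil 0}"
  have eq: "B_fil \<chi> \<I> \<tau> c (Suc n) = add_span U S"
    by (simp add: S_def Suc Htheta_BFil gen_fun)
  have prodE: "\<exists>x y i. h = uc (x * BA i * y) \<and> act x b1 \<in> Bf n \<and> act y b1 \<in> Bf 0"
    if "h \<in> {x \<otimes>\<^bsub>U\<^esub> uc (BA i) \<otimes>\<^bsub>U\<^esub> h | x i h. x \<in> BFil n \<and> h \<in> BFil 0}" for h
    using that by (auto elim!: BFilE simp flip: uc_mult, blast)
  have S_sub: "S \<subseteq> BFil (Suc n)"
  proof
    fix h assume "h \<in> S"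
    then consider "h \<in> BFil n" | x y i where "h = uc (x * BA i * y)" "act x b1 \<in> Bf n" "act y b1 \<in> Bf 0"
      unfolding S_def using prodE by blast
    then show "h \<in> BFil (Suc n)"
    proof cases
      case 1
      then show ?thesis by (auto elim!: BFilE simp: BFil_iff intro: Bf_mono[OF _ le_SucI[OF le_refl]])
    next
      case 2
      have "BL 1 i (act y b1) \<in> Bf 1" using BL_Bf[OF 2(3)] by simp
      from act_Bf_mult[OF 2(2) this] show ?thesis by (simp add: 2(1) BFil_iff act_mult)
    qed
  qed
  have S_car: "S \<subseteq> carrier U" using S_sub BFil_closed by blast
  have "add_span U S \<subseteq> BFil (Suc n)"
  proof
    fix x assume "x \<in> add_span U S"
    then show "x \<in> BFil (Suc n)"
    proof (induction rule: add_span_induct)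
      case zero
      show ?case using pm.subspace_0[OF BFil_subspace, of "Suc n"] by (simp add: uc_0)
    next
      case (incl h)
      then show ?case using S_sub by auto
    next
      case (uminus h)
      then obtain y where "h = uc y" "uc y \<in> BFil (Suc n)" using S_sub by (auto elim!: BFilE simp: BFil_iff)
      then show ?case using pm.subspace_neg[OF BFil_subspace, of y "Suc n"] by (simp add: uc_uminus)
    next
      case (add h h')
      then obtain y y' where "h = uc y" "h' = uc y'" by (auto elim!: BFilE)
      then show ?case using add pm.subspace_add[OF BFil_subspace, of y "Suc n" y'] by (simp add: uc_add)
    qed
  qed
  moreover have "BFil (Suc n) \<subseteq> add_span U S"
  proof (rule BFil_minimal)
    have scal: "uc (nc_const a) \<otimes>\<^bsub>U\<^esub> x \<in> BFil n" if "x \<in> BFil n" for a x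
      using that pm.subspace_scale[OF BFil_subspace, of _ n a]
      by (auto elim!: BFilE simp: psc_eq_const BFil_iff simp flip: uc_mult)
    show "pm.subspace {x. uc x \<in> add_span U S}"
    proof (rule add_span_subspace[OF S_car])
      fix a h assume "h \<in> S"
      then show "uc (nc_const a) \<otimes>\<^bsub>U\<^esub> h \<in> S"
        unfolding S_def
      proof (elim UnE)
        assume "h \<in> BFil n"
        then show "uc (nc_const a) \<otimes>\<^bsub>U\<^esub> h \<in> BFil n \<union> {x \<otimes>\<^bsub>U\<^esub> uc (BA i) \<otimes>\<^bsub>U\<^esub> h | x i h. x \<in> BFil n \<and> h \<in> BFil 0}"
          by (intro UnI1 scal)
      next
        assume "h \<in> {x \<otimes>\<^bsub>U\<^esub> uc (BA i) \<otimes>\<^bsub>U\<^esub> h | x i h. x \<in> BFil n \<and> h \<in> BFil 0}"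
        then obtain x i y where h: "h = x \<otimes>\<^bsub>U\<^esub> uc (BA i) \<otimes>\<^bsub>U\<^esub> y" "x \<in> BFil n" "y \<in> BFil 0" by auto
        then have "uc (nc_const a) \<otimes>\<^bsub>U\<^esub> h = (uc (nc_const a) \<otimes>\<^bsub>U\<^esub> x) \<otimes>\<^bsub>U\<^esub> uc (BA i) \<otimes>\<^bsub>U\<^esub> y"
          using BFil_closed by (simp add: U.m_assoc)
        then show "uc (nc_const a) \<otimes>\<^bsub>U\<^esub> h \<in> BFil n \<union> {x \<otimes>\<^bsub>U\<^esub> uc (BA i) \<otimes>\<^bsub>U\<^esub> h | x i h. x \<in> BFil n \<and> h \<in> BFil 0}"
          using scal[OF h(2)] h(3) by blast
      qed
    qed
    fix w :: "'i word" and \<eta> assume w: "wlen w \<le> Suc n" "\<eta> \<in> Th"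
    show "uc (sub BA (bas w) * Ka \<eta>) \<in> add_span U S"
    proof (cases "wlen w \<le> n")
      case True
      then have "uc (sub BA (bas w) * Ka \<eta>) \<in> BFil n"
        using w(2) by (simp add: BFil_iff act_mult Kop_bas BfI)
      then show ?thesis by (intro add_span_incl) (simp add: S_def)
    next
      case False
      then obtain v i where v: "w = v + wcons i 0" "wlen v = n" using word_snoc[of w n] w(1) by auto
      have "sub BA (bas w) = sub BA (bas v) * BA i"
        using sub_mult[of BA "bas v" "nc_var i"] by (simp add: v nc_var_def flip: sub_simps(1)[of BA i])
      then have "uc (sub BA (bas w) * Ka \<eta>) = uc (sub BA (bas v)) \<otimes>\<^bsub>U\<^esub> uc (BA i) \<otimes>\<^bsub>U\<^esub> uc (Ka \<eta>)"
        by (simp add: uc_mult)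
      moreover have "uc (sub BA (bas v)) \<in> BFil n"
        using v(2) BfI[of v n 0] Th.zero by (simp add: BFil_iff)
      moreover have "uc (Ka \<eta>) \<in> BFil 0"
        using Ka_Htheta[OF w(2)] by (simp add: Htheta_BFil)
      ultimately show ?thesis by (intro add_span_incl) (auto simp: S_def)
    qed
  qed
  ultimately show ?case unfolding eq by (rule subset_antisym)
qed

section \<open>The projections\<close>

lemma finsum_uc: "finite A \<Longrightarrow> (\<Oplus>\<^bsub>U\<^esub>i\<in>A. uc (g i)) = uc (sum g A)"
  by (induction A rule: finite_induct) (simp_all add: uc_0 uc_add Pi_def)

lemma uc_zero_NF: "uc x = \<zero>\<^bsub>U\<^esub> \<longleftrightarrow> NF (act x b1) = 0"
  by (simp add: uc_zero_iff J_def)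

lemma NF_restr_fun:
  assumes "\<And>u v l u' v'. wdeg u = wdeg u' \<Longrightarrow> wdeg v = wdeg v' \<Longrightarrow> \<gamma> (u, v, l) = \<gamma> (u', v', l)"
  shows "restr (\<lambda>t. \<gamma> t = j) (NF m) = NF (restr (\<lambda>t. \<gamma> t = j) m)"
proof (rule NF_restr)
  fix u v u' v' :: "'i word" and l :: "'i \<Rightarrow> int"
  assume "wdeg u = wdeg u'" "wdeg v = wdeg v'"
  from assms[OF this, of l] show "(\<gamma> (u, v, l) = j) = (\<gamma> (u', v', l) = j)"
    by (simp only:)
qed

text \<open>\<gamma> labels each basis vector by the summand it belongs to. V1 separates the
  supports of normal forms and gives uniqueness of the decomposition; V2 says that the summands are
  large enough and gives existence.\<close>

lemma ds_component_U:
  assumes \<gamma>: "\<And>u v l u' v'. wdeg u = wdeg u' \<Longrightarrow> wdeg v = wdeg v' \<Longrightarrow> \<gamma> (u, v, l) = \<gamma> (u', v', l)"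
    and V1: "\<And>j Y. Y \<in> V j \<Longrightarrow> \<exists>x. Y = uc x \<and> Poly_Mapping.keys (NF (act x b1)) \<subseteq> {t. \<gamma> t = j}"
    and V2: "\<And>j m. Poly_Mapping.keys m \<subseteq> {t. \<gamma> t = j} \<Longrightarrow> uc (sd m) \<in> V j"
  shows "ds_component U V j (uc x) = uc (sd (restr (\<lambda>t. \<gamma> t = j) (act x b1)))"
proof -
  define m where "m = act x b1"
  define r where "r i = restr (\<lambda>t. \<gamma> t = i) m" for i
  define f where "f i = uc (sd (r i))" for i
  let ?A = "\<gamma> ` Poly_Mapping.keys m"
  let ?I = "{i. f i \<noteq> \<zero>\<^bsub>U\<^esub>}"
  have r0: "r i = 0" if "i \<notin> ?A" for i
    unfolding r_def by (rule restr_eq_0) (use that in auto)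
  have IA: "?I \<subseteq> ?A"
    using r0 by (auto simp: f_def lin_zero[OF lin_sd] uc_0)
  then have fin: "finite ?I" by (rule finite_subset) simp
  have sum_r: "sum r ?A = m"
  proof (rule poly_mapping_eqI)
    fix t
    have "lk (sum r ?A) t = (\<Sum>i\<in>?A. if \<gamma> t = i then lk m t else 0)"
      unfolding lookup_sum r_def by (rule sum.cong) (auto simp: lookup_restr)
    also have "\<dots> = lk m t" by (auto simp: in_keys_iff)
    finally show "lk (sum r ?A) t = lk m t" .
  qed
  have "(\<Oplus>\<^bsub>U\<^esub>i\<in>?I. f i) = uc (\<Sum>i\<in>?I. sd (r i))"
    unfolding f_def by (rule finsum_uc) (use fin in \<open>simp add: f_def\<close>)
  also have "\<dots> = uc x"
  proof -
    have "(\<Sum>i\<in>?A. sd (r i)) = (\<Sum>i\<in>?A - ?I. sd (r i)) + (\<Sum>i\<in>?I. sd (r i))"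
      by (rule sum.subset_diff[OF IA]) simp
    moreover have "(\<Sum>i\<in>?A - ?I. sd (r i)) \<in> NN"
      by (rule pm.subspace_sum[OF NN_subspace]) (simp add: NN_def f_def)
    moreover have "(\<Sum>i\<in>?A. sd (r i)) = sd m"
      by (simp add: sum_r flip: lin_sum[OF lin_sd])
    ultimately have "uc (sd m) = uc (\<Sum>i\<in>?I. sd (r i))"
      by (simp add: uc_eq_NN)
    then show ?thesis using uc_sd[of x] by (simp add: m_def)
  qed
  finally have ex: "uc x = (\<Oplus>\<^bsub>U\<^esub>i\<in>?I. f i)" by simp
  have fV: "f i \<in> V i" for i
    unfolding f_def r_def by (rule V2) (auto simp: keys_restr)
  show ?thesis
    unfolding ds_component_def m_def[symmetric] r_def[symmetric] f_def[symmetric]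
  proof (rule the_equality)
    show "\<exists>g. (\<forall>i. g i \<in> V i) \<and> finite {i. g i \<noteq> \<zero>\<^bsub>U\<^esub>} \<and>
        uc x = (\<Oplus>\<^bsub>U\<^esub>i\<in>{i. g i \<noteq> \<zero>\<^bsub>U\<^esub>}. g i) \<and> f j = g j"
      using fV fin ex by (intro exI[of _ f]) simp
  next
    fix y assume "\<exists>g. (\<forall>i. g i \<in> V i) \<and> finite {i. g i \<noteq> \<zero>\<^bsub>U\<^esub>} \<and>
        uc x = (\<Oplus>\<^bsub>U\<^esub>i\<in>{i. g i \<noteq> \<zero>\<^bsub>U\<^esub>}. g i) \<and> y = g j"
    then obtain g where g: "\<forall>i. g i \<in> V i" "finite {i. g i \<noteq> \<zero>\<^bsub>U\<^esub>}"
      "uc x = (\<Oplus>\<^bsub>U\<^esub>i\<in>{i. g i \<noteq> \<zero>\<^bsub>U\<^esub>}. g i)" "y = g j" by blast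
    have "\<forall>i. \<exists>z. g i = uc z \<and> Poly_Mapping.keys (NF (act z b1)) \<subseteq> {t. \<gamma> t = i}"
      using V1 g(1) by blast
    then obtain z where z: "\<And>i. g i = uc (z i)" "\<And>i. Poly_Mapping.keys (NF (act (z i) b1)) \<subseteq> {t. \<gamma> t = i}"
      by (auto dest!: choice)
    let ?I' = "{i. g i \<noteq> \<zero>\<^bsub>U\<^esub>}"
    let ?r = "restr (\<lambda>t. \<gamma> t = j)"
    have "uc x = uc (sum z ?I')"
      using g(2,3) by (simp add: z(1) finsum_uc)
    then have "NF m = (\<Sum>i\<in>?I'. NF (act (z i) b1))"
      by (simp add: uc_eq_NF m_def lin_sum[OF lin_evop1] lin_sum[OF lin_NF])
    then have "?r (NF m) = (\<Sum>i\<in>?I'. ?r (NF (act (z i) b1)))"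
      by (simp add: lin_sum[OF lin_restr])
    also have "\<dots> = (\<Sum>i\<in>?I'. if i = j then NF (act (z j) b1) else 0)"
    proof (rule sum.cong[OF refl])
      fix i assume "i \<in> ?I'"
      show "?r (NF (act (z i) b1)) = (if i = j then NF (act (z j) b1) else 0)"
        using z(2)[of i] by (auto intro!: restr_id restr_eq_0)
    qed
    also have "\<dots> = NF (act (z j) b1)"
    proof (cases "j \<in> ?I'")
      case True
      then show ?thesis by (simp only: sum.delta[OF g(2)] if_True)
    next
      case False
      then have "NF (act (z j) b1) = 0"
        using uc_zero_NF[of "z j"] z(1)[of j] by simp
      with False show ?thesis by (simp only: sum.delta[OF g(2)] if_False)
    qed
    finally have "?r (NF m) = NF (act (z j) b1)" .
    moreover have "?r (NF m) = NF (r j)"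
      unfolding r_def by (rule NF_restr_fun[where \<gamma> = \<gamma>, OF \<gamma>])
    ultimately have "NF (act (z j) b1) = NF (r j)" by simp
    then have "uc (z j) = uc (sd (r j))" by (simp add: uc_eq_NF)
    then show "y = f j" by (simp add: g(4) z(1) f_def)
  qed
qed

lemma add_span_subset:
  assumes W: "pm.subspace W" and S: "S \<subseteq> uc ` {x. act x b1 \<in> W}"
  shows "add_span U S \<subseteq> uc ` {x. act x b1 \<in> W}"
proof
  fix Y assume "Y \<in> add_span U S"
  then show "Y \<in> uc ` {x. act x b1 \<in> W}"
  proof (induction rule: add_span_induct)
    case zero
    show ?case by (rule image_eqI[of _ _ 0]) (simp_all add: uc_0 pm.subspace_0[OF W])
  next
    case (incl h)
    then show ?case using S by auto
  next
    case (uminus h)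
    then obtain x where "h = uc x" "act x b1 \<in> W" using S by auto
    then show ?case
      by (intro image_eqI[of _ _ "- x"])
        (simp_all add: uc_uminus lin_uminus[OF lin_evop1] pm.subspace_neg[OF W])
  next
    case (add h h')
    then obtain x y where "h = uc x" "act x b1 \<in> W" "h' = uc y" "act y b1 \<in> W" by auto
    then show ?case
      by (intro image_eqI[of _ _ "x + y"]) (simp_all add: uc_add pm.subspace_add[OF W])
  qed
qed

lemma keys_NF_subset:
  assumes \<gamma>: "\<And>u v l u' v'. wdeg u = wdeg u' \<Longrightarrow> wdeg v = wdeg v' \<Longrightarrow> \<gamma> (u, v, l) = \<gamma> (u', v', l)"
    and "Poly_Mapping.keys m \<subseteq> {t. \<gamma> t = j}"
  shows "Poly_Mapping.keys (NF m) \<subseteq> {t. \<gamma> t = j}"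
proof -
  have "restr (\<lambda>t. \<gamma> t = j) (NF m) = NF (restr (\<lambda>t. \<gamma> t = j) m)"
    by (rule NF_restr_fun[where \<gamma> = \<gamma>, OF \<gamma>])
  also have "restr (\<lambda>t. \<gamma> t = j) m = m" by (rule restr_id) (use assms(2) in auto)
  finally have "Poly_Mapping.keys (NF m) = Poly_Mapping.keys (restr (\<lambda>t. \<gamma> t = j) (NF m))" by simp
  then show ?thesis by (auto simp: keys_restr)
qed

lemma sd_in_span:
  assumes S: "S \<subseteq> carrier U" "\<And>a h. h \<in> S \<Longrightarrow> uc (nc_const a) \<otimes>\<^bsub>U\<^esub> h \<in> S"
    and m: "\<And>t. t \<in> Poly_Mapping.keys m \<Longrightarrow> uc (sd (bas t)) \<in> S"
  shows "uc (sd m) \<in> add_span U S"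
proof -
  have "lext (\<lambda>t. sd (bas t)) m \<in> {x. uc x \<in> add_span U S}"
    by (rule lext_in_subspace[OF add_span_subspace[OF S]]) (use m add_span_incl in auto)
  then show ?thesis by (simp flip: lin_eq_lext[OF lin_sd])
qed

lemma act_FK: "act (FK i) m = Fop 1 i (Kop (alpha i) m)"
  by (simp add: FK_def act_mult)

text \<open>Sorting a product of the F_i K_i costs only a nonzero scalar, so G^- is made of the F_v
  K_{wt v}; this is why \<open>grade\<close> subtracts wt v from the exponent.\<close>

lemma evw_FK: "\<exists>s. s \<noteq> 0 \<and> evw (\<lambda>i. act (FK i)) v b1 = Poly_Mapping.single (0, v, wt v) s"
proof (induction v)
  case 0
  show ?case by (intro exI[of _ 1]) simp
next
  case (wcons i v)
  then obtain s where s: "s \<noteq> 0" "evw (\<lambda>i. act (FK i)) v b1 = Poly_Mapping.single (0, v, wt v) s" by auto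
  then show ?case
    by (intro exI[of _ "s * \<chi> (alpha i) (- wt v)"], unfold evw_simps s(2)) (simp add: act_FK ops_single)
qed

lemma P_proj_uc:
  "P_proj \<chi> \<I> \<mu> (uc x) = uc (sd (restr (\<lambda>t. grade t = \<mu>) (act x b1)))"
  unfolding P_proj_def
proof (rule ds_component_U)
  show \<gamma>: "grade (u, v, l) = grade (u', v', l)" if "wdeg u = wdeg u'" "wdeg v = wdeg v'" for u v l u' v'
    using that by (simp add: grade_def flip: wt_eq_iff)
  fix \<mu>
  let ?S = "{u \<otimes>\<^bsub>U\<^esub> K_pow \<chi> \<I> \<mu> \<otimes>\<^bsub>U\<^esub> g | u g. u \<in> Uplus \<chi> \<I> \<and> g \<in> Gminus \<chi> \<I>}"
  have S: "?S = {uc (sub EA p * Ka \<mu> * sub FK q) | p q. True}"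
    by (auto simp: Uplus_eq Gminus_eq uc_mult uc_Ka)
  let ?G = "{t. grade t = \<mu>}"
  let ?W = "{m. NF m \<in> {m. Poly_Mapping.keys m \<subseteq> ?G}}"
  have W: "pm.subspace ?W" by (rule subspace_vimage[OF lin_NF subspace_keys])
  have act: "Poly_Mapping.keys (act (sub EA p * Ka \<mu> * sub FK q) b1) \<subseteq> ?G" for p q
  proof -
    let ?A = "{(u :: 'i word, v :: 'i word, l). u = 0 \<and> l = wt v}"
    have "evop (\<lambda>i. act (FK i)) q b1 \<in> {m. Poly_Mapping.keys m \<subseteq> ?A}"
    proof (rule evop_in[OF subspace_keys])
      fix i and m :: "('i, 'k) tmod" assume m: "m \<in> {m. Poly_Mapping.keys m \<subseteq> ?A}"
      have "Poly_Mapping.keys (act (FK i) m) \<subseteq> ?A"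
      proof (rule keys_linI[OF lin_act])
        fix t assume "t \<in> Poly_Mapping.keys m"
        then obtain v where t: "t = (0, v, wt v)" using m by auto
        show "Poly_Mapping.keys (act (FK i) (bas t)) \<subseteq> ?A"
          by (auto simp: act_FK t ops_single split: if_splits)
      qed
      then show "act (FK i) m \<in> {m. Poly_Mapping.keys m \<subseteq> ?A}" by simp
    qed simp
    then have A: "Poly_Mapping.keys (act (sub FK q) b1) \<subseteq> ?A"
      by (simp add: act_sub)
    have "Poly_Mapping.keys (Kop \<mu> (act (sub FK q) b1)) \<subseteq> ?G"
    proof (intro subsetI)
      fix t assume t: "t \<in> Poly_Mapping.keys (Kop \<mu> (act (sub FK q) b1))"
      obtain u v l where t': "t = (u, v, l)" by (cases t)
      have "(u, v, l - \<mu>) \<in> ?A" using Kop_keys[OF t[unfolded t']] A by blast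
      then have "l = wt v + \<mu>" by (simp add: diff_eq_eq)
      then show "t \<in> ?G" by (simp add: t' grade_def)
    qed
    then have "evop Eop p (Kop \<mu> (act (sub FK q) b1)) \<in> {m. Poly_Mapping.keys m \<subseteq> ?G}"
      by (intro evop_in[OF subspace_keys]) (auto dest!: Eop_keys simp: grade_def)
    then show ?thesis by (simp add: act_mult act_EF)
  qed
  have S_sub: "?S \<subseteq> uc ` {x. act x b1 \<in> ?W}"
    unfolding S
  proof (safe)
    fix p q
    have "Poly_Mapping.keys (NF (act (sub EA p * Ka \<mu> * sub FK q) b1)) \<subseteq> ?G"
      by (rule keys_NF_subset[of grade, OF \<gamma> act])
    then show "uc (sub EA p * Ka \<mu> * sub FK q) \<in> uc ` {x. act x b1 \<in> ?W}"
      by (intro imageI CollectI)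
  qed
  show "\<exists>x. Y = uc x \<and> Poly_Mapping.keys (NF (act x b1)) \<subseteq> ?G" if "Y \<in> add_span U ?S" for Y
    using add_span_subset[OF W S_sub] that by auto
  show "uc (sd m) \<in> add_span U ?S" if m: "Poly_Mapping.keys m \<subseteq> ?G" for m
  proof (rule sd_in_span)
    show "?S \<subseteq> carrier U" unfolding S by auto
    show "uc (nc_const a) \<otimes>\<^bsub>U\<^esub> h \<in> ?S" if "h \<in> ?S" for a h
    proof -
      from that obtain p q where "h = uc (sub EA p * Ka \<mu> * sub FK q)" unfolding S by auto
      then have "uc (nc_const a) \<otimes>\<^bsub>U\<^esub> h = uc (sub EA (psc a p) * Ka \<mu> * sub FK q)"
        by (simp add: psc_eq_const sub_mult mult.assoc flip: uc_mult)
      then show ?thesis unfolding S by blast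
    qed
    fix t assume t: "t \<in> Poly_Mapping.keys m"
    obtain u v l where t': "t = (u, v, l)" by (cases t)
    have l: "l = \<mu> + wt v" using m t by (auto simp: t' grade_def)
    obtain s where s: "s \<noteq> 0" "evw (\<lambda>i. act (FK i)) v b1 = Poly_Mapping.single (0, v, wt v) s"
      using evw_FK by blast
    \<comment> \<open>The scalar from sorting the F_i K_i together with the one from moving K_mu
      past F_v; the witness below divides by it.\<close>
    define s' where "s' = s * \<chi> \<mu> (- wt v)"
    have "act (sub EA (psc (1 / s') (bas u)) * Ka \<mu> * sub FK (bas v)) b1 =
        psc (1 / s') (evw Eop u (Poly_Mapping.single (0, v, l) s'))"
      by (simp add: act_mult act_EF act_sub s(2) ops_single l s'_def lin_psc[OF lin_evop1] evop_single del: psc_single)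
    also have "Poly_Mapping.single (0, v, l) s' = psc s' (bas (0, v, l) :: ('i, 'k) tmod)" by simp
    also have "psc (1 / s') (evw Eop u (psc s' (bas (0, v, l)))) = bas t"
      using s(1) by (simp only: evw_psc evw_Eop pm.scale_scale) (simp add: s'_def t')
    finally have "uc (sd (bas t)) = uc (sub EA (psc (1 / s') (bas u)) * Ka \<mu> * sub FK (bas v))"
      by (simp add: uc_eq_act J_zero del: psc_single)
    then show "uc (sd (bas t)) \<in> ?S" unfolding S by blast
  qed
qed

lemma evw_Eop_keys: "(u', v', l') \<in> Poly_Mapping.keys (evw Eop w m) \<Longrightarrow>
    \<exists>u. u' = w + u \<and> (u, v', l') \<in> Poly_Mapping.keys m"
  by (induction w arbitrary: u') (auto dest!: Eop_keys)

definition fdeg :: "'i trip \<Rightarrow> ('i \<Rightarrow> nat) \<times> ('i \<Rightarrow> nat)" where "fdeg = (\<lambda>(u, v, l). (wdeg u, wdeg v))"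

lemma pi_proj_uc:
  "pi_proj \<chi> \<I> d (uc x) = uc (sd (restr (\<lambda>t. fdeg t = d) (act x b1)))"
  unfolding pi_proj_def
proof (rule ds_component_U)
  show \<gamma>: "fdeg (u, v, l) = fdeg (u', v', l)" if "wdeg u = wdeg u'" "wdeg v = wdeg v'" for u v l u' v'
    using that by (simp add: fdeg_def)
  fix d :: "('i \<Rightarrow> nat) \<times> ('i \<Rightarrow> nat)"
  obtain a b where d: "d = (a, b)" by (cases d)
  let ?S = "{u \<otimes>\<^bsub>U\<^esub> h \<otimes>\<^bsub>U\<^esub> v | u h v. u \<in> Uplus_deg \<chi> \<I> a \<and> h \<in> Ucartan \<chi> \<I> \<and> v \<in> Uminus_deg \<chi> \<I> b}"
  have S: "?S = {uc (sub EA p * sub KLA r * sub FA q) | p q r. homogeneous a p \<and> homogeneous b q}"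
    unfolding deg_eq Ucartan_eq by (auto simp: uc_mult) blast
  let ?G = "{t. fdeg t = d}"
  let ?W = "{m. NF m \<in> {m. Poly_Mapping.keys m \<subseteq> ?G}}"
  have W: "pm.subspace ?W" by (rule subspace_vimage[OF lin_NF subspace_keys])
  have act: "Poly_Mapping.keys (act (sub EA p * sub KLA r * sub FA q) b1) \<subseteq> ?G"
    if pq: "homogeneous a p" "homogeneous b q" for p q r
  proof -
    let ?A = "{(u :: 'i word, v :: 'i word, l :: 'i \<Rightarrow> int). u = 0 \<and> wdeg v = b}"
    have q: "evop (Fop 1) q b1 \<in> {m. Poly_Mapping.keys m \<subseteq> ?A}"
      unfolding evop_def
      by (rule lext_in_subspace[OF subspace_keys]) (use pq(2) in \<open>auto simp: evw_Fop homogeneous_def\<close>)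
    have "act (sub KLA r) (act (sub FA q) b1) \<in> {m. Poly_Mapping.keys m \<subseteq> ?A}"
      unfolding act_sub[of KLA] act_EF
    proof (rule evop_in[OF subspace_keys _ q])
      fix s and m :: "('i, 'k) tmod" assume "m \<in> {m. Poly_Mapping.keys m \<subseteq> ?A}"
      then show "act (KLA s) m \<in> {m. Poly_Mapping.keys m \<subseteq> ?A}"
        by (cases s) (auto simp: KLA_def dest!: Kop_keys)
    qed
    then have m: "Poly_Mapping.keys (act (sub KLA r) (act (sub FA q) b1)) \<subseteq> ?A" by simp
    have "evop Eop p (act (sub KLA r) (act (sub FA q) b1)) \<in> {m. Poly_Mapping.keys m \<subseteq> ?G}"
      unfolding evop_def[of Eop]
    proof (rule lext_in_subspace[OF subspace_keys], rule CollectI, rule subsetI)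
      fix w t assume w: "w \<in> Poly_Mapping.keys p"
        and t: "t \<in> Poly_Mapping.keys (evw Eop w (act (sub KLA r) (act (sub FA q) b1)))"
      obtain u v l where t': "t = (u, v, l)" by (cases t)
      from evw_Eop_keys[OF t[unfolded t']] m have "u = w" "wdeg v = b" by auto
      then show "t \<in> ?G" using w pq(1) by (simp add: t' fdeg_def d homogeneous_def)
    qed
    then show ?thesis by (simp add: act_mult act_EF(1))
  qed
  have S_sub: "?S \<subseteq> uc ` {x. act x b1 \<in> ?W}"
    unfolding S
  proof (safe)
    fix p q :: "('i, 'k) ncpoly" and r
    assume pq: "homogeneous a p" "homogeneous b q"
    have "Poly_Mapping.keys (NF (act (sub EA p * sub KLA r * sub FA q) b1)) \<subseteq> ?G"
      by (rule keys_NF_subset[of fdeg, OF \<gamma> act[OF pq]])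
    then show "uc (sub EA p * sub KLA r * sub FA q) \<in> uc ` {x. act x b1 \<in> ?W}"
      by (intro imageI CollectI)
  qed
  show "\<exists>x. Y = uc x \<and> Poly_Mapping.keys (NF (act x b1)) \<subseteq> ?G"
    if "Y \<in> (case d of (a, b) \<Rightarrow> add_span U {u \<otimes>\<^bsub>U\<^esub> h \<otimes>\<^bsub>U\<^esub> v | u h v.
      u \<in> Uplus_deg \<chi> \<I> a \<and> h \<in> Ucartan \<chi> \<I> \<and> v \<in> Uminus_deg \<chi> \<I> b})" for Y
    using add_span_subset[OF W S_sub] that unfolding d prod.case by auto
  show "uc (sd m) \<in> (case d of (a, b) \<Rightarrow> add_span U {u \<otimes>\<^bsub>U\<^esub> h \<otimes>\<^bsub>U\<^esub> v | u h v.
      u \<in> Uplus_deg \<chi> \<I> a \<and> h \<in> Ucartan \<chi> \<I> \<and> v \<in> Uminus_deg \<chi> \<I> b})"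
    if m: "Poly_Mapping.keys m \<subseteq> ?G" for m
    unfolding d prod.case
  proof (rule sd_in_span)
    show "?S \<subseteq> carrier U" unfolding S by auto
    show "uc (nc_const s) \<otimes>\<^bsub>U\<^esub> h \<in> ?S" if "h \<in> ?S" for s h
    proof -
      from that obtain p q r where h: "h = uc (sub EA p * sub KLA r * sub FA q)" "homogeneous a p" "homogeneous b q"
        unfolding S by auto
      then have "uc (nc_const s) \<otimes>\<^bsub>U\<^esub> h = uc (sub EA (psc s p) * sub KLA r * sub FA q)"
        by (simp add: psc_eq_const sub_mult mult.assoc flip: uc_mult)
      moreover have "homogeneous a (psc s p)"
        using h(2) by (auto simp: homogeneous_def dest: keys_pscD)
      ultimately show ?thesis unfolding S using h(3) by blast
    qed
    fix t assume t: "t \<in> Poly_Mapping.keys m"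
    obtain u v l where t': "t = (u, v, l)" by (cases t)
    have uv: "wdeg u = a" "wdeg v = b" using m t by (auto simp: t' fdeg_def d)
    define s where "s = \<chi> l (- wt v)"
    obtain r where r: "uc (Ka l) = uc (sub KLA r)"
      using K_pow_Ucartan[of l] by (auto simp: Ucartan_eq)
    have "act (sub EA (psc (1 / s) (bas u)) * Ka l * sub FA (bas v)) b1 =
        psc (1 / s) (evw Eop u (Poly_Mapping.single (0, v, l) s))"
      by (simp add: act_mult act_EF evw_Fop Kop_bas s_def lin_psc[OF lin_evop1] evop_single del: psc_single)
    also have "Poly_Mapping.single (0, v, l) s = psc s (bas (0, v, l) :: ('i, 'k) tmod)" by simp
    also have "psc (1 / s) (evw Eop u (psc s (bas (0, v, l)))) = bas t"
      by (simp only: evw_psc evw_Eop pm.scale_scale) (simp add: s_def t')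
    finally have "uc (sd (bas t)) = uc (sub EA (psc (1 / s) (bas u)) * Ka l * sub FA (bas v))"
      by (simp add: uc_eq_act J_zero del: psc_single)
    also have "\<dots> = uc (sub EA (psc (1 / s) (bas u)) * sub KLA r * sub FA (bas v))"
      by (intro uc_cong_mult refl r)
    finally show "uc (sd (bas t)) \<in> ?S"
      unfolding S using uv by (auto simp: homogeneous_def intro!: exI split: if_splits)
  qed
qed

text \<open>P keeps the lowest grade of p(B), which is the degenerate value; \<pi>_{0,0} keeps of it
  the terms without E and F.\<close>

theorem projection_zero_iff:
  assumes "homogeneous lam p"
  shows "pi_proj \<chi> \<I> (0, 0) (P_proj \<chi> \<I> (\<lambda>i. - int (lam i))
      (nc_eval (U_scal \<chi> \<I>) U (B_gen \<chi> \<I> \<tau> c) p)) = \<zero>\<^bsub>U\<^esub> \<longleftrightarrow>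
    (\<forall>l. lk (NF (evop (BL 0) p b1)) (0, 0, l) = 0)"
proof -
  let ?y = "evop (BL 0) p b1" and ?Q = "\<lambda>t. fdeg t = (0, 0)"
  have "nc_eval (U_scal \<chi> \<I>) U (B_gen \<chi> \<I> \<tau> c) p = uc (sub BA p)"
    unfolding gen_fun(6) by (rule nc_eval_U)
  then have "P_proj \<chi> \<I> (\<lambda>i. - int (lam i)) (nc_eval (U_scal \<chi> \<I>) U (B_gen \<chi> \<I> \<tau> c) p) = uc (sd ?y)"
    by (simp add: P_proj_uc evop_BL_restr[OF assms])
  then have "pi_proj \<chi> \<I> (0, 0) (P_proj \<chi> \<I> (\<lambda>i. - int (lam i))
      (nc_eval (U_scal \<chi> \<I>) U (B_gen \<chi> \<I> \<tau> c) p)) = uc (sd (restr ?Q ?y))"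
    by (simp add: pi_proj_uc)
  moreover have "NF (restr ?Q ?y) = restr ?Q (NF ?y)"
    by (rule NF_restr[symmetric]) (simp add: fdeg_def)
  moreover have "?Q (u, v, l) \<longleftrightarrow> u = 0 \<and> v = 0" for u v l
  proof -
    have "wdeg w = 0 \<longleftrightarrow> w = 0" for w :: "'i word"
      using wt_eq_iff[of w 0] sum_wt[of w] by (auto simp: wdeg_def fun_eq_iff wt_def fun_apply)
    then show ?thesis by (simp add: fdeg_def)
  qed
  ultimately show ?thesis
    by (auto simp: uc_zero_NF poly_mapping_eq_iff fun_eq_iff lookup_restr)
qed

section \<open>The associated graded algebra\<close>

abbreviation BB :: "('i, 'k) U_elem set" where "BB \<equiv> B_alg \<chi> \<I> \<tau> c"
abbreviation UB :: "('i, 'k) U_elem ring" where "UB \<equiv> U\<lparr>carrier := BB\<rparr>"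
abbreviation G :: "(nat \<Rightarrow> ('i, 'k) U_elem set) ring" where "G \<equiv> grB \<chi> \<I> \<tau> c"

lemma B_fil_BFil: "B_fil \<chi> \<I> \<tau> c = BFil"
  by (rule ext) (rule B_fil_eq)

lemma Htheta_closed: "Htheta \<chi> \<I> \<tau> \<subseteq> carrier U"
  using BFil_closed by (auto simp: Htheta_BFil)

sublocale UB: ring UB
proof (rule U.subring_is_ring)
  show "subring BB U"
    unfolding B_alg_def subalg_def
    by (rule U.generate_ring_is_subring) (use Htheta_closed in \<open>auto simp: gen_fun\<close>)
qed

lemma BFil_BB: "BFil n \<subseteq> BB"
proof (rule BFil_minimal)
  show "pm.subspace {x. uc x \<in> BB}" unfolding B_alg_def by (rule subalg_subspace)
  fix w :: "'i word" and \<eta> assume "\<eta> \<in> Th"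
  then have "uc (Ka \<eta>) \<in> BB" unfolding B_alg_def by (intro subalg_incl UnI1 Ka_Htheta)
  moreover have "uc (sub BA (bas w)) \<in> BB"
    unfolding B_alg_def by (rule sub_in_subalg, rule subalg_incl) (simp add: gen_fun)
  ultimately show "uc (sub BA (bas w) * Ka \<eta>) \<in> BB"
    unfolding B_alg_def by (intro subalg_mult)
qed

lemma finsum_UB:
  "finite A \<Longrightarrow> (\<And>i. i \<in> A \<Longrightarrow> uc (g i) \<in> BB) \<Longrightarrow> (\<Oplus>\<^bsub>UB\<^esub>i\<in>A. uc (g i)) = uc (sum g A)"
proof (induction A rule: finite_induct)
  case empty
  show ?case using UB.finsum_empty by (simp add: uc_0)
next
  case (insert j A)
  then have "(\<Oplus>\<^bsub>UB\<^esub>i\<in>insert j A. uc (g i)) = uc (g j) \<oplus>\<^bsub>UB\<^esub> (\<Oplus>\<^bsub>UB\<^esub>i\<in>A. uc (g i))"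
    by (intro UB.finsum_insert) auto
  with insert show ?case by (simp add: uc_add)
qed

section \<open>Cosets of the filtration and their representatives\<close>

definition cs :: "nat \<Rightarrow> ('i gen, 'k) ncpoly \<Rightarrow> ('i, 'k) U_elem set"
  where "cs m x = uc ` {y. act y b1 - act x b1 \<in> Bfp m}"

lemma uc_in_cs: "uc y \<in> cs m x \<longleftrightarrow> act y b1 - act x b1 \<in> Bfp m"
proof
  assume "uc y \<in> cs m x"
  then obtain y' where "uc y = uc y'" "act y' b1 - act x b1 \<in> Bfp m" by (auto simp: cs_def)
  then have "act y b1 - act y' b1 \<in> Bfp m" "act y' b1 - act x b1 \<in> Bfp m"
    by (auto simp: uc_eq_act intro: J_Bfp)
  from pm.subspace_add[OF Bfp_subspace this] show "act y b1 - act x b1 \<in> Bfp m" by simp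
qed (auto simp: cs_def)

lemma csE:
  assumes "Y \<in> cs m x" obtains y where "Y = uc y" "act y b1 - act x b1 \<in> Bfp m"
  using assms by (auto simp: cs_def)

lemma cs_eq_iff: "cs m x = cs m y \<longleftrightarrow> act x b1 - act y b1 \<in> Bfp m"
proof
  assume "cs m x = cs m y"
  moreover have "uc x \<in> cs m x" by (simp add: uc_in_cs pm.subspace_0[OF Bfp_subspace])
  ultimately show "act x b1 - act y b1 \<in> Bfp m" by (simp add: uc_in_cs)
next
  assume d: "act x b1 - act y b1 \<in> Bfp m"
  show "cs m x = cs m y"
  proof (intro Set.set_eqI iffI)
    fix Y assume "Y \<in> cs m x"
    then obtain z where "Y = uc z" "act z b1 - act x b1 \<in> Bfp m" by (rule csE)
    with pm.subspace_add[OF Bfp_subspace this(2) d] show "Y \<in> cs m y" by (simp add: uc_in_cs)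
  next
    fix Y assume "Y \<in> cs m y"
    then obtain z where "Y = uc z" "act z b1 - act y b1 \<in> Bfp m" by (rule csE)
    with pm.subspace_diff[OF Bfp_subspace this(2) d] show "Y \<in> cs m x" by (simp add: uc_in_cs)
  qed
qed

lemma fil_pred_cs: "fil_pred UB BFil m = cs m 0"
  by (cases m, auto simp: fil_pred_def cs_def BFil_def uc_0 J_zero image_iff simp flip: uc_zero_iff)
    (rule exI[of _ 0], rule uc_0)

lemma fil_pred_coset: "fil_pred UB BFil m +>\<^bsub>UB\<^esub> uc x = cs m x"
proof
  show "fil_pred UB BFil m +>\<^bsub>UB\<^esub> uc x \<subseteq> cs m x"
    by (auto simp: a_r_coset_def' fil_pred_cs uc_in_cs elim!: csE simp flip: uc_add)
  show "cs m x \<subseteq> fil_pred UB BFil m +>\<^bsub>UB\<^esub> uc x"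
  proof
    fix Y assume "Y \<in> cs m x"
    then obtain y where y: "Y = uc y" "act y b1 - act x b1 \<in> Bfp m" by (rule csE)
    then have "uc (y - x) \<in> cs m 0" by (simp add: uc_in_cs)
    moreover have "Y = uc (y - x) \<oplus>\<^bsub>U\<^esub> uc x" by (simp add: y(1) flip: uc_add)
    ultimately show "Y \<in> fil_pred UB BFil m +>\<^bsub>UB\<^esub> uc x"
      by (auto simp: a_r_coset_def' fil_pred_cs)
  qed
qed

lemma cs_add: "cs m x <+>\<^bsub>UB\<^esub> cs m y = cs m (x + y)"
proof
  show "cs m x <+>\<^bsub>UB\<^esub> cs m y \<subseteq> cs m (x + y)"
  proof
    fix Z assume "Z \<in> cs m x <+>\<^bsub>UB\<^esub> cs m y"
    then obtain x' y' where "Z = uc (x' + y')" "act x' b1 - act x b1 \<in> Bfp m" "act y' b1 - act y b1 \<in> Bfp m"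
      by (auto simp: set_add_def' uc_add elim!: csE)
    with pm.subspace_add[OF Bfp_subspace this(2,3)] show "Z \<in> cs m (x + y)"
      by (simp add: uc_in_cs algebra_simps)
  qed
  show "cs m (x + y) \<subseteq> cs m x <+>\<^bsub>UB\<^esub> cs m y"
  proof
    fix Z assume "Z \<in> cs m (x + y)"
    then obtain z where z: "Z = uc z" "act z b1 - act (x + y) b1 \<in> Bfp m" by (rule csE)
    then have "uc (z - y) \<in> cs m x" by (simp add: uc_in_cs algebra_simps)
    moreover have "uc y \<in> cs m y" by (simp add: uc_in_cs pm.subspace_0[OF Bfp_subspace])
    moreover have "Z = uc (z - y) \<oplus>\<^bsub>U\<^esub> uc y" by (simp add: z(1) flip: uc_add)
    ultimately show "Z \<in> cs m x <+>\<^bsub>UB\<^esub> cs m y"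
      unfolding set_add_def' by auto
  qed
qed

subsection \<open>Products of cosets\<close>

lemma act_Bfp_mult:
  assumes "act x b1 \<in> Bf l" "y \<in> Bfp n" shows "act x y \<in> Bfp (l + n)"
proof (cases n)
  case 0
  then show ?thesis using assms(2) by (auto intro: act_J J_Bfp)
next
  case (Suc k)
  then show ?thesis using act_Bf_mult[OF assms(1), of y k] assms(2) by simp
qed

lemma act_Bfp_mult':
  assumes "act x b1 \<in> Bfp l" "y \<in> Bf n" shows "act x y \<in> Bfp (l + n)"
proof (cases l)
  \<comment> \<open>Here x sends the vector 1 into \<open>J\<close>, and only \<open>faith\<close>
    carries this over to \<open>y\<close>.\<close>
  case 0
  then show ?thesis using assms(1) by (auto intro: faith J_Bfp)
next
  case (Suc k)
  then show ?thesis using act_Bf_mult[OF _ assms(2), of x k] assms(1) by simp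
qed

text \<open>xy - ab = x(y - b) + (x - a)b; the second summand is the one that requires control of
  right multiplication.\<close>

lemma act_cong_mult:
  assumes "act a b1 \<in> Bf l" "act b b1 \<in> Bf n" "act x b1 - act a b1 \<in> Bfp l" "act y b1 - act b b1 \<in> Bfp n"
  shows "act (x * y) b1 - act (a * b) b1 \<in> Bfp (l + n)"
proof -
  have "act x b1 \<in> Bf l"
    using pm.subspace_add[OF Bf_subspace Bfp_Bf[OF assms(3)] assms(1)] by simp
  from act_Bfp_mult[OF this assms(4)] have "act x (act y b1) - act x (act b b1) \<in> Bfp (l + n)"
    by (simp add: lin_diff[OF lin_act])
  moreover have "act x (act b b1) - act a (act b b1) \<in> Bfp (l + n)"
    using act_Bfp_mult'[of "x - a" l, OF _ assms(2)] assms(3) by simp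
  ultimately show ?thesis
    using pm.subspace_add[OF Bfp_subspace] by (fastforce simp: act_mult)
qed

text \<open>Elements of the associated graded algebra are handled through families of representatives.\<close>

definition elt :: "(nat \<Rightarrow> ('i gen, 'k) ncpoly) \<Rightarrow> nat \<Rightarrow> ('i, 'k) U_elem set"
  where "elt a = (\<lambda>m. cs m (a m))"

definition adm :: "(nat \<Rightarrow> ('i gen, 'k) ncpoly) \<Rightarrow> bool"
  where "adm a \<longleftrightarrow> (\<forall>m. act (a m) b1 \<in> Bf m) \<and> finite {m. a m \<noteq> 0}"

abbreviation sg :: "nat \<Rightarrow> ('i gen, 'k) ncpoly \<Rightarrow> nat \<Rightarrow> ('i gen, 'k) ncpoly"
  where "sg m x \<equiv> (\<lambda>_. 0)(m := x)"

definition cv :: "(nat \<Rightarrow> ('i gen, 'k) ncpoly) \<Rightarrow> (nat \<Rightarrow> ('i gen, 'k) ncpoly) \<Rightarrow> nat \<Rightarrow> ('i gen, 'k) ncpoly"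
  where "cv a b m = (\<Sum>i\<le>m. a i * b (m - i))"

lemma elt_eq_iff: "elt a = elt b \<longleftrightarrow> (\<forall>m. act (a m) b1 - act (b m) b1 \<in> Bfp m)"
  by (simp add: elt_def fun_eq_iff cs_eq_iff)

lemma grB_eq: "G = assoc_graded UB BFil"
  by (simp add: grB_def B_fil_BFil)

lemma G_carrier: "carrier G = elt ` {a. adm a}"
proof
  show "carrier G \<subseteq> elt ` {a. adm a}"
  proof
    fix f assume "f \<in> carrier G"
    then have f0: "\<And>m. \<exists>x\<in>BFil m. f m = fil_pred UB BFil m +>\<^bsub>UB\<^esub> x" "finite {m. f m \<noteq> fil_pred UB BFil m}"
      by (auto simp: grB_eq assoc_graded_def)
    have f: "\<exists>x. act x b1 \<in> Bf m \<and> f m = cs m x" for m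
    proof -
      obtain Y where Y: "Y \<in> BFil m" "f m = fil_pred UB BFil m +>\<^bsub>UB\<^esub> Y" using f0(1) by blast
      from Y(1) obtain x where "Y = uc x" "act x b1 \<in> Bf m" by (rule BFilE)
      then show ?thesis using Y(2) by (intro exI[of _ x]) (simp add: fil_pred_coset)
    qed
    have fin: "finite {m. f m \<noteq> cs m 0}"
      using f0(2) by (simp add: fil_pred_cs)
    define a where "a m = (SOME x. act x b1 \<in> Bf m \<and> f m = cs m x)" for m
    have a: "act (a m) b1 \<in> Bf m" "f m = cs m (a m)" for m
      using someI_ex[OF f, of m] by (simp_all add: a_def)
    define a' where "a' m = (if f m = cs m 0 then 0 else a m)" for m
    have f_eq: "f = elt a'" by (auto simp: elt_def a'_def a(2) fun_eq_iff)
    have "finite {m. a' m \<noteq> 0}"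
      by (rule finite_subset[OF _ fin]) (auto simp: a'_def)
    then have "adm a'"
      using a(1) by (auto simp: adm_def a'_def pm.subspace_0[OF Bf_subspace])
    then show "f \<in> elt ` {a. adm a}" using f_eq by blast
  qed
  show "elt ` {a. adm a} \<subseteq> carrier G"
  proof (intro image_subsetI)
    fix a assume "a \<in> {a. adm a}"
    then have a: "\<And>m. act (a m) b1 \<in> Bf m" "finite {m. a m \<noteq> 0}" by (auto simp: adm_def)
    have "finite {m. elt a m \<noteq> cs m 0}"
      by (rule finite_subset[OF _ a(2)]) (auto simp: elt_def)
    moreover have "\<exists>x\<in>BFil m. elt a m = fil_pred UB BFil m +>\<^bsub>UB\<^esub> x" for m
      using a(1) by (intro bexI[of _ "uc (a m)"]) (simp_all add: fil_pred_coset elt_def BFil_iff)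
    ultimately show "elt a \<in> carrier G"
      by (simp add: grB_eq assoc_graded_def fil_pred_cs)
  qed
qed

lemma G_class: "grB_class \<chi> \<I> \<tau> c m (uc x) = elt (sg m x)"
  by (simp add: grB_class_def B_fil_BFil gr_class_def fil_pred_coset elt_def fun_eq_iff)
    (simp add: fil_pred_cs)

lemma G_add: "elt a \<oplus>\<^bsub>G\<^esub> elt b = elt (\<lambda>m. a m + b m)"
  by (simp add: grB_eq assoc_graded_def elt_def cs_add)

text \<open>The product in \<open>assoc_graded\<close> collects all products of representatives.
  That these fill exactly one coset is \<open>act_cong_mult\<close> summed over complementary
  degrees, together with the free summand from the previous step.\<close>

lemma G_mult:
  assumes a: "\<And>m. act (a m) b1 \<in> Bf m" and b: "\<And>m. act (b m) b1 \<in> Bf m"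
  shows "elt a \<otimes>\<^bsub>G\<^esub> elt b = elt (cv a b)"
proof
  fix m
  let ?P = "{z \<oplus>\<^bsub>UB\<^esub> (\<Oplus>\<^bsub>UB\<^esub>i\<in>{..m}. x i \<otimes>\<^bsub>UB\<^esub> y (m - i)) | z x y.
      z \<in> cs m 0 \<and> (\<forall>i. x i \<in> elt a i) \<and> (\<forall>i. y i \<in> elt b i)}"
  have sum: "(\<Oplus>\<^bsub>UB\<^esub>i\<in>{..m}. uc (x i) \<otimes>\<^bsub>UB\<^esub> uc (y (m - i))) = uc (cv x y m)"
    if "\<And>i. act (x i) b1 \<in> Bf i" "\<And>i. act (y i) b1 \<in> Bf i" for x y
  proof -
    have "uc (x i) \<in> BB" "uc (y i) \<in> BB" for i
      using BFil_BB that BFil_iff by blast+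
    then have "uc (x i * y j) \<in> BB" for i j
      using UB.m_closed[of "uc (x i)" "uc (y j)"] by (simp add: uc_mult)
    then show ?thesis
      using finsum_UB[of "{..m}" "\<lambda>i. x i * y (m - i)"] by (simp add: uc_mult cv_def)
  qed
  have "?P = cs m (cv a b m)"
  proof
    show "?P \<subseteq> cs m (cv a b m)"
    proof
      fix Z assume "Z \<in> ?P"
      then obtain z x y where Z: "Z = z \<oplus>\<^bsub>UB\<^esub> (\<Oplus>\<^bsub>UB\<^esub>i\<in>{..m}. x i \<otimes>\<^bsub>UB\<^esub> y (m - i))"
        "z \<in> cs m 0" "\<forall>i. x i \<in> cs i (a i)" "\<forall>i. y i \<in> cs i (b i)" by (auto simp: elt_def)
      obtain z' where z': "z = uc z'" "act z' b1 \<in> Bfp m" using Z(2) by (auto elim: csE)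
      have "\<forall>i. \<exists>t. x i = uc t \<and> act t b1 - act (a i) b1 \<in> Bfp i" using Z(3) by (metis csE)
      then obtain x' where x': "\<And>i. x i = uc (x' i)" "\<And>i. act (x' i) b1 - act (a i) b1 \<in> Bfp i" by metis
      have "\<forall>i. \<exists>t. y i = uc t \<and> act t b1 - act (b i) b1 \<in> Bfp i" using Z(4) by (metis csE)
      then obtain y' where y': "\<And>i. y i = uc (y' i)" "\<And>i. act (y' i) b1 - act (b i) b1 \<in> Bfp i" by metis
      have B: "act (x' i) b1 \<in> Bf i" "act (y' i) b1 \<in> Bf i" for i
        using pm.subspace_add[OF Bf_subspace Bfp_Bf[OF x'(2)] a[of i]]
          pm.subspace_add[OF Bf_subspace Bfp_Bf[OF y'(2)] b[of i]] by simp_all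
      have "Z = uc (z' + cv x' y' m)"
        unfolding Z(1) x'(1) y'(1) sum[of x' y', OF B] z'(1) by (simp add: uc_add)
      moreover have "(\<Sum>i\<le>m. act (x' i * y' (m - i)) b1 - act (a i * b (m - i)) b1) \<in> Bfp m"
      proof (rule pm.subspace_sum[OF Bfp_subspace])
        fix i assume "i \<in> {..m}"
        then show "act (x' i * y' (m - i)) b1 - act (a i * b (m - i)) b1 \<in> Bfp m"
          using act_cong_mult[OF a b x'(2) y'(2), of i "m - i"] by simp
      qed
      then have "act (cv x' y' m) b1 - act (cv a b m) b1 \<in> Bfp m"
        by (simp add: cv_def lin_sum[OF lin_evop1] sum_subtractf)
      from pm.subspace_add[OF Bfp_subspace z'(2) this]
      have "act (z' + cv x' y' m) b1 - act (cv a b m) b1 \<in> Bfp m" by (simp add: algebra_simps)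
      ultimately show "Z \<in> cs m (cv a b m)" by (simp add: uc_in_cs)
    qed
    show "cs m (cv a b m) \<subseteq> ?P"
    proof
      fix Z assume "Z \<in> cs m (cv a b m)"
      then obtain z where z: "Z = uc z" "act z b1 - act (cv a b m) b1 \<in> Bfp m" by (rule csE)
      have "uc (z - cv a b m) \<in> cs m 0" using z(2) by (simp add: uc_in_cs)
      moreover have "\<forall>i. uc (a i) \<in> elt a i" "\<forall>i. uc (b i) \<in> elt b i"
        by (simp_all add: elt_def uc_in_cs pm.subspace_0[OF Bfp_subspace])
      moreover have "Z = uc (z - cv a b m) \<oplus>\<^bsub>UB\<^esub> (\<Oplus>\<^bsub>UB\<^esub>i\<in>{..m}. uc (a i) \<otimes>\<^bsub>UB\<^esub> uc (b (m - i)))"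
        unfolding sum[OF a b] by (simp add: z(1) flip: uc_add)
      ultimately show "Z \<in> ?P"
        by (intro CollectI exI[of _ "uc (z - cv a b m)"] exI[of _ "\<lambda>i. uc (a i)"] exI[of _ "\<lambda>i. uc (b i)"]) simp
    qed
  qed
  moreover have "(elt a \<otimes>\<^bsub>G\<^esub> elt b) m = ?P"
    by (simp add: grB_eq assoc_graded_def fil_pred_cs)
  ultimately show "(elt a \<otimes>\<^bsub>G\<^esub> elt b) m = elt (cv a b) m"
    by (simp add: elt_def)
qed

lemma adm_sg: "act x b1 \<in> Bf m \<Longrightarrow> adm (sg m x)"
  by (auto simp: adm_def pm.subspace_0[OF Bf_subspace])

lemma sg_Bf: "act x b1 \<in> Bf m \<Longrightarrow> act (sg m x k) b1 \<in> Bf k"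
  by (auto simp: pm.subspace_0[OF Bf_subspace])

lemma adm_zero: "adm (\<lambda>_. 0)"
  by (auto simp: adm_def pm.subspace_0[OF Bf_subspace])

lemma adm_add: "adm a \<Longrightarrow> adm b \<Longrightarrow> adm (\<lambda>m. a m + b m)"
  unfolding adm_def
proof (intro conjI allI)
  assume ab: "(\<forall>m. act (a m) b1 \<in> Bf m) \<and> finite {m. a m \<noteq> 0}" "(\<forall>m. act (b m) b1 \<in> Bf m) \<and> finite {m. b m \<noteq> 0}"
  show "act (a m + b m) b1 \<in> Bf m" for m
    using pm.subspace_add[OF Bf_subspace, of "act (a m) b1" m "act (b m) b1"] ab by simp
  show "finite {m. a m + b m \<noteq> 0}"
    by (rule finite_subset[of _ "{m. a m \<noteq> 0} \<union> {m. b m \<noteq> 0}"]) (use ab in auto)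
qed

lemma adm_cv: "adm a \<Longrightarrow> adm b \<Longrightarrow> adm (cv a b)"
  unfolding adm_def
proof (intro conjI allI)
  assume ab: "(\<forall>m. act (a m) b1 \<in> Bf m) \<and> finite {m. a m \<noteq> 0}" "(\<forall>m. act (b m) b1 \<in> Bf m) \<and> finite {m. b m \<noteq> 0}"
  show "act (cv a b m) b1 \<in> Bf m" for m
    unfolding cv_def lin_sum[OF lin_evop1]
  proof (rule pm.subspace_sum[OF Bf_subspace])
    fix i assume "i \<in> {..m}"
    then show "act (a i * b (m - i)) b1 \<in> Bf m"
      using act_Bf_mult[of "a i" i "act (b (m - i)) b1" "m - i"] ab by (simp add: act_mult)
  qed
  show "finite {m. cv a b m \<noteq> 0}"
  proof (rule finite_subset)
    show "{m. cv a b m \<noteq> 0} \<subseteq> (\<lambda>(i, j). i + j) ` ({m. a m \<noteq> 0} \<times> {m. b m \<noteq> 0})"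
    proof
      fix m assume "m \<in> {m. cv a b m \<noteq> 0}"
      then obtain i where "i \<le> m" "a i * b (m - i) \<noteq> 0"
        unfolding cv_def by (auto elim: sum.not_neutral_contains_not_neutral)
      then show "m \<in> (\<lambda>(i, j). i + j) ` ({m. a m \<noteq> 0} \<times> {m. b m \<noteq> 0})"
        by (intro image_eqI[of _ _ "(i, m - i)"]) auto
    qed
  qed (use ab in auto)
qed

lemma cv_sg: "cv (sg m x) (sg n y) = sg (m + n) (x * y)"
proof
  fix k
  have "(\<Sum>i\<le>k. sg m x i * sg n y (k - i)) = (\<Sum>i\<le>k. if i = m then x * sg n y (k - m) else 0)"
    by (rule sum.cong) auto
  then show "cv (sg m x) (sg n y) k = sg (m + n) (x * y) k"
    by (auto simp: cv_def)
qed

lemma G_mult_sg: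
  assumes "act x b1 \<in> Bf m" "act y b1 \<in> Bf n"
  shows "elt (sg m x) \<otimes>\<^bsub>G\<^esub> elt (sg n y) = elt (sg (m + n) (x * y))"
  unfolding G_mult[OF sg_Bf[OF assms(1)] sg_Bf[OF assms(2)]] cv_sg ..

lemma G_add_sg: "elt (sg m x) \<oplus>\<^bsub>G\<^esub> elt (sg m y) = elt (sg m (x + y))"
  unfolding G_add by (rule arg_cong[of _ _ elt]) auto

end

section \<open>The homomorphism \<phi> in terms of top components in F\<close>

locale gr_hom = qsp \<chi> \<I> \<tau> c
  for \<chi> :: "('i::finite, 'k::field) bichar" and \<I> :: "('i, 'k) ncpoly set" and \<tau> :: "'i \<Rightarrow> 'i" and c :: "'i \<Rightarrow> 'k" +
  fixes \<phi> :: "(nat \<Rightarrow> ('i, 'k) U_elem set) \<Rightarrow> ('i, 'k) U_elem"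
  assumes phi_hom: "\<phi> \<in> ring_hom G (U\<lparr>carrier := Htheta_Uminus \<chi> \<I> \<tau>\<rparr>)"
    and phi_B: "\<phi> (grB_class \<chi> \<I> \<tau> c 1 (B_gen \<chi> \<I> \<tau> c i)) = U_F \<chi> \<I> i"
    and phi_H: "h \<in> Htheta \<chi> \<I> \<tau> \<Longrightarrow> \<phi> (grB_class \<chi> \<I> \<tau> c 0 h) = h"
begin

lemma elt_G: "adm a \<Longrightarrow> elt a \<in> carrier G"
  by (simp add: G_carrier)

lemma phi_add: "adm a \<Longrightarrow> adm b \<Longrightarrow> \<phi> (elt (\<lambda>m. a m + b m)) = \<phi> (elt a) \<oplus>\<^bsub>U\<^esub> \<phi> (elt b)"
  using ring_hom_add[OF phi_hom elt_G elt_G, of a b] by (simp add: G_add)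

lemma phi_add_sg:
  "act x b1 \<in> Bf m \<Longrightarrow> act y b1 \<in> Bf m \<Longrightarrow> \<phi> (elt (sg m (x + y))) = \<phi> (elt (sg m x)) \<oplus>\<^bsub>U\<^esub> \<phi> (elt (sg m y))"
  using ring_hom_add[OF phi_hom elt_G[OF adm_sg] elt_G[OF adm_sg], of x m y m] by (simp add: G_add_sg)

lemma phi_mult_sg:
  "act x b1 \<in> Bf m \<Longrightarrow> act y b1 \<in> Bf n \<Longrightarrow>
    \<phi> (elt (sg (m + n) (x * y))) = \<phi> (elt (sg m x)) \<otimes>\<^bsub>U\<^esub> \<phi> (elt (sg n y))"
  using ring_hom_mult[OF phi_hom elt_G[OF adm_sg] elt_G[OF adm_sg], of x m y n] by (simp add: G_mult_sg)

lemma phi_sg_B: "\<phi> (elt (sg 1 (BA i))) = uc (FA i)"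
  using phi_B[of i] unfolding gen_fun G_class .

lemma phi_sg_H: "act x b1 \<in> Bf 0 \<Longrightarrow> \<phi> (elt (sg 0 x)) = uc x"
  using phi_H[of "uc x"] by (simp add: Htheta_BFil BFil_iff G_class)

lemma const_Bf0: "act (nc_const s) b1 \<in> Bf 0"
proof -
  have "act (nc_const s) b1 = psc s b1" by (simp add: lin_psc[OF lin_evop1] add: nc_const_def flip: psc_one)
  moreover have "b1 \<in> Bf 0" using BfI[of 0 0 0] Th.zero by simp
  ultimately show ?thesis using pm.subspace_scale[OF Bf_subspace, of b1 0 s] by (simp only:)
qed

lemma phi_zero: "\<phi> (elt (\<lambda>_. 0)) = \<zero>\<^bsub>U\<^esub>"
proof -
  have "\<phi> (elt (sg 0 0)) = uc 0" by (rule phi_sg_H) (simp add: pm.subspace_0[OF Bf_subspace])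
  moreover have "sg 0 0 = (\<lambda>_. 0)" by auto
  ultimately show ?thesis by (simp add: uc_0)
qed

text \<open>The part of F-length m in the normal form; by \<open>phi_sg\<close> it computes \<phi>
  in degree m.\<close>

definition L :: "nat \<Rightarrow> ('i gen, 'k) ncpoly \<Rightarrow> ('i, 'k) tmod"
  where "L m x = restr (\<lambda>(u, v, l). wlen v = m) (NF (act x b1))"

lemma lin_L [simp]: "lin (L m)"
  unfolding L_def by (rule lin_comp[OF lin_restr lin_comp[OF lin_NF lin_evop1]])

lemma NF_restr_wlen: "restr (\<lambda>(u, v, l). wlen v = m) (NF y) = NF (restr (\<lambda>(u, v, l). wlen v = m) y)"
  by (rule NF_restr) (auto dest: wdeg_eq_wlen)

lemma L_Bf:
  assumes "act x b1 \<in> Bfp m" shows "L m x = 0"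
proof (cases m)
  case 0
  then show ?thesis using assms by (simp add: L_def J_def lin_zero[OF lin_restr])
next
  case (Suc n)
  then have "act x b1 \<in> Bf n" using assms by simp
  from Bf_Fbound[OF faith this] show ?thesis
    unfolding L_def by (intro restr_eq_0) (use Suc in force)
qed

lemma phi_word: "\<eta> \<in> Th \<Longrightarrow> \<phi> (elt (sg (wlen w) (sub BA (bas w) * Ka \<eta>))) = uc (sub FA (bas w) * Ka \<eta>)"
proof (induction w)
  case 0
  have "act (Ka \<eta>) b1 \<in> Bf 0" using BfI[OF _ 0, of 0 0] by (simp add: Kop_bas)
  then have "\<phi> (elt (sg 0 (Ka \<eta>))) = uc (Ka \<eta>)" by (rule phi_sg_H)
  moreover have "sub b (bas 0) * x = x" for b :: "'i \<Rightarrow> ('i gen, 'k) ncpoly" and x by simp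
  moreover have "wlen (0 :: 'i word) = 0" by simp
  ultimately show ?case by (simp only:)
next
  case (wcons i w)
  have e: "sub b (bas (wcons i w)) * x = b i * (sub b (bas w) * x)"
    for b :: "'i \<Rightarrow> ('i gen, 'k) ncpoly" and x
    using sub_mult[of b "nc_var i" "bas w"] by (simp add: nc_var_def mult.assoc flip: sub_simps(1)[of b i])
  have len: "wlen (wcons i w) = 1 + wlen w" by simp
  have 1: "act (BA i) b1 \<in> Bf 1"
    using BL_Bf[OF BfI[OF _ Th.zero, of 0 0], of i] by simp
  have 2: "act (sub BA (bas w) * Ka \<eta>) b1 \<in> Bf (wlen w)"
    using BfI[OF le_refl wcons.prems, of w] by (simp add: act_mult Kop_bas)
  have "\<phi> (elt (sg (1 + wlen w) (BA i * (sub BA (bas w) * Ka \<eta>)))) =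
      uc (FA i) \<otimes>\<^bsub>U\<^esub> uc (sub FA (bas w) * Ka \<eta>)"
    unfolding phi_mult_sg[OF 1 2] phi_sg_B wcons.IH[OF wcons.prems] ..
  then show ?case
    by (simp only: e len uc_mult)
qed

lemma uc_sd_NF: "uc (sd (NF m)) = uc (sd m)"
  by (simp add: uc_eq_NF)

lemma L_word:
  assumes "\<eta> \<in> Th"
  shows "uc (sd (L (wlen w) (sub BA (bas w) * Ka \<eta>))) = uc (sub FA (bas w) * Ka \<eta>)"
proof -
  let ?Q = "\<lambda>(u :: 'i word, v :: 'i word, l :: 'i \<Rightarrow> int). wlen v = wlen w"
  let ?y = "evw (BL 1) w (bas (0, 0, \<eta>))"
  have "restr ?Q (?y - bas (0, w, \<eta>)) = 0"
    by (rule restr_eq_0) (use evw_BL_Ftop[of _ _ _ 1 w \<eta>] in force)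
  moreover have "restr ?Q (bas (0, w, \<eta>)) = bas (0, w, \<eta>)" by (simp add: restr_bas)
  ultimately have "restr ?Q ?y = bas (0, w, \<eta>)" by (simp add: lin_diff[OF lin_restr])
  then have "L (wlen w) (sub BA (bas w) * Ka \<eta>) = NF (bas (0, w, \<eta>))"
    by (simp add: L_def act_mult Kop_bas NF_restr_wlen)
  moreover have "uc (sd (bas (0, w, \<eta>))) = uc (sub FA (bas w) * Ka \<eta>)"
    using evw_Fop[of 1 w 0 \<eta>] by (simp add: uc_eq_act act_mult act_EF Kop_bas J_zero)
  ultimately show ?thesis by (simp add: uc_sd_NF)
qed

text \<open>\<phi> is prescribed on generators only. Multiplicativity gives the formula on the B_w
  K_eta and for scalar multiples, and additivity extends it to the whole filtration step.\<close>

lemma phi_sg: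
  assumes "act x b1 \<in> Bf m"
  shows "\<phi> (elt (sg m x)) = uc (sd (L m x))"
proof -
  \<comment> \<open>The quantifier over representatives makes membership a property of the class, as
    \<open>BFil_minimal\<close> requires.\<close>
  let ?S = "{Y. \<forall>x. Y = uc x \<longrightarrow> act x b1 \<in> Bf m \<and> \<phi> (elt (sg m x)) = uc (sd (L m x))}"
  have zero: "\<phi> (elt (sg m x)) = uc (sd (L m x))" if "act x b1 \<in> Bfp m" for x
  proof -
    have "elt (sg m x) = elt (\<lambda>_. 0)"
      unfolding elt_eq_iff using that by (auto simp: pm.subspace_0[OF Bfp_subspace])
    then show ?thesis by (simp add: phi_zero L_Bf[OF that] lin_zero[OF lin_sd] uc_0)
  qed
  have cong: "elt (sg m x) = elt (sg m y)" "L m x = L m y" "act x b1 \<in> Bf m \<longleftrightarrow> act y b1 \<in> Bf m" if "uc x = uc y" for x y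
  proof -
    show "elt (sg m x) = elt (sg m y)"
      using that by (auto simp: elt_eq_iff uc_eq_act J_Bfp pm.subspace_0[OF Bfp_subspace])
    show "L m x = L m y" using that by (simp add: L_def uc_eq_NF)
    show "act x b1 \<in> Bf m \<longleftrightarrow> act y b1 \<in> Bf m" using that by (simp flip: BFil_iff)
  qed
  have S: "uc x \<in> ?S \<longleftrightarrow> act x b1 \<in> Bf m \<and> \<phi> (elt (sg m x)) = uc (sd (L m x))" for x
  proof
    assume x: "act x b1 \<in> Bf m \<and> \<phi> (elt (sg m x)) = uc (sd (L m x))"
    show "uc x \<in> ?S"
    proof (rule CollectI, intro allI impI)
      fix y assume "uc x = uc y"
      from cong[OF this] x show "act y b1 \<in> Bf m \<and> \<phi> (elt (sg m y)) = uc (sd (L m y))" by simp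
    qed
  qed blast
  have "pm.subspace {x. uc x \<in> ?S}"
    unfolding S pm.subspace_def
  proof (intro conjI ballI allI; unfold mem_Collect_eq)
    show "act 0 b1 \<in> Bf m \<and> \<phi> (elt (sg m 0)) = uc (sd (L m 0))"
      using zero[of 0] by (simp add: pm.subspace_0[OF Bf_subspace] pm.subspace_0[OF Bfp_subspace])
  next
    fix x y
    assume x: "act x b1 \<in> Bf m \<and> \<phi> (elt (sg m x)) = uc (sd (L m x))"
      and y: "act y b1 \<in> Bf m \<and> \<phi> (elt (sg m y)) = uc (sd (L m y))"
    have "act (x + y) b1 \<in> Bf m"
      using pm.subspace_add[OF Bf_subspace] x y by simp
    then show "act (x + y) b1 \<in> Bf m \<and> \<phi> (elt (sg m (x + y))) = uc (sd (L m (x + y)))"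
      using x y by (simp add: phi_add_sg lin_add[OF lin_L] lin_add[OF lin_sd] uc_add)
  next
    fix s x
    assume x: "act x b1 \<in> Bf m \<and> \<phi> (elt (sg m x)) = uc (sd (L m x))"
    have "\<phi> (elt (sg (0 + m) (nc_const s * x))) = uc (nc_const s) \<otimes>\<^bsub>U\<^esub> uc (sd (L m x))"
      unfolding phi_mult_sg[OF const_Bf0 conjunct1[OF x]] phi_sg_H[OF const_Bf0] conjunct2[OF x] ..
    also have "\<dots> = uc (sd (L m (psc s x)))"
      unfolding lin_psc[OF lin_L] lin_psc[OF lin_sd] by (simp add: psc_eq_const uc_mult)
    finally have "\<phi> (elt (sg m (psc s x))) = uc (sd (L m (psc s x)))"
      by (simp add: psc_eq_const)
    moreover have "act (psc s x) b1 \<in> Bf m"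
      using pm.subspace_scale[OF Bf_subspace] x by (simp add: lin_psc[OF lin_evop1])
    ultimately show "act (psc s x) b1 \<in> Bf m \<and> \<phi> (elt (sg m (psc s x))) = uc (sd (L m (psc s x)))" by blast
  qed
  moreover have "uc (sub BA (bas w) * Ka \<eta>) \<in> ?S" if w: "wlen w \<le> m" "\<eta> \<in> Th" for w \<eta>
    unfolding S
  proof
    have B: "act (sub BA (bas w) * Ka \<eta>) b1 \<in> Bf n" if "wlen w \<le> n" for n
      using BfI[OF that w(2)] by (simp add: act_mult Kop_bas)
    then show "act (sub BA (bas w) * Ka \<eta>) b1 \<in> Bf m" using w(1) .
    show "\<phi> (elt (sg m (sub BA (bas w) * Ka \<eta>))) = uc (sd (L m (sub BA (bas w) * Ka \<eta>)))"
    proof (cases "wlen w = m")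
      case True
      then show ?thesis using phi_word[OF w(2), of w] L_word[OF w(2), of w] by simp
    next
      case False
      with w(1) obtain n where "m = Suc n" "wlen w \<le> n" by (cases m) auto
      with B[of n] show ?thesis by (intro zero) simp
    qed
  qed
  ultimately have "BFil m \<subseteq> ?S" by (rule BFil_minimal)
  moreover have "uc x \<in> BFil m" using assms by (simp add: BFil_iff)
  ultimately show ?thesis using S[of x] by blast
qed

lemma phi_elt:
  "finite A \<Longrightarrow> adm a \<Longrightarrow> {m. a m \<noteq> 0} \<subseteq> A \<Longrightarrow> \<phi> (elt a) = uc (sd (\<Sum>m\<in>A. L m (a m)))"
proof (induction A arbitrary: a rule: finite_induct)
  case empty
  then have "a = (\<lambda>_. 0)" by auto
  then show ?case by (simp add: phi_zero lin_zero[OF lin_sd] uc_0)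
next
  case (insert m A)
  let ?b = "a(m := 0)"
  have a: "a = (\<lambda>k. sg m (a m) k + ?b k)" by auto
  have m: "act (a m) b1 \<in> Bf m" using insert.prems(1) by (simp add: adm_def)
  have "finite {k. ?b k \<noteq> 0}"
    by (rule finite_subset[of _ "{k. a k \<noteq> 0}"]) (use insert.prems(1) in \<open>auto simp: adm_def\<close>)
  then have b: "adm ?b"
    using insert.prems(1) by (auto simp: adm_def pm.subspace_0[OF Bf_subspace])
  have "\<phi> (elt a) = \<phi> (elt (sg m (a m))) \<oplus>\<^bsub>U\<^esub> \<phi> (elt ?b)"
    by (subst a) (rule phi_add[OF adm_sg[OF m] b])
  also have "\<phi> (elt ?b) = uc (sd (\<Sum>k\<in>A. L k (?b k)))"
    by (rule insert.IH[OF b]) (use insert.prems(2) in auto)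
  also have "(\<Sum>k\<in>A. L k (?b k)) = (\<Sum>k\<in>A. L k (a k))"
    by (rule sum.cong) (use insert.hyps(2) in auto)
  also have "\<phi> (elt (sg m (a m))) = uc (sd (L m (a m)))"
    by (rule phi_sg[OF m])
  finally show ?case
    using insert.hyps by (simp add: lin_add[OF lin_sd] uc_add)
qed

lemma restr_L: "restr (\<lambda>(u, v, l). wlen v = n) (L m x) = (if m = n then L m x else 0)"
  unfolding L_def by (auto intro!: restr_id restr_eq_0 simp: keys_restr)

lemma NF_L: "NF (L m x) = L m x"
  by (simp add: L_def NF_restr_wlen[symmetric])

lemma Bfp_of_top_zero:
  assumes D: "\<And>n. deg_inj n" and x: "act x b1 \<in> Bf m" "L m x = 0"
  shows "act x b1 \<in> Bfp m"
proof -
  have no: "wlen v \<noteq> m" if "(u, v, l) \<in> Poly_Mapping.keys (NF (act x b1))" for u v l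
  proof
    assume "wlen v = m"
    then have "(u, v, l) \<in> Poly_Mapping.keys (L m x)" using that by (simp add: L_def keys_restr)
    then show False by (simp add: x(2))
  qed
  show ?thesis
  proof (cases m)
    \<comment> \<open>In degree 0 there is no F at all, so the top component is the whole normal
      form.\<close>
    case 0
    have False if "t \<in> Poly_Mapping.keys (NF (act x b1))" for t
    proof -
      obtain u v l where t: "t = (u, v, l)" by (cases t)
      have "v = 0" using Bf0_keys[OF x(1)[unfolded 0] that[unfolded t]] by blast
      then show False using no[OF that[unfolded t]] 0 by simp
    qed
    then have "Poly_Mapping.keys (NF (act x b1)) = {}" by blast
    then show ?thesis using 0 by (simp add: J_def)
  next
    case (Suc n)
    then show ?thesis using D[of n] x(1) no by (auto simp: deg_inj_def)
  qed
qed

lemma inj_on_phi_iff: "inj_on \<phi> (carrier G) \<longleftrightarrow> (\<forall>n. deg_inj n)"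
proof
  assume inj: "inj_on \<phi> (carrier G)"
  show "\<forall>n. deg_inj n"
    unfolding deg_inj_def
  proof (intro allI ballI impI)
    fix n y assume y: "y \<in> Bf (Suc n)"
      and no: "\<forall>u v l. (u, v, l) \<in> Poly_Mapping.keys (NF y) \<longrightarrow> wlen v \<noteq> Suc n"
    have B: "act (sd y) b1 \<in> Bf (Suc n)" using y by simp
    have "L (Suc n) (sd y) = 0"
      unfolding L_def by (rule restr_eq_0) (use no in auto)
    then have "\<phi> (elt (sg (Suc n) (sd y))) = \<phi> (elt (\<lambda>_. 0))"
      by (simp add: phi_sg[OF B] phi_zero lin_zero[OF lin_sd] uc_0)
    from inj_onD[OF inj this elt_G[OF adm_sg[OF B]] elt_G[OF adm_zero]]
    have "act (sg (Suc n) (sd y) (Suc n)) b1 - act 0 b1 \<in> Bfp (Suc n)"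
      unfolding elt_eq_iff by blast
    then show "y \<in> Bf n" by simp
  qed
next
  assume D: "\<forall>n. deg_inj n"
  show "inj_on \<phi> (carrier G)"
    unfolding G_carrier
  proof (rule inj_onI; elim imageE; unfold mem_Collect_eq)
    fix f g a b assume eq: "\<phi> f = \<phi> g" and f: "f = elt a" and g: "g = elt b" and a: "adm a" and b: "adm b"
    let ?A = "{m. a m \<noteq> 0} \<union> {m. b m \<noteq> 0}"
    have fin: "finite ?A" using a b by (simp add: adm_def)
    have "uc (sd (\<Sum>m\<in>?A. L m (a m))) = uc (sd (\<Sum>m\<in>?A. L m (b m)))"
      using eq phi_elt[OF fin a] phi_elt[OF fin b] by (simp add: f g)
    then have sum: "(\<Sum>m\<in>?A. L m (a m)) = (\<Sum>m\<in>?A. L m (b m))"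
      by (simp add: uc_eq_NF lin_sum[OF lin_NF] NF_L)
    have L: "L n (a n) = L n (b n)" for n
    proof (cases "n \<in> ?A")
      case True
      \<comment> \<open>Components of different degrees have different F-lengths, so the two sums
        can be compared degree by degree.\<close>
      have r: "restr (\<lambda>(u, v, l). wlen v = n) (\<Sum>m\<in>?A. L m (x m)) = L n (x n)" for x
        unfolding lin_sum[OF lin_restr] restr_L using fin True by (simp only: sum.delta' sum.delta if_True)
      show ?thesis by (rule trans[OF r[of a, symmetric, unfolded sum] r[of b]])
    qed simp
    show "f = g"
      unfolding f g elt_eq_iff
    proof
      fix n
      have "act (a n - b n) b1 \<in> Bf n"
        using a b pm.subspace_diff[OF Bf_subspace] by (simp add: adm_def)
      from Bfp_of_top_zero[OF spec[OF D] this] show "act (a n) b1 - act (b n) b1 \<in> Bfp n"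
        using L by (simp add: lin_diff[OF lin_L])
    qed
  qed
qed

lemma phi_image_const: "uc (nc_const s) \<in> \<phi> ` carrier G"
  by (rule image_eqI[OF _ elt_G[OF adm_sg[OF const_Bf0]]]) (simp add: phi_sg_H[OF const_Bf0])

lemma phi_image_mult: "x \<in> \<phi> ` carrier G \<Longrightarrow> y \<in> \<phi> ` carrier G \<Longrightarrow> x \<otimes>\<^bsub>U\<^esub> y \<in> \<phi> ` carrier G"
proof (elim imageE)
  fix f g assume x: "x = \<phi> f" and y: "y = \<phi> g" and f: "f \<in> carrier G" and g: "g \<in> carrier G"
  from f g obtain a b where ab: "f = elt a" "g = elt b" "adm a" "adm b" by (auto simp: G_carrier)
  have "f \<otimes>\<^bsub>G\<^esub> g \<in> carrier G"
    using ab G_mult[of a b] elt_G[OF adm_cv[of a b]] by (simp add: adm_def)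
  then show "x \<otimes>\<^bsub>U\<^esub> y \<in> \<phi> ` carrier G"
    by (rule image_eqI[rotated]) (use ring_hom_mult[OF phi_hom f g] x y in simp)
qed

lemma phi_image_add: "x \<in> \<phi> ` carrier G \<Longrightarrow> y \<in> \<phi> ` carrier G \<Longrightarrow> x \<oplus>\<^bsub>U\<^esub> y \<in> \<phi> ` carrier G"
proof (elim imageE)
  fix f g assume x: "x = \<phi> f" and y: "y = \<phi> g" and f: "f \<in> carrier G" and g: "g \<in> carrier G"
  from f g obtain a b where ab: "f = elt a" "g = elt b" "adm a" "adm b" by (auto simp: G_carrier)
  have "f \<oplus>\<^bsub>G\<^esub> g \<in> carrier G"
    using ab elt_G[OF adm_add[of a b]] by (simp add: G_add)
  then show "x \<oplus>\<^bsub>U\<^esub> y \<in> \<phi> ` carrier G"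
    by (rule image_eqI[rotated]) (use ring_hom_add[OF phi_hom f g] x y in simp)
qed

lemma phi_image_closed: "x \<in> \<phi> ` carrier G \<Longrightarrow> x \<in> carrier U"
proof (elim imageE)
  fix f assume x: "x = \<phi> f" and "f \<in> carrier G"
  then obtain a where a: "f = elt a" "adm a" by (auto simp: G_carrier)
  then have "\<phi> f = uc (sd (\<Sum>m\<in>{m. a m \<noteq> 0}. L m (a m)))"
    using phi_elt[of "{m. a m \<noteq> 0}" a] by (simp add: adm_def)
  then show "x \<in> carrier U" by (simp add: x)
qed

lemma subalg_phi_image:
  assumes S: "S \<subseteq> \<phi> ` carrier G"
  shows "subalg \<chi> \<I> S \<subseteq> \<phi> ` carrier G"
proof
  fix x assume "x \<in> subalg \<chi> \<I> S"
  then show "x \<in> \<phi> ` carrier G"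
    unfolding subalg_def
  proof (induction rule: generate_ring.induct)
    case one
    show ?case using phi_image_const[of 1] by (simp add: uc_1)
  next
    case (incl h)
    then show ?case using S phi_image_const by (auto simp: gen_fun)
  next
    case (a_inv h)
    then have h: "h \<in> \<phi> ` carrier G" using S phi_image_const by (auto simp: gen_fun)
    then obtain x where x: "h = uc x" using phi_image_closed uc_surj by blast
    have "\<ominus>\<^bsub>U\<^esub> h = uc (nc_const (- 1)) \<otimes>\<^bsub>U\<^esub> h"
      by (simp add: x flip: uc_mult psc_eq_const uc_uminus)
    then show ?case using phi_image_mult[OF phi_image_const h] by simp
  qed (simp_all add: phi_image_add phi_image_mult)
qed

text \<open>Surjectivity follows from the prescribed values: the image is closed under the algebra
  operations and contains H_theta and all F_i.\<close>

lemma phi_image: "\<phi> ` carrier G = Htheta_Uminus \<chi> \<I> \<tau>"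
proof
  show "\<phi> ` carrier G \<subseteq> Htheta_Uminus \<chi> \<I> \<tau>"
    using ring_hom_closed[OF phi_hom] by auto
  have "Htheta \<chi> \<I> \<tau> \<subseteq> \<phi> ` carrier G"
  proof
    fix h assume h: "h \<in> Htheta \<chi> \<I> \<tau>"
    then obtain x where x: "h = uc x" "act x b1 \<in> Bf 0" by (auto simp: Htheta_BFil elim: BFilE)
    then show "h \<in> \<phi> ` carrier G"
      by (intro image_eqI[OF _ elt_G[OF adm_sg[OF x(2)]]]) (simp add: phi_sg_H)
  qed
  moreover have "Uminus \<chi> \<I> \<subseteq> \<phi> ` carrier G"
    unfolding Uminus_def
  proof (rule subalg_phi_image, unfold gen_fun, rule image_subsetI)
    fix i
    have 1: "act (BA i) b1 \<in> Bf 1"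
      using BL_Bf[OF BfI[OF _ Th.zero, of 0 0], of i] by simp
    show "uc (FA i) \<in> \<phi> ` carrier G"
      by (rule image_eqI[of _ \<phi>, OF phi_sg_B[symmetric] elt_G[OF adm_sg[OF 1]]])
  qed
  ultimately show "Htheta_Uminus \<chi> \<I> \<tau> \<subseteq> \<phi> ` carrier G"
    unfolding Htheta_Uminus_def by (intro subalg_phi_image) simp
qed

theorem phi_iso_iff: "\<phi> \<in> ring_iso G (U\<lparr>carrier := Htheta_Uminus \<chi> \<I> \<tau>\<rparr>) \<longleftrightarrow> (\<forall>n. deg_inj n)"
  using phi_hom phi_image inj_on_phi_iff by (auto simp: ring_iso_def bij_betw_def)

end

section \<open>Homogeneous generators and the final equivalence\<close>

context qsp
begin

lemma deg_inj_lowest: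
  assumes D: "\<And>n. deg_inj n" and p: "p \<in> \<I>" "homogeneous lam p"
  shows "NF (evop (BL 0) p b1) = 0"
proof -
  let ?r = "restr (\<lambda>t. grade t = (\<lambda>i. - int (lam i)))"
  have "NF (evop (BL 0) p b1) = NF (?r (evop (BL 1) p b1))"
    by (simp only: evop_BL_restr[OF p(2)])
  also have "\<dots> = ?r (NF (evop (BL 1) p b1))"
    by (rule NF_restr[symmetric]) (simp add: grade_def flip: wt_eq_iff)
  finally show ?thesis using deg_inj_imp_lowest_zero[OF D p] by simp
qed

text \<open>The homogeneous components of a generator lie in \<I> and sum to it, so replacing each
  generator by its finitely many components keeps a finite generating set.\<close>

lemma homogeneous_generators:
  assumes "finite S" "\<I> = Idl\<^bsub>free_alg\<^esub> S"
  obtains H where "finite H" "\<I> = Idl\<^bsub>free_alg\<^esub> H" "\<forall>p\<in>H. \<exists>lam. homogeneous lam p"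
proof -
  let ?H = "\<Union>p\<in>S. (\<lambda>lam. hom_component lam p) ` wdeg ` Poly_Mapping.keys p"
  have I: "ideal \<I> free_alg" using biideal by (simp add: graded_biideal_def)
  have S_I: "S \<subseteq> \<I>" unfolding assms(2) by (rule ring.genideal_self[OF ring_free_alg]) simp
  have H_I: "?H \<subseteq> \<I>" using S_I biideal by (auto simp: graded_biideal_def)
  have ideal: "ideal (Idl\<^bsub>free_alg\<^esub> ?H) free_alg"
    by (rule ring.genideal_ideal[OF ring_free_alg]) simp
  have "S \<subseteq> Idl\<^bsub>free_alg\<^esub> ?H"
  proof
    fix p assume p: "p \<in> S"
    have c1: "(\<Sum>lam\<in>A. hom_component lam p) \<in> Idl\<^bsub>free_alg\<^esub> ?H" if "finite A" "A \<subseteq> wdeg ` Poly_Mapping.keys p" for A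
      using that
    proof (induction A rule: finite_induct)
      case empty
      show ?case using additive_subgroup.zero_closed[OF ideal.axioms(1)[OF ideal]] by simp
    next
      case (insert lam A)
      have "hom_component lam p \<in> ?H" using p insert.prems by auto
      then have "hom_component lam p \<in> Idl\<^bsub>free_alg\<^esub> ?H"
        using ring.genideal_self[OF ring_free_alg, of ?H] by auto
      then show ?case
        using additive_subgroup.a_closed[OF ideal.axioms(1)[OF ideal]] insert by simp
    qed
    have c2: "(\<Sum>lam\<in>wdeg ` Poly_Mapping.keys p. hom_component lam p) = p"
    proof (rule poly_mapping_eqI)
      fix w
      have "lk (\<Sum>lam\<in>wdeg ` Poly_Mapping.keys p. hom_component lam p) w =
          (\<Sum>lam\<in>wdeg ` Poly_Mapping.keys p. if wdeg w = lam then lk p w else 0)"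
        unfolding lookup_sum hom_component_restr by (rule sum.cong) (auto simp: lookup_restr)
      also have "\<dots> = lk p w" by (auto simp: in_keys_iff)
      finally show "lk (\<Sum>lam\<in>wdeg ` Poly_Mapping.keys p. hom_component lam p) w = lk p w" .
    qed
    show "p \<in> Idl\<^bsub>free_alg\<^esub> ?H"
      using c1[OF finite_imageI[OF finite_keys] subset_refl] unfolding c2 .
  qed
  from genideal_free_alg_minimal[OF ideal this] genideal_free_alg_minimal[OF I H_I]
  have "\<I> = Idl\<^bsub>free_alg\<^esub> ?H" using assms(2) by simp
  moreover have "\<forall>p\<in>?H. \<exists>lam. homogeneous lam p"
    by (auto simp: hom_component_restr homogeneous_def keys_restr)
  moreover have "finite ?H" using assms(1) by simp
  ultimately show ?thesis by (intro that)
qed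

theorem generators_iff:
  assumes fg: "finite S" "\<I> = Idl\<^bsub>free_alg\<^esub> S"
  shows "(\<forall>n. deg_inj n) \<longleftrightarrow>
    (\<exists>(r::nat) (p :: nat \<Rightarrow> ('i, 'k) ncpoly) (lam :: nat \<Rightarrow> 'i \<Rightarrow> nat).
       (\<forall>j\<in>{1..r}. homogeneous (lam j) (p j)) \<and>
       \<I> = Idl\<^bsub>free_alg\<^esub> (p ` {1..r}) \<and>
       (\<forall>j\<in>{1..r}.
          pi_proj \<chi> \<I> (0, 0)
            (P_proj \<chi> \<I> (\<lambda>i. - int (lam j i))
              (nc_eval (U_scal \<chi> \<I>) U (B_gen \<chi> \<I> \<tau> c) (p j))) = \<zero>\<^bsub>U\<^esub>))"
    (is "_ \<longleftrightarrow> (\<exists>r p lam. ?P r p lam)")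
proof
  assume D: "\<forall>n. deg_inj n"
  obtain H where H: "finite H" "\<I> = Idl\<^bsub>free_alg\<^esub> H" "\<forall>p\<in>H. \<exists>lam. homogeneous lam p"
    by (rule homogeneous_generators[OF fg])
  from ex_bij_betw_nat_finite_1[OF H(1)] obtain p where "bij_betw p {1..card H} H" by blast
  then have p: "p ` {1..card H} = H" by (simp add: bij_betw_def)
  \<comment> \<open>A degree has to be chosen, since the zero polynomial is homogeneous of every
    degree.\<close>
  define lam where "lam j = (SOME l. homogeneous l (p j))" for j
  have hom: "homogeneous (lam j) (p j)" if "j \<in> {1..card H}" for j
  proof -
    have "\<exists>l. homogeneous l (p j)" using H(3) p that by blast
    then show ?thesis unfolding lam_def by (rule someI_ex)
  qed
  have I: "p j \<in> \<I>" if "j \<in> {1..card H}" for j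
  proof -
    have "H \<subseteq> \<I>" unfolding H(2) by (rule ring.genideal_self[OF ring_free_alg]) simp
    then show ?thesis using p that by blast
  qed
  have "?P (card H) p lam"
  proof (intro conjI ballI)
    fix j assume j: "j \<in> {1..card H}"
    show "homogeneous (lam j) (p j)" by (rule hom[OF j])
    show "pi_proj \<chi> \<I> (0, 0) (P_proj \<chi> \<I> (\<lambda>i. - int (lam j i))
        (nc_eval (U_scal \<chi> \<I>) U (B_gen \<chi> \<I> \<tau> c) (p j))) = \<zero>\<^bsub>U\<^esub>"
      unfolding projection_zero_iff[OF hom[OF j]] using deg_inj_lowest[OF spec[OF D] I[OF j] hom[OF j]] by simp
  qed (use p H(2) in simp)
  then show "\<exists>r p lam. ?P r p lam" by blast
next
  assume "\<exists>r p lam. ?P r p lam"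
  then obtain r p lam where P: "?P r p lam" by (elim exE)
  have "deg_inj n" for n
  proof (rule deg_inj_of_generators[OF faith conjunct1[OF conjunct2[OF P]]])
    fix q assume "q \<in> p ` {1..r}"
    then obtain j where j: "j \<in> {1..r}" "q = p j" by blast
    have hom: "homogeneous (lam j) (p j)" using P j(1) by blast
    have "pi_proj \<chi> \<I> (0, 0) (P_proj \<chi> \<I> (\<lambda>i. - int (lam j i))
        (nc_eval (U_scal \<chi> \<I>) U (B_gen \<chi> \<I> \<tau> c) (p j))) = \<zero>\<^bsub>U\<^esub>" using P j(1) by blast
    then have "\<forall>l. lk (NF (evop (BL 0) (p j) b1)) (0, 0, l) = 0"
      unfolding projection_zero_iff[OF hom] .
    with hom show "\<exists>lam. homogeneous lam q \<and> (\<forall>l. lk (NF (evop (BL 0) q b1)) (0, 0, l) = 0)"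
      unfolding j(2) by blast
  qed assumption
  then show "\<forall>n. deg_inj n" by blast
qed

end

lemma nc_eval_free_alg: "nc_eval nc_const free_alg b p = sub b (p :: ('x, 'k::field) ncpoly)"
proof -
  have "(\<lambda>x. x) \<in> ring_hom (free_alg :: ('y, 'k) ncpoly ring) free_alg"
    by (rule ring_hom_memI) simp_all
  from nc_eval_hom[OF ring_free_alg this, of b p] show ?thesis by simp
qed

theorem theoremA:
  fixes \<chi> :: "('i::finite, 'k::field) bichar"
    and \<I> :: "('i, 'k) ncpoly set"
    and \<tau> :: "'i \<Rightarrow> 'i"
    and c :: "'i \<Rightarrow> 'k"
    and \<phi> :: "(nat \<Rightarrow> ('i, 'k) U_elem set) \<Rightarrow> ('i, 'k) U_elem"
  assumes "bicharacter \<chi>"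
    and "\<And>i j. qmat \<chi> i j = qmat \<chi> j i"
    and "graded_biideal \<chi> \<I>"
    and "\<And>p w. p \<in> \<I> \<Longrightarrow> w \<in> Poly_Mapping.keys p \<Longrightarrow> length (letters w) \<ge> 2"
    and "\<exists>S. finite S \<and> \<I> = Idl\<^bsub>free_alg\<^esub> S"
    and "bij \<tau>"
    and "\<And>i. \<tau> (\<tau> i) = i"
    and "\<And>i j. qmat \<chi> (\<tau> i) (\<tau> j) = qmat \<chi> i j"
    and "nc_eval nc_const free_alg (\<lambda>i. nc_var (\<tau> i)) ` \<I> = \<I>"
    and "\<phi> \<in> ring_hom (grB \<chi> \<I> \<tau> c) (Uchi \<chi> \<I>\<lparr>carrier := Htheta_Uminus \<chi> \<I> \<tau>\<rparr>)"
    and "\<And>i. \<phi> (grB_class \<chi> \<I> \<tau> c 1 (B_gen \<chi> \<I> \<tau> c i)) = U_F \<chi> \<I> i"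
    and "\<And>h. h \<in> Htheta \<chi> \<I> \<tau> \<Longrightarrow> \<phi> (grB_class \<chi> \<I> \<tau> c 0 h) = h"
  shows "\<phi> \<in> ring_iso (grB \<chi> \<I> \<tau> c) (Uchi \<chi> \<I>\<lparr>carrier := Htheta_Uminus \<chi> \<I> \<tau>\<rparr>) \<longleftrightarrow>
    (\<exists>(r::nat) (p :: nat \<Rightarrow> ('i, 'k) ncpoly) (lam :: nat \<Rightarrow> 'i \<Rightarrow> nat).
       (\<forall>j\<in>{1..r}. homogeneous (lam j) (p j)) \<and>
       \<I> = Idl\<^bsub>free_alg\<^esub> (p ` {1..r}) \<and>
       (\<forall>j\<in>{1..r}.
          pi_proj \<chi> \<I> (0, 0)
            (P_proj \<chi> \<I> (\<lambda>i. - int (lam j i))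
              (nc_eval (U_scal \<chi> \<I>) (Uchi \<chi> \<I>) (B_gen \<chi> \<I> \<tau> c) (p j))) = \<zero>\<^bsub>Uchi \<chi> \<I>\<^esub>))"
proof -
  interpret gr_hom \<chi> \<I> \<tau> c \<phi>
  proof unfold_locales
    fix p assume "p \<in> \<I>"
    then show "sub (\<lambda>i. nc_var (\<tau> i)) p \<in> \<I>"
      using assms(9) by (simp add: nc_eval_free_alg[abs_def] image_subset_iff set_eq_subset)
  qed (use assms in \<open>simp_all add: qmat_def\<close>)
  from assms(5) obtain S where "finite S" "\<I> = Idl\<^bsub>free_alg\<^esub> S" by blast
  from generators_iff[OF this] show ?thesis
    unfolding phi_iso_iff .
qed

end
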